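(* Let $R$ be a commutative noetherian ring, $n\ge2$, and let $C$ be an $n$-cotilting $R$-module whose cotilting class ${}^\perp C$ equals $\mathcal C_{(Y_1,\dots,Y_n)}$, where $(Y_1,\dots,Y_n)$ is a sequence of subsets of $\mathrm{Spec}(R)$ such that each $Y_i$ is closed under specialization, $Y_1\supseteq\dots\supseteq Y_n$, and $\mathrm{Ass}(\mho_{i-1}(R))\cap Y_i=\emptyset$ for all $1\le i\le n$. Put $X_2=\mathrm{Spec}(R)\setminus Y_2$. Then $$D=\mho_1(C)\oplus\bigoplus_{\mathfrak p\in X_2}E(R/\mathfrak p)$$ is an $(n-1)$-cotilting module, with corresponding cotilting class ${}^\perp D=\mathcal C_{(Y_2,\dots,Y_n)}$.
   Context: A module $C$ is $n$-cotilting if it has injective dimension $\le n$; $\mathrm{Ext}^i_R(C^\kappa,C)=0$ for all $i\ge1$ and all cardinals $\kappa$; and there is an exact sequence $0\to C_r\to\dots\to C_0\to W\to0$ with $W$ an injective cogenerator of the category $\mathrm{Mod}\text{-}R$ of all $R$-modules and all $C_j$ direct summands of products of copies of $C$. Its cotilting class is ${}^\perp C=\{M\mid\mathrm{Ext}^i_R(M,C)=0\ \forall i\ge1\}$. For a module $M$ with minimal injective coresolution $0\to M\to E_0(M)\to E_1(M)\to\cdots$, $\mho_0(M)=M$ and $\mho_i(M)$ is the image of $E_{i-1}(M)\to E_i(M)$ for $i\ge1$; so $\mho_1(M)=E(M)/M$, where $E(M)$ is the injective envelope. $\mathrm{Ass}$ denotes associated primes. A subset $Y\subseteq\mathrm{Spec}(R)$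 is closed under specialization if $\mathfrak p\in Y$, $\mathfrak p\subseteq\mathfrak q\in\mathrm{Spec}(R)$ imply $\mathfrak q\in Y$. For a sequence $(Z_1,\dots,Z_m)$ of subsets of $\mathrm{Spec}(R)$, $\mathcal C_{(Z_1,\dots,Z_m)}=\{M\in\mathrm{Mod}\text{-}R\mid\mathrm{Ass}(\mho_{i-1}(M))\cap Z_i=\emptyset\text{ for all }1\le i\le m\}$. Every $n$-cotilting class is of the form $\mathcal C_{(Y_1,\dots,Y_n)}$ for a unique sequence $(Y_1,\dots,Y_n)$ satisfying the conditions in the claim. *)

theory Defs
  imports "HOL-Algebra.Module" "HOL-Algebra.Ring_Divisibility" "HOL-Library.FuncSet"
begin

section \<open>Modules: homomorphisms, quotients, products, sums\<close>

text \<open>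
  The fields \<open>mult\<close> and \<open>one\<close> that a module record inherits from rings are irrelevant.
  Homomorphisms are extensional functions, so that equality of homomorphisms is equality
  on the carrier.
\<close>

definition mod_hom ::
  "('r, 'q) ring_scheme \<Rightarrow> ('r, 'm) module \<Rightarrow> ('r, 'n) module \<Rightarrow> ('m \<Rightarrow> 'n) set" where
  "mod_hom R M N = {f \<in> carrier M \<rightarrow>\<^sub>E carrier N.
     (\<forall>x\<in>carrier M. \<forall>y\<in>carrier M. f (x \<oplus>\<^bsub>M\<^esub> y) = f x \<oplus>\<^bsub>N\<^esub> f y) \<and>
     (\<forall>r\<in>carrier R. \<forall>x\<in>carrier M. f (r \<odot>\<^bsub>M\<^esub> x) = r \<odot>\<^bsub>N\<^esub> f x)}"

definition mod_isomorphic ::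
  "('r, 'q) ring_scheme \<Rightarrow> ('r, 'm) module \<Rightarrow> ('r, 'n) module \<Rightarrow> bool" where
  "mod_isomorphic R M N \<longleftrightarrow> (\<exists>f\<in>mod_hom R M N. bij_betw f (carrier M) (carrier N))"

definition zero_module :: "('r, 'm) module \<Rightarrow> bool" where
  "zero_module M \<longleftrightarrow> carrier M = {\<zero>\<^bsub>M\<^esub>}"

definition regular_module :: "('r, 'q) ring_scheme \<Rightarrow> ('r, 'r) module" where
  "regular_module R =
     \<lparr>carrier = carrier R, mult = undefined, one = undefined,
      zero = \<zero>\<^bsub>R\<^esub>, add = (\<oplus>\<^bsub>R\<^esub>), smult = (\<otimes>\<^bsub>R\<^esub>)\<rparr>"

definition quot_module :: "('r, 'm) module \<Rightarrow> 'm set \<Rightarrow> ('r, 'm set) module" where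
  "quot_module M H =
     \<lparr>carrier = a_rcosets\<^bsub>M\<^esub> H, mult = undefined, one = undefined,
      zero = H, add = (<+>\<^bsub>M\<^esub>), smult = (\<lambda>r X. \<Union>x\<in>X. H +>\<^bsub>M\<^esub> (r \<odot>\<^bsub>M\<^esub> x))\<rparr>"

definition mod_product :: "'i set \<Rightarrow> ('i \<Rightarrow> ('r, 'm) module) \<Rightarrow> ('r, 'i \<Rightarrow> 'm) module" where
  "mod_product I F =
     \<lparr>carrier = (\<Pi>\<^sub>E i\<in>I. carrier (F i)), mult = undefined, one = undefined,
      zero = (\<lambda>i\<in>I. \<zero>\<^bsub>F i\<^esub>), add = (\<lambda>f g. \<lambda>i\<in>I. f i \<oplus>\<^bsub>F i\<^esub> g i),
      smult = (\<lambda>r f. \<lambda>i\<in>I. r \<odot>\<^bsub>F i\<^esub> f i)\<rparr>"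

definition mod_power :: "'i set \<Rightarrow> ('r, 'm) module \<Rightarrow> ('r, 'i \<Rightarrow> 'm) module" where
  "mod_power I M = mod_product I (\<lambda>_. M)"

definition direct_sum :: "'i set \<Rightarrow> ('i \<Rightarrow> ('r, 'm) module) \<Rightarrow> ('r, 'i \<Rightarrow> 'm) module" where
  "direct_sum I F = (mod_product I F)
     \<lparr>carrier := {f \<in> carrier (mod_product I F). finite {i\<in>I. f i \<noteq> \<zero>\<^bsub>F i\<^esub>}}\<rparr>"

definition dir_sum2 :: "('r, 'm) module \<Rightarrow> ('r, 'n) module \<Rightarrow> ('r, 'm \<times> 'n) module" where
  "dir_sum2 M N =
     \<lparr>carrier = carrier M \<times> carrier N, mult = undefined, one = undefined,
      zero = (\<zero>\<^bsub>M\<^esub>, \<zero>\<^bsub>N\<^esub>),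
      add = (\<lambda>(x, y) (x', y'). (x \<oplus>\<^bsub>M\<^esub> x', y \<oplus>\<^bsub>N\<^esub> y')),
      smult = (\<lambda>r (x, y). (r \<odot>\<^bsub>M\<^esub> x, r \<odot>\<^bsub>N\<^esub> y))\<rparr>"

definition hom_module ::
  "('r, 'q) ring_scheme \<Rightarrow> ('r, 'm) module \<Rightarrow> ('r, 'n) module \<Rightarrow> ('r, 'm \<Rightarrow> 'n) module" where
  "hom_module R M N =
     \<lparr>carrier = mod_hom R M N, mult = undefined, one = undefined,
      zero = (\<lambda>x\<in>carrier M. \<zero>\<^bsub>N\<^esub>), add = (\<lambda>f g. \<lambda>x\<in>carrier M. f x \<oplus>\<^bsub>N\<^esub> g x),
      smult = (\<lambda>r f. \<lambda>x\<in>carrier M. r \<odot>\<^bsub>N\<^esub> f x)\<rparr>"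

definition direct_summand ::
  "('r, 'q) ring_scheme \<Rightarrow> ('r, 'm) module \<Rightarrow> ('r, 'n) module \<Rightarrow> bool" where
  "direct_summand R M P \<longleftrightarrow>
     (\<exists>A B. submodule A R P \<and> submodule B R P \<and> A \<inter> B = {\<zero>\<^bsub>P\<^esub>} \<and> A <+>\<^bsub>P\<^esub> B = carrier P \<and>
            mod_isomorphic R M (P\<lparr>carrier := A\<rparr>))"


section \<open>Minimal injective coresolutions\<close>

text \<open>
  A quantifier cannot range over modules on all types, so a type is needed that is large enough
  for the constructions starting from a module \<open>M\<close> on \<open>'m\<close> over a ring on \<open>'r\<close>.  The divisible
  hull \<open>D\<close> of the additive group of \<open>M\<close> has at most \<open>|'m \<times> nat|\<close> elements, and \<open>M\<close> embeds into
  the injective module \<open>Hom\<^sub>\<int>(R, D)\<close>, which has at most \<open>|'m \<times> nat|\<^bsup>|'r \<times> nat|\<^esup>\<close>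
  elements.  This cardinal does not grow when the step is repeated with the cokernel, so a
  minimal injective coresolution of \<open>M\<close> exists on the following type; as it is unique up to
  isomorphism, the choice of one by \<open>SOME\<close> below is harmless.
\<close>

type_synonym ('r, 'm) hulltype = "'r \<times> nat \<Rightarrow> 'm \<times> nat"

text \<open>
  In the next definition the test modules also range over a hull type.  As this
  type is at least as large as \<open>'r\<close>, all ideals of \<open>R\<close>, and \<open>R\<close> itself, occur
  among them up to isomorphism; by Baer's criterion further test modules, on whatever
  type, impose no further condition.
\<close>

definition injective_module :: "('r, 'q) ring_scheme \<Rightarrow> ('r, 'm) module \<Rightarrow> bool" where
  "injective_module R I \<longleftrightarrow> module R I \<and>
     (\<forall>A :: ('r, ('r, 'm) hulltype) module. \<forall>B :: ('r, ('r, 'm) hulltype) module.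
        \<forall>j\<in>mod_hom R A B. \<forall>f\<in>mod_hom R A I.
        module R A \<longrightarrow> module R B \<longrightarrow> inj_on j (carrier A) \<longrightarrow>
        (\<exists>g\<in>mod_hom R B I. \<forall>x\<in>carrier A. g (j x) = f x))"

definition essential_submodule ::
  "('r, 'q) ring_scheme \<Rightarrow> 'm set \<Rightarrow> ('r, 'm) module \<Rightarrow> bool" where
  "essential_submodule R H M \<longleftrightarrow> submodule H R M \<and>
     (\<forall>L. submodule L R M \<longrightarrow> L \<inter> H = {\<zero>\<^bsub>M\<^esub>} \<longrightarrow> L = {\<zero>\<^bsub>M\<^esub>})"

definition injective_coresolution ::
  "('r, 'q) ring_scheme \<Rightarrow> ('r, 'm) module \<Rightarrow>
   (nat \<Rightarrow> ('r, 'e) module) \<Rightarrow> ('m \<Rightarrow> 'e) \<Rightarrow> (nat \<Rightarrow> 'e \<Rightarrow> 'e) \<Rightarrow> bool" where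
  "injective_coresolution R M E \<epsilon> d \<longleftrightarrow>
     (\<forall>i. injective_module R (E i)) \<and>
     \<epsilon> \<in> mod_hom R M (E 0) \<and> (\<forall>i. d i \<in> mod_hom R (E i) (E (Suc i))) \<and>
     inj_on \<epsilon> (carrier M) \<and>
     \<epsilon> ` carrier M = a_kernel (E 0) (E 1) (d 0) \<and>
     (\<forall>i. d i ` carrier (E i) = a_kernel (E (Suc i)) (E (Suc (Suc i))) (d (Suc i)))"

definition minimal_injective_coresolution ::
  "('r, 'q) ring_scheme \<Rightarrow> ('r, 'm) module \<Rightarrow>
   (nat \<Rightarrow> ('r, 'e) module) \<Rightarrow> ('m \<Rightarrow> 'e) \<Rightarrow> (nat \<Rightarrow> 'e \<Rightarrow> 'e) \<Rightarrow> bool" where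
  "minimal_injective_coresolution R M E \<epsilon> d \<longleftrightarrow>
     injective_coresolution R M E \<epsilon> d \<and>
     essential_submodule R (\<epsilon> ` carrier M) (E 0) \<and>
     (\<forall>i. essential_submodule R (d i ` carrier (E i)) (E (Suc i)))"

definition min_cores ::
  "('r, 'q) ring_scheme \<Rightarrow> ('r, 'm) module \<Rightarrow>
   (nat \<Rightarrow> ('r, ('r, 'm) hulltype) module) \<times> ('m \<Rightarrow> ('r, 'm) hulltype) \<times>
   (nat \<Rightarrow> ('r, 'm) hulltype \<Rightarrow> ('r, 'm) hulltype)" where
  "min_cores R M = (SOME (E, \<epsilon>, d). minimal_injective_coresolution R M E \<epsilon> d)"

definition inj_term ::
  "('r, 'q) ring_scheme \<Rightarrow> ('r, 'm) module \<Rightarrow> nat \<Rightarrow> ('r, ('r, 'm) hulltype) module" where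
  "inj_term R M = fst (min_cores R M)"

definition inj_aug :: "('r, 'q) ring_scheme \<Rightarrow> ('r, 'm) module \<Rightarrow> 'm \<Rightarrow> ('r, 'm) hulltype" where
  "inj_aug R M = fst (snd (min_cores R M))"

definition inj_diff ::
  "('r, 'q) ring_scheme \<Rightarrow> ('r, 'm) module \<Rightarrow> nat \<Rightarrow> ('r, 'm) hulltype \<Rightarrow> ('r, 'm) hulltype" where
  "inj_diff R M = snd (snd (min_cores R M))"

definition inj_envelope ::
  "('r, 'q) ring_scheme \<Rightarrow> ('r, 'm) module \<Rightarrow> ('r, ('r, 'm) hulltype) module" where
  "inj_envelope R M = inj_term R M 0"

text \<open>
  For typing reasons \<open>\<mho>\<^sub>0(M)\<close> is the isomorphic copy of \<open>M\<close> inside \<open>E\<^sub>0(M)\<close>.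
\<close>

fun mho ::
  "('r, 'q) ring_scheme \<Rightarrow> ('r, 'm) module \<Rightarrow> nat \<Rightarrow> ('r, ('r, 'm) hulltype) module" where
  "mho R M 0 = (inj_term R M 0)\<lparr>carrier := inj_aug R M ` carrier M\<rparr>"
| "mho R M (Suc i) =
     (inj_term R M (Suc i))\<lparr>carrier := inj_diff R M i ` carrier (inj_term R M i)\<rparr>"


section \<open>Ext\<close>

text \<open>\<open>Ext\<^bsup>i\<^esup>(M, N)\<close> is the cohomology of the complex \<open>Hom(M, E\<^sub>\<bullet>(N))\<close> in degree \<open>i\<close>.\<close>

definition ext_cocycles ::
  "('r, 'q) ring_scheme \<Rightarrow> nat \<Rightarrow> ('r, 'm) module \<Rightarrow> ('r, 'n) module \<Rightarrow>
   ('m \<Rightarrow> ('r, 'n) hulltype) set" where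
  "ext_cocycles R i M N = {f \<in> mod_hom R M (inj_term R N i).
     \<forall>x\<in>carrier M. inj_diff R N i (f x) = \<zero>\<^bsub>inj_term R N (Suc i)\<^esub>}"

fun ext_coboundaries ::
  "('r, 'q) ring_scheme \<Rightarrow> nat \<Rightarrow> ('r, 'm) module \<Rightarrow> ('r, 'n) module \<Rightarrow>
   ('m \<Rightarrow> ('r, 'n) hulltype) set" where
  "ext_coboundaries R 0 M N = {\<lambda>x\<in>carrier M. \<zero>\<^bsub>inj_term R N 0\<^esub>}"
| "ext_coboundaries R (Suc i) M N =
     (\<lambda>g. compose (carrier M) (inj_diff R N i) g) ` mod_hom R M (inj_term R N i)"

definition Ext ::
  "('r, 'q) ring_scheme \<Rightarrow> nat \<Rightarrow> ('r, 'm) module \<Rightarrow> ('r, 'n) module \<Rightarrow>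
   ('r, ('m \<Rightarrow> ('r, 'n) hulltype) set) module" where
  "Ext R i M N =
     quot_module ((hom_module R M (inj_term R N i))\<lparr>carrier := ext_cocycles R i M N\<rparr>)
                 (ext_coboundaries R i M N)"


section \<open>Cotilting modules and their classes\<close>

text \<open>
  Test modules on the hull type suffice here, too: the injective envelopes of all simple modules
  occur there, and a module with a nonzero map to \<open>W\<close> at each nonzero element of these contains
  copies of all of them, hence cogenerates every module.
\<close>

definition cogenerator :: "('r, 'q) ring_scheme \<Rightarrow> ('r, 'w) module \<Rightarrow> bool" where
  "cogenerator R W \<longleftrightarrow> module R W \<and>
     (\<forall>M :: ('r, ('r, 'w) hulltype) module. module R M \<longrightarrow>
        (\<forall>x\<in>carrier M. x \<noteq> \<zero>\<^bsub>M\<^esub> \<longrightarrow> (\<exists>f\<in>mod_hom R M W. f x \<noteq> \<zero>\<^bsub>W\<^esub>)))"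

definition inj_dim_le :: "('r, 'q) ring_scheme \<Rightarrow> nat \<Rightarrow> ('r, 'm) module \<Rightarrow> bool" where
  "inj_dim_le R n M \<longleftrightarrow>
     (\<exists>E :: nat \<Rightarrow> ('r, ('r, 'm) hulltype) module. \<exists>\<epsilon> d.
        injective_coresolution R M E \<epsilon> d \<and> (\<forall>i>n. zero_module (E i)))"

definition in_Prod ::
  "'u itself \<Rightarrow> ('r, 'q) ring_scheme \<Rightarrow> ('r, 'c) module \<Rightarrow> ('r, 'm) module \<Rightarrow> bool" where
  "in_Prod U R C M \<longleftrightarrow> module R M \<and> (\<exists>K :: 'u set. direct_summand R M (mod_power K C))"

text \<open>
  The type \<open>'u\<close> serves as universe: the cardinals \<open>\<kappa>\<close> are those of its subsets, and the modules
  of the exact sequence live on it.  That sequence \<open>0 \<rightarrow> C\<^sub>r \<rightarrow> \<dots> \<rightarrow> C\<^sub>0 \<rightarrow> W \<rightarrow> 0\<close> is given as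
  \<open>X 0 = W\<close> and \<open>X (Suc j) = C\<^sub>j\<close> with \<open>d j : X (Suc j) \<rightarrow> X j\<close>.
\<close>

definition cotilting ::
  "'u itself \<Rightarrow> ('r, 'q) ring_scheme \<Rightarrow> nat \<Rightarrow> ('r, 'c) module \<Rightarrow> bool" where
  "cotilting U R n C \<longleftrightarrow>
     module R C \<and>
     inj_dim_le R n C \<and>
     (\<forall>i\<ge>1. \<forall>K :: 'u set. zero_module (Ext R i (mod_power K C) C)) \<and>
     (\<exists>r d. \<exists>X :: nat \<Rightarrow> ('r, 'u) module.
        injective_module R (X 0) \<and> cogenerator R (X 0) \<and>
        (\<forall>j\<le>r. in_Prod U R C (X (Suc j)) \<and> d j \<in> mod_hom R (X (Suc j)) (X j)) \<and>
        d 0 ` carrier (X 1) = carrier (X 0) \<and>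
        (\<forall>j<r. d (Suc j) ` carrier (X (Suc (Suc j))) = a_kernel (X (Suc j)) (X j) (d j)) \<and>
        inj_on (d r) (carrier (X (Suc r))))"

definition perp :: "('r, 'q) ring_scheme \<Rightarrow> ('r, 'c) module \<Rightarrow> ('r, 'm) module set" where
  "perp R C = {M. module R M \<and> (\<forall>i\<ge>1. zero_module (Ext R i M C))}"

definition Spec :: "('r, 'q) ring_scheme \<Rightarrow> 'r set set" where
  "Spec R = {p. primeideal p R}"

definition specialization_closed :: "('r, 'q) ring_scheme \<Rightarrow> 'r set set \<Rightarrow> bool" where
  "specialization_closed R Y \<longleftrightarrow> (\<forall>p\<in>Y. \<forall>q\<in>Spec R. p \<subseteq> q \<longrightarrow> q \<in> Y)"

definition Ass :: "('r, 'q) ring_scheme \<Rightarrow> ('r, 'm) module \<Rightarrow> 'r set set" where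
  "Ass R M = {p \<in> Spec R. \<exists>x\<in>carrier M. p = {r \<in> carrier R. r \<odot>\<^bsub>M\<^esub> x = \<zero>\<^bsub>M\<^esub>}}"

text \<open>A sequence \<open>(Z\<^sub>1, \<dots>, Z\<^sub>m)\<close> is a function on \<open>nat\<close> of which only the values
  at \<open>1, \<dots>, m\<close> are used.\<close>

definition cot_class ::
  "('r, 'q) ring_scheme \<Rightarrow> nat \<Rightarrow> (nat \<Rightarrow> 'r set set) \<Rightarrow> ('r, 'm) module set" where
  "cot_class R m Z = {M. module R M \<and> (\<forall>i\<in>{1..m}. Ass R (mho R M (i - 1)) \<inter> Z i = {})}"

text \<open>
  The universe for a module on \<open>'c\<close> over a ring on \<open>'r\<close>.  As \<open>'t\<close> is arbitrary, every
  module can be moved into it.  The second summand only ensures that the universe is not too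
  small: the modules that serve as witnesses in the definition of a cotilting module, and the
  powers and approximation sequences by which two modules with the same cotilting class are
  compared, have cardinality at most a threefold iterated power set of \<open>('r + 'c) list\<close>.
\<close>

type_synonym ('r, 'c, 't) univ = "'t + ('r + 'c) list set set set set"

end

theory Submission
  imports Defs "HOL-Algebra.AbelCoset"
begin

text \<open>
  Since \<open>D\<close> is the cosyzygy \<open>\<mho>\<^sub>1(C)\<close> plus an injective module \<open>J\<close>, \<open>Ext\<^sup>i(M, D)\<close> is
  \<open>Ext\<^sup>i\<^sup>+\<^sup>1(M, C)\<close> for \<open>i \<ge> 1\<close>.  For \<open>0 \<rightarrow> K \<rightarrow> F \<rightarrow> M \<rightarrow> 0\<close> with \<open>F\<close> free, this says that \<open>M\<close> lies in
  \<open>\<^sup>\<bottom>D\<close> if and only if \<open>K\<close> lies in \<open>\<^sup>\<bottom>C\<close>, and the vanishing of \<open>Ext\<^sup>j(R/p, -)\<close> that defines the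
  classes shifts by one between \<open>K\<close> and \<open>M\<close>, because \<open>F\<close> belongs to the class of \<open>C\<close>.
  In particular all injective modules without \<open>Y\<^sub>2\<close>-torsion lie in \<open>\<^sup>\<bottom>D\<close>; applied to the
  powers of \<open>E\<^sub>0(C) \<oplus> J\<close> this gives \<open>Ext\<^sup>i(D\<^sup>K, D) = 0\<close>.

  To resolve the injective cogenerator \<open>W\<close> by summands of powers of \<open>D\<close>, walk up its resolution by
  summands of powers of \<open>C\<close>: every syzygy \<open>Z\<close> has an embedding \<open>0 \<rightarrow> Z \<rightarrow> N \<rightarrow> V \<rightarrow> 0\<close> with \<open>N\<close>
  finitely resolved by such summands and \<open>V\<close> one of them.  A summand of \<open>C\<^sup>K\<close> has such an
  embedding into an injective \<open>I\<close> without \<open>Y\<^sub>2\<close>-torsion, which is a summand of a power of \<open>J\<close>, and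
  a pushout passes to the cokernel.  For \<open>Z = W\<close> the embedding splits.

  The hypothesis on \<open>\<^sup>\<bottom>C\<close> covers modules on one type only.  Larger injective modules are reached
  because over a noetherian ring they are exhausted by small injective submodules.
\<close>

text \<open>\<open>Ext\<close> is computed from a coresolution picked by \<open>SOME\<close> on a
  type that depends on the module, and the hypothesis on the class of \<open>C\<close> concerns one
  type. Hence everything is phrased through \<open>exv\<close>, vanishing of the cohomology of
  \<open>Hom(M, E)\<close> for an arbitrary injective coresolution \<open>E\<close> on any type. It
  does not depend on \<open>E\<close>, and modules are moved between types by counting. Enough
  injectives exist because the cotilting datum of \<open>C\<close> brings an injective cogenerator
  \<open>W\<close>: modules of bounded size embed into its powers, and the noetherian condition cuts
  injectives of bounded size out of these. The module \<open>J\<close> enters the resolution of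
  \<open>W\<close> because the cokernel of an embedding of a summand of \<open>C\<^sup>K\<close>
  into a chosen injective is a summand of a power of \<open>\<mho>\<^sub>1(C)\<close> only up to
  injectives without \<open>Y\<^sub>2\<close>-torsion, which embed into powers of \<open>J\<close>.
  When the embedding of \<open>W\<close> into \<open>N\<close> splits, a surplus summand
  \<open>V\<close> of \<open>N\<close> remains. It is moved into the kernel of an epimorphism onto
  \<open>W\<close>: if \<open>B\<close> is the first syzygy of \<open>N\<close>, then
  \<open>Ext\<^sup>1(V, B) = 0\<close> by the orthogonality of powers of \<open>D\<close>, so the
  new kernel is the sum of \<open>B\<close> and \<open>V\<close>.\<close>

unbundle cardinal_syntax

section \<open>Linear maps\<close>

lemma (in abelian_group) uminus_zero: "\<ominus> \<zero> = \<zero>"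
  by (metis a_inv_closed l_zero r_neg zero_closed)

lemma (in abelian_group) minus_zero_right: "x \<in> carrier G \<Longrightarrow> x \<ominus> \<zero> = x"
  by (simp add: minus_eq uminus_zero)

text \<open>Lets the method \<open>algebra\<close> normalise sums and differences in the additive
  group of a module; \<open>one\<close> and \<open>mult\<close> merely fill the signature that its
  \<open>ring\<close> structure asks for.\<close>

lemmas (in abelian_group) abelian_group_simprules
  [algebra ring "zero G" "add G" "a_inv G" "a_minus G" "one G" "mult G"] =
  a_closed zero_closed a_inv_closed minus_closed a_assoc l_zero l_neg a_comm minus_eq
  r_zero r_neg r_neg2 r_neg1 minus_add minus_minus uminus_zero a_lcomm

lemma (in abelian_group) minus_eq_zero_iff:
  "\<lbrakk>x \<in> carrier G; y \<in> carrier G\<rbrakk> \<Longrightarrow> x \<ominus> y = \<zero> \<longleftrightarrow> x = y"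
  by (metis a_minus_def minus_equality minus_minus r_neg add.inv_closed)

text \<open>\<open>mod_hom\<close> demands extensional functions, a property that composition and
  pointwise formulas destroy. Dropping it and recording that both ends are modules lets linear maps
  be composed and added as plain functions.\<close>

definition lin ::
  "('r, 'q) ring_scheme \<Rightarrow> ('r, 'm) module \<Rightarrow> ('r, 'n) module \<Rightarrow> ('m \<Rightarrow> 'n) \<Rightarrow> bool" where
  "lin R M N f \<longleftrightarrow> module R M \<and> module R N \<and> f \<in> carrier M \<rightarrow> carrier N \<and>
     (\<forall>x\<in>carrier M. \<forall>y\<in>carrier M. f (x \<oplus>\<^bsub>M\<^esub> y) = f x \<oplus>\<^bsub>N\<^esub> f y) \<and>
     (\<forall>r\<in>carrier R. \<forall>x\<in>carrier M. f (r \<odot>\<^bsub>M\<^esub> x) = r \<odot>\<^bsub>N\<^esub> f x)"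

lemma linI:
  assumes "module R M" "module R N" "\<And>x. x \<in> carrier M \<Longrightarrow> f x \<in> carrier N"
    "\<And>x y. \<lbrakk>x \<in> carrier M; y \<in> carrier M\<rbrakk> \<Longrightarrow> f (x \<oplus>\<^bsub>M\<^esub> y) = f x \<oplus>\<^bsub>N\<^esub> f y"
    "\<And>r x. \<lbrakk>r \<in> carrier R; x \<in> carrier M\<rbrakk> \<Longrightarrow> f (r \<odot>\<^bsub>M\<^esub> x) = r \<odot>\<^bsub>N\<^esub> f x"
  shows "lin R M N f"
  using assms by (auto simp: lin_def)

lemma lin_dom: "lin R M N f \<Longrightarrow> module R M" and lin_cod: "lin R M N f \<Longrightarrow> module R N"
  and lin_closed: "lin R M N f \<Longrightarrow> x \<in> carrier M \<Longrightarrow> f x \<in> carrier N"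
  and lin_add: "lin R M N f \<Longrightarrow> x \<in> carrier M \<Longrightarrow> y \<in> carrier M \<Longrightarrow> f (x \<oplus>\<^bsub>M\<^esub> y) = f x \<oplus>\<^bsub>N\<^esub> f y"
  and lin_smult: "lin R M N f \<Longrightarrow> r \<in> carrier R \<Longrightarrow> x \<in> carrier M \<Longrightarrow> f (r \<odot>\<^bsub>M\<^esub> x) = r \<odot>\<^bsub>N\<^esub> f x"
  by (auto simp: lin_def)

lemma module_abelian_group: "module R M \<Longrightarrow> abelian_group M"
  by (rule module.axioms(2))

lemma lin_neg:
  assumes "lin R M N f" "x \<in> carrier M" shows "f (\<ominus>\<^bsub>M\<^esub> x) = \<ominus>\<^bsub>N\<^esub> f x"
proof -
  interpret M: module R M by (rule lin_dom[OF assms(1)])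
  interpret N: module R N by (rule lin_cod[OF assms(1)])
  have "f (\<ominus>\<^bsub>M\<^esub> x) = f ((\<ominus>\<^bsub>R\<^esub> \<one>\<^bsub>R\<^esub>) \<odot>\<^bsub>M\<^esub> x)" using assms by (simp add: M.smult_l_minus)
  also have "\<dots> = \<ominus>\<^bsub>N\<^esub> f x"
    using lin_closed[OF assms] by (simp add: lin_smult[OF assms(1)] assms(2) N.smult_l_minus)
  finally show ?thesis .
qed

lemma lin_minus:
  assumes "lin R M N f" "x \<in> carrier M" "y \<in> carrier M" shows "f (x \<ominus>\<^bsub>M\<^esub> y) = f x \<ominus>\<^bsub>N\<^esub> f y"
proof -
  interpret M: module R M by (rule lin_dom[OF assms(1)])
  show ?thesis using assms by (simp add: a_minus_def lin_add[OF assms(1)] lin_neg[OF assms(1)])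
qed

lemma lin_zero:
  assumes "lin R M N f" shows "f \<zero>\<^bsub>M\<^esub> = \<zero>\<^bsub>N\<^esub>"
proof -
  interpret M: module R M by (rule lin_dom[OF assms(1)])
  interpret N: module R N by (rule lin_cod[OF assms(1)])
  have "f \<zero>\<^bsub>M\<^esub> = f (\<zero>\<^bsub>M\<^esub> \<ominus>\<^bsub>M\<^esub> \<zero>\<^bsub>M\<^esub>)" by (metis M.minus_eq M.r_neg M.zero_closed)
  also have "\<dots> = \<zero>\<^bsub>N\<^esub>" using lin_closed[OF assms M.zero_closed]
    by (simp add: lin_minus[OF assms] N.minus_eq_zero_iff)
  finally show ?thesis .
qed

lemma mod_hom_lin: "\<lbrakk>f \<in> mod_hom R M N; module R M; module R N\<rbrakk> \<Longrightarrow> lin R M N f"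
  by (auto simp: mod_hom_def lin_def PiE_def)

lemma lin_mod_hom:
  assumes "lin R M N f" shows "restrict f (carrier M) \<in> mod_hom R M N"
proof -
  interpret M: module R M by (rule lin_dom[OF assms(1)])
  show ?thesis using assms by (auto simp: mod_hom_def lin_def PiE_def)
qed

lemma lin_cong:
  assumes "lin R M N f" "\<And>x. x \<in> carrier M \<Longrightarrow> g x = f x" shows "lin R M N g"
proof -
  interpret M: module R M by (rule lin_dom[OF assms(1)])
  show ?thesis using assms by (auto simp: lin_def)
qed

lemma lin_comp: "lin R M N f \<Longrightarrow> lin R N P g \<Longrightarrow> lin R M P (\<lambda>x. g (f x))"
  by (auto simp: lin_def Pi_def)

lemma lin_id: "module R M \<Longrightarrow> lin R M M (\<lambda>x. x)"
  by (auto simp: lin_def)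

lemma lin_zero_map:
  assumes "module R M" "module R N" shows "lin R M N (\<lambda>_. \<zero>\<^bsub>N\<^esub>)"
proof -
  interpret M: module R M by fact
  interpret N: module R N by fact
  show ?thesis using assms by (auto simp: lin_def)
qed

lemma lin_add_map:
  assumes "lin R M N f" "lin R M N g" shows "lin R M N (\<lambda>x. f x \<oplus>\<^bsub>N\<^esub> g x)"
proof -
  interpret M: module R M by (rule lin_dom[OF assms(1)])
  interpret N: module R N by (rule lin_cod[OF assms(1)])
  note cl = lin_closed[OF assms(1)] lin_closed[OF assms(2)]
  show ?thesis
    by (rule linI) (auto simp: cl lin_add[OF assms(1)] lin_add[OF assms(2)] lin_smult[OF assms(1)]
      lin_smult[OF assms(2)] N.smult_r_distr N.a_ac M.module_axioms N.module_axioms)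
qed

lemma lin_neg_map:
  assumes "lin R M N f" shows "lin R M N (\<lambda>x. \<ominus>\<^bsub>N\<^esub> f x)"
proof -
  interpret M: module R M by (rule lin_dom[OF assms(1)])
  interpret N: module R N by (rule lin_cod[OF assms(1)])
  note cl = lin_closed[OF assms(1)]
  show ?thesis
    by (rule linI) (auto simp: cl lin_add[OF assms(1)] lin_smult[OF assms(1)]
       N.smult_r_minus N.minus_add M.module_axioms N.module_axioms)
qed

lemma lin_minus_map: "lin R M N f \<Longrightarrow> lin R M N g \<Longrightarrow> lin R M N (\<lambda>x. f x \<ominus>\<^bsub>N\<^esub> g x)"
  unfolding a_minus_def by (intro lin_add_map lin_neg_map)

lemma regular_module_simps [simp]:
  "carrier (regular_module R) = carrier R" "\<zero>\<^bsub>regular_module R\<^esub> = \<zero>\<^bsub>R\<^esub>"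
  "x \<oplus>\<^bsub>regular_module R\<^esub> y = x \<oplus>\<^bsub>R\<^esub> y" "r \<odot>\<^bsub>regular_module R\<^esub> x = r \<otimes>\<^bsub>R\<^esub> x"
  by (simp_all add: regular_module_def)

lemma module_regular:
  assumes "cring R" shows "module R (regular_module R)"
proof -
  interpret cring R by fact
  show ?thesis
  proof (rule moduleI[OF assms])
    show "abelian_group (regular_module R)"
      by (rule abelian_groupI) (auto simp: a_ac intro!: bexI[of _ "\<ominus>\<^bsub>R\<^esub> _"] l_neg)
  qed (auto simp: m_assoc l_distr r_distr)
qed

lemma lin_smult_map:
  assumes "module R M" "x \<in> carrier M" shows "lin R (regular_module R) M (\<lambda>r. r \<odot>\<^bsub>M\<^esub> x)"
proof -
  interpret M: module R M by fact
  show ?thesis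
    by (rule linI) (use assms in \<open>auto simp: module_regular M.R.is_cring M.smult_l_distr M.smult_assoc1\<close>)
qed

subsection \<open>Submodules\<close>

lemma submoduleI:
  assumes "module R M" "H \<subseteq> carrier M" "\<zero>\<^bsub>M\<^esub> \<in> H"
    "\<And>x y. \<lbrakk>x \<in> H; y \<in> H\<rbrakk> \<Longrightarrow> x \<oplus>\<^bsub>M\<^esub> y \<in> H"
    "\<And>r x. \<lbrakk>r \<in> carrier R; x \<in> H\<rbrakk> \<Longrightarrow> r \<odot>\<^bsub>M\<^esub> x \<in> H"
  shows "submodule H R M"
proof -
  interpret M: module R M by fact
  show ?thesis
  proof (rule M.submoduleI)
    fix a assume "a \<in> H"
    then have "(\<ominus>\<^bsub>R\<^esub> \<one>\<^bsub>R\<^esub>) \<odot>\<^bsub>M\<^esub> a \<in> H" by (intro assms) auto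
    then show "\<ominus>\<^bsub>M\<^esub> a \<in> H" using \<open>a \<in> H\<close> assms(2) by (auto simp: M.smult_l_minus)
  qed (use assms in auto)
qed

lemma submoduleD:
  assumes "submodule H R M"
  shows "H \<subseteq> carrier M" "\<zero>\<^bsub>M\<^esub> \<in> H" "\<And>x y. \<lbrakk>x \<in> H; y \<in> H\<rbrakk> \<Longrightarrow> x \<oplus>\<^bsub>M\<^esub> y \<in> H"
    "\<And>r x. \<lbrakk>r \<in> carrier R; x \<in> H\<rbrakk> \<Longrightarrow> r \<odot>\<^bsub>M\<^esub> x \<in> H" "\<And>x. x \<in> H \<Longrightarrow> x \<in> carrier M"
    "\<And>x. x \<in> H \<Longrightarrow> \<ominus>\<^bsub>M\<^esub> x \<in> H" "\<And>x y. \<lbrakk>x \<in> H; y \<in> H\<rbrakk> \<Longrightarrow> x \<ominus>\<^bsub>M\<^esub> y \<in> H"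
proof -
  interpret submodule H R M by fact
  show "H \<subseteq> carrier M" "\<zero>\<^bsub>M\<^esub> \<in> H" "\<And>x y. \<lbrakk>x \<in> H; y \<in> H\<rbrakk> \<Longrightarrow> x \<oplus>\<^bsub>M\<^esub> y \<in> H"
    "\<And>r x. \<lbrakk>r \<in> carrier R; x \<in> H\<rbrakk> \<Longrightarrow> r \<odot>\<^bsub>M\<^esub> x \<in> H" "\<And>x. x \<in> H \<Longrightarrow> x \<in> carrier M"
    "\<And>x. x \<in> H \<Longrightarrow> \<ominus>\<^bsub>M\<^esub> x \<in> H" "\<And>x y. \<lbrakk>x \<in> H; y \<in> H\<rbrakk> \<Longrightarrow> x \<ominus>\<^bsub>M\<^esub> y \<in> H"
    using subset one_closed m_closed m_inv_closed by (auto simp: a_inv_def a_minus_def)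
qed

lemma submodule_module: "module R M \<Longrightarrow> submodule H R M \<Longrightarrow> module R (M\<lparr>carrier := H\<rparr>)"
  by (rule submodule.submodule_is_module)

lemma lin_incl: "module R M \<Longrightarrow> submodule H R M \<Longrightarrow> lin R (M\<lparr>carrier := H\<rparr>) M (\<lambda>x. x)"
  by (rule linI) (auto simp: submodule_module dest: submoduleD)

lemma lin_restrict: "lin R M N f \<Longrightarrow> submodule H R M \<Longrightarrow> lin R (M\<lparr>carrier := H\<rparr>) N f"
  using lin_comp[OF lin_incl] lin_dom by fastforce

lemma lin_corestrict:
  "lin R M N f \<Longrightarrow> submodule H R N \<Longrightarrow> (\<And>x. x \<in> carrier M \<Longrightarrow> f x \<in> H) \<Longrightarrow> lin R M (N\<lparr>carrier := H\<rparr>) f"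
  by (rule linI) (auto simp: submodule_module lin_def)

lemma a_kernel_iff: "x \<in> a_kernel M N f \<longleftrightarrow> x \<in> carrier M \<and> f x = \<zero>\<^bsub>N\<^esub>"
  by (simp add: a_kernel_def')

lemma submodule_vimage:
  assumes "lin R M N f" "submodule H R N"
  shows "submodule {x \<in> carrier M. f x \<in> H} R M"
proof -
  interpret M: module R M by (rule lin_dom[OF assms(1)])
  show ?thesis
    by (rule submoduleI) (use assms submoduleD[OF assms(2)] in
      \<open>auto simp: M.module_axioms lin_zero[OF assms(1)] lin_add[OF assms(1)] lin_smult[OF assms(1)]\<close>)
qed

lemma submodule_zero: "module R M \<Longrightarrow> submodule {\<zero>\<^bsub>M\<^esub>} R M"
proof -
  assume "module R M"
  then interpret M: module R M .
  show ?thesis by (rule submoduleI) (auto simp: M.module_axioms)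
qed

lemma submodule_carrier: "module R M \<Longrightarrow> submodule (carrier M) R M"
  by (rule module.carrier_is_submodule)

lemma submodule_kernel: "lin R M N f \<Longrightarrow> submodule (a_kernel M N f) R M"
  using submodule_vimage[OF _ submodule_zero[OF lin_cod]] by (fastforce simp: a_kernel_def')

lemma submodule_image:
  assumes "lin R M N f" "submodule H R M" shows "submodule (f ` H) R N"
proof -
  interpret N: module R N by (rule lin_cod[OF assms(1)])
  note * = submoduleD[OF assms(2)]
  show ?thesis
  proof (rule submoduleI)
    show "\<zero>\<^bsub>N\<^esub> \<in> f ` H" using * lin_zero[OF assms(1)] by force
    fix x y assume "x \<in> f ` H" "y \<in> f ` H" then show "x \<oplus>\<^bsub>N\<^esub> y \<in> f ` H"
      using * lin_add[OF assms(1), symmetric] by (auto intro!: imageI)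
  next
    fix r x assume "r \<in> carrier R" "x \<in> f ` H" then show "r \<odot>\<^bsub>N\<^esub> x \<in> f ` H"
      using * lin_smult[OF assms(1), symmetric] by (auto intro!: imageI)
  qed (use * assms lin_closed[OF assms(1)] N.module_axioms in auto)
qed

lemma submodule_range: "lin R M N f \<Longrightarrow> submodule (f ` carrier M) R N"
  by (rule submodule_image) (auto intro: submodule_carrier lin_dom)

lemma submodule_trans:
  assumes "module R M" "submodule H R M"
  shows "submodule K R (M\<lparr>carrier := H\<rparr>) \<longleftrightarrow> submodule K R M \<and> K \<subseteq> H"
proof
  assume K: "submodule K R (M\<lparr>carrier := H\<rparr>)"
  have "submodule K R M"
    by (rule submoduleI[OF assms(1)])
      (use submoduleD(1,2,3,4)[OF K] submoduleD(1)[OF assms(2)] in auto)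
  then show "submodule K R M \<and> K \<subseteq> H" using submoduleD(1)[OF K] by simp
next
  assume K: "submodule K R M \<and> K \<subseteq> H"
  then have "submodule K R M" by simp
  note * = submoduleD(1-4)[OF this]
  show "submodule K R (M\<lparr>carrier := H\<rparr>)"
    by (rule submoduleI[OF submodule_module[OF assms]]) (use K * in auto)
qed

lemma submodule_sum:
  assumes "module R M" "submodule H R M" "submodule K R M"
  shows "submodule {x \<oplus>\<^bsub>M\<^esub> y | x y. x \<in> H \<and> y \<in> K} R M"
proof -
  interpret M: module R M by fact
  note H = submoduleD[OF assms(2)] and K = submoduleD[OF assms(3)]
  show ?thesis
  proof (rule submoduleI)
    have "\<zero>\<^bsub>M\<^esub> = \<zero>\<^bsub>M\<^esub> \<oplus>\<^bsub>M\<^esub> \<zero>\<^bsub>M\<^esub>" by simp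
    then show "\<zero>\<^bsub>M\<^esub> \<in> {x \<oplus>\<^bsub>M\<^esub> y | x y. x \<in> H \<and> y \<in> K}" using H(2) K(2) by blast
  next
    fix a b assume "a \<in> {x \<oplus>\<^bsub>M\<^esub> y | x y. x \<in> H \<and> y \<in> K}" "b \<in> {x \<oplus>\<^bsub>M\<^esub> y | x y. x \<in> H \<and> y \<in> K}"
    then obtain x y x' y' where *: "a = x \<oplus>\<^bsub>M\<^esub> y" "b = x' \<oplus>\<^bsub>M\<^esub> y'" "x \<in> H" "y \<in> K" "x' \<in> H" "y' \<in> K" by blast
    then have "a \<oplus>\<^bsub>M\<^esub> b = (x \<oplus>\<^bsub>M\<^esub> x') \<oplus>\<^bsub>M\<^esub> (y \<oplus>\<^bsub>M\<^esub> y')" using H K by (simp add: M.a_ac)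
    moreover have "x \<oplus>\<^bsub>M\<^esub> x' \<in> H" "y \<oplus>\<^bsub>M\<^esub> y' \<in> K" using * H(3) K(3) by auto
    ultimately show "a \<oplus>\<^bsub>M\<^esub> b \<in> {x \<oplus>\<^bsub>M\<^esub> y | x y. x \<in> H \<and> y \<in> K}" by blast
  next
    fix r a assume r: "r \<in> carrier R" and "a \<in> {x \<oplus>\<^bsub>M\<^esub> y | x y. x \<in> H \<and> y \<in> K}"
    then obtain x y where *: "a = x \<oplus>\<^bsub>M\<^esub> y" "x \<in> H" "y \<in> K" by blast
    then have "r \<odot>\<^bsub>M\<^esub> a = r \<odot>\<^bsub>M\<^esub> x \<oplus>\<^bsub>M\<^esub> r \<odot>\<^bsub>M\<^esub> y" using H K r by (simp add: M.smult_r_distr)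
    moreover have "r \<odot>\<^bsub>M\<^esub> x \<in> H" "r \<odot>\<^bsub>M\<^esub> y \<in> K" using * H(4) K(4) r by auto
    ultimately show "r \<odot>\<^bsub>M\<^esub> a \<in> {x \<oplus>\<^bsub>M\<^esub> y | x y. x \<in> H \<and> y \<in> K}" by blast
  qed (use H K assms in auto)
qed

lemma submodule_Union_chain:
  assumes "module R M" "\<C> \<noteq> {}" "subset.chain \<A> \<C>" "\<And>H. H \<in> \<C> \<Longrightarrow> submodule H R M"
  shows "submodule (\<Union>\<C>) R M"
proof (rule submoduleI[OF assms(1)])
  note * = submoduleD[OF assms(4)]
  show "\<Union>\<C> \<subseteq> carrier M" "\<zero>\<^bsub>M\<^esub> \<in> \<Union>\<C>" using * assms(2) by blast+
  show "r \<odot>\<^bsub>M\<^esub> x \<in> \<Union>\<C>" if "r \<in> carrier R" "x \<in> \<Union>\<C>" for r x using * that by blast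
  fix x y assume "x \<in> \<Union>\<C>" "y \<in> \<Union>\<C>"
  then obtain H K where "H \<in> \<C>" "K \<in> \<C>" "x \<in> H" "y \<in> K" by blast
  moreover then have "H \<subseteq> K \<or> K \<subseteq> H" using assms(3) by (auto simp: subset.chain_def)
  ultimately show "x \<oplus>\<^bsub>M\<^esub> y \<in> \<Union>\<C>" using * by blast
qed

lemma lin_inj_iff:
  assumes "lin R M N f"
  shows "inj_on f (carrier M) \<longleftrightarrow> (\<forall>x\<in>carrier M. f x = \<zero>\<^bsub>N\<^esub> \<longrightarrow> x = \<zero>\<^bsub>M\<^esub>)"
proof -
  interpret M: module R M by (rule lin_dom[OF assms(1)])
  interpret N: module R N by (rule lin_cod[OF assms(1)])
  show ?thesis
  proof
    assume i: "inj_on f (carrier M)"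
    show "\<forall>x\<in>carrier M. f x = \<zero>\<^bsub>N\<^esub> \<longrightarrow> x = \<zero>\<^bsub>M\<^esub>"
      using inj_onD[OF i] lin_zero[OF assms] by (metis M.zero_closed)
  next
    assume a: "\<forall>x\<in>carrier M. f x = \<zero>\<^bsub>N\<^esub> \<longrightarrow> x = \<zero>\<^bsub>M\<^esub>"
    show "inj_on f (carrier M)"
    proof (rule inj_onI)
      fix x y assume *: "x \<in> carrier M" "y \<in> carrier M" "f x = f y"
      then have "f (x \<ominus>\<^bsub>M\<^esub> y) = \<zero>\<^bsub>N\<^esub>"
        by (simp add: lin_minus[OF assms] N.minus_eq_zero_iff lin_closed[OF assms])
      then have "x \<ominus>\<^bsub>M\<^esub> y = \<zero>\<^bsub>M\<^esub>" using a * M.minus_closed by blast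
      then show "x = y" using * by (simp add: M.minus_eq_zero_iff)
    qed
  qed
qed

lemma lin_factor:
  assumes b: "lin R B C \<beta>" "\<beta> ` carrier B = carrier C" and g: "lin R B X g"
    and k: "\<And>x. x \<in> carrier B \<Longrightarrow> \<beta> x = \<zero>\<^bsub>C\<^esub> \<Longrightarrow> g x = \<zero>\<^bsub>X\<^esub>"
  obtains h where "lin R C X h" "\<And>x. x \<in> carrier B \<Longrightarrow> h (\<beta> x) = g x"
proof -
  interpret B: module R B by (rule lin_dom[OF b(1)])
  interpret C: module R C by (rule lin_cod[OF b(1)])
  interpret X: module R X by (rule lin_cod[OF g])
  define h where "h = (\<lambda>c. g (inv_into (carrier B) \<beta> c))"
  have h: "h (\<beta> x) = g x" if "x \<in> carrier B" for x
  proof -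
    let ?y = "inv_into (carrier B) \<beta> (\<beta> x)"
    have y: "?y \<in> carrier B" "\<beta> ?y = \<beta> x" using that by (auto intro: inv_into_into f_inv_into_f)
    then have "\<beta> (?y \<ominus>\<^bsub>B\<^esub> x) = \<zero>\<^bsub>C\<^esub>"
      using that by (simp add: lin_minus[OF b(1)] C.minus_eq_zero_iff lin_closed[OF b(1)])
    then have "g (?y \<ominus>\<^bsub>B\<^esub> x) = \<zero>\<^bsub>X\<^esub>" using y that by (intro k) auto
    then show ?thesis
      using y that by (simp add: h_def lin_minus[OF g] X.minus_eq_zero_iff lin_closed[OF g])
  qed
  have "lin R C X h"
  proof (rule linI[OF C.module_axioms X.module_axioms])
    fix x assume "x \<in> carrier C"
    then obtain x' where x': "x = \<beta> x'" "x' \<in> carrier B" using b(2) by blast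
    show "h x \<in> carrier X" using x' h lin_closed[OF g] by simp
    show "h (r \<odot>\<^bsub>C\<^esub> x) = r \<odot>\<^bsub>X\<^esub> h x" if "r \<in> carrier R" for r
    proof -
      have "r \<odot>\<^bsub>C\<^esub> x = \<beta> (r \<odot>\<^bsub>B\<^esub> x')" using x' that by (simp add: lin_smult[OF b(1)])
      then show ?thesis using that x' h by (simp add: lin_smult[OF g])
    qed
    fix y assume "y \<in> carrier C"
    then obtain y' where y': "y = \<beta> y'" "y' \<in> carrier B" using b(2) by blast
    have "x \<oplus>\<^bsub>C\<^esub> y = \<beta> (x' \<oplus>\<^bsub>B\<^esub> y')" using x' y' by (simp add: lin_add[OF b(1)])
    then show "h (x \<oplus>\<^bsub>C\<^esub> y) = h x \<oplus>\<^bsub>X\<^esub> h y" using x' y' h by (simp add: lin_add[OF g])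
  qed
  then show thesis using h that by blast
qed

lemma lin_inv:
  assumes "lin R A B j" "inj_on j (carrier A)"
  obtains h where "lin R (B\<lparr>carrier := j ` carrier A\<rparr>) A h" "\<And>x. x \<in> carrier A \<Longrightarrow> h (j x) = x"
proof -
  have A: "module R A" and B: "module R B" using lin_dom lin_cod assms(1) by auto
  have j: "lin R A (B\<lparr>carrier := j ` carrier A\<rparr>) j"
    by (rule lin_corestrict[OF assms(1) submodule_range[OF assms(1)]]) auto
  show thesis
    by (rule lin_factor[OF j _ lin_id[OF A]]) (use assms lin_inj_iff[OF assms(1)] that in auto)
qed

section \<open>Transport along surjections\<close>

text \<open>The structure that a map \<open>\<pi>\<close> transfers to its image: a copy of \<open>M\<close> if \<open>\<pi>\<close> is injective,
  a copy of \<open>M / H\<close> if \<open>\<pi>\<close> identifies exactly the elements that are congruent modulo \<open>H\<close>.\<close>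

definition push :: "('r, 'm) module \<Rightarrow> ('m \<Rightarrow> 'n) \<Rightarrow> ('r, 'n) module" where
  "push M \<pi> = (let s = inv_into (carrier M) \<pi> in
     \<lparr>carrier = \<pi> ` carrier M, mult = undefined, one = undefined, zero = \<pi> \<zero>\<^bsub>M\<^esub>,
      add = (\<lambda>a b. \<pi> (s a \<oplus>\<^bsub>M\<^esub> s b)), smult = (\<lambda>r a. \<pi> (r \<odot>\<^bsub>M\<^esub> s a))\<rparr>)"

lemma lin_push:
  assumes "module R M" "submodule H R M"
    and pi: "\<And>x y. \<lbrakk>x \<in> carrier M; y \<in> carrier M\<rbrakk> \<Longrightarrow> \<pi> x = \<pi> y \<longleftrightarrow> x \<ominus>\<^bsub>M\<^esub> y \<in> H"
  shows "lin R M (push M \<pi>) \<pi>" "a_kernel M (push M \<pi>) \<pi> = H"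
proof -
  interpret M: module R M by fact
  note H = submoduleD[OF assms(2)]
  define s where "s = inv_into (carrier M) \<pi>"
  have s: "s (\<pi> x) \<in> carrier M" "\<pi> (s (\<pi> x)) = \<pi> x" "s (\<pi> x) \<ominus>\<^bsub>M\<^esub> x \<in> H" if "x \<in> carrier M" for x
  proof -
    show *: "s (\<pi> x) \<in> carrier M" "\<pi> (s (\<pi> x)) = \<pi> x"
      unfolding s_def using that by (auto intro: inv_into_into f_inv_into_f)
    then show "s (\<pi> x) \<ominus>\<^bsub>M\<^esub> x \<in> H" using pi that by blast
  qed
  have c: "carrier (push M \<pi>) = \<pi> ` carrier M" by (simp add: push_def Let_def)
  have z: "\<zero>\<^bsub>push M \<pi>\<^esub> = \<pi> \<zero>\<^bsub>M\<^esub>" by (simp add: push_def Let_def)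
  have a: "\<pi> x \<oplus>\<^bsub>push M \<pi>\<^esub> \<pi> y = \<pi> (x \<oplus>\<^bsub>M\<^esub> y)" if "x \<in> carrier M" "y \<in> carrier M" for x y
  proof -
    have "(s (\<pi> x) \<oplus>\<^bsub>M\<^esub> s (\<pi> y)) \<ominus>\<^bsub>M\<^esub> (x \<oplus>\<^bsub>M\<^esub> y) = (s (\<pi> x) \<ominus>\<^bsub>M\<^esub> x) \<oplus>\<^bsub>M\<^esub> (s (\<pi> y) \<ominus>\<^bsub>M\<^esub> y)"
      using s(1)[OF that(1)] s(1)[OF that(2)] that by algebra
    also have "\<dots> \<in> H" by (intro H(3) s(3) that)
    finally have "\<pi> (s (\<pi> x) \<oplus>\<^bsub>M\<^esub> s (\<pi> y)) = \<pi> (x \<oplus>\<^bsub>M\<^esub> y)" using pi s that by simp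
    then show ?thesis by (simp add: push_def Let_def s_def)
  qed
  have m: "r \<odot>\<^bsub>push M \<pi>\<^esub> \<pi> x = \<pi> (r \<odot>\<^bsub>M\<^esub> x)" if "r \<in> carrier R" "x \<in> carrier M" for r x
  proof -
    have "r \<odot>\<^bsub>M\<^esub> s (\<pi> x) \<ominus>\<^bsub>M\<^esub> r \<odot>\<^bsub>M\<^esub> x = r \<odot>\<^bsub>M\<^esub> (s (\<pi> x) \<ominus>\<^bsub>M\<^esub> x)"
      using s(1)[OF that(2)] that by (simp add: a_minus_def M.smult_r_distr M.smult_r_minus)
    also have "\<dots> \<in> H" by (intro H(4) s(3) that)
    finally have "\<pi> (r \<odot>\<^bsub>M\<^esub> s (\<pi> x)) = \<pi> (r \<odot>\<^bsub>M\<^esub> x)" using pi s that by simp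
    then show ?thesis by (simp add: push_def Let_def s_def)
  qed
  have mo: "module R (push M \<pi>)"
  proof (rule moduleI[OF M.R.is_cring])
    show "abelian_group (push M \<pi>)"
    proof (rule abelian_groupI)
      fix x assume "x \<in> carrier (push M \<pi>)"
      then obtain x' where x': "x = \<pi> x'" "x' \<in> carrier M" using c by auto
      show "\<zero>\<^bsub>push M \<pi>\<^esub> \<oplus>\<^bsub>push M \<pi>\<^esub> x = x" using x' by (simp add: z a)
      have "\<pi> (\<ominus>\<^bsub>M\<^esub> x') \<oplus>\<^bsub>push M \<pi>\<^esub> x = \<zero>\<^bsub>push M \<pi>\<^esub>" "\<pi> (\<ominus>\<^bsub>M\<^esub> x') \<in> carrier (push M \<pi>)"
        using x' by (auto simp: z a M.l_neg c)
      then show "\<exists>y\<in>carrier (push M \<pi>). y \<oplus>\<^bsub>push M \<pi>\<^esub> x = \<zero>\<^bsub>push M \<pi>\<^esub>" by blast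
    qed (auto simp: c z a M.a_ac)
  qed (auto simp: c z a m M.smult_l_distr M.smult_r_distr M.smult_assoc1)
  show "lin R M (push M \<pi>) \<pi>"
    by (rule linI) (auto simp: M.module_axioms mo c a m)
  show "a_kernel M (push M \<pi>) \<pi> = H"
  proof -
    have "\<pi> x = \<pi> \<zero>\<^bsub>M\<^esub> \<longleftrightarrow> x \<in> H" if "x \<in> carrier M" for x using pi[OF that M.zero_closed] that
      by (simp add: M.minus_zero_right)
    then show ?thesis using H by (auto simp: a_kernel_iff z)
  qed
qed

lemma carrier_push [simp]: "carrier (push M \<pi>) = \<pi> ` carrier M"
  by (simp add: push_def Let_def)

lemma push_inj:
  assumes "module R M" "inj_on \<pi> (carrier M)" shows "lin R M (push M \<pi>) \<pi>"
proof -
  interpret M: module R M by fact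
  show ?thesis
    by (rule lin_push(1)[OF assms(1) submodule_zero[OF assms(1)]])
      (use assms in \<open>auto simp: M.minus_eq_zero_iff dest: inj_onD\<close>)
qed

text \<open>\<open>quot_module\<close> raises the type to sets, so quotients could not be iterated
  on one type. Here every coset is represented by a chosen element, which an injection places into
  \<open>A\<close>.\<close>

lemma quotient_exists:
  fixes M :: "('r, 'm) module"
  assumes "module R M" "submodule H R M" "|carrier M| \<le>o |A :: 'b set|"
  obtains Q :: "('r, 'b) module" and \<pi> where "lin R M Q \<pi>" "\<pi> ` carrier M = carrier Q"
    "a_kernel M Q \<pi> = H" "carrier Q \<subseteq> A"
proof -
  interpret M: module R M by fact
  note H = submoduleD[OF assms(2)]
  obtain \<iota> where \<iota>: "inj_on \<iota> (carrier M)" "\<iota> ` carrier M \<subseteq> A"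
    using assms(3) by (auto simp: card_of_ordLeq[symmetric])
  define c where "c x = (SOME y. y \<in> carrier M \<and> x \<ominus>\<^bsub>M\<^esub> y \<in> H)" for x
  have c: "c x \<in> carrier M \<and> x \<ominus>\<^bsub>M\<^esub> c x \<in> H" if "x \<in> carrier M" for x
    unfolding c_def by (rule someI[of _ x]) (use that H in \<open>simp add: a_minus_def M.r_neg\<close>)
  have eq: "c x = c y \<longleftrightarrow> x \<ominus>\<^bsub>M\<^esub> y \<in> H" if xy: "x \<in> carrier M" "y \<in> carrier M" for x y
  proof
    assume "c x = c y"
    moreover have "x \<ominus>\<^bsub>M\<^esub> y = (x \<ominus>\<^bsub>M\<^esub> c x) \<ominus>\<^bsub>M\<^esub> (y \<ominus>\<^bsub>M\<^esub> c x)"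
    proof -
      have "c x \<in> carrier M" using c xy by blast
      then show ?thesis using xy by algebra
    qed
    moreover have "x \<ominus>\<^bsub>M\<^esub> c x \<in> H" "y \<ominus>\<^bsub>M\<^esub> c y \<in> H" using c xy by auto
    ultimately show "x \<ominus>\<^bsub>M\<^esub> y \<in> H" using H(7)[of "x \<ominus>\<^bsub>M\<^esub> c x" "y \<ominus>\<^bsub>M\<^esub> c y"] by simp
  next
    assume xyH: "x \<ominus>\<^bsub>M\<^esub> y \<in> H"
    have "x \<ominus>\<^bsub>M\<^esub> z \<in> H \<longleftrightarrow> y \<ominus>\<^bsub>M\<^esub> z \<in> H" if z: "z \<in> carrier M" for z
    proof -
      have "x \<ominus>\<^bsub>M\<^esub> z = (x \<ominus>\<^bsub>M\<^esub> y) \<oplus>\<^bsub>M\<^esub> (y \<ominus>\<^bsub>M\<^esub> z)" "y \<ominus>\<^bsub>M\<^esub> z = (x \<ominus>\<^bsub>M\<^esub> z) \<ominus>\<^bsub>M\<^esub> (x \<ominus>\<^bsub>M\<^esub> y)"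
        using xy z by algebra+
      then show ?thesis using H(3)[OF xyH, of "y \<ominus>\<^bsub>M\<^esub> z"] H(7)[OF _ xyH, of "x \<ominus>\<^bsub>M\<^esub> z"] by auto
    qed
    \<comment> \<open>The predicate inside \<open>SOME\<close> depends only on the coset, hence so
      does the chosen representative.\<close>
    then have "(\<lambda>z. z \<in> carrier M \<and> x \<ominus>\<^bsub>M\<^esub> z \<in> H) = (\<lambda>z. z \<in> carrier M \<and> y \<ominus>\<^bsub>M\<^esub> z \<in> H)" by blast
    then show "c x = c y" by (simp add: c_def)
  qed
  have eq': "(\<iota> \<circ> c) x = (\<iota> \<circ> c) y \<longleftrightarrow> x \<ominus>\<^bsub>M\<^esub> y \<in> H" if "x \<in> carrier M" "y \<in> carrier M" for x y
    using inj_on_eq_iff[OF \<iota>(1), of "c x" "c y"] eq[OF that] c[OF that(1)] c[OF that(2)] by simp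
  show thesis
  proof (rule that)
    show "lin R M (push M (\<iota> \<circ> c)) (\<iota> \<circ> c)" by (rule lin_push(1)[OF assms(1,2) eq'])
    show "a_kernel M (push M (\<iota> \<circ> c)) (\<iota> \<circ> c) = H" by (rule lin_push(2)[OF assms(1,2) eq'])
    show "(\<iota> \<circ> c) ` carrier M = carrier (push M (\<iota> \<circ> c))" by simp
    show "carrier (push M (\<iota> \<circ> c)) \<subseteq> A" using c \<iota>(2) by fastforce
  qed
qed

text \<open>The facts assumed about \<open>C\<close> and \<open>W\<close> concern modules on fixed
  types; a module of bounded size is brought there as an isomorphic copy.\<close>

lemma transport_exists:
  fixes M :: "('r, 'm) module"
  assumes "module R M" "|carrier M| \<le>o |A :: 'b set|"
  obtains Q :: "('r, 'b) module" and \<pi> \<rho> where "lin R M Q \<pi>" "lin R Q M \<rho>"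
    "\<And>x. x \<in> carrier M \<Longrightarrow> \<rho> (\<pi> x) = x" "\<And>x. x \<in> carrier Q \<Longrightarrow> \<pi> (\<rho> x) = x" "carrier Q \<subseteq> A"
proof -
  obtain \<iota> where \<iota>: "inj_on \<iota> (carrier M)" "\<iota> ` carrier M \<subseteq> A"
    using assms(2) by (auto simp: card_of_ordLeq[symmetric])
  have l: "lin R M (push M \<iota>) \<iota>" by (rule push_inj) fact+
  obtain h where h: "lin R (push M \<iota>\<lparr>carrier := \<iota> ` carrier M\<rparr>) M h" "\<And>x. x \<in> carrier M \<Longrightarrow> h (\<iota> x) = x"
    using lin_inv[OF l \<iota>(1)] by blast
  have "push M \<iota>\<lparr>carrier := \<iota> ` carrier M\<rparr> = push M \<iota>" by (simp add: push_def Let_def)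
  then have "lin R (push M \<iota>) M h" using h(1) by metis
  then show thesis using l h(2) \<iota> by (intro that[of "push M \<iota>" \<iota> h]) auto
qed

section \<open>Products and sums\<close>

lemma mod_product_simps [simp]:
  "carrier (mod_product I F) = (\<Pi>\<^sub>E i\<in>I. carrier (F i))"
  "\<zero>\<^bsub>mod_product I F\<^esub> = (\<lambda>i\<in>I. \<zero>\<^bsub>F i\<^esub>)"
  "f \<oplus>\<^bsub>mod_product I F\<^esub> g = (\<lambda>i\<in>I. f i \<oplus>\<^bsub>F i\<^esub> g i)"
  "r \<odot>\<^bsub>mod_product I F\<^esub> f = (\<lambda>i\<in>I. r \<odot>\<^bsub>F i\<^esub> f i)"
  by (simp_all add: mod_product_def)

lemma PiE_eqI:
  "\<lbrakk>x \<in> Pi\<^sub>E I A; y \<in> Pi\<^sub>E I B; \<And>i. i \<in> I \<Longrightarrow> x i = y i\<rbrakk> \<Longrightarrow> x = y"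
  by (rule ext) (metis PiE_arb)

lemma module_mod_product:
  assumes "cring R" "\<And>i. i \<in> I \<Longrightarrow> module R (F i)" shows "module R (mod_product I F)"
proof -
  interpret cring R by fact
  have i: "abelian_group (F i)" if "i \<in> I" for i using assms(2)[OF that] module_abelian_group by blast
  note ge = abelian_groupE[OF i]
  note mo = assms(2)
  let ?P = "mod_product I F"
  have cl: "x i \<in> carrier (F i)" if "x \<in> carrier ?P" "i \<in> I" for x i using that by auto
  have add: "x \<oplus>\<^bsub>?P\<^esub> y \<in> carrier ?P" if "x \<in> carrier ?P" "y \<in> carrier ?P" for x y
    using cl[OF that(1)] cl[OF that(2)] by (simp add: ge(1))
  have smu: "r \<odot>\<^bsub>?P\<^esub> y \<in> carrier ?P" if "r \<in> carrier R" "y \<in> carrier ?P" for r y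
    using cl[OF that(2)] that(1) by (simp add: module.smult_closed[OF mo])
  have zer: "\<zero>\<^bsub>?P\<^esub> \<in> carrier ?P" by (simp add: ge(2))
  have eq: "x = y" if "x \<in> carrier ?P" "y \<in> carrier ?P" "\<And>i. i \<in> I \<Longrightarrow> x i = y i" for x y
    using that by (auto intro: PiE_eqI)
  have ev: "i \<in> I \<Longrightarrow> (x \<oplus>\<^bsub>?P\<^esub> y) i = x i \<oplus>\<^bsub>F i\<^esub> y i" "i \<in> I \<Longrightarrow> (r \<odot>\<^bsub>?P\<^esub> y) i = r \<odot>\<^bsub>F i\<^esub> y i"
     "i \<in> I \<Longrightarrow> \<zero>\<^bsub>?P\<^esub> i = \<zero>\<^bsub>F i\<^esub>" for x y i r
    by auto
  \<comment> \<open>The operations stay folded from here on; identities are checked coordinatewise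
    through \<open>eq\<close> and \<open>ev\<close>.\<close>
  note [simp del] = mod_product_simps
  show ?thesis
  proof (rule moduleI[OF assms(1)])
    show "abelian_group (mod_product I F)"
    proof (rule abelian_groupI)
      fix x assume x: "x \<in> carrier ?P"
      show "\<exists>y\<in>carrier ?P. y \<oplus>\<^bsub>?P\<^esub> x = \<zero>\<^bsub>?P\<^esub>"
      proof (rule bexI)
        show 1: "(\<lambda>i\<in>I. \<ominus>\<^bsub>F i\<^esub> x i) \<in> carrier ?P"
          using cl[OF x] by (simp add: abelian_group.a_inv_closed[OF i] mod_product_simps)
        show "(\<lambda>i\<in>I. \<ominus>\<^bsub>F i\<^esub> x i) \<oplus>\<^bsub>?P\<^esub> x = \<zero>\<^bsub>?P\<^esub>"
          by (rule eq[OF add[OF 1 x] zer]) (use cl[OF x] in \<open>simp add: ev abelian_group.l_neg[OF i]\<close>)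
      qed
      show "\<zero>\<^bsub>?P\<^esub> \<oplus>\<^bsub>?P\<^esub> x = x" by (rule eq[OF add[OF zer x] x]) (simp add: ev ge(5) cl[OF x])
      fix y assume y: "y \<in> carrier ?P"
      show "x \<oplus>\<^bsub>?P\<^esub> y \<in> carrier ?P" using x y by (rule add)
      show "x \<oplus>\<^bsub>?P\<^esub> y = y \<oplus>\<^bsub>?P\<^esub> x"
        by (rule eq[OF add[OF x y] add[OF y x]]) (simp add: ev ge(4)[OF _ cl[OF x] cl[OF y]])
      fix z assume z: "z \<in> carrier ?P"
      show "x \<oplus>\<^bsub>?P\<^esub> y \<oplus>\<^bsub>?P\<^esub> z = x \<oplus>\<^bsub>?P\<^esub> (y \<oplus>\<^bsub>?P\<^esub> z)"
        by (rule eq) (simp_all add: add x y z ev ge(1) cl[OF x] cl[OF y] cl[OF z] ge(3)[OF _ cl[OF x] cl[OF y] cl[OF z]])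
    qed (rule zer)
  next
    fix a x assume a: "a \<in> carrier R" and x: "x \<in> carrier ?P"
    show "a \<odot>\<^bsub>?P\<^esub> x \<in> carrier ?P" using a x by (rule smu)
    fix y assume y: "y \<in> carrier ?P"
    show "a \<odot>\<^bsub>?P\<^esub> (x \<oplus>\<^bsub>?P\<^esub> y) = a \<odot>\<^bsub>?P\<^esub> x \<oplus>\<^bsub>?P\<^esub> a \<odot>\<^bsub>?P\<^esub> y"
      by (rule eq) (simp_all add: smu add x y a ev cl[OF x] cl[OF y] module.smult_r_distr[OF mo])
  next
    fix a b x assume ab: "a \<in> carrier R" "b \<in> carrier R" and x: "x \<in> carrier ?P"
    show "(a \<oplus>\<^bsub>R\<^esub> b) \<odot>\<^bsub>?P\<^esub> x = a \<odot>\<^bsub>?P\<^esub> x \<oplus>\<^bsub>?P\<^esub> b \<odot>\<^bsub>?P\<^esub> x"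
      by (rule eq) (simp_all add: smu add x ab ev cl[OF x] module.smult_l_distr[OF mo])
    show "(a \<otimes>\<^bsub>R\<^esub> b) \<odot>\<^bsub>?P\<^esub> x = a \<odot>\<^bsub>?P\<^esub> (b \<odot>\<^bsub>?P\<^esub> x)"
      by (rule eq) (simp_all add: smu add x ab ev cl[OF x] module.smult_assoc1[OF mo])
  next
    fix x assume x: "x \<in> carrier ?P"
    show "\<one>\<^bsub>R\<^esub> \<odot>\<^bsub>?P\<^esub> x = x" by (rule eq) (simp_all add: smu x ev cl[OF x] module.smult_one[OF mo])
  qed
qed

lemma lin_proj:
  assumes "cring R" "\<And>i. i \<in> I \<Longrightarrow> module R (F i)" "i \<in> I" shows "lin R (mod_product I F) (F i) (\<lambda>x. x i)"
  proof (rule linI)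
  show "module R (mod_product I F)" using assms by (intro module_mod_product)
qed (use assms(2)[OF assms(3)] assms(3) in auto)

lemma lin_tuple:
  assumes "cring R" "module R M" "\<And>i. i \<in> I \<Longrightarrow> lin R M (F i) (f i)" shows "lin R M (mod_product I F) (\<lambda>x. \<lambda>i\<in>I. f i x)"
proof -
  have "module R (mod_product I F)" using assms(1) lin_cod[OF assms(3)] by (rule module_mod_product)
  then show ?thesis
  proof (rule linI[OF assms(2)])
    show "(\<lambda>i\<in>I. f i (x \<oplus>\<^bsub>M\<^esub> y)) = (\<lambda>i\<in>I. f i x) \<oplus>\<^bsub>mod_product I F\<^esub> (\<lambda>i\<in>I. f i y)"
      if "x \<in> carrier M" "y \<in> carrier M" for x y
      using lin_add[OF assms(3) that] by (simp add: restrict_def fun_eq_iff)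
    show "(\<lambda>i\<in>I. f i (r \<odot>\<^bsub>M\<^esub> x)) = r \<odot>\<^bsub>mod_product I F\<^esub> (\<lambda>i\<in>I. f i x)"
      if "r \<in> carrier R" "x \<in> carrier M" for r x
      using lin_smult[OF assms(3) that] by (simp add: restrict_def fun_eq_iff)
    show "(\<lambda>i\<in>I. f i x) \<in> carrier (mod_product I F)" if "x \<in> carrier M" for x
      using lin_closed[OF assms(3) that] by simp
  qed
qed

lemma dir_sum2_simps [simp]:
  "carrier (dir_sum2 M N) = carrier M \<times> carrier N"
  "\<zero>\<^bsub>dir_sum2 M N\<^esub> = (\<zero>\<^bsub>M\<^esub>, \<zero>\<^bsub>N\<^esub>)"
  "a \<oplus>\<^bsub>dir_sum2 M N\<^esub> b = (fst a \<oplus>\<^bsub>M\<^esub> fst b, snd a \<oplus>\<^bsub>N\<^esub> snd b)"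
  "r \<odot>\<^bsub>dir_sum2 M N\<^esub> a = (r \<odot>\<^bsub>M\<^esub> fst a, r \<odot>\<^bsub>N\<^esub> snd a)"
  by (simp_all add: dir_sum2_def case_prod_beta)

lemma module_dir_sum2:
  assumes "module R M" "module R N" shows "module R (dir_sum2 M N)"
proof -
  interpret M: module R M by fact
  interpret N: module R N by fact
  show ?thesis
  proof (rule moduleI[OF M.R.is_cring])
    show "abelian_group (dir_sum2 M N)"
    proof (rule abelian_groupI)
      fix x assume x: "x \<in> carrier (dir_sum2 M N)"
      show "\<exists>y\<in>carrier (dir_sum2 M N). y \<oplus>\<^bsub>dir_sum2 M N\<^esub> x = \<zero>\<^bsub>dir_sum2 M N\<^esub>"
        by (rule bexI[of _ "(\<ominus>\<^bsub>M\<^esub> fst x, \<ominus>\<^bsub>N\<^esub> snd x)"]) (use x in \<open>auto simp: M.l_neg N.l_neg\<close>)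
    qed (auto simp: M.a_ac N.a_ac)
  qed (auto simp: M.smult_l_distr M.smult_r_distr M.smult_assoc1 N.smult_l_distr N.smult_r_distr N.smult_assoc1)
qed

lemma lin_fst: "module R M \<Longrightarrow> module R N \<Longrightarrow> lin R (dir_sum2 M N) M fst"
  and lin_snd: "module R M \<Longrightarrow> module R N \<Longrightarrow> lin R (dir_sum2 M N) N snd"
  by (auto intro!: linI module_dir_sum2)

lemma lin_pair: "lin R X M f \<Longrightarrow> lin R X N g \<Longrightarrow> lin R X (dir_sum2 M N) (\<lambda>x. (f x, g x))"
  by (rule linI) (auto simp: lin_def intro: module_dir_sum2)

text \<open>A zero module on an arbitrary type: it fills the vanishing places of coresolutions,
  where some element of the type has to serve as zero.\<close>

definition zmod :: "'m \<Rightarrow> ('r, 'm) module" where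
  "zmod c = \<lparr>carrier = {c}, mult = undefined, one = undefined, zero = c, add = (\<lambda>_ _. c), smult = (\<lambda>_ _. c)\<rparr>"

lemma zmod_simps [simp]: "carrier (zmod c) = {c}" "\<zero>\<^bsub>zmod c\<^esub> = c"
  by (simp_all add: zmod_def)

lemma module_zmod: "cring R \<Longrightarrow> module R (zmod c)"
  by (rule moduleI, assumption, rule abelian_groupI) (auto simp: zmod_def)

section \<open>Injective modules\<close>

text \<open>Injectivity by Baer's criterion: it refers to ideals only and so does not depend on a
  type of test modules. A map from an ideal extends to \<open>R\<close> exactly if it is
  multiplication by some element \<open>e\<close>, the value at 1.\<close>

definition baer :: "('r, 'q) ring_scheme \<Rightarrow> ('r, 'm) module \<Rightarrow> bool" where
  "baer R I \<longleftrightarrow> module R I \<and>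
     (\<forall>J f. ideal J R \<longrightarrow> lin R ((regular_module R)\<lparr>carrier := J\<rparr>) I f \<longrightarrow>
        (\<exists>e\<in>carrier I. \<forall>r\<in>J. f r = r \<odot>\<^bsub>I\<^esub> e))"

lemma baer_module: "baer R I \<Longrightarrow> module R I"
  by (simp add: baer_def)

lemma baerD:
  "\<lbrakk>baer R I; ideal J R; lin R ((regular_module R)\<lparr>carrier := J\<rparr>) I f\<rbrakk> \<Longrightarrow> \<exists>e\<in>carrier I. \<forall>r\<in>J. f r = r \<odot>\<^bsub>I\<^esub> e"
  unfolding baer_def by blast

lemma submodule_ideal_iff:
  assumes "cring R" shows "submodule J R (regular_module R) \<longleftrightarrow> ideal J R"
proof
  interpret cring R by fact
  assume J: "ideal J R"
  interpret J: ideal J R by fact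
  show "submodule J R (regular_module R)"
    by (rule submoduleI[OF module_regular[OF assms]])
      (use J.a_subset J.I_l_closed in auto)
next
  interpret cring R by fact
  assume J: "submodule J R (regular_module R)"
  show "ideal J R"
  proof (rule idealI[OF ring_axioms])
    have sub: "J \<subseteq> carrier R" using submoduleD(1)[OF J] by simp
    have "\<ominus>\<^bsub>R\<^esub> x \<in> J" if "x \<in> J" for x
    proof -
      have "(\<ominus>\<^bsub>R\<^esub> \<one>\<^bsub>R\<^esub>) \<otimes>\<^bsub>R\<^esub> x \<in> J" using submoduleD(4)[OF J, of "\<ominus>\<^bsub>R\<^esub> \<one>\<^bsub>R\<^esub>" x] that by simp
      moreover have "x \<in> carrier R" using that sub by blast
      ultimately show ?thesis by (simp add: l_minus)
    qed
    then show "subgroup J (add_monoid R)"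
      using submoduleD(2,3)[OF J] sub by (intro subgroup.intro) (auto simp: a_inv_def)
    fix a x assume *: "a \<in> J" "x \<in> carrier R"
    then show "x \<otimes>\<^bsub>R\<^esub> a \<in> J" using submoduleD(4)[OF J, of x a] by simp
    moreover have "a \<in> carrier R" using submoduleD(5)[OF J, of a] * by simp
    ultimately show "a \<otimes>\<^bsub>R\<^esub> x \<in> J" using * by (simp add: m_comm)
  qed
qed

lemma ideal_subset: "ideal J R \<Longrightarrow> J \<subseteq> carrier R"
  by (simp add: additive_subgroup.a_subset ideal.axioms(1))

text \<open>Baer's criterion: a maximal extension of \<open>f\<close>, viewed as a submodule of \<open>B \<oplus> I\<close> that is the
  graph of a map, is defined on all of \<open>B\<close>.\<close>

lemma baer_extend_submodule:
  assumes I: "baer R I" and B: "module R B" and A: "submodule A R B"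
    and f: "lin R (B\<lparr>carrier := A\<rparr>) I f"
  obtains g where "lin R B I g" "\<And>x. x \<in> A \<Longrightarrow> g x = f x"
proof -
  interpret B: module R B by fact
  interpret I: module R I by (rule baer_module[OF I])
  let ?P = "dir_sum2 B I"
  interpret P: module R ?P by (rule module_dir_sum2[OF B I.module_axioms])
  define \<G> where "\<G> = {G. submodule G R ?P \<and> (\<forall>y. (\<zero>\<^bsub>B\<^esub>, y) \<in> G \<longrightarrow> y = \<zero>\<^bsub>I\<^esub>) \<and> (\<lambda>x. (x, f x)) ` A \<subseteq> G}"
  have "lin R (B\<lparr>carrier := A\<rparr>) ?P (\<lambda>x. (x, f x))"
    by (rule lin_pair[OF lin_incl[OF B A] f])
  from submodule_range[OF this] have "submodule ((\<lambda>x. (x, f x)) ` A) R ?P" by simp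
  moreover have "f \<zero>\<^bsub>B\<^esub> = \<zero>\<^bsub>I\<^esub>" using lin_zero[OF f] by simp
  ultimately have "(\<lambda>x. (x, f x)) ` A \<in> \<G>" by (auto simp: \<G>_def)
  then have "\<G> \<noteq> {}" by blast
  moreover have "\<Union>\<C> \<in> \<G>" if ch: "\<C> \<noteq> {}" "subset.chain \<G> \<C>" for \<C>
  proof -
    have "\<C> \<subseteq> \<G>" using that by (simp add: subset.chain_def)
    then have sU: "submodule (\<Union>\<C>) R ?P"
      by (intro submodule_Union_chain[OF P.module_axioms that]) (auto simp: \<G>_def)
    obtain H where "H \<in> \<C>" using ch(1) by blast
    moreover from this have "(\<lambda>x. (x, f x)) ` A \<subseteq> H" using \<open>\<C> \<subseteq> \<G>\<close> unfolding \<G>_def by blast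
    ultimately have "(\<lambda>x. (x, f x)) ` A \<subseteq> \<Union>\<C>" by blast
    moreover have "y = \<zero>\<^bsub>I\<^esub>" if "(\<zero>\<^bsub>B\<^esub>, y) \<in> \<Union>\<C>" for y
      using \<open>\<C> \<subseteq> \<G>\<close> that by (auto simp: \<G>_def)
    ultimately show ?thesis using sU by (auto simp: \<G>_def)
  qed
  ultimately obtain G where G: "G \<in> \<G>" and max: "\<And>X. X \<in> \<G> \<Longrightarrow> G \<subseteq> X \<Longrightarrow> X = G"
    using subset_Zorn_nonempty[of \<G>] by blast
  have sG: "submodule G R ?P" and zG: "\<And>y. (\<zero>\<^bsub>B\<^esub>, y) \<in> G \<Longrightarrow> y = \<zero>\<^bsub>I\<^esub>"
    and fG: "\<And>x. x \<in> A \<Longrightarrow> (x, f x) \<in> G"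
    using G by (auto simp: \<G>_def)
  note G' = submoduleD[OF sG]
  have lf: "lin R (?P\<lparr>carrier := G\<rparr>) B fst"
    by (rule lin_restrict[OF lin_fst[OF B I.module_axioms] sG])
  have ls: "lin R (?P\<lparr>carrier := G\<rparr>) I snd"
    by (rule lin_restrict[OF lin_snd[OF B I.module_axioms] sG])
  have "inj_on fst (carrier (?P\<lparr>carrier := G\<rparr>))"
    unfolding lin_inj_iff[OF lf] using zG by auto
  from lin_inv[OF lf this] obtain h where h: "lin R (B\<lparr>carrier := fst ` G\<rparr>) (?P\<lparr>carrier := G\<rparr>) h"
    "\<And>z. z \<in> G \<Longrightarrow> h (fst z) = z" by auto
  define S where "S = fst ` G"
  define g where "g = (\<lambda>x. snd (h x))"
  have sS: "submodule S R B" using submodule_range[OF lf] by (simp add: S_def)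
  note S = submoduleD[OF sS]
  have g: "lin R (B\<lparr>carrier := S\<rparr>) I g" unfolding g_def S_def by (rule lin_comp[OF h(1) ls])
  have gG: "g (fst z) = snd z" if "z \<in> G" for z using h(2)[OF that] by (simp add: g_def)
  have gf: "g x = f x" if "x \<in> A" for x using gG[OF fG[OF that]] by simp
  have "b \<in> S" if b: "b \<in> carrier B" for b
  proof (rule ccontr)
    assume "b \<notin> S"
    \<comment> \<open>To adjoin \<open>b\<close>, consider the ideal of scalars that carry it into
      \<open>S\<close> and the map \<open>r \<mapsto> g (r b)\<close> on this ideal; the element
      \<open>e\<close> that injectivity provides becomes the value at \<open>b\<close>.\<close>
    define J where "J = {r \<in> carrier R. r \<odot>\<^bsub>B\<^esub> b \<in> S}"
    have lb: "lin R (regular_module R) B (\<lambda>r. r \<odot>\<^bsub>B\<^esub> b)" by (rule lin_smult_map[OF B b])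
    have sJ: "submodule J R (regular_module R)"
      using submodule_vimage[OF lb sS] by (simp add: J_def)
    then have J: "ideal J R" by (simp add: submodule_ideal_iff B.R.is_cring)
    have "lin R ((regular_module R)\<lparr>carrier := J\<rparr>) (B\<lparr>carrier := S\<rparr>) (\<lambda>r. r \<odot>\<^bsub>B\<^esub> b)"
      by (rule lin_corestrict[OF lin_restrict[OF lb sJ] sS]) (simp add: J_def)
    from baerD[OF I J lin_comp[OF this g]]
    obtain e where e: "e \<in> carrier I" "\<And>r. r \<in> J \<Longrightarrow> g (r \<odot>\<^bsub>B\<^esub> b) = r \<odot>\<^bsub>I\<^esub> e" by blast
    let ?m = "\<lambda>r. r \<odot>\<^bsub>?P\<^esub> (b, e)"
    have be: "(b, e) \<in> carrier ?P" using b e by simp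
    have lm: "lin R (regular_module R) ?P ?m" by (rule lin_smult_map[OF P.module_axioms be])
    define G2 where "G2 = {x \<oplus>\<^bsub>?P\<^esub> y | x y. x \<in> G \<and> y \<in> ?m ` carrier R}"
    have sG2: "submodule G2 R ?P"
      unfolding G2_def using submodule_range[OF lm] by (intro submodule_sum[OF P.module_axioms sG]) simp
    have mem: "z \<oplus>\<^bsub>?P\<^esub> ?m r \<in> G2" if "z \<in> G" "r \<in> carrier R" for z r
      using that unfolding G2_def by blast
    have "z \<in> G2" if "z \<in> G" for z
    proof -
      have "z \<oplus>\<^bsub>?P\<^esub> ?m \<zero>\<^bsub>R\<^esub> = z" using G'(5)[OF that] b e by (cases z) auto
      then show ?thesis using mem[OF that B.R.zero_closed] by simp
    qed
    then have GG2: "G \<subseteq> G2" by blast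
    have "y = \<zero>\<^bsub>I\<^esub>" if y: "(\<zero>\<^bsub>B\<^esub>, y) \<in> G2" for y
    proof -
      from y obtain z r where z: "z \<in> G" and r: "r \<in> carrier R" and eq: "(\<zero>\<^bsub>B\<^esub>, y) = z \<oplus>\<^bsub>?P\<^esub> ?m r"
        unfolding G2_def by blast
      have zc: "fst z \<in> carrier B" "snd z \<in> carrier I" using G'(5)[OF z] by auto
      have zS: "fst z \<in> S" using z by (simp add: S_def)
      have 1: "fst z \<oplus>\<^bsub>B\<^esub> r \<odot>\<^bsub>B\<^esub> b = \<zero>\<^bsub>B\<^esub>" using eq by simp
      then have "r \<odot>\<^bsub>B\<^esub> b = \<ominus>\<^bsub>B\<^esub> fst z"
        using zc r b by (metis B.minus_equality B.smult_closed B.a_comm)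
      then have rb: "r \<odot>\<^bsub>B\<^esub> b \<in> S" using S(6)[OF zS] by simp
      then have rJ: "r \<in> J" using r by (simp add: J_def)
      have "y = snd z \<oplus>\<^bsub>I\<^esub> r \<odot>\<^bsub>I\<^esub> e" using eq by simp
      also have "\<dots> = g (fst z) \<oplus>\<^bsub>I\<^esub> g (r \<odot>\<^bsub>B\<^esub> b)" using gG[OF z] e(2)[OF rJ] by simp
      also have "\<dots> = g (fst z \<oplus>\<^bsub>B\<^esub> r \<odot>\<^bsub>B\<^esub> b)" using lin_add[OF g, of "fst z" "r \<odot>\<^bsub>B\<^esub> b"] zS rb by simp
      also have "\<dots> = \<zero>\<^bsub>I\<^esub>" using 1 lin_zero[OF g] by simp
      finally show ?thesis .
    qed
    then have "G2 \<in> \<G>" using sG2 GG2 fG by (auto simp: \<G>_def)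
    from max[OF this GG2] have "G2 = G" .
    moreover have "\<zero>\<^bsub>?P\<^esub> \<oplus>\<^bsub>?P\<^esub> ?m \<one>\<^bsub>R\<^esub> = (b, e)" using b e by simp
    then have "(b, e) \<in> G2" using mem[OF G'(2) B.R.one_closed] by simp
    ultimately have "(b, e) \<in> G" by simp
    then have "b \<in> S" unfolding S_def by force
    then show False using \<open>b \<notin> S\<close> by simp
  qed
  then have "S = carrier B" using S(1) by blast
  then show thesis using that[of g] g gf by simp
qed

lemma baer_extend:
  assumes I: "baer R I" and j: "lin R A B j" "inj_on j (carrier A)" and f: "lin R A I f"
  obtains g where "lin R B I g" "\<And>x. x \<in> carrier A \<Longrightarrow> g (j x) = f x"
proof -
  obtain h where h: "lin R (B\<lparr>carrier := j ` carrier A\<rparr>) A h" "\<And>x. x \<in> carrier A \<Longrightarrow> h (j x) = x"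
    using lin_inv[OF j] by blast
  obtain g where "lin R B I g" "\<And>x. x \<in> j ` carrier A \<Longrightarrow> g x = f (h x)"
    using baer_extend_submodule[OF I lin_cod[OF j(1)] submodule_range[OF j(1)] lin_comp[OF h(1) f]] by blast
  then show thesis using that h(2) by simp
qed

text \<open>\<open>g\<close> factors through the image of \<open>b\<close>, and the factor extends.
  In this form injectivity yields chain maps and homotopies, since differentials are not
  injective.\<close>

lemma baer_extend_over:
  assumes I: "baer R I" and b: "lin R Y Z b" and g: "lin R Y I g"
    and k: "\<And>y. y \<in> carrier Y \<Longrightarrow> b y = \<zero>\<^bsub>Z\<^esub> \<Longrightarrow> g y = \<zero>\<^bsub>I\<^esub>"
  obtains h where "lin R Z I h" "\<And>y. y \<in> carrier Y \<Longrightarrow> h (b y) = g y"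
proof -
  have sb: "submodule (b ` carrier Y) R Z" by (rule submodule_range[OF b])
  have b': "lin R Y (Z\<lparr>carrier := b ` carrier Y\<rparr>) b" by (rule lin_corestrict[OF b sb]) simp
  obtain h0 where h0: "lin R (Z\<lparr>carrier := b ` carrier Y\<rparr>) I h0" "\<And>y. y \<in> carrier Y \<Longrightarrow> h0 (b y) = g y"
    by (rule lin_factor[OF b' _ g]) (use k in auto)
  obtain h where "lin R Z I h" "\<And>x. x \<in> b ` carrier Y \<Longrightarrow> h x = h0 x"
    using baer_extend_submodule[OF I lin_cod[OF b] sb h0(1)] by blast
  then show thesis using that h0(2) by simp
qed

lemma baer_injective_module:
  fixes R :: "('a, 'q) ring_scheme" and I :: "('a, 'b) module"
  shows "baer R I \<Longrightarrow> injective_module R I"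
  unfolding injective_module_def
proof (intro conjI allI ballI impI)
  assume I: "baer R I"
  then show mI: "module R I" by (rule baer_module)
  fix A B :: "('a, ('a, 'b) hulltype) module" and j f
  assume j: "j \<in> mod_hom R A B" and f: "f \<in> mod_hom R A I" and AB: "module R A" "module R B"
    and inj: "inj_on j (carrier A)"
  obtain g where g: "lin R B I g" "\<And>x. x \<in> carrier A \<Longrightarrow> g (j x) = f x"
    using baer_extend[OF I mod_hom_lin[OF j AB] inj mod_hom_lin[OF f AB(1) mI]] by blast
  have "j x \<in> carrier B" if "x \<in> carrier A" for x using j that by (auto simp: mod_hom_def)
  then show "\<exists>g\<in>mod_hom R B I. \<forall>x\<in>carrier A. g (j x) = f x"
    using lin_mod_hom[OF g(1)] g(2) by (intro bexI[of _ "restrict g (carrier B)"]) auto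
qed

text \<open>A ring element \<open>r\<close> is coded by the indicator function of the pairs with
  first component \<open>r\<close>.\<close>

lemma card_ring_hulltype: "|A :: 'r set| \<le>o |UNIV :: ('r, 'e) hulltype set|"
proof -
  let ?i = "\<lambda>(r::'r) (z :: 'r \<times> nat). (undefined :: 'e, if fst z = r then 1 else (0::nat))"
  have "inj_on ?i A"
  proof (rule inj_onI)
    fix x y assume "?i x = ?i y"
    then have "?i x (x, 0) = ?i y (x, 0)" by metis
    then show "x = y" by (auto split: if_splits)
  qed
  then show ?thesis by (metis card_of_ordLeq subset_UNIV)
qed

text \<open>The hull type contains a copy of \<open>R\<close>, so the inclusion of an ideal occurs
  among the test monomorphisms; the element required by Baer's criterion is the image of 1 under the
  extended map.\<close>

lemma injective_module_baer:
  assumes "injective_module R (I :: ('r, 'e) module)" shows "baer R I"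
  unfolding baer_def
proof (intro conjI allI impI)
  show mI: "module R I" using assms by (simp add: injective_module_def)
  interpret I: module R I by fact
  let ?Re = "regular_module R"
  have mR: "module R ?Re" by (rule module_regular[OF I.R.is_cring])
  fix J f assume J: "ideal J R" and f: "lin R (?Re\<lparr>carrier := J\<rparr>) I f"
  have sJ: "submodule J R ?Re" using J by (simp add: submodule_ideal_iff I.R.is_cring)
  obtain Q :: "('r, ('r, 'e) hulltype) module" and \<pi> \<rho> where Q: "lin R ?Re Q \<pi>" "lin R Q ?Re \<rho>"
    "\<And>x. x \<in> carrier ?Re \<Longrightarrow> \<rho> (\<pi> x) = x"
    using transport_exists[OF mR card_ring_hulltype] by metis
  have sub: "J \<subseteq> carrier R" using submoduleD(1)[OF sJ] by simp
  let ?A = "Q\<lparr>carrier := \<pi> ` J\<rparr>"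
  have sA: "submodule (\<pi> ` J) R Q" by (rule submodule_image[OF Q(1) sJ])
  have mQ: "module R Q" by (rule lin_cod[OF Q(1)])
  have mA: "module R ?A" by (rule submodule_module[OF mQ sA])
  have 1: "restrict (\<lambda>x. x) (\<pi> ` J) \<in> mod_hom R ?A Q"
    using lin_mod_hom[OF lin_incl[OF mQ sA]] by simp
  have "lin R ?A (?Re\<lparr>carrier := J\<rparr>) \<rho>"
    by (rule lin_corestrict[OF lin_restrict[OF Q(2) sA] sJ]) (use Q(3) sub in auto)
  from lin_mod_hom[OF lin_comp[OF this f]]
  have 2: "restrict (\<lambda>x. f (\<rho> x)) (\<pi> ` J) \<in> mod_hom R ?A I" by simp
  have 3: "inj_on (restrict (\<lambda>x. x) (\<pi> ` J)) (carrier ?A)" by (auto simp: inj_on_def)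
  obtain g where g: "g \<in> mod_hom R Q I" "\<forall>x\<in>\<pi> ` J. g (restrict (\<lambda>x. x) (\<pi> ` J) x) = restrict (\<lambda>x. f (\<rho> x)) (\<pi> ` J) x"
    using assms[unfolded injective_module_def, THEN conjunct2, rule_format, OF 1 2 mA mQ 3]
    by auto
  have gl: "lin R Q I g" by (rule mod_hom_lin[OF g(1) mQ mI])
  show "\<exists>e\<in>carrier I. \<forall>r\<in>J. f r = r \<odot>\<^bsub>I\<^esub> e"
  proof (intro bexI ballI)
    show "g (\<pi> \<one>\<^bsub>R\<^esub>) \<in> carrier I" by (rule lin_closed[OF gl lin_closed[OF Q(1)]]) simp
    fix r assume r: "r \<in> J"
    have rc: "r \<in> carrier R" using r sub by blast
    have "f r = g (\<pi> r)" using g(2) r Q(3) rc by simp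
    also have "\<pi> r = r \<odot>\<^bsub>Q\<^esub> \<pi> \<one>\<^bsub>R\<^esub>" using lin_smult[OF Q(1), of r "\<one>\<^bsub>R\<^esub>"] rc by simp
    also have "g \<dots> = r \<odot>\<^bsub>I\<^esub> g (\<pi> \<one>\<^bsub>R\<^esub>)"
      by (rule lin_smult[OF gl rc lin_closed[OF Q(1)]]) simp
    finally show "f r = r \<odot>\<^bsub>I\<^esub> g (\<pi> \<one>\<^bsub>R\<^esub>)" .
  qed
qed

lemma injective_module_iff_baer: "injective_module R I \<longleftrightarrow> baer R I"
  using injective_module_baer baer_injective_module by blast

lemma baer_retract:
  assumes I: "baer R I" and s: "lin R S I s" and p: "lin R I S p" and ps: "\<And>x. x \<in> carrier S \<Longrightarrow> p (s x) = x"
  shows "baer R S"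
  unfolding baer_def
proof (intro conjI allI impI)
  show "module R S" by (rule lin_dom[OF s])
  fix J f assume J: "ideal J R" and f: "lin R ((regular_module R)\<lparr>carrier := J\<rparr>) S f"
  have sub: "J \<subseteq> carrier R" by (rule ideal_subset[OF J])
  obtain e where e: "e \<in> carrier I" "\<And>r. r \<in> J \<Longrightarrow> s (f r) = r \<odot>\<^bsub>I\<^esub> e"
    using baerD[OF I J lin_comp[OF f s]] by blast
  show "\<exists>e\<in>carrier S. \<forall>r\<in>J. f r = r \<odot>\<^bsub>S\<^esub> e"
  proof (intro bexI ballI)
    show "p e \<in> carrier S" by (rule lin_closed[OF p e(1)])
    fix r assume r: "r \<in> J"
    have "f r \<in> carrier S" using lin_closed[OF f] r by simp
    then have "f r = p (s (f r))" by (simp add: ps)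
    also have "\<dots> = r \<odot>\<^bsub>S\<^esub> p e" using e(2)[OF r] lin_smult[OF p _ e(1)] r sub by auto
    finally show "f r = r \<odot>\<^bsub>S\<^esub> p e" .
  qed
qed

lemma baer_split:
  assumes "baer R I" "lin R I M j" "inj_on j (carrier I)"
  obtains p where "lin R M I p" "\<And>x. x \<in> carrier I \<Longrightarrow> p (j x) = x"
  using baer_extend[OF assms lin_id[OF baer_module[OF assms(1)]]] by blast

lemma baer_product:
  assumes "cring R" "\<And>i. i \<in> I \<Longrightarrow> baer R (F i)" shows "baer R (mod_product I F)"
  unfolding baer_def
proof (intro conjI allI impI)
  have mo: "\<And>i. i \<in> I \<Longrightarrow> module R (F i)" using assms(2) baer_module by blast
  show "module R (mod_product I F)" by (rule module_mod_product[OF assms(1) mo])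
  fix J f assume J: "ideal J R" and f: "lin R ((regular_module R)\<lparr>carrier := J\<rparr>) (mod_product I F) f"
  have "lin R (mod_product I F) (F i) (\<lambda>x. x i)" if i: "i \<in> I" for i
    by (rule lin_proj[OF assms(1) _ i]) (rule mo)
  from baerD[OF assms(2) J lin_comp[OF f this]]
  have "\<exists>e\<in>carrier (F i). \<forall>r\<in>J. f r i = r \<odot>\<^bsub>F i\<^esub> e" if "i \<in> I" for i
    using that by blast
  then obtain e where e: "\<And>i. i \<in> I \<Longrightarrow> e i \<in> carrier (F i)" "\<And>i r. i \<in> I \<Longrightarrow> r \<in> J \<Longrightarrow> f r i = r \<odot>\<^bsub>F i\<^esub> e i"
    by metis
  show "\<exists>e\<in>carrier (mod_product I F). \<forall>r\<in>J. f r = r \<odot>\<^bsub>mod_product I F\<^esub> e"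
  proof (intro bexI ballI)
    show "restrict e I \<in> carrier (mod_product I F)" using e by simp
    fix r assume r: "r \<in> J"
    have fr: "f r \<in> Pi\<^sub>E I (\<lambda>i. carrier (F i))" using lin_closed[OF f, of r] r by simp
    show "f r = r \<odot>\<^bsub>mod_product I F\<^esub> restrict e I"
    proof (rule ext)
      fix i
      show "f r i = (r \<odot>\<^bsub>mod_product I F\<^esub> restrict e I) i"
        using e(2)[OF _ r, of i] PiE_arb[OF fr, of i] by (cases "i \<in> I") simp_all
    qed
  qed
qed

lemma baer_dir_sum2:
  assumes "baer R M" "baer R N" shows "baer R (dir_sum2 M N)"
  unfolding baer_def
proof (intro conjI allI impI)
  note mo = baer_module[OF assms(1)] baer_module[OF assms(2)]
  show "module R (dir_sum2 M N)" by (rule module_dir_sum2[OF mo])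
  fix J f assume J: "ideal J R" and f: "lin R ((regular_module R)\<lparr>carrier := J\<rparr>) (dir_sum2 M N) f"
  obtain a where a: "a \<in> carrier M" "\<And>r. r \<in> J \<Longrightarrow> fst (f r) = r \<odot>\<^bsub>M\<^esub> a"
    using baerD[OF assms(1) J lin_comp[OF f lin_fst[OF mo]]] by blast
  obtain b where b: "b \<in> carrier N" "\<And>r. r \<in> J \<Longrightarrow> snd (f r) = r \<odot>\<^bsub>N\<^esub> b"
    using baerD[OF assms(2) J lin_comp[OF f lin_snd[OF mo]]] by blast
  show "\<exists>e\<in>carrier (dir_sum2 M N). \<forall>r\<in>J. f r = r \<odot>\<^bsub>dir_sum2 M N\<^esub> e"
    by (rule bexI[of _ "(a, b)"]) (use a b in \<open>auto simp: prod_eq_iff\<close>)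
qed

lemma baer_zmod: "cring R \<Longrightarrow> baer R (zmod c)"
  unfolding baer_def by (intro conjI module_zmod) (auto simp: lin_def zmod_def)

section \<open>Consequences of the noetherian condition\<close>

text \<open>Ideals are finitely generated, so it is enough to find \<open>e\<close> that gives the
  right values on generators \<open>A\<close>. The premise \<open>ex\<close> may also use that
  \<open>f\<close> maps \<open>J\<close> into every submodule containing the values on
  \<open>A\<close>.\<close>

lemma baer_noetherianI:
  assumes "cring R" "noetherian_ring R" "module R I"
    and ex: "\<And>J A f. \<lbrakk>ideal J R; finite A; A \<subseteq> J; lin R ((regular_module R)\<lparr>carrier := J\<rparr>) I f;
        \<And>H r. \<lbrakk>submodule H R I; f ` A \<subseteq> H; r \<in> J\<rbrakk> \<Longrightarrow> f r \<in> H\<rbrakk> \<Longrightarrow>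
      \<exists>e\<in>carrier I. \<forall>r\<in>A. f r = r \<odot>\<^bsub>I\<^esub> e"
  shows "baer R I"
  unfolding baer_def
proof (intro conjI allI impI)
  interpret I: module R I by fact
  show "module R I" by fact
  fix J f assume J: "ideal J R" and f: "lin R ((regular_module R)\<lparr>carrier := J\<rparr>) I f"
  obtain A where A0: "A \<subseteq> carrier R" "finite A" "J = Idl\<^bsub>R\<^esub> A"
    using noetherian_ring.finetely_gen[OF assms(2) J] by blast
  have AJ: "A \<subseteq> J" using A0 I.R.genideal_self by blast
  have sJ: "submodule J R (regular_module R)" using assms(1) J by (simp add: submodule_ideal_iff)
  have gen: "g r \<in> H" if g: "lin R ((regular_module R)\<lparr>carrier := J\<rparr>) I g" and H: "submodule H R I"
    and a: "g ` A \<subseteq> H" and r: "r \<in> J" for g H r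
  proof -
    have "submodule {x \<in> J. g x \<in> H} R ((regular_module R)\<lparr>carrier := J\<rparr>)"
      using submodule_vimage[OF g H] by simp
    then have "submodule {x \<in> J. g x \<in> H} R (regular_module R)"
      using submodule_trans[OF module_regular[OF assms(1)] sJ] by blast
    then have "ideal {x \<in> J. g x \<in> H} R" by (simp add: submodule_ideal_iff[OF assms(1)])
    from I.R.genideal_minimal[OF this] have "J \<subseteq> {x \<in> J. g x \<in> H}" using A0(3) AJ a by blast
    then show ?thesis using r by blast
  qed
  have sub: "J \<subseteq> carrier R" by (rule ideal_subset[OF J])
  obtain e where e: "e \<in> carrier I" "\<And>r. r \<in> A \<Longrightarrow> f r = r \<odot>\<^bsub>I\<^esub> e"
    using ex[OF J A0(2) AJ f gen[OF f]] by auto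
  have l: "lin R ((regular_module R)\<lparr>carrier := J\<rparr>) I (\<lambda>r. r \<odot>\<^bsub>I\<^esub> e)"
    by (rule lin_restrict[OF lin_smult_map[OF assms(3) e(1)] sJ])
  \<comment> \<open>\<open>gen\<close> applied to the difference of the two maps and the zero
    submodule: the difference vanishes on the generators, hence on \<open>J\<close>.\<close>
  have "f r \<ominus>\<^bsub>I\<^esub> r \<odot>\<^bsub>I\<^esub> e \<in> {\<zero>\<^bsub>I\<^esub>}" if "r \<in> J" for r
  proof (rule gen[OF lin_minus_map[OF f l] submodule_zero[OF assms(3)] _ that])
    show "(\<lambda>a. f a \<ominus>\<^bsub>I\<^esub> a \<odot>\<^bsub>I\<^esub> e) ` A \<subseteq> {\<zero>\<^bsub>I\<^esub>}"
      using e A0(1) by (auto simp: I.minus_eq_zero_iff subset_iff)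
  qed
  moreover have "f r \<in> carrier I" if "r \<in> J" for r using lin_closed[OF f] that by simp
  ultimately have "f r = r \<odot>\<^bsub>I\<^esub> e" if "r \<in> J" for r
    using that sub e(1) by (metis I.minus_eq_zero_iff I.smult_closed singletonD subsetD)
  then show "\<exists>e\<in>carrier I. \<forall>r\<in>J. f r = r \<odot>\<^bsub>I\<^esub> e" using e(1) by blast
qed

text \<open>The values on finitely many generators of an ideal lie in one member of the chain, so
  the whole map lands in that member, which is injective.\<close>

lemma baer_Union_chain:
  assumes "cring R" "noetherian_ring R" "module R M" "\<C> \<noteq> {}" "subset.chain \<A> \<C>"
    and s: "\<And>H. H \<in> \<C> \<Longrightarrow> submodule H R M" and b: "\<And>H. H \<in> \<C> \<Longrightarrow> baer R (M\<lparr>carrier := H\<rparr>)"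
  shows "baer R (M\<lparr>carrier := \<Union>\<C>\<rparr>)"
proof (rule baer_noetherianI[OF assms(1,2)])
  have sU: "submodule (\<Union>\<C>) R M" by (rule submodule_Union_chain[OF assms(3,4,5) s])
  show mU: "module R (M\<lparr>carrier := \<Union>\<C>\<rparr>)" by (rule submodule_module[OF assms(3) sU])
  fix J A f assume J: "ideal J R" and A: "finite A" "A \<subseteq> J"
    and f: "lin R ((regular_module R)\<lparr>carrier := J\<rparr>) (M\<lparr>carrier := \<Union>\<C>\<rparr>) f"
    and gen: "\<And>H r. \<lbrakk>submodule H R (M\<lparr>carrier := \<Union>\<C>\<rparr>); f ` A \<subseteq> H; r \<in> J\<rbrakk> \<Longrightarrow> f r \<in> H"
  have "f a \<in> \<Union>\<C>" if "a \<in> A" for a using lin_closed[OF f, of a] A(2) that by auto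
  then have "f ` A \<subseteq> \<Union>\<C>" by blast
  then obtain H where H: "H \<in> \<C>" "f ` A \<subseteq> H"
    using finite_subset_Union_chain[of "f ` A" \<C>] A(1) assms(4,5) by (metis finite_imageI)
  have sH: "submodule H R (M\<lparr>carrier := \<Union>\<C>\<rparr>)"
    using submodule_trans[OF assms(3) sU, of H] s[OF H(1)] H(1) by blast
  have "lin R ((regular_module R)\<lparr>carrier := J\<rparr>) (M\<lparr>carrier := \<Union>\<C>, carrier := H\<rparr>) f"
    by (rule lin_corestrict[OF f sH]) (use gen[OF sH H(2)] in simp)
  then have "lin R ((regular_module R)\<lparr>carrier := J\<rparr>) (M\<lparr>carrier := H\<rparr>) f" by simp
  from baerD[OF b[OF H(1)] J this] obtain e where "e \<in> H" "\<forall>r\<in>J. f r = r \<odot>\<^bsub>M\<^esub> e" by auto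
  then show "\<exists>e\<in>carrier (M\<lparr>carrier := \<Union>\<C>\<rparr>). \<forall>r\<in>A. f r = r \<odot>\<^bsub>M\<lparr>carrier := \<Union>\<C>\<rparr>\<^esub> e"
    using H(1) A(2) by (intro bexI[of _ e]) auto
qed

lemma direct_sum_eq:
  "direct_sum I F = (mod_product I F)\<lparr>carrier := {f \<in> carrier (mod_product I F). finite {i \<in> I. f i \<noteq> \<zero>\<^bsub>F i\<^esub>}}\<rparr>"
  by (simp add: direct_sum_def)

lemma submodule_direct_sum:
  assumes "cring R" "\<And>i. i \<in> I \<Longrightarrow> module R (F i)"
  shows "submodule {f \<in> carrier (mod_product I F). finite {i \<in> I. f i \<noteq> \<zero>\<^bsub>F i\<^esub>}} R (mod_product I F)"
    (is "submodule ?S R ?P")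
proof (rule submoduleI)
  show mP: "module R ?P" by (rule module_mod_product[OF assms])
  interpret P: module R ?P by fact
  have z: "\<zero>\<^bsub>F i\<^esub> \<oplus>\<^bsub>F i\<^esub> \<zero>\<^bsub>F i\<^esub> = \<zero>\<^bsub>F i\<^esub>" "r \<in> carrier R \<Longrightarrow> r \<odot>\<^bsub>F i\<^esub> \<zero>\<^bsub>F i\<^esub> = \<zero>\<^bsub>F i\<^esub>" if "i \<in> I" for i r
  proof -
    interpret F: module R "F i" by (rule assms(2)[OF that])
    show "\<zero>\<^bsub>F i\<^esub> \<oplus>\<^bsub>F i\<^esub> \<zero>\<^bsub>F i\<^esub> = \<zero>\<^bsub>F i\<^esub>" "r \<in> carrier R \<Longrightarrow> r \<odot>\<^bsub>F i\<^esub> \<zero>\<^bsub>F i\<^esub> = \<zero>\<^bsub>F i\<^esub>" by simp_all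
  qed
  show "?S \<subseteq> carrier ?P" by blast
  have "{i \<in> I. \<zero>\<^bsub>?P\<^esub> i \<noteq> \<zero>\<^bsub>F i\<^esub>} = {}" by simp
  then have "finite {i \<in> I. \<zero>\<^bsub>?P\<^esub> i \<noteq> \<zero>\<^bsub>F i\<^esub>}" by (metis finite.emptyI)
  then show "\<zero>\<^bsub>?P\<^esub> \<in> ?S" using P.zero_closed by blast
  fix x y assume x: "x \<in> ?S" and y: "y \<in> ?S"
  have "{i \<in> I. (x \<oplus>\<^bsub>?P\<^esub> y) i \<noteq> \<zero>\<^bsub>F i\<^esub>} \<subseteq> {i \<in> I. x i \<noteq> \<zero>\<^bsub>F i\<^esub>} \<union> {i \<in> I. y i \<noteq> \<zero>\<^bsub>F i\<^esub>}"
    using z by auto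
  then have "finite {i \<in> I. (x \<oplus>\<^bsub>?P\<^esub> y) i \<noteq> \<zero>\<^bsub>F i\<^esub>}" using x y finite_subset by blast
  moreover have "x \<oplus>\<^bsub>?P\<^esub> y \<in> carrier ?P" using x y by (intro P.a_closed) blast+
  ultimately show "x \<oplus>\<^bsub>?P\<^esub> y \<in> ?S" by blast
next
  have mP: "module R ?P" by (rule module_mod_product[OF assms])
  interpret P: module R ?P by fact
  fix r x assume r: "r \<in> carrier R" and x: "x \<in> ?S"
  have z: "r \<odot>\<^bsub>F i\<^esub> \<zero>\<^bsub>F i\<^esub> = \<zero>\<^bsub>F i\<^esub>" if "i \<in> I" for i
    using module.smult_r_null[OF assms(2)[OF that] r] .
  have "{i \<in> I. (r \<odot>\<^bsub>?P\<^esub> x) i \<noteq> \<zero>\<^bsub>F i\<^esub>} \<subseteq> {i \<in> I. x i \<noteq> \<zero>\<^bsub>F i\<^esub>}" using z by auto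
  then have "finite {i \<in> I. (r \<odot>\<^bsub>?P\<^esub> x) i \<noteq> \<zero>\<^bsub>F i\<^esub>}" using x finite_subset by blast
  moreover have "r \<odot>\<^bsub>?P\<^esub> x \<in> carrier ?P" using r x by (intro P.smult_closed) blast+
  ultimately show "r \<odot>\<^bsub>?P\<^esub> x \<in> ?S" by blast
qed

lemma module_direct_sum:
  "\<lbrakk>cring R; \<And>i. i \<in> I \<Longrightarrow> module R (F i)\<rbrakk> \<Longrightarrow> module R (direct_sum I F)"
  unfolding direct_sum_eq by (intro submodule_module submodule_direct_sum module_mod_product)

text \<open>The product is injective and gives a solution \<open>e\<close> with possibly infinite
  support. Only the finitely many coordinates in which some generator has a nonzero value matter, so
  \<open>e\<close> may be cut off to them.\<close>

lemma baer_direct_sum: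
  assumes "cring R" "noetherian_ring R" "\<And>i. i \<in> I \<Longrightarrow> baer R (F i)"
  shows "baer R (direct_sum I F)"
proof (rule baer_noetherianI[OF assms(1,2)])
  have mo: "\<And>i. i \<in> I \<Longrightarrow> module R (F i)" using assms(3) baer_module by blast
  let ?P = "mod_product I F" and ?S = "{f \<in> carrier (mod_product I F). finite {i \<in> I. f i \<noteq> \<zero>\<^bsub>F i\<^esub>}}"
  show mD: "module R (direct_sum I F)" by (rule module_direct_sum[OF assms(1) mo])
  have mP: "module R ?P" by (rule module_mod_product[OF assms(1) mo])
  fix J A f assume J: "ideal J R" and A: "finite A" "A \<subseteq> J"
    and f: "lin R ((regular_module R)\<lparr>carrier := J\<rparr>) (direct_sum I F) f"
  have sub: "J \<subseteq> carrier R" by (rule ideal_subset[OF J])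
  have fS: "f r \<in> ?S" if "r \<in> J" for r using lin_closed[OF f, of r] that by (simp add: direct_sum_eq)
  have "lin R (direct_sum I F) ?P (\<lambda>x. x)"
    unfolding direct_sum_eq by (rule lin_incl[OF mP submodule_direct_sum[OF assms(1) mo]])
  moreover have "baer R ?P" by (rule baer_product[OF assms(1,3)])
  ultimately obtain e where e: "e \<in> carrier ?P" "\<And>r. r \<in> J \<Longrightarrow> f r = r \<odot>\<^bsub>?P\<^esub> e"
    using baerD[OF _ J lin_comp[OF f]] by blast
  define T where "T = (\<Union>a\<in>A. {i \<in> I. f a i \<noteq> \<zero>\<^bsub>F i\<^esub>})"
  have "finite {i \<in> I. f a i \<noteq> \<zero>\<^bsub>F i\<^esub>}" if "a \<in> A" for a using fS[of a] A(2) that by blast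
  then have T: "finite T" unfolding T_def using A(1) by (rule finite_UN_I[rotated])
  define e' where "e' = (\<lambda>i\<in>I. if i \<in> T then e i else \<zero>\<^bsub>F i\<^esub>)"
  have z: "\<zero>\<^bsub>F i\<^esub> \<in> carrier (F i)" if "i \<in> I" for i
    using abelian_groupE(2)[OF module_abelian_group[OF mo[OF that]]] .
  have eP: "e' \<in> carrier ?P" using e(1) z by (auto simp: e'_def)
  have "{i \<in> I. e' i \<noteq> \<zero>\<^bsub>F i\<^esub>} \<subseteq> T" by (auto simp: e'_def)
  then have "finite {i \<in> I. e' i \<noteq> \<zero>\<^bsub>F i\<^esub>}" using T finite_subset by blast
  then have eS: "e' \<in> carrier (direct_sum I F)" using eP by (simp add: direct_sum_eq)
  have "f a = a \<odot>\<^bsub>?P\<^esub> e'" if a: "a \<in> A" for a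
  proof (rule ext)
    fix i
    have aJ: "a \<in> J" and ac: "a \<in> carrier R" using a A(2) sub by auto
    have fa: "f a \<in> carrier ?P" using fS[OF aJ] by blast
    show "f a i = (a \<odot>\<^bsub>?P\<^esub> e') i"
    proof (cases "i \<in> I")
      case True
      then show ?thesis
      proof (cases "i \<in> T")
        case True
        then show ?thesis using e(2)[OF aJ] \<open>i \<in> I\<close> by (simp add: e'_def)
      next
        case False
        then have "f a i = \<zero>\<^bsub>F i\<^esub>" using a \<open>i \<in> I\<close> unfolding T_def by blast
        then show ?thesis using False \<open>i \<in> I\<close> module.smult_r_null[OF mo ac] by (simp add: e'_def)
      qed
    next
      case False
      moreover from fa have "f a \<in> Pi\<^sub>E I (\<lambda>i. carrier (F i))" by simp
      ultimately show ?thesis using PiE_arb[of "f a" I _ i] by simp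
    qed
  qed
  then have "\<forall>a\<in>A. f a = a \<odot>\<^bsub>direct_sum I F\<^esub> e'" by (simp add: direct_sum_eq)
  then show "\<exists>e\<in>carrier (direct_sum I F). \<forall>r\<in>A. f r = r \<odot>\<^bsub>direct_sum I F\<^esub> e" using eS by blast
qed

section \<open>Cardinal bounds and small injective submodules\<close>

lemma card_of_Un_le: "\<lbrakk>infinite K; |X| \<le>o |K|; |Y| \<le>o |K|\<rbrakk> \<Longrightarrow> |X \<union> Y| \<le>o |K|"
  by (rule card_of_Un_ordLeq_infinite_Field) (auto simp: Field_card_of card_of_card_order_on)

lemma card_of_lists_infinite:
  assumes "infinite K" "|X| \<le>o |K|" shows "|lists X| \<le>o |K|"
proof -
  have K: "|{l \<in> lists X. length l = n}| \<le>o |K|" for n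
  proof (induction n)
    case 0
    have "{l \<in> lists X. length l = 0} = {[]}" by auto
    moreover have "K \<noteq> {}" using assms(1) by auto
    ultimately show ?case using card_of_singl_ordLeq[of K "[]"] by simp
  next
    case (Suc n)
    have "{l \<in> lists X. length l = Suc n} \<subseteq> (\<lambda>(x, l). x # l) ` (X \<times> {l \<in> lists X. length l = n})"
    proof
      fix l assume "l \<in> {l \<in> lists X. length l = Suc n}"
      then show "l \<in> (\<lambda>(x, l). x # l) ` (X \<times> {l \<in> lists X. length l = n})"
        by (cases l) auto
    qed
    then have "|{l \<in> lists X. length l = Suc n}| \<le>o |X \<times> {l \<in> lists X. length l = n}|"
      by (rule ordLeq_transitive[OF card_of_mono1 card_of_image])
    also have "|X \<times> {l \<in> lists X. length l = n}| \<le>o |K|"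
      using assms Suc by (intro card_of_Sigma_ordLeq_infinite) auto
    finally show ?case .
  qed
  have "lists X = (\<Union>n. {l \<in> lists X. length l = n})" by auto
  moreover have "|\<Union>n. {l \<in> lists X. length l = n}| \<le>o |K|"
    by (rule card_of_UNION_ordLeq_infinite[OF assms(1)])
      (use infinite_iff_card_of_nat[THEN iffD1, OF assms(1)] K in auto)
  ultimately show ?thesis by simp
qed

text \<open>Over a noetherian ring every subset \<open>A\<close> of an injective module lies in an injective submodule
  that is not larger than \<open>A\<close>, \<open>R\<close> and \<open>\<nat>\<close>: close \<open>A\<close> under the operations and under the choice
  of a solution for each solvable finite system \<open>r\<^sub>i x = h\<^sub>i\<close>.\<close>

lemma small_injective_submodule:
  fixes E :: "('r, 'e) module"
  assumes R: "cring R" "noetherian_ring R" and E: "baer R E" and A: "A \<subseteq> carrier E"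
  obtains H where "submodule H R E" "baer R (E\<lparr>carrier := H\<rparr>)" "A \<subseteq> H"
    "\<And>K :: 'k set. \<lbrakk>infinite K; |A| \<le>o |K|; |carrier R| \<le>o |K|\<rbrakk> \<Longrightarrow> |H| \<le>o |K|"
proof -
  interpret E: module R E by (rule baer_module[OF E])
  define solves where "solves l x \<longleftrightarrow> x \<in> carrier E \<and> (\<forall>z\<in>set l. fst z \<odot>\<^bsub>E\<^esub> x = snd z)" for l x
  \<comment> \<open>The default value for an unsolvable system keeps \<open>sol\<close> inside
    \<open>E\<close>, so closing under it never leaves the carrier.\<close>
  define sol where "sol l = (if \<exists>x. solves l x then SOME x. solves l x else \<zero>\<^bsub>E\<^esub>)" for l
  have sol: "solves l (sol l)" if "\<exists>x. solves l x" for l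
    using someI_ex[OF that] that by (simp add: sol_def)
  have solc: "sol l \<in> carrier E" for l
    using sol[of l] by (cases "\<exists>x. solves l x") (auto simp: solves_def sol_def)
  define H where "H = rec_nat A (\<lambda>_ X. insert \<zero>\<^bsub>E\<^esub> (X \<union> (\<lambda>z. fst z \<oplus>\<^bsub>E\<^esub> snd z) ` (X \<times> X) \<union>
    (\<lambda>z. fst z \<odot>\<^bsub>E\<^esub> snd z) ` (carrier R \<times> X) \<union> sol ` lists (carrier R \<times> X)))"
  have H0: "H 0 = A" and HS: "H (Suc k) = insert \<zero>\<^bsub>E\<^esub> (H k \<union> (\<lambda>z. fst z \<oplus>\<^bsub>E\<^esub> snd z) ` (H k \<times> H k) \<union>
    (\<lambda>z. fst z \<odot>\<^bsub>E\<^esub> snd z) ` (carrier R \<times> H k) \<union> sol ` lists (carrier R \<times> H k))" for k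
    by (simp_all add: H_def)
  have mono: "H k \<subseteq> H l" if "k \<le> l" for k l
    using lift_Suc_mono_le[of H, OF _ that] HS by blast
  have Hc: "H k \<subseteq> carrier E" for k
  proof (induction k)
    case (Suc k)
    then show ?case using solc by (fastforce simp: HS)
  qed (use A H0 in simp)
  let ?H = "\<Union>k. H k"
  have s: "submodule ?H R E"
  proof (rule submoduleI[OF E.module_axioms])
    show "?H \<subseteq> carrier E" using Hc by blast
    show "\<zero>\<^bsub>E\<^esub> \<in> ?H" using HS by blast
    show "r \<odot>\<^bsub>E\<^esub> x \<in> ?H" if rx: "r \<in> carrier R" "x \<in> ?H" for r x
    proof -
      obtain k where "x \<in> H k" using rx by blast
      then have "(r, x) \<in> carrier R \<times> H k" using rx(1) by simp
      from imageI[OF this, of "\<lambda>z. fst z \<odot>\<^bsub>E\<^esub> snd z"] have "r \<odot>\<^bsub>E\<^esub> x \<in> H (Suc k)"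
        unfolding HS by simp
      then show ?thesis by blast
    qed
    show "x \<oplus>\<^bsub>E\<^esub> y \<in> ?H" if xy: "x \<in> ?H" "y \<in> ?H" for x y
    proof -
      obtain k l where "x \<in> H k" "y \<in> H l" using xy by blast
      then have "x \<in> H (max k l)" "y \<in> H (max k l)" using mono[of k "max k l"] mono[of l "max k l"] by auto
      then have "(x, y) \<in> H (max k l) \<times> H (max k l)" by simp
      from imageI[OF this, of "\<lambda>z. fst z \<oplus>\<^bsub>E\<^esub> snd z"] have "x \<oplus>\<^bsub>E\<^esub> y \<in> H (Suc (max k l))"
        unfolding HS by simp
      then show ?thesis by blast
    qed
  qed
  have b: "baer R (E\<lparr>carrier := ?H\<rparr>)"
  proof (rule baer_noetherianI[OF R submodule_module[OF E.module_axioms s]])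
    fix J B f assume J: "ideal J R" and B: "finite B" "B \<subseteq> J"
      and f: "lin R ((regular_module R)\<lparr>carrier := J\<rparr>) (E\<lparr>carrier := ?H\<rparr>) f"
    have sub: "J \<subseteq> carrier R" by (rule ideal_subset[OF J])
    have fH: "f r \<in> ?H" if "r \<in> J" for r using lin_closed[OF f, of r] that by simp
    have "lin R ((regular_module R)\<lparr>carrier := J\<rparr>) E f"
      using lin_comp[OF f lin_incl[OF E.module_axioms s]] .
    then obtain e where e: "e \<in> carrier E" "\<And>r. r \<in> J \<Longrightarrow> f r = r \<odot>\<^bsub>E\<^esub> e"
      using baerD[OF E J] by blast
    obtain bs where bs: "set bs = B" using B(1) finite_list by blast
    define l where "l = map (\<lambda>a. (a, f a)) bs"
    have "\<exists>k. f ` B \<subseteq> H k"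
      using B fH
    proof (induction B rule: finite_induct)
      case (insert x F)
      then have "F \<subseteq> J" by simp
      from insert.IH[OF this insert.prems(2)] obtain k where "f ` F \<subseteq> H k" by blast
      moreover from insert.prems obtain m where "f x \<in> H m" by blast
      ultimately have "f ` insert x F \<subseteq> H (max k m)" using mono[of k "max k m"] mono[of m "max k m"] by auto
      then show ?case by blast
    qed simp
    then obtain k where k: "f ` B \<subseteq> H k" by blast
    \<comment> \<open>The system that describes \<open>f\<close> on the generators is solvable in
      \<open>E\<close> since \<open>E\<close> is injective; its data lie in stage \<open>k\<close>,
      so its chosen solution lies in stage \<open>k + 1\<close>.\<close>
    have "solves l e" using e B(2) by (auto simp: solves_def l_def bs)
    then have so: "solves l (sol l)" using sol by blast
    have "l \<in> lists (carrier R \<times> H k)" using k B(2) sub unfolding l_def bs lists_eq_set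
      by (auto simp: bs image_subset_iff)
    then have "sol l \<in> H (Suc k)" unfolding HS by blast
    then have "sol l \<in> ?H" by blast
    moreover have "\<forall>r\<in>B. f r = r \<odot>\<^bsub>E\<^esub> sol l" using so by (auto simp: solves_def l_def bs)
    ultimately show "\<exists>e\<in>carrier (E\<lparr>carrier := ?H\<rparr>). \<forall>r\<in>B. f r = r \<odot>\<^bsub>E\<lparr>carrier := ?H\<rparr>\<^esub> e" by auto
  qed
  have "|?H| \<le>o |K|" if K: "infinite K" "|A| \<le>o |K|" "|carrier R| \<le>o |K|" for K :: "'k set"
  proof -
    have "|H k| \<le>o |K|" for k
    proof (induction k)
      case (Suc k)
      have 1: "|(\<lambda>z. fst z \<oplus>\<^bsub>E\<^esub> snd z) ` (H k \<times> H k)| \<le>o |K|"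
        by (rule ordLeq_transitive[OF card_of_image]) (use K Suc in \<open>intro card_of_Sigma_ordLeq_infinite, auto\<close>)
      have RH: "|carrier R \<times> H k| \<le>o |K|" using K Suc by (intro card_of_Sigma_ordLeq_infinite) auto
      have 2: "|(\<lambda>z. fst z \<odot>\<^bsub>E\<^esub> snd z) ` (carrier R \<times> H k)| \<le>o |K|"
        by (rule ordLeq_transitive[OF card_of_image RH])
      have 3: "|sol ` lists (carrier R \<times> H k)| \<le>o |K|"
        by (rule ordLeq_transitive[OF card_of_image card_of_lists_infinite[OF K(1) RH]])
      have 4: "|{\<zero>\<^bsub>E\<^esub>}| \<le>o |K|" using K(1) by (intro card_of_singl_ordLeq) auto
      have "H (Suc k) = {\<zero>\<^bsub>E\<^esub>} \<union> (H k \<union> (\<lambda>z. fst z \<oplus>\<^bsub>E\<^esub> snd z) ` (H k \<times> H k) \<union>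
        (\<lambda>z. fst z \<odot>\<^bsub>E\<^esub> snd z) ` (carrier R \<times> H k) \<union> sol ` lists (carrier R \<times> H k))"
        by (simp add: HS)
      then show ?case by (simp only:) (intro card_of_Un_le K(1) 1 2 3 4 Suc)
    qed (use K H0 in simp)
    then show ?thesis by (intro card_of_UNION_ordLeq_infinite[OF K(1)])
      (use infinite_iff_card_of_nat[THEN iffD1, OF K(1)] in auto)
  qed
  then show thesis using that s b H0 by blast
qed

section \<open>Injective hulls and minimal coresolutions\<close>

text \<open>Essentiality need only be tested on the nonzero cyclic submodules.\<close>

lemma essential_iff:
  assumes "module R M" "submodule A R M"
  shows "essential_submodule R A M \<longleftrightarrow>
    (\<forall>x\<in>carrier M. x \<noteq> \<zero>\<^bsub>M\<^esub> \<longrightarrow> (\<exists>r\<in>carrier R. r \<odot>\<^bsub>M\<^esub> x \<in> A \<and> r \<odot>\<^bsub>M\<^esub> x \<noteq> \<zero>\<^bsub>M\<^esub>))"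
proof
  interpret M: module R M by fact
  note A = submoduleD[OF assms(2)]
  {
    assume e: "essential_submodule R A M"
    show "\<forall>x\<in>carrier M. x \<noteq> \<zero>\<^bsub>M\<^esub> \<longrightarrow> (\<exists>r\<in>carrier R. r \<odot>\<^bsub>M\<^esub> x \<in> A \<and> r \<odot>\<^bsub>M\<^esub> x \<noteq> \<zero>\<^bsub>M\<^esub>)"
    proof (intro ballI impI)
      fix x assume x: "x \<in> carrier M" "x \<noteq> \<zero>\<^bsub>M\<^esub>"
      let ?X = "(\<lambda>r. r \<odot>\<^bsub>M\<^esub> x) ` carrier R"
      have X: "submodule ?X R M" using submodule_range[OF lin_smult_map[OF assms(1) x(1)]] by simp
      have "\<one>\<^bsub>R\<^esub> \<odot>\<^bsub>M\<^esub> x \<in> ?X" by (rule imageI) simp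
      then have "x \<in> ?X" using x by simp
      then have "?X \<noteq> {\<zero>\<^bsub>M\<^esub>}" using x by blast
      then have "?X \<inter> A \<noteq> {\<zero>\<^bsub>M\<^esub>}" using e X unfolding essential_submodule_def by blast
      moreover have "\<zero>\<^bsub>M\<^esub> \<in> ?X \<inter> A" using submoduleD(2)[OF X] A(2) by blast
      ultimately obtain y where "y \<in> ?X" "y \<in> A" "y \<noteq> \<zero>\<^bsub>M\<^esub>" by blast
      then show "\<exists>r\<in>carrier R. r \<odot>\<^bsub>M\<^esub> x \<in> A \<and> r \<odot>\<^bsub>M\<^esub> x \<noteq> \<zero>\<^bsub>M\<^esub>" by blast
    qed
  next
    assume e: "\<forall>x\<in>carrier M. x \<noteq> \<zero>\<^bsub>M\<^esub> \<longrightarrow> (\<exists>r\<in>carrier R. r \<odot>\<^bsub>M\<^esub> x \<in> A \<and> r \<odot>\<^bsub>M\<^esub> x \<noteq> \<zero>\<^bsub>M\<^esub>)"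
    show "essential_submodule R A M"
      unfolding essential_submodule_def
    proof (intro conjI allI impI)
      fix L assume L: "submodule L R M" "L \<inter> A = {\<zero>\<^bsub>M\<^esub>}"
      have "x = \<zero>\<^bsub>M\<^esub>" if x: "x \<in> L" for x
      proof (rule ccontr)
        assume "x \<noteq> \<zero>\<^bsub>M\<^esub>"
        then obtain r where r: "r \<in> carrier R" "r \<odot>\<^bsub>M\<^esub> x \<in> A" "r \<odot>\<^bsub>M\<^esub> x \<noteq> \<zero>\<^bsub>M\<^esub>"
          using e submoduleD(5)[OF L(1) x] by blast
        then have "r \<odot>\<^bsub>M\<^esub> x \<in> L" using submoduleD(4)[OF L(1) _ x] by simp
        then show False using r L(2) by blast
      qed
      then show "L = {\<zero>\<^bsub>M\<^esub>}" using submoduleD(2)[OF L(1)] by blast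
    qed (rule assms(2))
  }
qed

text \<open>Zorn's lemma for the next construction, which uses it twice: with \<open>A = 0\<close>,
  \<open>B = M\<close> to find \<open>N\<close>, then with \<open>A = M\<close>,
  \<open>B = N\<close> to find \<open>L\<close>.\<close>

lemma maximal_submodule_exists:
  assumes "module R M" "submodule A R M" "submodule B R M" "A \<inter> B = {\<zero>\<^bsub>M\<^esub>}"
  obtains L where "submodule L R M" "A \<subseteq> L" "L \<inter> B = {\<zero>\<^bsub>M\<^esub>}"
    "\<And>X. \<lbrakk>submodule X R M; L \<subseteq> X; X \<inter> B = {\<zero>\<^bsub>M\<^esub>}\<rbrakk> \<Longrightarrow> X = L"
proof -
  define \<S> where "\<S> = {L. submodule L R M \<and> A \<subseteq> L \<and> L \<inter> B = {\<zero>\<^bsub>M\<^esub>}}"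
  have "A \<in> \<S>" using assms by (simp add: \<S>_def)
  then have "\<S> \<noteq> {}" by blast
  moreover have "\<Union>\<C> \<in> \<S>" if ch: "\<C> \<noteq> {}" "subset.chain \<S> \<C>" for \<C>
  proof -
    have sub: "\<C> \<subseteq> \<S>" using ch by (simp add: subset.chain_def)
    then have "submodule (\<Union>\<C>) R M"
      by (intro submodule_Union_chain[OF assms(1) ch]) (auto simp: \<S>_def)
    moreover have "A \<subseteq> \<Union>\<C>" using ch(1) sub unfolding \<S>_def by blast
    moreover have "H \<inter> B = {\<zero>\<^bsub>M\<^esub>}" if "H \<in> \<C>" for H using sub that unfolding \<S>_def by blast
    then have "\<Union>\<C> \<inter> B = {\<zero>\<^bsub>M\<^esub>}" using ch(1) by blast
    ultimately show ?thesis by (simp add: \<S>_def)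
  qed
  ultimately obtain L where L: "L \<in> \<S>" and max: "\<And>X. X \<in> \<S> \<Longrightarrow> L \<subseteq> X \<Longrightarrow> X = L"
    using subset_Zorn_nonempty[of \<S>] by blast
  show thesis
  proof (rule that[of L])
    show "X = L" if "submodule X R M" "L \<subseteq> X" "X \<inter> B = {\<zero>\<^bsub>M\<^esub>}" for X
      using L that by (intro max) (auto simp: \<S>_def)
  qed (use L in \<open>auto simp: \<S>_def\<close>)
qed

text \<open>Inside an injective \<open>H\<close>, let \<open>N\<close> be maximal with \<open>N \<inter> M = 0\<close> and \<open>L \<supseteq> M\<close> maximal with
  \<open>L \<inter> N = 0\<close>; then \<open>L\<close> is a complement of \<open>N\<close> and an essential extension of \<open>M\<close>.\<close>

lemma hull_inside_injective:
  assumes H: "baer R H" and M: "submodule M R H"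
  obtains L where "submodule L R H" "M \<subseteq> L" "baer R (H\<lparr>carrier := L\<rparr>)"
    "essential_submodule R M (H\<lparr>carrier := L\<rparr>)"
proof -
  have mH: "module R H" by (rule baer_module[OF H])
  interpret H: module R H by fact
  have M0: "\<zero>\<^bsub>H\<^esub> \<in> M" by (rule submoduleD(2)[OF M])
  then have M0': "{\<zero>\<^bsub>H\<^esub>} \<inter> M = {\<zero>\<^bsub>H\<^esub>}" by blast
  obtain N where N: "submodule N R H" "N \<inter> M = {\<zero>\<^bsub>H\<^esub>}"
    and maxN: "\<And>X. \<lbrakk>submodule X R H; N \<subseteq> X; X \<inter> M = {\<zero>\<^bsub>H\<^esub>}\<rbrakk> \<Longrightarrow> X = N"
    using maximal_submodule_exists[OF mH submodule_zero[OF mH] M M0'] by metis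
  have MN: "M \<inter> N = {\<zero>\<^bsub>H\<^esub>}" using N(2) by blast
  obtain L where L: "submodule L R H" "M \<subseteq> L" "L \<inter> N = {\<zero>\<^bsub>H\<^esub>}"
    and maxL: "\<And>X. \<lbrakk>submodule X R H; L \<subseteq> X; X \<inter> N = {\<zero>\<^bsub>H\<^esub>}\<rbrakk> \<Longrightarrow> X = L"
    using maximal_submodule_exists[OF mH M N(1) MN] by metis
  note NC = submoduleD(5)[OF N(1)] and LC = submoduleD(5)[OF L(1)]
  have mL: "module R (H\<lparr>carrier := L\<rparr>)" by (rule submodule_module[OF mH L(1)])
  have ess: "essential_submodule R M (H\<lparr>carrier := L\<rparr>)"
    unfolding essential_submodule_def
  proof (intro conjI allI impI)
    show "submodule M R (H\<lparr>carrier := L\<rparr>)" using submodule_trans[OF mH L(1)] M L(2) by blast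
    fix X assume "submodule X R (H\<lparr>carrier := L\<rparr>)" and XM: "X \<inter> M = {\<zero>\<^bsub>H\<lparr>carrier := L\<rparr>\<^esub>}"
    then have X: "submodule X R H" "X \<subseteq> L" using submodule_trans[OF mH L(1)] by blast+
    \<comment> \<open>If \<open>X\<close> meets \<open>M\<close> trivially, then so does
      \<open>X + N\<close>: for \<open>x + y\<close> in \<open>M\<close> the summand
      \<open>y\<close> lies in both \<open>L\<close> and \<open>N\<close>, hence is zero. Maximality
      of \<open>N\<close> gives \<open>X + N = N\<close>, and \<open>X\<close> is zero because
      \<open>L\<close> meets \<open>N\<close> trivially.\<close>
    let ?S = "{x \<oplus>\<^bsub>H\<^esub> y | x y. x \<in> X \<and> y \<in> N}"
    have S: "submodule ?S R H" by (rule submodule_sum[OF mH X(1) N(1)])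
    have mem: "x \<oplus>\<^bsub>H\<^esub> y \<in> ?S" if "x \<in> X" "y \<in> N" for x y using that by blast
    have "N \<subseteq> ?S"
    proof
      fix y assume y: "y \<in> N"
      show "y \<in> ?S" using mem[OF submoduleD(2)[OF X(1)] y] NC[OF y] by simp
    qed
    moreover have "s = \<zero>\<^bsub>H\<^esub>" if s: "s \<in> ?S" "s \<in> M" for s
    proof -
      obtain x y where xy: "s = x \<oplus>\<^bsub>H\<^esub> y" "x \<in> X" "y \<in> N" using s(1) by blast
      have c: "x \<in> carrier H" "y \<in> carrier H" using xy X L NC LC by auto
      have "s \<in> L" "x \<in> L" using s(2) L(2) X(2) xy(2) by auto
      then have "s \<ominus>\<^bsub>H\<^esub> x \<in> L" by (rule submoduleD(7)[OF L(1)])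
      moreover have "s \<ominus>\<^bsub>H\<^esub> x = y" using c unfolding xy(1) by algebra
      ultimately have "y = \<zero>\<^bsub>H\<^esub>" using xy(3) L(3) by blast
      then have "s = x" using xy c by simp
      then show ?thesis using xy(2) s(2) XM by auto
    qed
    then have "?S \<inter> M = {\<zero>\<^bsub>H\<^esub>}" using submoduleD(2)[OF S] M0 by blast
    ultimately have SN: "?S = N" using maxN[OF S] by blast
    have "x = \<zero>\<^bsub>H\<^esub>" if "x \<in> X" for x
    proof -
      have "x \<oplus>\<^bsub>H\<^esub> \<zero>\<^bsub>H\<^esub> \<in> N" using mem[OF that submoduleD(2)[OF N(1)]] SN by blast
      then have "x \<in> N" using submoduleD(5)[OF X(1) that] by simp
      then show ?thesis using that X(2) L(3) by blast
    qed
    then have "X \<subseteq> {\<zero>\<^bsub>H\<^esub>}" by blast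
    moreover have "\<zero>\<^bsub>H\<^esub> \<in> X" by (rule submoduleD(2)[OF X(1)])
    ultimately show "X = {\<zero>\<^bsub>H\<lparr>carrier := L\<rparr>\<^esub>}" by simp blast
  qed
  \<comment> \<open>\<open>L\<close> embeds into \<open>H / N\<close>, so its inclusion into the
    injective module \<open>H\<close> extends to \<open>H / N\<close>. The composite
    \<open>p\<close> with the quotient map fixes \<open>L\<close> and kills
    \<open>N\<close>.\<close>
  obtain Q :: "('a, 'c) module" and \<pi> where Q: "lin R H Q \<pi>" "\<pi> ` carrier H = carrier Q" "a_kernel H Q \<pi> = N"
    using quotient_exists[OF mH N(1) card_of_mono1[OF subset_UNIV]] by metis
  have kerN: "\<pi> x = \<zero>\<^bsub>Q\<^esub> \<longleftrightarrow> x \<in> N" if "x \<in> carrier H" for x using Q(3) that by (auto simp: a_kernel_iff set_eq_iff)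
  have lL: "lin R (H\<lparr>carrier := L\<rparr>) Q \<pi>" by (rule lin_restrict[OF Q(1) L(1)])
  have "inj_on \<pi> (carrier (H\<lparr>carrier := L\<rparr>))"
    unfolding lin_inj_iff[OF lL] using kerN LC L(3) by auto
  from baer_extend[OF H lL this lin_incl[OF mH L(1)]]
  obtain g where g: "lin R Q H g" "\<And>x. x \<in> L \<Longrightarrow> g (\<pi> x) = x" by auto
  define p where "p = (\<lambda>x. g (\<pi> x))"
  have p: "lin R H H p" unfolding p_def by (rule lin_comp[OF Q(1) g(1)])
  have pL: "p x = x" if "x \<in> L" for x using g(2)[OF that] by (simp add: p_def)
  have pN: "p x = \<zero>\<^bsub>H\<^esub>" if "x \<in> N" for x
    using kerN[OF NC[OF that]] that lin_zero[OF g(1)] by (simp add: p_def)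
  \<comment> \<open>The preimage of \<open>N\<close> under \<open>p\<close> meets \<open>M\<close>
    trivially, so it equals \<open>N\<close> by maximality. Then the range of \<open>p\<close> meets
    \<open>N\<close> trivially and must be \<open>L\<close>, again by maximality: \<open>p\<close>
    is a projection onto \<open>L\<close>.\<close>
  let ?Y = "{h \<in> carrier H. p h \<in> N}"
  have Y: "submodule ?Y R H" by (rule submodule_vimage[OF p N(1)])
  have "N \<subseteq> ?Y" using NC pN submoduleD(2)[OF N(1)] by auto
  moreover have "?Y \<inter> M = {\<zero>\<^bsub>H\<^esub>}"
  proof -
    have "h = \<zero>\<^bsub>H\<^esub>" if "h \<in> ?Y" "h \<in> M" for h
    proof -
      have "h \<in> N" using that pL[of h] L(2) by auto
      then show ?thesis using that(2) N(2) by blast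
    qed
    then show ?thesis using submoduleD(2)[OF Y] M0 by blast
  qed
  ultimately have YN: "?Y = N" using maxN[OF Y] by blast
  let ?L' = "p ` carrier H"
  have L': "submodule ?L' R H" by (rule submodule_range[OF p])
  have "x \<in> ?L'" if "x \<in> L" for x using imageI[OF LC[OF that], of p] pL[OF that] by simp
  moreover have "y = \<zero>\<^bsub>H\<^esub>" if y: "y \<in> ?L'" "y \<in> N" for y
  proof -
    obtain h where h: "y = p h" "h \<in> carrier H" using y(1) by blast
    then have "h \<in> N" using YN y(2) by blast
    then show ?thesis using pN h(1) by simp
  qed
  then have "?L' \<inter> N = {\<zero>\<^bsub>H\<^esub>}" using submoduleD(2)[OF L'] submoduleD(2)[OF N(1)] by blast
  ultimately have L'L: "?L' = L" by (intro maxL[OF L']) auto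
  have "lin R H (H\<lparr>carrier := L\<rparr>) p" by (rule lin_corestrict[OF p L(1)]) (use L'L in blast)
  from baer_retract[OF H lin_incl[OF mH L(1)] this] have "baer R (H\<lparr>carrier := L\<rparr>)" using pL by simp
  then show thesis using that L(1,2) ess by blast
qed

text \<open>The notion of coresolution used in all arguments: free of extensionality and of a fixed
  hull type, with exactness as a pointwise equivalence.\<close>

definition cores ::
  "('r, 'q) ring_scheme \<Rightarrow> ('r, 'm) module \<Rightarrow> (nat \<Rightarrow> ('r, 'e) module) \<Rightarrow> ('m \<Rightarrow> 'e) \<Rightarrow> (nat \<Rightarrow> 'e \<Rightarrow> 'e) \<Rightarrow> bool" where
  "cores R M E \<epsilon> d \<longleftrightarrow> (\<forall>i. baer R (E i)) \<and> lin R M (E 0) \<epsilon> \<and> inj_on \<epsilon> (carrier M) \<and>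
     (\<forall>i. lin R (E i) (E (Suc i)) (d i)) \<and>
     (\<forall>x\<in>carrier (E 0). d 0 x = \<zero>\<^bsub>E 1\<^esub> \<longleftrightarrow> x \<in> \<epsilon> ` carrier M) \<and>
     (\<forall>i. \<forall>x\<in>carrier (E (Suc i)). d (Suc i) x = \<zero>\<^bsub>E (Suc (Suc i))\<^esub> \<longleftrightarrow> x \<in> d i ` carrier (E i))"

lemma injective_coresolution_cores:
  assumes "module R M" "injective_coresolution R M E \<epsilon> d" shows "cores R M E \<epsilon> d"
proof -
  have b: "baer R (E i)" for i using assms(2) by (simp add: injective_coresolution_def injective_module_iff_baer)
  have e: "\<epsilon> \<in> mod_hom R M (E 0)" "d i \<in> mod_hom R (E i) (E (Suc i))" "inj_on \<epsilon> (carrier M)"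
    "\<epsilon> ` carrier M = a_kernel (E 0) (E 1) (d 0)"
    "d i ` carrier (E i) = a_kernel (E (Suc i)) (E (Suc (Suc i))) (d (Suc i))" for i
    using assms(2) unfolding injective_coresolution_def by blast+
  show ?thesis
    unfolding cores_def e(4,5) using b e(3) mod_hom_lin[OF e(1) assms(1) baer_module[OF b]]
      mod_hom_lin[OF e(2) baer_module[OF b] baer_module[OF b]]
    by (auto simp: a_kernel_iff)
qed

lemma cores_injective_coresolution:
  assumes "cores R M E \<epsilon> d"
  shows "injective_coresolution R M E (restrict \<epsilon> (carrier M)) (\<lambda>i. restrict (d i) (carrier (E i)))"
proof -
  have c: "baer R (E i)" "lin R M (E 0) \<epsilon>" "inj_on \<epsilon> (carrier M)" "lin R (E i) (E (Suc i)) (d i)"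
    "x \<in> carrier (E 0) \<Longrightarrow> d 0 x = \<zero>\<^bsub>E 1\<^esub> \<longleftrightarrow> x \<in> \<epsilon> ` carrier M"
    "x \<in> carrier (E (Suc i)) \<Longrightarrow> d (Suc i) x = \<zero>\<^bsub>E (Suc (Suc i))\<^esub> \<longleftrightarrow> x \<in> d i ` carrier (E i)" for i x
    using assms unfolding cores_def by blast+
  have 1: "restrict (d i) (carrier (E i)) ` carrier (E i) = d i ` carrier (E i)" for i by auto
  have 2: "restrict \<epsilon> (carrier M) ` carrier M = \<epsilon> ` carrier M" by auto
  have 3: "x \<in> \<epsilon> ` carrier M \<Longrightarrow> x \<in> carrier (E 0)" for x using lin_closed[OF c(2)] by blast
  have 4: "x \<in> d i ` carrier (E i) \<Longrightarrow> x \<in> carrier (E (Suc i))" for x i using lin_closed[OF c(4)] by blast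
  show ?thesis
    unfolding injective_coresolution_def 1 2
  proof (intro conjI allI)
    show "inj_on (restrict \<epsilon> (carrier M)) (carrier M)" using c(3) by (simp add: inj_on_def)
    show "\<epsilon> ` carrier M = a_kernel (E 0) (E 1) (restrict (d 0) (carrier (E 0)))"
      using c(5) 3 by (auto simp: a_kernel_iff)
    show "d i ` carrier (E i) = a_kernel (E (Suc i)) (E (Suc (Suc i))) (restrict (d (Suc i)) (carrier (E (Suc i))))" for i
      using c(6) 4 by (auto simp: a_kernel_iff)
    show "injective_module R (E i)" for i by (rule baer_injective_module[OF c(1)])
    show "restrict \<epsilon> (carrier M) \<in> mod_hom R M (E 0)" by (rule lin_mod_hom[OF c(2)])
    show "restrict (d i) (carrier (E i)) \<in> mod_hom R (E i) (E (Suc i))" for i by (rule lin_mod_hom[OF c(4)])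
  qed
qed

section \<open>Sizes of hull types, and existence of minimal coresolutions\<close>

lemma card_hulltype_mono:
  assumes "|UNIV :: 'm set| \<le>o |UNIV :: 'u set|"
  shows "|UNIV :: ('r, 'm) hulltype set| \<le>o |UNIV :: ('r, 'u) hulltype set|"
proof -
  obtain i :: "'m \<Rightarrow> 'u" where i: "inj i" using assms by (metis card_of_ordLeq)
  have "inj (\<lambda>f :: ('r, 'm) hulltype. \<lambda>z. map_prod i id (f z))"
  proof (rule injI)
    fix f g :: "('r, 'm) hulltype" assume "(\<lambda>z. map_prod i id (f z)) = (\<lambda>z. map_prod i id (g z))"
    then have "map_prod i id (f z) = map_prod i id (g z)" for z by metis
    then show "f = g" using i by (auto simp: fun_eq_iff prod_eq_iff dest: injD)
  qed
  then show ?thesis by (metis card_of_ordLeq subset_UNIV)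
qed

lemma card_module_hulltype: "|A :: 'm set| \<le>o |UNIV :: ('r, 'm) hulltype set|"
proof -
  have "inj_on (\<lambda>m::'m. \<lambda>_ :: 'r \<times> nat. (m, 0 :: nat)) A" by (auto simp: inj_on_def fun_eq_iff)
  then show ?thesis by (metis card_of_ordLeq subset_UNIV)
qed

lemma infinite_hulltype: "infinite (UNIV :: ('r, 'm) hulltype set)"
proof -
  have "inj (\<lambda>n::nat. (\<lambda>_. (undefined, n)) :: ('r, 'm) hulltype)" by (auto simp: inj_on_def fun_eq_iff)
  then show ?thesis using infinite_UNIV_nat by (metis finite_imageD finite_subset subset_UNIV)
qed

text \<open>\<open>W\<close> will be the injective cogenerator that ends the exact sequence in the
  definition of \<open>cotilting\<close>; it is the source of enough injectives.\<close>

locale cogenerated =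
  fixes R :: "('r, 'q) ring_scheme" and W :: "('r, 'u) module"
  assumes cring: "cring R" and noetherian: "noetherian_ring R"
    and inj_W: "baer R W" and cogenerator_W: "cogenerator R W"
    and infinite_univ: "infinite (UNIV :: 'u set)" and ring_le_univ: "|UNIV :: 'r set| \<le>o |UNIV :: 'u set|"
begin

text \<open>Evaluation at all homomorphisms into \<open>W\<close> embeds \<open>M\<close> into a
  power of \<open>W\<close>. The cogenerator property is available for modules on the hull type of
  \<open>'u\<close>, so it is applied to a copy of \<open>M\<close> there.\<close>

lemma embedding_exists:
  fixes M :: "('r, 'm) module"
  assumes M: "module R M" and le: "|carrier M| \<le>o |UNIV :: ('r, 'u) hulltype set|"
  obtains E :: "('r, ('m \<Rightarrow> 'u) \<Rightarrow> 'u) module" and j where "baer R E" "lin R M E j" "inj_on j (carrier M)"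
proof -
  define K where "K = {f. lin R M W f}"
  let ?E = "mod_product K (\<lambda>_. W)" and ?j = "\<lambda>x. \<lambda>f\<in>K. f x"
  have mW: "module R W" by (rule baer_module[OF inj_W])
  have b: "baer R ?E" by (rule baer_product[OF cring inj_W])
  have l: "lin R M ?E ?j" by (rule lin_tuple[OF cring M]) (simp add: K_def)
  have "x = \<zero>\<^bsub>M\<^esub>" if x: "x \<in> carrier M" and j: "?j x = \<zero>\<^bsub>?E\<^esub>" for x
  proof (rule ccontr)
    assume nz: "x \<noteq> \<zero>\<^bsub>M\<^esub>"
    obtain Q :: "('r, ('r, 'u) hulltype) module" and \<pi> \<rho> where Q: "lin R M Q \<pi>" "lin R Q M \<rho>"
      "\<And>x. x \<in> carrier M \<Longrightarrow> \<rho> (\<pi> x) = x"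
      using transport_exists[OF M le] by metis
    have mQ: "module R Q" by (rule lin_cod[OF Q(1)])
    have "\<pi> x \<noteq> \<zero>\<^bsub>Q\<^esub>"
    proof
      assume "\<pi> x = \<zero>\<^bsub>Q\<^esub>"
      then have "\<rho> (\<pi> x) = \<zero>\<^bsub>M\<^esub>" using lin_zero[OF Q(2)] by simp
      then show False using Q(3)[OF x] nz by simp
    qed
    then obtain f where f: "f \<in> mod_hom R Q W" "f (\<pi> x) \<noteq> \<zero>\<^bsub>W\<^esub>"
      using cogenerator_W mQ lin_closed[OF Q(1) x] unfolding cogenerator_def by blast
    have "(\<lambda>x. f (\<pi> x)) \<in> K"
      unfolding K_def using lin_comp[OF Q(1) mod_hom_lin[OF f(1) mQ mW]] by simp
    then show False using fun_cong[OF j, of "\<lambda>x. f (\<pi> x)"] f(2) by simp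
  qed
  then have "inj_on ?j (carrier M)" unfolding lin_inj_iff[OF l] by blast
  then show thesis using that b l by blast
qed

text \<open>The power of \<open>W\<close> containing \<open>M\<close> lives on a much larger type.
  The noetherian condition gives an injective submodule around \<open>M\<close> that fits
  \<open>'e\<close>, and the hull is formed inside it, so the construction can be repeated on the
  same type.\<close>

lemma injective_hull_exists:
  fixes M :: "('r, 'e) module"
  assumes M: "module R M" and inf: "infinite (UNIV :: 'e set)" and le: "|UNIV :: 'r set| \<le>o |UNIV :: 'e set|"
    "|UNIV :: 'e set| \<le>o |UNIV :: ('r, 'u) hulltype set|"
  obtains E :: "('r, 'e) module" and \<epsilon> where "baer R E" "lin R M E \<epsilon>" "inj_on \<epsilon> (carrier M)"
    "essential_submodule R (\<epsilon> ` carrier M) E"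
proof -
  have "|carrier M| \<le>o |UNIV :: ('r, 'u) hulltype set|"
    by (rule ordLeq_transitive[OF card_of_mono1[OF subset_UNIV] le(2)])
  then obtain E0 :: "('r, ('e \<Rightarrow> 'u) \<Rightarrow> 'u) module" and j where j: "baer R E0" "lin R M E0 j" "inj_on j (carrier M)"
    using embedding_exists[OF M] by metis
  let ?A = "j ` carrier M"
  have sA: "submodule ?A R E0" by (rule submodule_range[OF j(2)])
  obtain H where H: "submodule H R E0" "baer R (E0\<lparr>carrier := H\<rparr>)" "?A \<subseteq> H"
    "\<And>K :: 'e set. \<lbrakk>infinite K; |?A| \<le>o |K|; |carrier R| \<le>o |K|\<rbrakk> \<Longrightarrow> |H| \<le>o |K|"
    using small_injective_submodule[OF cring noetherian j(1) submoduleD(1)[OF sA], where ?'k = 'e] by metis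
  have mE0: "module R E0" by (rule baer_module[OF j(1)])
  have mH: "module R (E0\<lparr>carrier := H\<rparr>)" by (rule baer_module[OF H(2)])
  have "|?A| \<le>o |UNIV :: 'e set|" by (rule ordLeq_transitive[OF card_of_image card_of_mono1[OF subset_UNIV]])
  then have cH: "|H| \<le>o |UNIV :: 'e set|"
    by (rule H(4)[OF inf]) (rule ordLeq_transitive[OF card_of_mono1[OF subset_UNIV] le(1)])
  have "submodule ?A R (E0\<lparr>carrier := H\<rparr>)" using submodule_trans[OF mE0 H(1)] sA H(3) by blast
  from hull_inside_injective[OF H(2) this] obtain L where
    L: "submodule L R (E0\<lparr>carrier := H\<rparr>)" "?A \<subseteq> L" "baer R (E0\<lparr>carrier := L\<rparr>)" "essential_submodule R ?A (E0\<lparr>carrier := L\<rparr>)"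
    by auto
  let ?L = "E0\<lparr>carrier := L\<rparr>"
  have sL: "submodule L R E0" "L \<subseteq> H" using L(1) submodule_trans[OF mE0 H(1)] by blast+
  have mL: "module R ?L" by (rule baer_module[OF L(3)])
  have "|carrier ?L| \<le>o |UNIV :: 'e set|" using ordLeq_transitive[OF card_of_mono1[OF sL(2)] cH] by simp
  from transport_exists[OF mL this] obtain Q :: "('r, 'e) module" and \<pi> \<rho> where
    Q: "lin R ?L Q \<pi>" "lin R Q ?L \<rho>" "\<And>x. x \<in> carrier ?L \<Longrightarrow> \<rho> (\<pi> x) = x" "\<And>x. x \<in> carrier Q \<Longrightarrow> \<pi> (\<rho> x) = x" by metis
  have mQ: "module R Q" by (rule lin_cod[OF Q(1)])
  have jL: "lin R M ?L j" by (rule lin_corestrict[OF j(2) sL(1)]) (use L(2) in blast)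
  have l: "lin R M Q (\<lambda>x. \<pi> (j x))" by (rule lin_comp[OF jL Q(1)])
  have sj: "submodule ?A R ?L" by (rule submodule_range[OF jL])
  show thesis
  proof (rule that[of Q "\<lambda>x. \<pi> (j x)"])
    show "baer R Q" by (rule baer_retract[OF L(3) Q(2) Q(1)]) (rule Q(4))
    show "lin R M Q (\<lambda>x. \<pi> (j x))" by fact
    have jc: "j x \<in> carrier ?L" if "x \<in> carrier M" for x using lin_closed[OF jL that] .
    show "inj_on (\<lambda>x. \<pi> (j x)) (carrier M)"
      using j(3) Q(3)[OF jc] unfolding inj_on_def by metis
    have sl: "submodule ((\<lambda>x. \<pi> (j x)) ` carrier M) R Q" by (rule submodule_range[OF l])
    show "essential_submodule R ((\<lambda>x. \<pi> (j x)) ` carrier M) Q"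
      unfolding essential_iff[OF mQ sl]
    proof (intro ballI impI)
      fix x assume x: "x \<in> carrier Q" "x \<noteq> \<zero>\<^bsub>Q\<^esub>"
      have rc: "\<rho> x \<in> carrier ?L" by (rule lin_closed[OF Q(2) x(1)])
      have "\<rho> x \<noteq> \<zero>\<^bsub>?L\<^esub>" using x Q(4)[OF x(1)] lin_zero[OF Q(1)] by metis
      then obtain r where r: "r \<in> carrier R" "r \<odot>\<^bsub>?L\<^esub> \<rho> x \<in> ?A" "r \<odot>\<^bsub>?L\<^esub> \<rho> x \<noteq> \<zero>\<^bsub>?L\<^esub>"
        using L(4) rc unfolding essential_iff[OF mL sj] by blast
      have eq: "r \<odot>\<^bsub>Q\<^esub> x = \<pi> (r \<odot>\<^bsub>?L\<^esub> \<rho> x)" using lin_smult[OF Q(1) r(1) rc] Q(4)[OF x(1)] by simp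
      obtain y where "y \<in> carrier M" "r \<odot>\<^bsub>?L\<^esub> \<rho> x = j y" using r(2) by blast
      then have "r \<odot>\<^bsub>Q\<^esub> x \<in> (\<lambda>x. \<pi> (j x)) ` carrier M" using eq by auto
      moreover have "r \<odot>\<^bsub>Q\<^esub> x \<noteq> \<zero>\<^bsub>Q\<^esub>"
      proof
        assume "r \<odot>\<^bsub>Q\<^esub> x = \<zero>\<^bsub>Q\<^esub>"
        then have "\<rho> (\<pi> (r \<odot>\<^bsub>?L\<^esub> \<rho> x)) = \<zero>\<^bsub>?L\<^esub>" using lin_zero[OF Q(2)] eq by simp
        moreover have "r \<odot>\<^bsub>?L\<^esub> \<rho> x \<in> carrier ?L" by (rule module.smult_closed[OF mL r(1) rc])
        ultimately show False using Q(3) r(3) by simp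
      qed
      ultimately show "\<exists>r\<in>carrier R. r \<odot>\<^bsub>Q\<^esub> x \<in> (\<lambda>x. \<pi> (j x)) ` carrier M \<and> r \<odot>\<^bsub>Q\<^esub> x \<noteq> \<zero>\<^bsub>Q\<^esub>" using r(1) by blast
    qed
  qed
qed

text \<open>Starting from a copy of \<open>M\<close> on the hull type, take a hull and its cokernel
  alternately, all on this type; \<open>F\<close> chooses both at once. The differentials compose
  the quotient map with the next embedding.\<close>

lemma minimal_coresolution_exists:
  fixes M :: "('r, 'm) module"
  assumes M: "module R M" and le: "|UNIV :: 'm set| \<le>o |UNIV :: 'u set|"
  shows "\<exists>(E :: nat \<Rightarrow> ('r, ('r, 'm) hulltype) module) \<epsilon> d. minimal_injective_coresolution R M E \<epsilon> d"
proof -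
  define P where "P N z \<longleftrightarrow> (case z of (E, \<epsilon>, N', \<pi>) \<Rightarrow> baer R E \<and> lin R N E \<epsilon> \<and> inj_on \<epsilon> (carrier N) \<and>
      essential_submodule R (\<epsilon> ` carrier N) E \<and> lin R E N' \<pi> \<and> \<pi> ` carrier E = carrier N' \<and>
      a_kernel E N' \<pi> = \<epsilon> ` carrier N)"
    for N :: "('r, ('r, 'm) hulltype) module"
      and z :: "('r, ('r, 'm) hulltype) module \<times> (('r, 'm) hulltype \<Rightarrow> ('r, 'm) hulltype) \<times>
         ('r, ('r, 'm) hulltype) module \<times> (('r, 'm) hulltype \<Rightarrow> ('r, 'm) hulltype)"
  have "\<exists>z. P N z" if N: "module R N" for N
  proof -
    obtain E :: "('r, ('r, 'm) hulltype) module" and \<epsilon> where E: "baer R E" "lin R N E \<epsilon>" "inj_on \<epsilon> (carrier N)"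
      "essential_submodule R (\<epsilon> ` carrier N) E"
      by (rule injective_hull_exists[OF N infinite_hulltype card_ring_hulltype card_hulltype_mono[OF le]])
    obtain N' :: "('r, ('r, 'm) hulltype) module" and \<pi> where
      "lin R E N' \<pi>" "\<pi> ` carrier E = carrier N'" "a_kernel E N' \<pi> = \<epsilon> ` carrier N"
      using quotient_exists[OF baer_module[OF E(1)] submodule_range[OF E(2)] card_of_mono1[OF subset_UNIV]] by metis
    then have "P N (E, \<epsilon>, N', \<pi>)" using E by (simp add: P_def)
    then show ?thesis by blast
  qed
  then obtain F where F: "\<And>N. module R N \<Longrightarrow> P N (F N)" by metis
  obtain N0 :: "('r, ('r, 'm) hulltype) module" and \<tau> \<tau>' where
    N0: "lin R M N0 \<tau>" "lin R N0 M \<tau>'" "\<And>x. x \<in> carrier M \<Longrightarrow> \<tau>' (\<tau> x) = x" "\<And>x. x \<in> carrier N0 \<Longrightarrow> \<tau> (\<tau>' x) = x"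
    using transport_exists[OF M card_module_hulltype] by metis
  define N where "N = rec_nat N0 (\<lambda>_ N. fst (snd (snd (F N))))"
  define E where "E k = fst (F (N k))" for k
  define e where "e k = fst (snd (F (N k)))" for k
  define q where "q k = snd (snd (snd (F (N k))))" for k
  have NS: "N (Suc k) = fst (snd (snd (F (N k))))" for k by (simp add: N_def)
  have Pk: "P (N k) (E k, e k, N (Suc k), q k)" if "module R (N k)" for k
    using F[OF that] by (simp add: E_def e_def q_def NS)
  have mN: "module R (N k)" for k
  proof (induction k)
    case 0 show ?case using lin_cod[OF N0(1)] by (simp add: N_def)
  next
    case (Suc k) show ?case using Pk[OF Suc] lin_cod unfolding P_def by blast
  qed
  have p: "baer R (E k)" "lin R (N k) (E k) (e k)" "inj_on (e k) (carrier (N k))"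
    "essential_submodule R (e k ` carrier (N k)) (E k)" "lin R (E k) (N (Suc k)) (q k)"
    "q k ` carrier (E k) = carrier (N (Suc k))" "a_kernel (E k) (N (Suc k)) (q k) = e k ` carrier (N k)" for k
    using Pk[OF mN] by (auto simp: P_def)
  define d where "d k = (\<lambda>x. e (Suc k) (q k x))" for k
  define \<epsilon> where "\<epsilon> = (\<lambda>x. e 0 (\<tau> x))"
  have N00: "N 0 = N0" by (simp add: N_def)
  have d: "lin R (E k) (E (Suc k)) (d k)" for k unfolding d_def by (rule lin_comp[OF p(5) p(2)])
  have ker: "d k x = \<zero>\<^bsub>E (Suc k)\<^esub> \<longleftrightarrow> x \<in> e k ` carrier (N k)" if x: "x \<in> carrier (E k)" for k x
  proof -
    have "d k x = \<zero>\<^bsub>E (Suc k)\<^esub> \<longleftrightarrow> q k x = \<zero>\<^bsub>N (Suc k)\<^esub>"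
      using p(3)[of "Suc k"] lin_closed[OF p(5) x] lin_zero[OF p(2)] unfolding lin_inj_iff[OF p(2)] d_def by metis
    then show ?thesis using p(7)[of k] x by (auto simp: a_kernel_iff set_eq_iff)
  qed
  have im: "d k ` carrier (E k) = e (Suc k) ` carrier (N (Suc k))" for k
    using p(6)[of k] unfolding d_def by (metis image_image)
  have tau: "\<tau> ` carrier M = carrier N0"
  proof
    show "carrier N0 \<subseteq> \<tau> ` carrier M"
    proof
      fix x assume x: "x \<in> carrier N0"
      then show "x \<in> \<tau> ` carrier M" using imageI[OF lin_closed[OF N0(2) x], of \<tau>] N0(4)[OF x] by simp
    qed
  qed (use lin_closed[OF N0(1)] in blast)
  have im0: "\<epsilon> ` carrier M = e 0 ` carrier (N 0)" using tau unfolding N00 \<epsilon>_def by (metis image_image)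
  have "cores R M E \<epsilon> d"
    unfolding cores_def
  proof (intro conjI allI ballI)
    show "lin R M (E 0) \<epsilon>" unfolding \<epsilon>_def by (rule lin_comp[OF N0(1)]) (use p(2)[of 0] N00 in simp)
    show "inj_on \<epsilon> (carrier M)"
      unfolding \<epsilon>_def using p(3)[of 0] N0(3) lin_closed[OF N0(1)] unfolding inj_on_def N00 by metis
  qed (use p(1) d ker im im0 in auto)
  from cores_injective_coresolution[OF this]
  have "injective_coresolution R M E (restrict \<epsilon> (carrier M)) (\<lambda>i. restrict (d i) (carrier (E i)))" .
  moreover have "restrict (d i) (carrier (E i)) ` carrier (E i) = d i ` carrier (E i)" for i by auto
  moreover have "restrict \<epsilon> (carrier M) ` carrier M = \<epsilon> ` carrier M" by auto
  ultimately have "minimal_injective_coresolution R M E (restrict \<epsilon> (carrier M)) (\<lambda>i. restrict (d i) (carrier (E i)))"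
    unfolding minimal_injective_coresolution_def using p(4) by (simp add: im im0)
  then show ?thesis by blast
qed

lemma minimal_min_cores:
  fixes M :: "('r, 'm) module"
  assumes M: "module R M" and le: "|UNIV :: 'm set| \<le>o |UNIV :: 'u set|"
  shows "minimal_injective_coresolution R M (inj_term R M) (inj_aug R M) (inj_diff R M)"
proof -
  let ?Q = "\<lambda>(E :: nat \<Rightarrow> ('r, ('r, 'm) hulltype) module, \<epsilon>, d). minimal_injective_coresolution R M E \<epsilon> d"
  have "\<exists>z. ?Q z" using minimal_coresolution_exists[OF assms] by auto
  then have "?Q (min_cores R M)" unfolding min_cores_def by (rule someI_ex)
  then show ?thesis by (simp add: inj_term_def inj_aug_def inj_diff_def case_prod_beta)
qed

lemma cores_min:
  fixes M :: "('r, 'm) module"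
  assumes M: "module R M" and le: "|UNIV :: 'm set| \<le>o |UNIV :: 'u set|"
  shows "cores R M (inj_term R M) (inj_aug R M) (inj_diff R M)"
  by (rule injective_coresolution_cores[OF M])
    (use minimal_min_cores[OF assms] in \<open>simp add: minimal_injective_coresolution_def\<close>)

end

section \<open>Vanishing of Ext\<close>

lemma cores_baer: "cores R M E \<epsilon> d \<Longrightarrow> baer R (E i)"
  and cores_aug: "cores R M E \<epsilon> d \<Longrightarrow> lin R M (E 0) \<epsilon>"
  and cores_inj: "cores R M E \<epsilon> d \<Longrightarrow> inj_on \<epsilon> (carrier M)"
  and cores_d: "cores R M E \<epsilon> d \<Longrightarrow> lin R (E i) (E (Suc i)) (d i)"
  and cores_ker0: "cores R M E \<epsilon> d \<Longrightarrow> x \<in> carrier (E 0) \<Longrightarrow> d 0 x = \<zero>\<^bsub>E (Suc 0)\<^esub> \<longleftrightarrow> x \<in> \<epsilon> ` carrier M"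
  and cores_ker: "cores R M E \<epsilon> d \<Longrightarrow> x \<in> carrier (E (Suc i)) \<Longrightarrow>
      d (Suc i) x = \<zero>\<^bsub>E (Suc (Suc i))\<^esub> \<longleftrightarrow> x \<in> d i ` carrier (E i)"
  unfolding cores_def by simp_all

lemma cores_module: "cores R M E \<epsilon> d \<Longrightarrow> module R (E i)"
  using cores_baer baer_module by blast

lemma cores_d_aug:
  assumes "cores R M E \<epsilon> d" "x \<in> carrier M" shows "d 0 (\<epsilon> x) = \<zero>\<^bsub>E (Suc 0)\<^esub>"
  using cores_ker0[OF assms(1) lin_closed[OF cores_aug[OF assms(1)] assms(2)]] assms(2) by blast

lemma cores_d_d:
  assumes "cores R M E \<epsilon> d" "x \<in> carrier (E i)" shows "d (Suc i) (d i x) = \<zero>\<^bsub>E (Suc (Suc i))\<^esub>"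
  using cores_ker[OF assms(1) lin_closed[OF cores_d[OF assms(1)] assms(2)]] assms(2) by blast

text \<open>\<open>exv R M E d j\<close> says that the complex \<open>Hom(M, E)\<close> has no cohomology in degree \<open>j\<close>, i.e.
  that \<open>Ext\<^sup>j(M, N) = 0\<close> if \<open>E\<close> is an injective coresolution of \<open>N\<close>.\<close>

definition exv ::
  "('r, 'q) ring_scheme \<Rightarrow> ('r, 'm) module \<Rightarrow> (nat \<Rightarrow> ('r, 'e) module) \<Rightarrow> (nat \<Rightarrow> 'e \<Rightarrow> 'e) \<Rightarrow> nat \<Rightarrow> bool" where
  "exv R M E d j \<longleftrightarrow> (\<forall>z. lin R M (E j) z \<longrightarrow> (\<forall>x\<in>carrier M. d j (z x) = \<zero>\<^bsub>E (Suc j)\<^esub>) \<longrightarrow>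
     (case j of 0 \<Rightarrow> \<forall>x\<in>carrier M. z x = \<zero>\<^bsub>E 0\<^esub>
      | Suc i \<Rightarrow> \<exists>w. lin R M (E i) w \<and> (\<forall>x\<in>carrier M. d i (w x) = z x)))"

lemma exv_0D:
  "\<lbrakk>exv R M E d 0; lin R M (E 0) z; \<And>x. x \<in> carrier M \<Longrightarrow> d 0 (z x) = \<zero>\<^bsub>E (Suc 0)\<^esub>; x \<in> carrier M\<rbrakk> \<Longrightarrow> z x = \<zero>\<^bsub>E 0\<^esub>"
  by (simp add: exv_def)

lemma exv_SucD:
  assumes "exv R M E d (Suc i)" "lin R M (E (Suc i)) z"
    "\<And>x. x \<in> carrier M \<Longrightarrow> d (Suc i) (z x) = \<zero>\<^bsub>E (Suc (Suc i))\<^esub>"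
  obtains w where "lin R M (E i) w" "\<And>x. x \<in> carrier M \<Longrightarrow> d i (w x) = z x"
  using assms by (auto simp: exv_def)

lemma exv_0I:
  "(\<And>z x. \<lbrakk>lin R M (E 0) z; \<And>x. x \<in> carrier M \<Longrightarrow> d 0 (z x) = \<zero>\<^bsub>E (Suc 0)\<^esub>; x \<in> carrier M\<rbrakk> \<Longrightarrow> z x = \<zero>\<^bsub>E 0\<^esub>)
    \<Longrightarrow> exv R M E d 0"
  by (simp add: exv_def)

lemma exv_SucI:
  "(\<And>z. \<lbrakk>lin R M (E (Suc i)) z; \<And>x. x \<in> carrier M \<Longrightarrow> d (Suc i) (z x) = \<zero>\<^bsub>E (Suc (Suc i))\<^esub>\<rbrakk> \<Longrightarrow>
      \<exists>w. lin R M (E i) w \<and> (\<forall>x\<in>carrier M. d i (w x) = z x))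
    \<Longrightarrow> exv R M E d (Suc i)"
  by (simp add: exv_def)

text \<open>The degree on the left has to be positive: in degree 0 \<open>exv\<close> asks for a
  zero cocycle instead of a primitive.\<close>

lemma exv_shift: "exv R M (\<lambda>i. E (Suc i)) (\<lambda>i. d (Suc i)) (Suc i) \<longleftrightarrow> exv R M E d (Suc (Suc i))"
  by (simp add: exv_def)

lemma comparison_map:
  assumes c: "cores R M E \<epsilon> d" and c': "cores R M' E' \<epsilon>' d'" and \<phi>: "lin R M M' \<phi>"
  obtains f where "\<And>i. lin R (E i) (E' i) (f i)" "\<And>x. x \<in> carrier M \<Longrightarrow> f 0 (\<epsilon> x) = \<epsilon>' (\<phi> x)"
    "\<And>i x. x \<in> carrier (E i) \<Longrightarrow> f (Suc i) (d i x) = d' i (f i x)"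
proof -
  \<comment> \<open>\<open>P\<close> also records that cocycles go to cocycles: this is the kernel
    condition under which the next map extends along \<open>d n\<close>.\<close>
  define P where "P n g \<longleftrightarrow> lin R (E n) (E' n) g \<and> (n = 0 \<longrightarrow> (\<forall>x\<in>carrier M. g (\<epsilon> x) = \<epsilon>' (\<phi> x))) \<and>
    (\<forall>x\<in>carrier (E n). d n x = \<zero>\<^bsub>E (Suc n)\<^esub> \<longrightarrow> d' n (g x) = \<zero>\<^bsub>E' (Suc n)\<^esub>)" for n g
  define Q where "Q n g g' \<longleftrightarrow> (\<forall>x\<in>carrier (E n). g' (d n x) = d' n (g x))" for n and g g'
  have "\<exists>f. \<forall>n. P n (f n) \<and> Q n (f n) (f (Suc n))"
  proof (rule dependent_nat_choice)
    obtain g where g: "lin R (E 0) (E' 0) g" "\<And>x. x \<in> carrier M \<Longrightarrow> g (\<epsilon> x) = \<epsilon>' (\<phi> x)"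
      using baer_extend[OF cores_baer[OF c'] cores_aug[OF c] cores_inj[OF c] lin_comp[OF \<phi> cores_aug[OF c']]] by blast
    have "d' 0 (g x) = \<zero>\<^bsub>E' (Suc 0)\<^esub>" if x: "x \<in> carrier (E 0)" "d 0 x = \<zero>\<^bsub>E (Suc 0)\<^esub>" for x
    proof -
      obtain m where m: "x = \<epsilon> m" "m \<in> carrier M" using cores_ker0[OF c x(1)] x(2) by blast
      show ?thesis using g(2)[OF m(2)] cores_d_aug[OF c' lin_closed[OF \<phi> m(2)]] m(1) by simp
    qed
    then show "\<exists>g. P 0 g" using g unfolding P_def by blast
  next
    fix g n assume "P n g"
    then have g: "lin R (E n) (E' n) g"
      and k: "\<And>x. x \<in> carrier (E n) \<Longrightarrow> d n x = \<zero>\<^bsub>E (Suc n)\<^esub> \<Longrightarrow> d' n (g x) = \<zero>\<^bsub>E' (Suc n)\<^esub>"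
      by (auto simp: P_def)
    obtain h where h: "lin R (E (Suc n)) (E' (Suc n)) h" "\<And>x. x \<in> carrier (E n) \<Longrightarrow> h (d n x) = d' n (g x)"
      using baer_extend_over[OF cores_baer[OF c'] cores_d[OF c] lin_comp[OF g cores_d[OF c']] k] by blast
    have "d' (Suc n) (h x) = \<zero>\<^bsub>E' (Suc (Suc n))\<^esub>"
      if x: "x \<in> carrier (E (Suc n))" "d (Suc n) x = \<zero>\<^bsub>E (Suc (Suc n))\<^esub>" for x
    proof -
      obtain m where m: "x = d n m" "m \<in> carrier (E n)" using cores_ker[OF c x(1)] x(2) by blast
      show ?thesis using h(2)[OF m(2)] cores_d_d[OF c' lin_closed[OF g m(2)]] m(1) by simp
    qed
    then show "\<exists>h. P (Suc n) h \<and> Q n g h" using h unfolding P_def Q_def by blast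
  qed
  then obtain f where f: "\<And>n. P n (f n)" "\<And>n. Q n (f n) (f (Suc n))" by blast
  show thesis by (rule that[of f]) (use f in \<open>auto simp: P_def Q_def\<close>)
qed

lemma null_homotopy:
  assumes c: "cores R M E \<epsilon> d" and c': "cores R M' E' \<epsilon>' d'"
    and f: "\<And>i. lin R (E i) (E' i) (f i)" and f0: "\<And>x. x \<in> carrier M \<Longrightarrow> f 0 (\<epsilon> x) = \<zero>\<^bsub>E' 0\<^esub>"
    and fd: "\<And>i x. x \<in> carrier (E i) \<Longrightarrow> f (Suc i) (d i x) = d' i (f i x)"
  obtains h where "\<And>i. lin R (E (Suc i)) (E' i) (h i)" "\<And>x. x \<in> carrier (E 0) \<Longrightarrow> f 0 x = h 0 (d 0 x)"
    "\<And>i x. x \<in> carrier (E (Suc i)) \<Longrightarrow> f (Suc i) x = d' i (h i x) \<oplus>\<^bsub>E' (Suc i)\<^esub> h (Suc i) (d (Suc i) x)"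
proof -
  \<comment> \<open>By the last clause of \<open>P\<close> the map \<open>f (n + 1)\<close> minus
    \<open>d' n\<close> after \<open>g\<close> vanishes on the image of \<open>d n\<close>, so it
    extends along \<open>d (n + 1)\<close> and yields the next homotopy.\<close>
  define P where "P n g \<longleftrightarrow> lin R (E (Suc n)) (E' n) g \<and> (n = 0 \<longrightarrow> (\<forall>x\<in>carrier (E 0). g (d 0 x) = f 0 x)) \<and>
    (\<forall>x\<in>carrier (E n). d' n (g (d n x)) = d' n (f n x))" for n g
  define Q where "Q n g g' \<longleftrightarrow> (\<forall>x\<in>carrier (E (Suc n)). f (Suc n) x = d' n (g x) \<oplus>\<^bsub>E' (Suc n)\<^esub> g' (d (Suc n) x))"
    for n and g g'
  note dc = lin_closed[OF cores_d[OF c]] and fc = lin_closed[OF f]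
  have "\<exists>h. \<forall>n. P n (h n) \<and> Q n (h n) (h (Suc n))"
  proof (rule dependent_nat_choice)
    have "f 0 x = \<zero>\<^bsub>E' 0\<^esub>" if x: "x \<in> carrier (E 0)" "d 0 x = \<zero>\<^bsub>E (Suc 0)\<^esub>" for x
      using cores_ker0[OF c x(1)] x(2) f0 by auto
    from baer_extend_over[OF cores_baer[OF c'] cores_d[OF c] f this]
    obtain g where "lin R (E (Suc 0)) (E' 0) g" "\<And>x. x \<in> carrier (E 0) \<Longrightarrow> g (d 0 x) = f 0 x" by blast
    then show "\<exists>g. P 0 g" unfolding P_def by auto
  next
    fix g n assume "P n g"
    then have g: "lin R (E (Suc n)) (E' n) g"
      and k: "\<And>x. x \<in> carrier (E n) \<Longrightarrow> d' n (g (d n x)) = d' n (f n x)"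
      by (auto simp: P_def)
    interpret E': module R "E' (Suc n)" by (rule cores_module[OF c'])
    interpret E2: module R "E' (Suc (Suc n))" by (rule cores_module[OF c'])
    let ?k = "\<lambda>x. f (Suc n) x \<ominus>\<^bsub>E' (Suc n)\<^esub> d' n (g x)"
    have lg: "lin R (E (Suc n)) (E' (Suc n)) (\<lambda>x. d' n (g x))" by (rule lin_comp[OF g cores_d[OF c']])
    have lk: "lin R (E (Suc n)) (E' (Suc n)) ?k" by (rule lin_minus_map[OF f lg])
    have "?k x = \<zero>\<^bsub>E' (Suc n)\<^esub>" if x: "x \<in> carrier (E (Suc n))" "d (Suc n) x = \<zero>\<^bsub>E (Suc (Suc n))\<^esub>" for x
    proof -
      obtain y where y: "x = d n y" "y \<in> carrier (E n)" using cores_ker[OF c x(1)] x(2) by blast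
      have "f (Suc n) x = d' n (g x)" using fd[OF y(2)] k[OF y(2)] y(1) by simp
      then show ?thesis using E'.minus_eq_zero_iff lin_closed[OF lg x(1)] by simp
    qed
    from baer_extend_over[OF cores_baer[OF c'] cores_d[OF c] lk this]
    obtain h where h: "lin R (E (Suc (Suc n))) (E' (Suc n)) h"
      "\<And>x. x \<in> carrier (E (Suc n)) \<Longrightarrow> h (d (Suc n) x) = ?k x" by blast
    have "d' (Suc n) (h (d (Suc n) x)) = d' (Suc n) (f (Suc n) x)" if x: "x \<in> carrier (E (Suc n))" for x
    proof -
      have "d' (Suc n) (h (d (Suc n) x)) = d' (Suc n) (f (Suc n) x) \<ominus>\<^bsub>E' (Suc (Suc n))\<^esub> d' (Suc n) (d' n (g x))"
        unfolding h(2)[OF x] by (rule lin_minus[OF cores_d[OF c'] fc[OF x] lin_closed[OF lg x]])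
      then show ?thesis
        using cores_d_d[OF c' lin_closed[OF g x]] lin_closed[OF cores_d[OF c'] fc[OF x]] by (simp add: E2.minus_zero_right)
    qed
    then have "P (Suc n) h" using h(1) unfolding P_def by simp
    moreover have "f (Suc n) x = d' n (g x) \<oplus>\<^bsub>E' (Suc n)\<^esub> h (d (Suc n) x)" if x: "x \<in> carrier (E (Suc n))" for x
    proof -
      have "f (Suc n) x \<in> carrier (E' (Suc n))" "d' n (g x) \<in> carrier (E' (Suc n))"
        using fc[OF x] lin_closed[OF lg x] by auto
      then show ?thesis unfolding h(2)[OF x] by algebra
    qed
    then have "Q n g h" unfolding Q_def by blast
    ultimately show "\<exists>h. P (Suc n) h \<and> Q n g h" by blast
  qed
  then obtain h where h: "\<And>n. P n (h n)" "\<And>n. Q n (h n) (h (Suc n))" by blast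
  show thesis by (rule that[of h]) (use h in \<open>auto simp: P_def Q_def\<close>)
qed

text \<open>The chain maps \<open>f\<close> and \<open>g\<close> lift \<open>s\<close> and
  \<open>p\<close>. Their composite lifts the identity of \<open>N'\<close>, so it differs from the
  identity by a null-homotopic map; on cocycles one of the two homotopy terms vanishes.\<close>

lemma homotopy_retract:
  assumes c: "cores R N E \<epsilon> d" and c': "cores R N' E' \<epsilon>' d'"
    and s: "lin R N' N s" and p: "lin R N N' p" and ps: "\<And>x. x \<in> carrier N' \<Longrightarrow> p (s x) = x"
  obtains f g h where "\<And>i. lin R (E' i) (E i) (f i)" "\<And>i. lin R (E i) (E' i) (g i)" "\<And>i. lin R (E' (Suc i)) (E' i) (h i)"
    "\<And>i x. x \<in> carrier (E' i) \<Longrightarrow> f (Suc i) (d' i x) = d i (f i x)"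
    "\<And>i x. x \<in> carrier (E i) \<Longrightarrow> g (Suc i) (d i x) = d' i (g i x)"
    "\<And>x. x \<in> carrier (E' 0) \<Longrightarrow> d' 0 x = \<zero>\<^bsub>E' (Suc 0)\<^esub> \<Longrightarrow> g 0 (f 0 x) = x"
    "\<And>i x. x \<in> carrier (E' (Suc i)) \<Longrightarrow> d' (Suc i) x = \<zero>\<^bsub>E' (Suc (Suc i))\<^esub> \<Longrightarrow>
        g (Suc i) (f (Suc i) x) = x \<oplus>\<^bsub>E' (Suc i)\<^esub> d' i (h i x)"
    "\<And>x. x \<in> carrier N' \<Longrightarrow> f 0 (\<epsilon>' x) = \<epsilon> (s x)" "\<And>x. x \<in> carrier N \<Longrightarrow> g 0 (\<epsilon> x) = \<epsilon>' (p x)"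
    "\<And>x. x \<in> carrier (E' 0) \<Longrightarrow> g 0 (f 0 x) = x \<oplus>\<^bsub>E' 0\<^esub> h 0 (d' 0 x)"
proof -
  obtain f where f: "\<And>i. lin R (E' i) (E i) (f i)" "\<And>x. x \<in> carrier N' \<Longrightarrow> f 0 (\<epsilon>' x) = \<epsilon> (s x)"
    "\<And>i x. x \<in> carrier (E' i) \<Longrightarrow> f (Suc i) (d' i x) = d i (f i x)"
    using comparison_map[OF c' c s] by metis
  obtain g where g: "\<And>i. lin R (E i) (E' i) (g i)" "\<And>x. x \<in> carrier N \<Longrightarrow> g 0 (\<epsilon> x) = \<epsilon>' (p x)"
    "\<And>i x. x \<in> carrier (E i) \<Longrightarrow> g (Suc i) (d i x) = d' i (g i x)"
    using comparison_map[OF c c' p] by metis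
  note fc = lin_closed[OF f(1)] and gc = lin_closed[OF g(1)] and dc' = lin_closed[OF cores_d[OF c']]
  have m: "abelian_group (E' i)" for i by (rule module_abelian_group[OF cores_module[OF c']])
  define k where "k i x = g i (f i x) \<ominus>\<^bsub>E' i\<^esub> x" for i x
  have k: "lin R (E' i) (E' i) (k i)" for i
    unfolding k_def by (rule lin_minus_map[OF lin_comp[OF f(1) g(1)] lin_id[OF cores_module[OF c']]])
  have k0: "k 0 (\<epsilon>' x) = \<zero>\<^bsub>E' 0\<^esub>" if x: "x \<in> carrier N'" for x
  proof -
    have "g 0 (f 0 (\<epsilon>' x)) = \<epsilon>' x" using f(2)[OF x] g(2)[OF lin_closed[OF s x]] ps[OF x] by simp
    then show ?thesis unfolding k_def
      using abelian_group.minus_eq_zero_iff[OF m] lin_closed[OF cores_aug[OF c'] x] by simp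
  qed
  have kd: "k (Suc i) (d' i x) = d' i (k i x)" if x: "x \<in> carrier (E' i)" for i x
  proof -
    have "g (Suc i) (f (Suc i) (d' i x)) = d' i (g i (f i x))" using f(3)[OF x] g(3)[OF fc[OF x]] by simp
    then show ?thesis unfolding k_def using lin_minus[OF cores_d[OF c'] gc[OF fc[OF x]] x] by simp
  qed
  obtain h where h: "\<And>i. lin R (E' (Suc i)) (E' i) (h i)" "\<And>x. x \<in> carrier (E' 0) \<Longrightarrow> k 0 x = h 0 (d' 0 x)"
    "\<And>i x. x \<in> carrier (E' (Suc i)) \<Longrightarrow> k (Suc i) x = d' i (h i x) \<oplus>\<^bsub>E' (Suc i)\<^esub> h (Suc i) (d' (Suc i) x)"
    using null_homotopy[OF c' c' k k0 kd] by metis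
  have gf: "g i (f i x) = x \<oplus>\<^bsub>E' i\<^esub> k i x" if x: "x \<in> carrier (E' i)" for i x
  proof -
    interpret A: abelian_group "E' i" by (rule m)
    have "g i (f i x) \<in> carrier (E' i)" using gc[OF fc[OF x]] .
    then show ?thesis unfolding k_def using x by algebra
  qed
  have 0: "g 0 (f 0 x) = x \<oplus>\<^bsub>E' 0\<^esub> h 0 (d' 0 x)" if x: "x \<in> carrier (E' 0)" for x
    using gf[OF x] h(2)[OF x] by simp
  show thesis
  proof (rule that[of f g h, OF f(1) g(1) h(1) f(3) g(3) _ _ f(2) g(2) 0])
    show "g 0 (f 0 x) = x" if x: "x \<in> carrier (E' 0)" "d' 0 x = \<zero>\<^bsub>E' (Suc 0)\<^esub>" for x
    proof -
      interpret A: abelian_group "E' 0" by (rule m)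
      show ?thesis using 0[OF x(1)] x lin_zero[OF h(1)] by simp
    qed
    show "g (Suc i) (f (Suc i) x) = x \<oplus>\<^bsub>E' (Suc i)\<^esub> d' i (h i x)"
      if x: "x \<in> carrier (E' (Suc i))" "d' (Suc i) x = \<zero>\<^bsub>E' (Suc (Suc i))\<^esub>" for i x
    proof -
      interpret A: abelian_group "E' (Suc i)" by (rule m)
      have "d' i (h i x) \<in> carrier (E' (Suc i))" using dc'[OF lin_closed[OF h(1) x(1)]] .
      then have "k (Suc i) x = d' i (h i x)" using h(3)[OF x(1)] x(2) lin_zero[OF h(1)] by simp
      then show ?thesis using gf[OF x(1)] by simp
    qed
  qed
qed

text \<open>A cocycle \<open>z\<close> into \<open>E'\<close> is pushed to \<open>E\<close> by
  \<open>f\<close>, solved there by \<open>w\<close>, and brought back by \<open>g\<close>;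
  subtracting \<open>h z\<close> corrects the homotopy.\<close>

lemma exv_retract:
  assumes c: "cores R N E \<epsilon> d" and c': "cores R N' E' \<epsilon>' d'"
    and s: "lin R N' N s" and p: "lin R N N' p" and ps: "\<And>x. x \<in> carrier N' \<Longrightarrow> p (s x) = x"
    and ex: "exv R M E d j"
  shows "exv R M E' d' j"
proof -
  obtain f g h where f: "\<And>i. lin R (E' i) (E i) (f i)" and g: "\<And>i. lin R (E i) (E' i) (g i)"
    and h: "\<And>i. lin R (E' (Suc i)) (E' i) (h i)"
    and fd: "\<And>i x. x \<in> carrier (E' i) \<Longrightarrow> f (Suc i) (d' i x) = d i (f i x)"
    and gd: "\<And>i x. x \<in> carrier (E i) \<Longrightarrow> g (Suc i) (d i x) = d' i (g i x)"
    and gf0: "\<And>x. x \<in> carrier (E' 0) \<Longrightarrow> d' 0 x = \<zero>\<^bsub>E' (Suc 0)\<^esub> \<Longrightarrow> g 0 (f 0 x) = x"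
    and gf: "\<And>i x. x \<in> carrier (E' (Suc i)) \<Longrightarrow> d' (Suc i) x = \<zero>\<^bsub>E' (Suc (Suc i))\<^esub> \<Longrightarrow>
        g (Suc i) (f (Suc i) x) = x \<oplus>\<^bsub>E' (Suc i)\<^esub> d' i (h i x)"
    by (rule homotopy_retract[OF c c' s p]) (erule ps, rule that)
  have fz: "d j (f j (z x)) = \<zero>\<^bsub>E (Suc j)\<^esub>"
    if "lin R M (E' j) z" "\<And>x. x \<in> carrier M \<Longrightarrow> d' j (z x) = \<zero>\<^bsub>E' (Suc j)\<^esub>" "x \<in> carrier M" for z x
    using fd[OF lin_closed[OF that(1,3)]] that(2)[OF that(3)] lin_zero[OF f[of "Suc j"]] by simp
  show ?thesis
  proof (cases j)
    case 0
    show ?thesis unfolding 0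
    proof (rule exv_0I)
      fix z x assume z: "lin R M (E' 0) z" "\<And>x. x \<in> carrier M \<Longrightarrow> d' 0 (z x) = \<zero>\<^bsub>E' (Suc 0)\<^esub>" and x: "x \<in> carrier M"
      have "f 0 (z x) = \<zero>\<^bsub>E 0\<^esub>"
        by (rule exv_0D[OF ex[unfolded 0] lin_comp[OF z(1) f] _ x]) (use fz[unfolded 0, OF z] in simp)
      then show "z x = \<zero>\<^bsub>E' 0\<^esub>" using gf0[OF lin_closed[OF z(1) x] z(2)[OF x]] lin_zero[OF g] by simp
    qed
  next
    case (Suc i)
    show ?thesis unfolding Suc
    proof (rule exv_SucI)
      fix z assume z: "lin R M (E' (Suc i)) z" "\<And>x. x \<in> carrier M \<Longrightarrow> d' (Suc i) (z x) = \<zero>\<^bsub>E' (Suc (Suc i))\<^esub>"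
      from exv_SucD[OF ex[unfolded Suc] lin_comp[OF z(1) f] fz[unfolded Suc, OF z]]
      obtain w where w: "lin R M (E i) w" "\<And>x. x \<in> carrier M \<Longrightarrow> d i (w x) = f (Suc i) (z x)" by blast
      let ?w = "\<lambda>x. g i (w x) \<ominus>\<^bsub>E' i\<^esub> h i (z x)"
      have l1: "lin R M (E' i) (\<lambda>x. g i (w x))" by (rule lin_comp[OF w(1) g])
      have l2: "lin R M (E' i) (\<lambda>x. h i (z x))" by (rule lin_comp[OF z(1) h])
      have "d' i (?w x) = z x" if x: "x \<in> carrier M" for x
      proof -
        interpret A: module R "E' (Suc i)" by (rule cores_module[OF c'])
        have zc: "z x \<in> carrier (E' (Suc i))" "d' i (h i (z x)) \<in> carrier (E' (Suc i))"
          using lin_closed[OF z(1) x] lin_closed[OF cores_d[OF c'] lin_closed[OF l2 x]] by auto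
        have "d' i (?w x) = d' i (g i (w x)) \<ominus>\<^bsub>E' (Suc i)\<^esub> d' i (h i (z x))"
          by (rule lin_minus[OF cores_d[OF c'] lin_closed[OF l1 x] lin_closed[OF l2 x]])
        also have "d' i (g i (w x)) = g (Suc i) (f (Suc i) (z x))"
          using gd[OF lin_closed[OF w(1) x]] w(2)[OF x] by simp
        also have "\<dots> = z x \<oplus>\<^bsub>E' (Suc i)\<^esub> d' i (h i (z x))"
          by (rule gf[OF zc(1) z(2)[OF x]])
        also have "\<dots> \<ominus>\<^bsub>E' (Suc i)\<^esub> d' i (h i (z x)) = z x" using zc by algebra
        finally show ?thesis .
      qed
      then show "\<exists>w. lin R M (E' i) w \<and> (\<forall>x\<in>carrier M. d' i (w x) = z x)"
        using lin_minus_map[OF l1 l2] by blast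
    qed
  qed
qed

text \<open>The case where both maps of the retraction are the identity. It frees all later
  statements from the coresolution chosen by \<open>SOME\<close>.\<close>

lemma exv_independent:
  assumes "cores R N E \<epsilon> d" "cores R N E' \<epsilon>' d'" shows "exv R M E d j \<longleftrightarrow> exv R M E' d' j"
proof -
  have N: "module R N" by (rule lin_dom[OF cores_aug[OF assms(1)]])
  show ?thesis
    using exv_retract[OF assms lin_id[OF N] lin_id[OF N]]
      exv_retract[OF assms(2,1) lin_id[OF N] lin_id[OF N]] by blast
qed

lemma exv_retract_first:
  assumes d: "\<And>i. lin R (E i) (E (Suc i)) (d i)" and s: "lin R M' M s" and p: "lin R M M' p"
    and ps: "\<And>x. x \<in> carrier M' \<Longrightarrow> p (s x) = x" and ex: "exv R M E d j"
  shows "exv R M' E d j"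
proof (cases j)
  case 0
  show ?thesis unfolding 0
  proof (rule exv_0I)
    fix z x assume z: "lin R M' (E 0) z" "\<And>x. x \<in> carrier M' \<Longrightarrow> d 0 (z x) = \<zero>\<^bsub>E (Suc 0)\<^esub>" and x: "x \<in> carrier M'"
    have "z (p (s x)) = \<zero>\<^bsub>E 0\<^esub>"
      by (rule exv_0D[OF ex[unfolded 0] lin_comp[OF p z(1)]])
        (use z(2) lin_closed[OF p] lin_closed[OF s x] in simp_all)
    then show "z x = \<zero>\<^bsub>E 0\<^esub>" using ps[OF x] by simp
  qed
next
  case (Suc i)
  show ?thesis unfolding Suc
  proof (rule exv_SucI)
    fix z assume z: "lin R M' (E (Suc i)) z" "\<And>x. x \<in> carrier M' \<Longrightarrow> d (Suc i) (z x) = \<zero>\<^bsub>E (Suc (Suc i))\<^esub>"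
    from exv_SucD[OF ex[unfolded Suc] lin_comp[OF p z(1)] z(2)[OF lin_closed[OF p]]]
    obtain w where w: "lin R M (E i) w" "\<And>x. x \<in> carrier M \<Longrightarrow> d i (w x) = z (p x)" by blast
    have "d i (w (s x)) = z x" if x: "x \<in> carrier M'" for x
      using w(2)[OF lin_closed[OF s x]] ps[OF x] by simp
    then show "\<exists>w. lin R M' (E i) w \<and> (\<forall>x\<in>carrier M'. d i (w x) = z x)" using lin_comp[OF s w(1)] by blast
  qed
qed

section \<open>Long exact sequences in both variables\<close>

definition ses ::
  "('r, 'q) ring_scheme \<Rightarrow> ('r, 'a) module \<Rightarrow> ('r, 'b) module \<Rightarrow> ('r, 'c) module \<Rightarrow> ('a \<Rightarrow> 'b) \<Rightarrow> ('b \<Rightarrow> 'c) \<Rightarrow> bool" where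
  "ses R A B C \<alpha> \<beta> \<longleftrightarrow> lin R A B \<alpha> \<and> inj_on \<alpha> (carrier A) \<and> lin R B C \<beta> \<and> \<beta> ` carrier B = carrier C \<and>
     (\<forall>x\<in>carrier B. \<beta> x = \<zero>\<^bsub>C\<^esub> \<longleftrightarrow> x \<in> \<alpha> ` carrier A)"

lemma sesD:
  assumes "ses R A B C \<alpha> \<beta>"
  shows "lin R A B \<alpha>" "inj_on \<alpha> (carrier A)" "lin R B C \<beta>" "\<beta> ` carrier B = carrier C"
    "\<And>x. x \<in> carrier B \<Longrightarrow> \<beta> x = \<zero>\<^bsub>C\<^esub> \<longleftrightarrow> x \<in> \<alpha> ` carrier A" "\<And>a. a \<in> carrier A \<Longrightarrow> \<beta> (\<alpha> a) = \<zero>\<^bsub>C\<^esub>"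
proof -
  show 1: "lin R A B \<alpha>" "inj_on \<alpha> (carrier A)" "lin R B C \<beta>" "\<beta> ` carrier B = carrier C"
    "\<And>x. x \<in> carrier B \<Longrightarrow> \<beta> x = \<zero>\<^bsub>C\<^esub> \<longleftrightarrow> x \<in> \<alpha> ` carrier A"
    using assms by (auto simp: ses_def)
  show "\<beta> (\<alpha> a) = \<zero>\<^bsub>C\<^esub>" if "a \<in> carrier A" for a using 1(5)[OF lin_closed[OF 1(1) that]] that by blast
qed

lemma ses_factor:
  assumes S: "ses R A B C \<alpha> \<beta>" and g: "lin R B X g" and 0: "\<And>a. a \<in> carrier A \<Longrightarrow> g (\<alpha> a) = \<zero>\<^bsub>X\<^esub>"
  obtains h where "lin R C X h" "\<And>x. x \<in> carrier B \<Longrightarrow> h (\<beta> x) = g x"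
proof -
  have "g x = \<zero>\<^bsub>X\<^esub>" if "x \<in> carrier B" "\<beta> x = \<zero>\<^bsub>C\<^esub>" for x using sesD(5)[OF S that(1)] that(2) 0 by auto
  then show thesis using lin_factor[OF sesD(3,4)[OF S] g] that by metis
qed

text \<open>The part \<open>Ext\<^sup>i\<^sup>+\<^sup>1(A, N) \<rightarrow>
  Ext\<^sup>i\<^sup>+\<^sup>2(C, N) \<rightarrow> Ext\<^sup>i\<^sup>+\<^sup>2(B, N)\<close> of the
  long exact sequence, by a chase in one coresolution of \<open>N\<close>.\<close>

lemma exv_cokernel:
  assumes S: "ses R A B C \<alpha> \<beta>" and c: "cores R N E \<epsilon> d"
    and A: "exv R A E d (Suc i)" and B: "exv R B E d (Suc (Suc i))"
  shows "exv R C E d (Suc (Suc i))"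
proof (rule exv_SucI)
  note s = sesD[OF S]
  fix z assume z: "lin R C (E (Suc (Suc i))) z" "\<And>x. x \<in> carrier C \<Longrightarrow> d (Suc (Suc i)) (z x) = \<zero>\<^bsub>E (Suc (Suc (Suc i)))\<^esub>"
  from exv_SucD[OF B lin_comp[OF s(3) z(1)] z(2)[OF lin_closed[OF s(3)]]]
  obtain w where w: "lin R B (E (Suc i)) w" "\<And>x. x \<in> carrier B \<Longrightarrow> d (Suc i) (w x) = z (\<beta> x)" by blast
  have "d (Suc i) (w (\<alpha> a)) = \<zero>\<^bsub>E (Suc (Suc i))\<^esub>" if a: "a \<in> carrier A" for a
    using w(2)[OF lin_closed[OF s(1) a]] s(6)[OF a] lin_zero[OF z(1)] by simp
  from exv_SucD[OF A lin_comp[OF s(1) w(1)] this]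
  obtain v where v: "lin R A (E i) v" "\<And>a. a \<in> carrier A \<Longrightarrow> d i (v a) = w (\<alpha> a)" by blast
  obtain v' where v': "lin R B (E i) v'" "\<And>a. a \<in> carrier A \<Longrightarrow> v' (\<alpha> a) = v a"
    using baer_extend[OF cores_baer[OF c] s(1,2) v(1)] by blast
  interpret E1: module R "E (Suc i)" by (rule cores_module[OF c])
  interpret E2: module R "E (Suc (Suc i))" by (rule cores_module[OF c])
  have ld: "lin R B (E (Suc i)) (\<lambda>x. d i (v' x))" by (rule lin_comp[OF v'(1) cores_d[OF c]])
  have lu: "lin R B (E (Suc i)) (\<lambda>x. w x \<ominus>\<^bsub>E (Suc i)\<^esub> d i (v' x))" by (rule lin_minus_map[OF w(1) ld])
  have "w (\<alpha> a) \<ominus>\<^bsub>E (Suc i)\<^esub> d i (v' (\<alpha> a)) = \<zero>\<^bsub>E (Suc i)\<^esub>" if a: "a \<in> carrier A" for a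
    using v'(2)[OF a] v(2)[OF a] lin_closed[OF w(1) lin_closed[OF s(1) a]] by (simp add: E1.minus_eq_zero_iff)
  from ses_factor[OF S lu this] obtain u where u: "lin R C (E (Suc i)) u"
    "\<And>x. x \<in> carrier B \<Longrightarrow> u (\<beta> x) = w x \<ominus>\<^bsub>E (Suc i)\<^esub> d i (v' x)" by blast
  have "d (Suc i) (u y) = z y" if y: "y \<in> carrier C" for y
  proof -
    obtain x where x: "y = \<beta> x" "x \<in> carrier B" using y s(4) by blast
    have "d (Suc i) (u y) = d (Suc i) (w x) \<ominus>\<^bsub>E (Suc (Suc i))\<^esub> d (Suc i) (d i (v' x))"
      unfolding x(1) u(2)[OF x(2)] by (rule lin_minus[OF cores_d[OF c] lin_closed[OF w(1) x(2)] lin_closed[OF ld x(2)]])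
    also have "\<dots> = z y"
      using w(2)[OF x(2)] cores_d_d[OF c lin_closed[OF v'(1) x(2)]] x lin_closed[OF z(1) y] by (simp add: E2.minus_zero_right)
    finally show ?thesis .
  qed
  then show "\<exists>w. lin R C (E (Suc i)) w \<and> (\<forall>x\<in>carrier C. d (Suc i) (w x) = z x)" using u(1) by blast
qed

text \<open>The part \<open>Ext\<^sup>i\<^sup>+\<^sup>1(B, N) \<rightarrow>
  Ext\<^sup>i\<^sup>+\<^sup>1(A, N) \<rightarrow> Ext\<^sup>i\<^sup>+\<^sup>2(C, N)\<close> of the
  long exact sequence.\<close>

lemma exv_kernel:
  assumes S: "ses R A B C \<alpha> \<beta>" and c: "cores R N E \<epsilon> d"
    and B: "exv R B E d (Suc i)" and C: "exv R C E d (Suc (Suc i))"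
  shows "exv R A E d (Suc i)"
proof (rule exv_SucI)
  note s = sesD[OF S]
  fix z assume z: "lin R A (E (Suc i)) z" "\<And>x. x \<in> carrier A \<Longrightarrow> d (Suc i) (z x) = \<zero>\<^bsub>E (Suc (Suc i))\<^esub>"
  obtain z' where z': "lin R B (E (Suc i)) z'" "\<And>a. a \<in> carrier A \<Longrightarrow> z' (\<alpha> a) = z a"
    using baer_extend[OF cores_baer[OF c] s(1,2) z(1)] by blast
  have ldz: "lin R B (E (Suc (Suc i))) (\<lambda>x. d (Suc i) (z' x))" by (rule lin_comp[OF z'(1) cores_d[OF c]])
  have "d (Suc i) (z' (\<alpha> a)) = \<zero>\<^bsub>E (Suc (Suc i))\<^esub>" if a: "a \<in> carrier A" for a
    using z'(2)[OF a] z(2)[OF a] by simp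
  from ses_factor[OF S ldz this] obtain y where y: "lin R C (E (Suc (Suc i))) y"
    "\<And>x. x \<in> carrier B \<Longrightarrow> y (\<beta> x) = d (Suc i) (z' x)" by blast
  have "d (Suc (Suc i)) (y x) = \<zero>\<^bsub>E (Suc (Suc (Suc i)))\<^esub>" if x: "x \<in> carrier C" for x
  proof -
    obtain b where b: "x = \<beta> b" "b \<in> carrier B" using x s(4) by blast
    then show ?thesis using y(2)[OF b(2)] cores_d_d[OF c lin_closed[OF z'(1) b(2)]] by simp
  qed
  from exv_SucD[OF C y(1) this] obtain u where u: "lin R C (E (Suc i)) u"
    "\<And>x. x \<in> carrier C \<Longrightarrow> d (Suc i) (u x) = y x" by blast
  interpret E1: module R "E (Suc i)" by (rule cores_module[OF c])
  interpret E2: module R "E (Suc (Suc i))" by (rule cores_module[OF c])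
  have lub: "lin R B (E (Suc i)) (\<lambda>x. u (\<beta> x))" by (rule lin_comp[OF s(3) u(1)])
  let ?t = "\<lambda>x. z' x \<ominus>\<^bsub>E (Suc i)\<^esub> u (\<beta> x)"
  have lt: "lin R B (E (Suc i)) ?t" by (rule lin_minus_map[OF z'(1) lub])
  have "d (Suc i) (?t x) = \<zero>\<^bsub>E (Suc (Suc i))\<^esub>" if x: "x \<in> carrier B" for x
  proof -
    have "d (Suc i) (?t x) = d (Suc i) (z' x) \<ominus>\<^bsub>E (Suc (Suc i))\<^esub> d (Suc i) (u (\<beta> x))"
      by (rule lin_minus[OF cores_d[OF c] lin_closed[OF z'(1) x] lin_closed[OF lub x]])
    also have "\<dots> = \<zero>\<^bsub>E (Suc (Suc i))\<^esub>"
      using u(2)[OF lin_closed[OF s(3) x]] y(2)[OF x] lin_closed[OF ldz x] by (simp add: E2.minus_eq_zero_iff)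
    finally show ?thesis .
  qed
  from exv_SucD[OF B lt this] obtain w where w: "lin R B (E i) w" "\<And>x. x \<in> carrier B \<Longrightarrow> d i (w x) = ?t x" by blast
  have "d i (w (\<alpha> a)) = z a" if a: "a \<in> carrier A" for a
    using w(2)[OF lin_closed[OF s(1) a]] z'(2)[OF a] s(6)[OF a] lin_zero[OF u(1)] lin_closed[OF z(1) a]
    by (simp add: E1.minus_zero_right)
  then show "\<exists>w. lin R A (E i) w \<and> (\<forall>x\<in>carrier A. d i (w x) = z x)" using lin_comp[OF s(1) w(1)] by blast
qed

text \<open>For a short exact sequence \<open>0 \<rightarrow> A \<rightarrow> B \<rightarrow> C \<rightarrow> 0\<close>, the mapping fibre of a chain map between
  coresolutions of \<open>B\<close> and \<open>C\<close> is a coresolution of \<open>A\<close>.  With independence of the coresolution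
  this contains the long exact sequence in the second variable.\<close>

definition fibre_term :: "(nat \<Rightarrow> ('r, 'b) module) \<Rightarrow> (nat \<Rightarrow> ('r, 'c) module) \<Rightarrow> nat \<Rightarrow> ('r, 'b \<times> 'c) module" where
  "fibre_term E G i = dir_sum2 (E i) (case i of 0 \<Rightarrow> zmod undefined | Suc k \<Rightarrow> G k)"

text \<open>The minus sign makes consecutive differentials compose to zero, since \<open>f\<close>
  commutes with \<open>d\<close> and \<open>e\<close>. In degree 0 the second component of the
  argument is the dummy element of a zero module.\<close>

definition fibre_diff ::
  "(nat \<Rightarrow> ('r, 'c) module) \<Rightarrow> (nat \<Rightarrow> 'b \<Rightarrow> 'b) \<Rightarrow> (nat \<Rightarrow> 'c \<Rightarrow> 'c) \<Rightarrow> (nat \<Rightarrow> 'b \<Rightarrow> 'c) \<Rightarrow> nat \<Rightarrow> 'b \<times> 'c \<Rightarrow> 'b \<times> 'c" where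
  "fibre_diff G d e f i z = (d i (fst z),
     case i of 0 \<Rightarrow> f 0 (fst z) | Suc k \<Rightarrow> f (Suc k) (fst z) \<ominus>\<^bsub>G (Suc k)\<^esub> e k (snd z))"

lemma fibre_simps [simp]:
  "fibre_term E G 0 = dir_sum2 (E 0) (zmod undefined)"
  "fibre_term E G (Suc k) = dir_sum2 (E (Suc k)) (G k)"
  "fibre_diff G d e f 0 z = (d 0 (fst z), f 0 (fst z))"
  "fibre_diff G d e f (Suc k) z = (d (Suc k) (fst z), f (Suc k) (fst z) \<ominus>\<^bsub>G (Suc k)\<^esub> e k (snd z))"
  by (simp_all add: fibre_term_def fibre_diff_def)

lemma cores_fibre:
  assumes S: "ses R A B C \<alpha> \<beta>" and c: "cores R B E \<epsilon> d" and c': "cores R C G \<eta> e"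
    and f: "\<And>i. lin R (E i) (G i) (f i)" and f0: "\<And>x. x \<in> carrier B \<Longrightarrow> f 0 (\<epsilon> x) = \<eta> (\<beta> x)"
    and fd: "\<And>i x. x \<in> carrier (E i) \<Longrightarrow> f (Suc i) (d i x) = e i (f i x)"
  shows "cores R A (fibre_term E G) (\<lambda>a. (\<epsilon> (\<alpha> a), undefined)) (fibre_diff G d e f)"
proof -
  note s = sesD[OF S]
  have cr: "cring R" by (rule module.axioms(1)[OF lin_dom[OF s(1)]])
  have mA: "module R A" by (rule lin_dom[OF s(1)])
  have mE: "module R (E i)" and mG: "module R (G i)" for i by (rule cores_module[OF c], rule cores_module[OF c'])
  note dc = lin_closed[OF cores_d[OF c]] and ec = lin_closed[OF cores_d[OF c']] and fc = lin_closed[OF f]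
  have z: "module R (zmod undefined :: ('a, 'c) module)" for c by (rule module_zmod[OF cr])
  let ?H = "fibre_term E G" and ?D = "fibre_diff G d e f" and ?a = "\<lambda>a. (\<epsilon> (\<alpha> a), undefined)"
  show ?thesis
    unfolding cores_def
  proof (intro conjI allI ballI)
    show "baer R (?H i)" for i
      using baer_dir_sum2[OF cores_baer[OF c] baer_zmod[OF cr]] baer_dir_sum2[OF cores_baer[OF c] cores_baer[OF c']]
      by (cases i) simp_all
    have la: "lin R A (E 0) (\<lambda>a. \<epsilon> (\<alpha> a))" by (rule lin_comp[OF s(1) cores_aug[OF c]])
    have lz: "lin R A (zmod undefined) (\<lambda>_. undefined)" using lin_zero_map[OF mA module_zmod[OF cr]] by simp
    show "lin R A (?H 0) ?a" using lin_pair[OF la lz] by simp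
    show "inj_on ?a (carrier A)"
      using s(2) cores_inj[OF c] lin_closed[OF s(1)] unfolding inj_on_def by simp
    show "lin R (?H i) (?H (Suc i)) (?D i)" for i
    proof (cases i)
      case 0
      have 1: "lin R (dir_sum2 (E 0) (zmod undefined)) (E 0) fst" by (rule lin_fst[OF mE module_zmod[OF cr]])
      have "?D 0 = (\<lambda>z. (d 0 (fst z), f 0 (fst z)))" by (rule ext) simp
      then show ?thesis using lin_pair[OF lin_comp[OF 1 cores_d[OF c]] lin_comp[OF 1 f]] 0 by simp
    next
      case (Suc k)
      have 1: "lin R (dir_sum2 (E (Suc k)) (G k)) (E (Suc k)) fst" by (rule lin_fst[OF mE mG])
      have 2: "lin R (dir_sum2 (E (Suc k)) (G k)) (G k) snd" by (rule lin_snd[OF mE mG])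
      have "lin R (dir_sum2 (E (Suc k)) (G k)) (dir_sum2 (E (Suc (Suc k))) (G (Suc k)))
          (\<lambda>z. (d (Suc k) (fst z), f (Suc k) (fst z) \<ominus>\<^bsub>G (Suc k)\<^esub> e k (snd z)))"
        by (rule lin_pair[OF lin_comp[OF 1 cores_d[OF c]] lin_minus_map[OF lin_comp[OF 1 f] lin_comp[OF 2 cores_d[OF c']]]])
      moreover have "?D (Suc k) = (\<lambda>z. (d (Suc k) (fst z), f (Suc k) (fst z) \<ominus>\<^bsub>G (Suc k)\<^esub> e k (snd z)))"
        by (rule ext) simp
      ultimately show ?thesis using Suc by simp
    qed
    show "?D 0 x = \<zero>\<^bsub>?H 1\<^esub> \<longleftrightarrow> x \<in> ?a ` carrier A" if x: "x \<in> carrier (?H 0)" for x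
    proof
      assume "?D 0 x = \<zero>\<^bsub>?H 1\<^esub>"
      then have 0: "d 0 (fst x) = \<zero>\<^bsub>E (Suc 0)\<^esub>" "f 0 (fst x) = \<zero>\<^bsub>G 0\<^esub>" by simp_all
      have xc: "fst x \<in> carrier (E 0)" "snd x = undefined" using x by auto
      obtain m where m: "fst x = \<epsilon> m" "m \<in> carrier B" using cores_ker0[OF c xc(1)] 0(1) by blast
      have "\<eta> (\<beta> m) = \<zero>\<^bsub>G 0\<^esub>" using f0[OF m(2)] 0(2) m(1) by simp
      then have "\<beta> m = \<zero>\<^bsub>C\<^esub>"
        using cores_inj[OF c'] lin_closed[OF s(3) m(2)] unfolding lin_inj_iff[OF cores_aug[OF c']] by blast
      then obtain a where "m = \<alpha> a" "a \<in> carrier A" using s(5)[OF m(2)] by blast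
      then show "x \<in> ?a ` carrier A" using m(1) xc(2) by (intro image_eqI[of _ _ a]) (simp_all add: prod_eq_iff)
    next
      assume "x \<in> ?a ` carrier A"
      then obtain a where a: "x = ?a a" "a \<in> carrier A" by blast
      have b: "\<alpha> a \<in> carrier B" by (rule lin_closed[OF s(1) a(2)])
      show "?D 0 x = \<zero>\<^bsub>?H 1\<^esub>"
        using a cores_d_aug[OF c b] f0[OF b] s(6)[OF a(2)] lin_zero[OF cores_aug[OF c']] by simp
    qed
    show "?D (Suc i) x = \<zero>\<^bsub>?H (Suc (Suc i))\<^esub> \<longleftrightarrow> x \<in> ?D i ` carrier (?H i)" if x: "x \<in> carrier (?H (Suc i))" for i x
    proof
      interpret G: module R "G (Suc i)" by (rule mG)
      have xc: "fst x \<in> carrier (E (Suc i))" "snd x \<in> carrier (G i)" using x by auto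
      {
        assume "?D (Suc i) x = \<zero>\<^bsub>?H (Suc (Suc i))\<^esub>"
        then have 1: "d (Suc i) (fst x) = \<zero>\<^bsub>E (Suc (Suc i))\<^esub>"
          and 2: "f (Suc i) (fst x) \<ominus>\<^bsub>G (Suc i)\<^esub> e i (snd x) = \<zero>\<^bsub>G (Suc i)\<^esub>" by simp_all
        have 2: "f (Suc i) (fst x) = e i (snd x)"
          using 2 G.minus_eq_zero_iff[OF fc[OF xc(1)] ec[OF xc(2)]] by blast
        obtain b where b: "fst x = d i b" "b \<in> carrier (E i)" using cores_ker[OF c xc(1)] 1 by blast
        interpret Gi: module R "G i" by (rule mG)
        \<comment> \<open>\<open>?t\<close> measures how far \<open>b\<close> alone is from being a
          preimage of \<open>x\<close>. It is a cocycle of \<open>G\<close>, so exactness of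
          \<open>G\<close> provides the missing component.\<close>
        let ?t = "f i b \<ominus>\<^bsub>G i\<^esub> snd x"
        have tc: "?t \<in> carrier (G i)" using fc[OF b(2)] xc(2) by simp
        have "e i (f i b) = e i (snd x)" using fd[OF b(2)] 2 b(1) by simp
        then have et: "e i ?t = \<zero>\<^bsub>G (Suc i)\<^esub>"
          using lin_minus[OF cores_d[OF c'] fc[OF b(2)] xc(2)] G.minus_eq_zero_iff[OF ec[OF fc[OF b(2)]] ec[OF xc(2)]] by simp
        show "x \<in> ?D i ` carrier (?H i)"
        proof (cases i)
          case 0
          have "e 0 ?t = \<zero>\<^bsub>G (Suc 0)\<^esub>" "?t \<in> carrier (G 0)" using et tc unfolding 0 by simp_all
          then obtain \<gamma> where g: "?t = \<eta> \<gamma>" "\<gamma> \<in> carrier C" using cores_ker0[OF c'] unfolding 0 by blast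
          \<comment> \<open>In degree 0 the fibre has no second component to absorb
            \<open>?t\<close>. Surjectivity of \<open>\<beta>\<close> lifts its source to
            \<open>B\<close>, and \<open>b\<close> is corrected by the image of this lift, which
            \<open>d 0\<close> kills.\<close>
          obtain m where m: "\<gamma> = \<beta> m" "m \<in> carrier B" using g(2) s(4) by blast
          have em: "\<epsilon> m \<in> carrier (E 0)" by (rule lin_closed[OF cores_aug[OF c] m(2)])
          interpret E0: module R "E 0" by (rule mE)
          interpret E1: module R "E (Suc 0)" by (rule mE)
          let ?b = "b \<ominus>\<^bsub>E 0\<^esub> \<epsilon> m"
          have b0: "b \<in> carrier (E 0)" using b(2) 0 by simp
          have "d 0 ?b = fst x"
            using lin_minus[OF cores_d[OF c] b0 em] cores_d_aug[OF c m(2)] b(1) dc[OF b0] 0 by (simp add: E1.minus_zero_right)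
          moreover have "f 0 ?b = snd x"
          proof -
            have "f 0 ?b = f i b \<ominus>\<^bsub>G i\<^esub> ?t"
              using lin_minus[OF f b0 em] f0[OF m(2)] g(1) m(1) 0 by simp
            also have "\<dots> = snd x" using fc[OF b(2)] xc(2) by algebra
            finally show ?thesis .
          qed
          ultimately have "?D 0 (?b, undefined) = x" by (simp add: prod_eq_iff)
          moreover have "(?b, undefined) \<in> carrier (?H 0)" using b0 em by simp
          ultimately show ?thesis unfolding 0 by blast
        next
          case (Suc k)
          have "e (Suc k) ?t = \<zero>\<^bsub>G (Suc (Suc k))\<^esub>" "?t \<in> carrier (G (Suc k))" using et tc unfolding Suc by simp_all
          then obtain \<gamma> where g: "?t = e k \<gamma>" "\<gamma> \<in> carrier (G k)" using cores_ker[OF c'] unfolding Suc by blast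
          have "f (Suc k) b \<ominus>\<^bsub>G (Suc k)\<^esub> e k \<gamma> = snd x"
          proof -
            have "f (Suc k) b \<ominus>\<^bsub>G (Suc k)\<^esub> e k \<gamma> = f i b \<ominus>\<^bsub>G i\<^esub> ?t" using g(1) Suc by simp
            also have "\<dots> = snd x" using fc[OF b(2)] xc(2) by algebra
            finally show ?thesis .
          qed
          then have "?D (Suc k) (b, \<gamma>) = x" using b(1) Suc by (simp add: prod_eq_iff)
          moreover have "(b, \<gamma>) \<in> carrier (?H (Suc k))" using b(2) g(2) Suc by simp
          ultimately show ?thesis unfolding Suc by blast
        qed
      next
        assume "x \<in> ?D i ` carrier (?H i)"
        then obtain y where y: "x = ?D i y" "y \<in> carrier (?H i)" by blast
        have yc: "fst y \<in> carrier (E i)" using y(2) by (cases i) auto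
        have 1: "d (Suc i) (fst x) = \<zero>\<^bsub>E (Suc (Suc i))\<^esub>"
          using cores_d_d[OF c yc] y(1) by (cases i) simp_all
        have "e i (snd x) = e i (f i (fst y))"
        proof (cases i)
          case 0 then show ?thesis using y(1) by simp
        next
          case (Suc k)
          interpret K: module R "G (Suc (Suc k))" by (rule mG)
          have y2: "fst y \<in> carrier (E (Suc k))" "snd y \<in> carrier (G k)" using y(2) Suc by auto
          have "e (Suc k) (f (Suc k) (fst y) \<ominus>\<^bsub>G (Suc k)\<^esub> e k (snd y)) = e (Suc k) (f (Suc k) (fst y))"
            using lin_minus[OF cores_d[OF c'] fc[OF y2(1)] ec[OF y2(2)]] cores_d_d[OF c' y2(2)] ec[OF fc[OF y2(1)]]
            by (simp add: K.minus_zero_right)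
          then show ?thesis using y(1) Suc by simp
        qed
        moreover have "f (Suc i) (fst x) = e i (f i (fst y))" using fd[OF yc] y(1) by (cases i) simp_all
        ultimately have "f (Suc i) (fst x) \<ominus>\<^bsub>G (Suc i)\<^esub> e i (snd x) = \<zero>\<^bsub>G (Suc i)\<^esub>"
          using G.minus_eq_zero_iff[OF fc[OF xc(1)] ec[OF xc(2)]] by simp
        then show "?D (Suc i) x = \<zero>\<^bsub>?H (Suc (Suc i))\<^esub>" using 1 by simp
      }
    qed
  qed
qed

text \<open>The part \<open>Ext\<^sup>i(M, C) \<rightarrow> Ext\<^sup>i\<^sup>+\<^sup>1(M, A)
  \<rightarrow> Ext\<^sup>i\<^sup>+\<^sup>1(M, B)\<close> of the long exact sequence, read off from
  the fibre as a coresolution of \<open>A\<close>.\<close>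

lemma exv_ses_sub:
  assumes S: "ses R A B C \<alpha> \<beta>" and cA: "cores R A F \<zeta> a" and c: "cores R B E \<epsilon> d" and c': "cores R C G \<eta> e"
    and B: "exv R M E d (Suc i)" and C: "exv R M G e i"
  shows "exv R M F a (Suc i)"
proof -
  obtain f where f: "\<And>i. lin R (E i) (G i) (f i)" "\<And>x. x \<in> carrier B \<Longrightarrow> f 0 (\<epsilon> x) = \<eta> (\<beta> x)"
    "\<And>i x. x \<in> carrier (E i) \<Longrightarrow> f (Suc i) (d i x) = e i (f i x)"
    using comparison_map[OF c c' sesD(3)[OF S]] by metis
  note cH = cores_fibre[OF S c c' f]
  have cr: "cring R" by (rule module.axioms(1)[OF lin_dom[OF sesD(1)[OF S]]])
  have mG: "module R (G i)" for i by (rule cores_module[OF c'])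
  have "exv R M (fibre_term E G) (fibre_diff G d e f) (Suc i)"
  proof (rule exv_SucI)
    fix z assume z: "lin R M (fibre_term E G (Suc i)) z"
      "\<And>x. x \<in> carrier M \<Longrightarrow> fibre_diff G d e f (Suc i) (z x) = \<zero>\<^bsub>fibre_term E G (Suc (Suc i))\<^esub>"
    have z': "lin R M (dir_sum2 (E (Suc i)) (G i)) z" using z(1) by simp
    have l1: "lin R M (E (Suc i)) (\<lambda>x. fst (z x))" and l2: "lin R M (G i) (\<lambda>x. snd (z x))"
      by (rule lin_comp[OF z' lin_fst[OF cores_module[OF c] mG]], rule lin_comp[OF z' lin_snd[OF cores_module[OF c] mG]])
    interpret G1: module R "G (Suc i)" by (rule mG)
    interpret Gi: module R "G i" by (rule mG)
    have 1: "d (Suc i) (fst (z x)) = \<zero>\<^bsub>E (Suc (Suc i))\<^esub>" "f (Suc i) (fst (z x)) = e i (snd (z x))" if x: "x \<in> carrier M" for x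
    proof -
      have "f (Suc i) (fst (z x)) \<ominus>\<^bsub>G (Suc i)\<^esub> e i (snd (z x)) = \<zero>\<^bsub>G (Suc i)\<^esub>" using z(2)[OF x] by simp
      then show "f (Suc i) (fst (z x)) = e i (snd (z x))"
        using G1.minus_eq_zero_iff[OF lin_closed[OF f(1) lin_closed[OF l1 x]] lin_closed[OF cores_d[OF c'] lin_closed[OF l2 x]]] by blast
    qed (use z(2)[OF x] in simp)
    from exv_SucD[OF B l1 1(1)] obtain w where w: "lin R M (E i) w" "\<And>x. x \<in> carrier M \<Longrightarrow> d i (w x) = fst (z x)" by blast
    have lf: "lin R M (G i) (\<lambda>x. f i (w x))" by (rule lin_comp[OF w(1) f(1)])
    let ?t = "\<lambda>x. f i (w x) \<ominus>\<^bsub>G i\<^esub> snd (z x)"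
    have lt: "lin R M (G i) ?t" by (rule lin_minus_map[OF lf l2])
    have t0: "e i (?t x) = \<zero>\<^bsub>G (Suc i)\<^esub>" if x: "x \<in> carrier M" for x
    proof -
      have "e i (f i (w x)) = e i (snd (z x))" using f(3)[OF lin_closed[OF w(1) x]] w(2)[OF x] 1(2)[OF x] by simp
      then show ?thesis
        using lin_minus[OF cores_d[OF c'] lin_closed[OF lf x] lin_closed[OF l2 x]]
          G1.minus_eq_zero_iff lin_closed[OF cores_d[OF c'] lin_closed[OF l2 x]] by simp
    qed
    show "\<exists>w. lin R M (fibre_term E G i) w \<and> (\<forall>x\<in>carrier M. fibre_diff G d e f i (w x) = z x)"
    proof (cases i)
      case 0
      have "f 0 (w x) = snd (z x)" if x: "x \<in> carrier M" for x
      proof -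
        have "?t x = \<zero>\<^bsub>G i\<^esub>" using exv_0D[OF C[unfolded 0] lt[unfolded 0] t0[unfolded 0] x] 0 by simp
        then show ?thesis using Gi.minus_eq_zero_iff[OF lin_closed[OF lf x] lin_closed[OF l2 x]] 0 by simp
      qed
      then have "\<forall>x\<in>carrier M. fibre_diff G d e f 0 (w x, undefined) = z x" using w(2) 0 by (simp add: prod_eq_iff)
      moreover have "lin R M (zmod undefined :: ('a, 'h) module) (\<lambda>_. undefined)"
        using lin_zero_map[OF lin_dom[OF z'] module_zmod[OF cr, of undefined]] by simp
      then have "lin R M (fibre_term E G 0) (\<lambda>x. (w x, undefined))" using lin_pair[of R M "E 0" w] w(1) 0 by simp
      ultimately show ?thesis unfolding 0 by blast
    next
      case (Suc k)
      from exv_SucD[OF C[unfolded Suc] lt[unfolded Suc] t0[unfolded Suc]]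
      obtain v where v: "lin R M (G k) v" "\<And>x. x \<in> carrier M \<Longrightarrow> e k (v x) = f (Suc k) (w x) \<ominus>\<^bsub>G (Suc k)\<^esub> snd (z x)" by blast
      have "f (Suc k) (w x) \<ominus>\<^bsub>G (Suc k)\<^esub> e k (v x) = snd (z x)" if x: "x \<in> carrier M" for x
      proof -
        have "f i (w x) \<ominus>\<^bsub>G i\<^esub> ?t x = snd (z x)" using lin_closed[OF lf x] lin_closed[OF l2 x] by algebra
        then show ?thesis using v(2)[OF x] Suc by simp
      qed
      then have "\<forall>x\<in>carrier M. fibre_diff G d e f (Suc k) (w x, v x) = z x" using w(2) Suc by (simp add: prod_eq_iff)
      moreover have "lin R M (fibre_term E G (Suc k)) (\<lambda>x. (w x, v x))" using lin_pair[OF _ v(1), of "E (Suc k)" w] w(1) Suc by simp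
      ultimately show ?thesis unfolding Suc by blast
    qed
  qed
  then show ?thesis using exv_independent[OF cH cA] by blast
qed

text \<open>The part \<open>Ext\<^sup>i(M, B) \<rightarrow> Ext\<^sup>i(M, C) \<rightarrow>
  Ext\<^sup>i\<^sup>+\<^sup>1(M, A)\<close>: a cocycle \<open>z\<close> of \<open>G\<close> becomes
  the cocycle \<open>(0, z)\<close> of the fibre one degree higher. Degree \<open>i = 0\<close> is
  included.\<close>

lemma exv_ses_quotient:
  assumes S: "ses R A B C \<alpha> \<beta>" and cA: "cores R A F \<zeta> a" and c: "cores R B E \<epsilon> d" and c': "cores R C G \<eta> e"
    and B: "exv R M E d i" and A: "exv R M F a (Suc i)"
  shows "exv R M G e i"
proof -
  obtain f where f: "\<And>i. lin R (E i) (G i) (f i)" "\<And>x. x \<in> carrier B \<Longrightarrow> f 0 (\<epsilon> x) = \<eta> (\<beta> x)"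
    "\<And>i x. x \<in> carrier (E i) \<Longrightarrow> f (Suc i) (d i x) = e i (f i x)"
    using comparison_map[OF c c' sesD(3)[OF S]] by metis
  note cH = cores_fibre[OF S c c' f]
  have mE: "module R (E i)" and mG: "module R (G i)" for i by (rule cores_module[OF c], rule cores_module[OF c'])
  have H: "exv R M (fibre_term E G) (fibre_diff G d e f) (Suc i)" using exv_independent[OF cH cA] A by blast
  have lift: "\<exists>y. lin R M (fibre_term E G i) y \<and> (\<forall>x\<in>carrier M. fibre_diff G d e f i (y x) = (\<zero>\<^bsub>E (Suc i)\<^esub>, z x))"
    if z: "lin R M (G i) z" "\<And>x. x \<in> carrier M \<Longrightarrow> e i (z x) = \<zero>\<^bsub>G (Suc i)\<^esub>" for z
  proof -
    have lz: "lin R M (fibre_term E G (Suc i)) (\<lambda>x. (\<zero>\<^bsub>E (Suc i)\<^esub>, z x))"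
      using lin_pair[OF lin_zero_map[OF lin_dom[OF z(1)] mE] z(1)] by simp
    interpret G1: module R "G (Suc i)" by (rule mG)
    have "fibre_diff G d e f (Suc i) (\<zero>\<^bsub>E (Suc i)\<^esub>, z x) = \<zero>\<^bsub>fibre_term E G (Suc (Suc i))\<^esub>" if "x \<in> carrier M" for x
      using z(2)[OF that] lin_zero[OF cores_d[OF c]] lin_zero[OF f(1)] by (simp add: G1.minus_zero_right)
    from exv_SucD[OF H lz this] obtain y where "lin R M (fibre_term E G i) y"
      "\<And>x. x \<in> carrier M \<Longrightarrow> fibre_diff G d e f i (y x) = (\<zero>\<^bsub>E (Suc i)\<^esub>, z x)" by blast
    then show ?thesis by blast
  qed
  show ?thesis
  proof (cases i)
    case 0
    show ?thesis unfolding 0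
    proof (rule exv_0I)
      fix z x assume z: "lin R M (G 0) z" "\<And>x. x \<in> carrier M \<Longrightarrow> e 0 (z x) = \<zero>\<^bsub>G (Suc 0)\<^esub>" and x: "x \<in> carrier M"
      obtain y where y: "lin R M (fibre_term E G 0) y" "\<forall>x\<in>carrier M. fibre_diff G d e f 0 (y x) = (\<zero>\<^bsub>E (Suc 0)\<^esub>, z x)"
        using lift[unfolded 0, OF z] by blast
      have cr: "cring R" by (rule module.axioms(1)[OF lin_dom[OF sesD(1)[OF S]]])
      have y': "lin R M (dir_sum2 (E 0) (zmod undefined)) y" using y(1) by simp
      have ly: "lin R M (E 0) (\<lambda>x. fst (y x))" by (rule lin_comp[OF y' lin_fst[OF mE module_zmod[OF cr]]])
      have "fst (y x) = \<zero>\<^bsub>E 0\<^esub>"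
        by (rule exv_0D[OF B[unfolded 0] ly _ x]) (use y(2) in simp)
      then show "z x = \<zero>\<^bsub>G 0\<^esub>" using y(2) x lin_zero[OF f(1)] by auto
    qed
  next
    case (Suc k)
    show ?thesis unfolding Suc
    proof (rule exv_SucI)
      fix z assume z: "lin R M (G (Suc k)) z" "\<And>x. x \<in> carrier M \<Longrightarrow> e (Suc k) (z x) = \<zero>\<^bsub>G (Suc (Suc k))\<^esub>"
      obtain y where y: "lin R M (fibre_term E G (Suc k)) y"
        "\<forall>x\<in>carrier M. fibre_diff G d e f (Suc k) (y x) = (\<zero>\<^bsub>E (Suc (Suc k))\<^esub>, z x)"
        using lift[unfolded Suc, OF z] by blast
      have y': "lin R M (dir_sum2 (E (Suc k)) (G k)) y" using y(1) by simp
      have l1: "lin R M (E (Suc k)) (\<lambda>x. fst (y x))" and l2: "lin R M (G k) (\<lambda>x. snd (y x))"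
        by (rule lin_comp[OF y' lin_fst[OF mE mG]], rule lin_comp[OF y' lin_snd[OF mE mG]])
      have "d (Suc k) (fst (y x)) = \<zero>\<^bsub>E (Suc (Suc k))\<^esub>" if "x \<in> carrier M" for x using y(2) that by simp
      from exv_SucD[OF B[unfolded Suc] l1 this]
      obtain b where b: "lin R M (E k) b" "\<And>x. x \<in> carrier M \<Longrightarrow> d k (b x) = fst (y x)" by blast
      have lfb: "lin R M (G k) (\<lambda>x. f k (b x))" by (rule lin_comp[OF b(1) f(1)])
      have "e k (f k (b x) \<ominus>\<^bsub>G k\<^esub> snd (y x)) = z x" if x: "x \<in> carrier M" for x
      proof -
        have "e k (f k (b x) \<ominus>\<^bsub>G k\<^esub> snd (y x)) = e k (f k (b x)) \<ominus>\<^bsub>G (Suc k)\<^esub> e k (snd (y x))"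
          by (rule lin_minus[OF cores_d[OF c'] lin_closed[OF lfb x] lin_closed[OF l2 x]])
        also have "e k (f k (b x)) = f (Suc k) (fst (y x))" using f(3)[OF lin_closed[OF b(1) x]] b(2)[OF x] by simp
        finally show ?thesis using y(2) x by simp
      qed
      then show "\<exists>w. lin R M (G k) w \<and> (\<forall>x\<in>carrier M. e k (w x) = z x)" using lin_minus_map[OF lfb l2] by blast
    qed
  qed
qed

text \<open>With the fibre as coresolution of \<open>A\<close>, the connecting map sends
  \<open>z\<close> to the cocycle \<open>(0, \<eta> z)\<close>. The first component of a primitive
  is killed by \<open>d 0\<close>, so it takes values in the image of \<open>B\<close> and gives the
  lift.\<close>

lemma ext1_lift:
  assumes S: "ses R A B C \<alpha> \<beta>" and cA: "cores R A F \<zeta> a" and c: "cores R B E \<epsilon> d" and c': "cores R C G \<eta> e"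
    and A: "exv R M F a (Suc 0)" and z: "lin R M C z"
  obtains y where "lin R M B y" "\<And>x. x \<in> carrier M \<Longrightarrow> \<beta> (y x) = z x"
proof -
  note s = sesD[OF S]
  obtain f where f: "\<And>i. lin R (E i) (G i) (f i)" "\<And>x. x \<in> carrier B \<Longrightarrow> f 0 (\<epsilon> x) = \<eta> (\<beta> x)"
    "\<And>i x. x \<in> carrier (E i) \<Longrightarrow> f (Suc i) (d i x) = e i (f i x)"
    using comparison_map[OF c c' sesD(3)[OF S]] by metis
  note cH = cores_fibre[OF S c c' f]
  have cr: "cring R" by (rule module.axioms(1)[OF lin_dom[OF s(1)]])
  have mE: "module R (E i)" and mG: "module R (G i)" for i by (rule cores_module[OF c], rule cores_module[OF c'])
  have H: "exv R M (fibre_term E G) (fibre_diff G d e f) (Suc 0)" using exv_independent[OF cH cA] A by blast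
  have lz: "lin R M (fibre_term E G (Suc 0)) (\<lambda>x. (\<zero>\<^bsub>E (Suc 0)\<^esub>, \<eta> (z x)))"
    using lin_pair[OF lin_zero_map[OF lin_dom[OF z] mE] lin_comp[OF z cores_aug[OF c']]] by simp
  interpret G1: module R "G (Suc 0)" by (rule mG)
  have "fibre_diff G d e f (Suc 0) (\<zero>\<^bsub>E (Suc 0)\<^esub>, \<eta> (z x)) = \<zero>\<^bsub>fibre_term E G (Suc (Suc 0))\<^esub>" if "x \<in> carrier M" for x
    using cores_d_aug[OF c' lin_closed[OF z that]] lin_zero[OF cores_d[OF c]] lin_zero[OF f(1)] by (simp add: G1.minus_zero_right)
  from exv_SucD[OF H lz this] obtain w where w: "lin R M (fibre_term E G 0) w"
    "\<And>x. x \<in> carrier M \<Longrightarrow> fibre_diff G d e f 0 (w x) = (\<zero>\<^bsub>E (Suc 0)\<^esub>, \<eta> (z x))" by blast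
  have w': "lin R M (dir_sum2 (E 0) (zmod undefined)) w" using w(1) by simp
  have lw: "lin R M (E 0) (\<lambda>x. fst (w x))" by (rule lin_comp[OF w' lin_fst[OF mE module_zmod[OF cr]]])
  have wi: "fst (w x) \<in> \<epsilon> ` carrier B" if x: "x \<in> carrier M" for x
    using cores_ker0[OF c lin_closed[OF lw x]] w(2)[OF x] by simp
  obtain i where i: "lin R (E 0\<lparr>carrier := \<epsilon> ` carrier B\<rparr>) B i" "\<And>x. x \<in> carrier B \<Longrightarrow> i (\<epsilon> x) = x"
    using lin_inv[OF cores_aug[OF c] cores_inj[OF c]] by blast
  have lw': "lin R M (E 0\<lparr>carrier := \<epsilon> ` carrier B\<rparr>) (\<lambda>x. fst (w x))"
    by (rule lin_corestrict[OF lw submodule_range[OF cores_aug[OF c]] wi])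
  have "\<beta> (i (fst (w x))) = z x" if x: "x \<in> carrier M" for x
  proof -
    obtain b where b: "fst (w x) = \<epsilon> b" "b \<in> carrier B" using wi[OF x] by blast
    have "\<eta> (\<beta> b) = \<eta> (z x)" using f(2)[OF b(2)] w(2)[OF x] b(1) by simp
    then have "\<beta> b = z x" using cores_inj[OF c'] lin_closed[OF s(3) b(2)] lin_closed[OF z x] by (simp add: inj_on_def)
    then show ?thesis using b i(2) by simp
  qed
  then show thesis using that[OF lin_comp[OF lw' i(1)]] by blast
qed

section \<open>Operations on coresolutions\<close>

lemma lin_map_prod:
  assumes "lin R M M' f" "lin R N N' g" shows "lin R (dir_sum2 M N) (dir_sum2 M' N') (map_prod f g)"
proof -
  note m = lin_dom[OF assms(1)] lin_dom[OF assms(2)]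
  show ?thesis
    by (rule lin_cong[OF lin_pair[OF lin_comp[OF lin_fst[OF m] assms(1)] lin_comp[OF lin_snd[OF m] assms(2)]]])
      (simp add: map_prod_def case_prod_beta)
qed

lemma cores_dir_sum2:
  assumes c: "cores R M E \<epsilon> d" and c': "cores R N G \<eta> e"
  shows "cores R (dir_sum2 M N) (\<lambda>i. dir_sum2 (E i) (G i)) (map_prod \<epsilon> \<eta>) (\<lambda>i. map_prod (d i) (e i))"
  unfolding cores_def
proof (intro conjI allI ballI)
  show "baer R (dir_sum2 (E i) (G i))" for i by (rule baer_dir_sum2[OF cores_baer[OF c] cores_baer[OF c']])
  show "lin R (dir_sum2 M N) (dir_sum2 (E 0) (G 0)) (map_prod \<epsilon> \<eta>)" by (rule lin_map_prod[OF cores_aug[OF c] cores_aug[OF c']])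
  show "inj_on (map_prod \<epsilon> \<eta>) (carrier (dir_sum2 M N))"
    using map_prod_inj_on[OF cores_inj[OF c] cores_inj[OF c']] by simp
  show "lin R (dir_sum2 (E i) (G i)) (dir_sum2 (E (Suc i)) (G (Suc i))) (map_prod (d i) (e i))" for i
    by (rule lin_map_prod[OF cores_d[OF c] cores_d[OF c']])
  have im: "map_prod f g ` carrier (dir_sum2 A B) = f ` carrier A \<times> g ` carrier B"
    for f :: "'x \<Rightarrow> 'y" and g :: "'z \<Rightarrow> 'w" and A :: "('r, 'x) module" and B :: "('r, 'z) module"
    by (auto simp: image_iff)
  show "map_prod (d 0) (e 0) x = \<zero>\<^bsub>dir_sum2 (E 1) (G 1)\<^esub> \<longleftrightarrow> x \<in> map_prod \<epsilon> \<eta> ` carrier (dir_sum2 M N)"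
    if x: "x \<in> carrier (dir_sum2 (E 0) (G 0))" for x
    using x cores_ker0[OF c, of "fst x"] cores_ker0[OF c', of "snd x"] unfolding im by (cases x) simp
  show "map_prod (d (Suc i)) (e (Suc i)) x = \<zero>\<^bsub>dir_sum2 (E (Suc (Suc i))) (G (Suc (Suc i)))\<^esub> \<longleftrightarrow>
      x \<in> map_prod (d i) (e i) ` carrier (dir_sum2 (E i) (G i))"
    if x: "x \<in> carrier (dir_sum2 (E (Suc i)) (G (Suc i)))" for i x
    using x cores_ker[OF c, of "fst x" i] cores_ker[OF c', of "snd x" i] unfolding im by (cases x) simp
qed

lemma exv_dir_sum2:
  assumes c: "cores R M E \<epsilon> d" and c': "cores R N G \<eta> e"
    and "exv R X E d (Suc i)" "exv R X G e (Suc i)"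
  shows "exv R X (\<lambda>i. dir_sum2 (E i) (G i)) (\<lambda>i. map_prod (d i) (e i)) (Suc i)"
proof (rule exv_SucI)
  fix z assume z: "lin R X (dir_sum2 (E (Suc i)) (G (Suc i))) z"
    "\<And>x. x \<in> carrier X \<Longrightarrow> map_prod (d (Suc i)) (e (Suc i)) (z x) = \<zero>\<^bsub>dir_sum2 (E (Suc (Suc i))) (G (Suc (Suc i)))\<^esub>"
  note m = cores_module[OF c] cores_module[OF c']
  have l: "lin R X (E (Suc i)) (\<lambda>x. fst (z x))" "lin R X (G (Suc i)) (\<lambda>x. snd (z x))"
    by (rule lin_comp[OF z(1) lin_fst[OF m]], rule lin_comp[OF z(1) lin_snd[OF m]])
  have "d (Suc i) (fst (z x)) = \<zero>\<^bsub>E (Suc (Suc i))\<^esub>" "e (Suc i) (snd (z x)) = \<zero>\<^bsub>G (Suc (Suc i))\<^esub>" if "x \<in> carrier X" for x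
    using z(2)[OF that] by (simp_all add: map_prod_def case_prod_beta)
  note 0 = this
  from exv_SucD[OF assms(3) l(1) 0(1)] obtain v where v: "lin R X (E i) v" "\<And>x. x \<in> carrier X \<Longrightarrow> d i (v x) = fst (z x)" by blast
  from exv_SucD[OF assms(4) l(2) 0(2)] obtain w where w: "lin R X (G i) w" "\<And>x. x \<in> carrier X \<Longrightarrow> e i (w x) = snd (z x)" by blast
  have "\<forall>x\<in>carrier X. map_prod (d i) (e i) (v x, w x) = z x" using v(2) w(2) by simp
  then show "\<exists>w. lin R X (dir_sum2 (E i) (G i)) w \<and> (\<forall>x\<in>carrier X. map_prod (d i) (e i) (w x) = z x)"
    using lin_pair[OF v(1) w(1)] by blast
qed

lemma mod_power_simps [simp]:
  "carrier (mod_power K M) = (\<Pi>\<^sub>E i\<in>K. carrier M)"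
  "\<zero>\<^bsub>mod_power K M\<^esub> = (\<lambda>i\<in>K. \<zero>\<^bsub>M\<^esub>)"
  "f \<oplus>\<^bsub>mod_power K M\<^esub> g = (\<lambda>i\<in>K. f i \<oplus>\<^bsub>M\<^esub> g i)"
  "r \<odot>\<^bsub>mod_power K M\<^esub> f = (\<lambda>i\<in>K. r \<odot>\<^bsub>M\<^esub> f i)"
  by (simp_all add: mod_power_def)

lemma module_mod_power: "module R M \<Longrightarrow> module R (mod_power K M)"
  unfolding mod_power_def by (rule module_mod_product) (auto intro: module.axioms(1))

lemma baer_mod_power: "baer R M \<Longrightarrow> baer R (mod_power K M)"
  unfolding mod_power_def by (rule baer_product) (auto intro: module.axioms(1) baer_module)

lemma lin_power_proj: "module R M \<Longrightarrow> k \<in> K \<Longrightarrow> lin R (mod_power K M) M (\<lambda>x. x k)"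
  unfolding mod_power_def using lin_proj[of R K "\<lambda>_. M" k] module.axioms(1) by blast

lemma lin_power_tuple:
  "module R X \<Longrightarrow> (\<And>k. k \<in> K \<Longrightarrow> lin R X M (f k)) \<Longrightarrow> lin R X (mod_power K M) (\<lambda>x. \<lambda>k\<in>K. f k x)"
  unfolding mod_power_def using lin_tuple[of R X K "\<lambda>_. M" f] module.axioms(1) by blast

lemma lin_power_map:
  assumes "lin R M N f" shows "lin R (mod_power K M) (mod_power K N) (\<lambda>x. \<lambda>k\<in>K. f (x k))"
  by (rule lin_power_tuple[OF module_mod_power[OF lin_dom[OF assms]]])
    (rule lin_comp[OF lin_power_proj[OF lin_dom[OF assms]] assms])

lemma power_map_image:
  assumes "x \<in> (\<Pi>\<^sub>E k\<in>K. A)"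
  shows "x \<in> (\<lambda>x. \<lambda>k\<in>K. f (x k)) ` (\<Pi>\<^sub>E k\<in>K. B) \<longleftrightarrow> (\<forall>k\<in>K. x k \<in> f ` B)"
proof
  assume "\<forall>k\<in>K. x k \<in> f ` B"
  then have "\<forall>k\<in>K. \<exists>b. b \<in> B \<and> x k = f b" by blast
  from bchoice[OF this] obtain y where y: "\<And>k. k \<in> K \<Longrightarrow> y k \<in> B" "\<And>k. k \<in> K \<Longrightarrow> x k = f (y k)" by blast
  show "x \<in> (\<lambda>x. \<lambda>k\<in>K. f (x k)) ` (\<Pi>\<^sub>E k\<in>K. B)"
  proof (rule image_eqI[of _ _ "restrict y K"])
    show "x = (\<lambda>k\<in>K. f (restrict y K k))"
      by (rule ext) (use y(2) PiE_arb[OF assms] in \<open>auto simp: restrict_def\<close>)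
  qed (use y(1) in simp)
qed auto

lemma cores_power:
  assumes c: "cores R M E \<epsilon> d"
  shows "cores R (mod_power K M) (\<lambda>i. mod_power K (E i)) (\<lambda>x. \<lambda>k\<in>K. \<epsilon> (x k)) (\<lambda>i x. \<lambda>k\<in>K. d i (x k))"
  unfolding cores_def
proof (intro conjI allI ballI)
  show "baer R (mod_power K (E i))" for i by (rule baer_mod_power[OF cores_baer[OF c]])
  show "lin R (mod_power K M) (mod_power K (E 0)) (\<lambda>x. \<lambda>k\<in>K. \<epsilon> (x k))" by (rule lin_power_map[OF cores_aug[OF c]])
  show "lin R (mod_power K (E i)) (mod_power K (E (Suc i))) (\<lambda>x. \<lambda>k\<in>K. d i (x k))" for i by (rule lin_power_map[OF cores_d[OF c]])
  show "inj_on (\<lambda>x. \<lambda>k\<in>K. \<epsilon> (x k)) (carrier (mod_power K M))"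
  proof (rule inj_onI)
    fix x y assume x: "x \<in> carrier (mod_power K M)" and y: "y \<in> carrier (mod_power K M)"
      and eq: "(\<lambda>k\<in>K. \<epsilon> (x k)) = (\<lambda>k\<in>K. \<epsilon> (y k))"
    have "x k = y k" if k: "k \<in> K" for k
    proof -
      have "x k \<in> carrier M" "y k \<in> carrier M" using x y k by auto
      moreover have "\<epsilon> (x k) = \<epsilon> (y k)" using fun_cong[OF eq, of k] k by simp
      ultimately show ?thesis using cores_inj[OF c] by (simp add: inj_on_def)
    qed
    then show "x = y" using x y by (intro PiE_eqI[of x K "\<lambda>_. carrier M" y]) simp_all
  qed
  have z: "(\<lambda>k\<in>K. g (x k)) = (\<lambda>k\<in>K. c) \<longleftrightarrow> (\<forall>k\<in>K. g (x k) = c)" for g :: "'x \<Rightarrow> 'y" and x :: "'z \<Rightarrow> 'x" and K c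
    by (auto simp: restrict_def fun_eq_iff)
  show "(\<lambda>k\<in>K. d 0 (x k)) = \<zero>\<^bsub>mod_power K (E 1)\<^esub> \<longleftrightarrow> x \<in> (\<lambda>x. \<lambda>k\<in>K. \<epsilon> (x k)) ` carrier (mod_power K M)"
    if x: "x \<in> carrier (mod_power K (E 0))" for x
  proof -
    have xk: "x k \<in> carrier (E 0)" if "k \<in> K" for k using x that by auto
    have x': "x \<in> (\<Pi>\<^sub>E k\<in>K. carrier (E 0))" using x by simp
    show ?thesis unfolding mod_power_simps power_map_image[OF x'] z using cores_ker0[OF c xk] by simp
  qed
  show "(\<lambda>k\<in>K. d (Suc i) (x k)) = \<zero>\<^bsub>mod_power K (E (Suc (Suc i)))\<^esub> \<longleftrightarrow>
      x \<in> (\<lambda>x. \<lambda>k\<in>K. d i (x k)) ` carrier (mod_power K (E i))"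
    if x: "x \<in> carrier (mod_power K (E (Suc i)))" for i x
  proof -
    have xk: "x k \<in> carrier (E (Suc i))" if "k \<in> K" for k using x that by auto
    have x': "x \<in> (\<Pi>\<^sub>E k\<in>K. carrier (E (Suc i)))" using x by simp
    show ?thesis unfolding mod_power_simps power_map_image[OF x'] z using cores_ker[OF c xk] by simp
  qed
qed

lemma exv_power:
  assumes c: "cores R M E \<epsilon> d" and ex: "exv R X E d (Suc i)"
  shows "exv R X (\<lambda>i. mod_power K (E i)) (\<lambda>i x. \<lambda>k\<in>K. d i (x k)) (Suc i)"
proof (rule exv_SucI)
  fix z assume z: "lin R X (mod_power K (E (Suc i))) z"
    "\<And>x. x \<in> carrier X \<Longrightarrow> (\<lambda>k\<in>K. d (Suc i) (z x k)) = \<zero>\<^bsub>mod_power K (E (Suc (Suc i)))\<^esub>"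
  have "\<exists>w. lin R X (E i) w \<and> (\<forall>x\<in>carrier X. d i (w x) = z x k)" if k: "k \<in> K" for k
  proof -
    have l: "lin R X (E (Suc i)) (\<lambda>x. z x k)" by (rule lin_comp[OF z(1) lin_power_proj[OF cores_module[OF c] k]])
    have "d (Suc i) (z x k) = \<zero>\<^bsub>E (Suc (Suc i))\<^esub>" if "x \<in> carrier X" for x
      using fun_cong[OF z(2)[OF that], of k] k by simp
    from exv_SucD[OF ex l this] obtain w where "lin R X (E i) w" "\<And>x. x \<in> carrier X \<Longrightarrow> d i (w x) = z x k" by blast
    then show ?thesis by blast
  qed
  then obtain w where w: "\<And>k. k \<in> K \<Longrightarrow> lin R X (E i) (w k)" "\<And>k x. k \<in> K \<Longrightarrow> x \<in> carrier X \<Longrightarrow> d i (w k x) = z x k"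
    by metis
  have "(\<lambda>k\<in>K. d i ((\<lambda>k\<in>K. w k x) k)) = z x" if x: "x \<in> carrier X" for x
  proof (rule ext)
    fix k
    have "z x \<in> (\<Pi>\<^sub>E k\<in>K. carrier (E (Suc i)))" using lin_closed[OF z(1) x] by simp
    then show "(\<lambda>k\<in>K. d i ((\<lambda>k\<in>K. w k x) k)) k = z x k" using w(2)[OF _ x] PiE_arb[of "z x" K _ k] by simp
  qed
  moreover have "lin R X (mod_power K (E i)) (\<lambda>x. \<lambda>k\<in>K. w k x)" by (rule lin_power_tuple[OF lin_dom[OF z(1)] w(1)])
  ultimately show "\<exists>w. lin R X (mod_power K (E i)) w \<and> (\<forall>x\<in>carrier X. (\<lambda>k\<in>K. d i (w x k)) = z x)"
    by (intro exI[of _ "\<lambda>x. \<lambda>k\<in>K. w k x"]) simp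
qed

definition inj_cores :: "('r, 'm) module \<Rightarrow> nat \<Rightarrow> ('r, 'm) module" where
  "inj_cores J i = (case i of 0 \<Rightarrow> J | Suc _ \<Rightarrow> zmod undefined)"

lemma inj_cores_simps [simp]: "inj_cores J 0 = J" "inj_cores J (Suc i) = zmod undefined"
  by (simp_all add: inj_cores_def)

lemma lin_to_zmod: "cring R \<Longrightarrow> module R M \<Longrightarrow> lin R M (zmod c) (\<lambda>_. c)"
  using lin_zero_map[OF _ module_zmod] by fastforce

lemma cores_injective:
  assumes J: "baer R J" shows "cores R J (inj_cores J) (\<lambda>x. x) (\<lambda>_ _. undefined)"
proof -
  have m: "module R J" by (rule baer_module[OF J])
  have cr: "cring R" by (rule module.axioms(1)[OF m])
  show ?thesis
    unfolding cores_def
  proof (intro conjI allI ballI)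
    show b: "baer R (inj_cores J i)" for i using J baer_zmod[OF cr] by (cases i) simp_all
    show "lin R (inj_cores J i) (inj_cores J (Suc i)) (\<lambda>_. undefined)" for i
      unfolding inj_cores_simps by (rule lin_to_zmod[OF cr baer_module[OF b]])
    show "lin R J (inj_cores J 0) (\<lambda>x. x)" using lin_id[OF m] by simp
  next
    show "undefined = \<zero>\<^bsub>inj_cores J (Suc (Suc i))\<^esub> \<longleftrightarrow> x \<in> (\<lambda>_. undefined) ` carrier (inj_cores J i)"
      if x: "x \<in> carrier (inj_cores J (Suc i))" for i x
    proof -
      have "module R (inj_cores J i)" using m module_zmod[OF cr] by (cases i) simp_all
      from abelian_groupE(2)[OF module_abelian_group[OF this]] show ?thesis using x by auto
    qed
  qed simp_all
qed

lemma exv_injective: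
  assumes J: "baer R J" and M: "module R M"
  shows "exv R M (inj_cores J) (\<lambda>_ _. undefined) (Suc i)"
proof (rule exv_SucI)
  have c: "cores R J (inj_cores J) (\<lambda>x. x) (\<lambda>_ _. undefined)" by (rule cores_injective[OF J])
  fix z assume z: "lin R M (inj_cores J (Suc i)) z"
  have "z x = undefined" if "x \<in> carrier M" for x using lin_closed[OF z that] by simp
  then show "\<exists>w. lin R M (inj_cores J i) w \<and> (\<forall>x\<in>carrier M. undefined = z x)"
    using lin_zero_map[OF M cores_module[OF c]] by metis
qed

lemma exv_injective_cores:
  assumes "cores R J E \<epsilon> d" "baer R J" "module R M" shows "exv R M E d (Suc i)"
  using exv_independent[OF assms(1) cores_injective[OF assms(2)]] exv_injective[OF assms(2,3)] by blast

lemma cores_cosyzygy: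
  assumes c: "cores R M E \<epsilon> d"
  shows "cores R ((E (Suc 0))\<lparr>carrier := d 0 ` carrier (E 0)\<rparr>) (\<lambda>i. E (Suc i)) (\<lambda>x. x) (\<lambda>i. d (Suc i))"
  unfolding cores_def
proof (intro conjI allI ballI)
  show "lin R (E (Suc 0)\<lparr>carrier := d 0 ` carrier (E 0)\<rparr>) (E (Suc 0)) (\<lambda>x. x)"
    by (rule lin_incl[OF cores_module[OF c] submodule_range[OF cores_d[OF c]]])
qed (use cores_baer[OF c] cores_d[OF c] cores_ker[OF c] in auto)

section \<open>Ext and the definition by minimal coresolutions\<close>

text \<open>A cocycle has the zero coset exactly if it is a coboundary. This is the only place where
  the coset construction of \<open>Ext\<close> is opened; all other arguments use
  \<open>exv\<close>.\<close>

lemma zero_Ext_iff: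
  assumes M: "module R M" and c: "cores R N (inj_term R N) (inj_aug R N) (inj_diff R N)"
  shows "zero_module (Ext R (Suc i) M N) \<longleftrightarrow> exv R M (inj_term R N) (inj_diff R N) (Suc i)"
proof -
  let ?E = "inj_term R N" and ?d = "inj_diff R N"
  let ?Z = "ext_cocycles R (Suc i) M N" and ?B = "ext_coboundaries R (Suc i) M N"
  let ?S = "(hom_module R M (?E (Suc i)))\<lparr>carrier := ?Z\<rparr>"
  note mE = cores_module[OF c]
  interpret E: module R "?E (Suc i)" by (rule mE)
  interpret M: module R M by (rule M)
  have Z: "f \<in> ?Z \<longleftrightarrow> lin R M (?E (Suc i)) f \<and> f \<in> extensional (carrier M) \<and>
      (\<forall>x\<in>carrier M. ?d (Suc i) (f x) = \<zero>\<^bsub>?E (Suc (Suc i))\<^esub>)" for f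
    using M mE[of "Suc i"] unfolding ext_cocycles_def mod_hom_def lin_def PiE_def by auto
  have B: "f \<in> ?B \<longleftrightarrow> (\<exists>w. lin R M (?E i) w \<and> f = (\<lambda>x\<in>carrier M. ?d i (w x)))" for f
  proof
    assume "f \<in> ?B"
    then obtain g where "g \<in> mod_hom R M (?E i)" "f = compose (carrier M) (?d i) g" by auto
    then show "\<exists>w. lin R M (?E i) w \<and> f = (\<lambda>x\<in>carrier M. ?d i (w x))"
      using mod_hom_lin[OF _ M mE] by (auto simp: compose_def)
  next
    assume "\<exists>w. lin R M (?E i) w \<and> f = (\<lambda>x\<in>carrier M. ?d i (w x))"
    then obtain w where w: "lin R M (?E i) w" "f = (\<lambda>x\<in>carrier M. ?d i (w x))" by blast
    then have "f = compose (carrier M) (?d i) (restrict w (carrier M))" by (auto simp: compose_def restrict_def)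
    then show "f \<in> ?B" using lin_mod_hom[OF w(1)] by auto
  qed
  have dw: "lin R M (?E (Suc i)) (\<lambda>x. ?d i (w x))" if "lin R M (?E i) w" for w
    by (rule lin_comp[OF that cores_d[OF c]])
  have BZ: "?B \<subseteq> ?Z"
  proof
    fix f assume "f \<in> ?B"
    then obtain w where w: "lin R M (?E i) w" "f = (\<lambda>x\<in>carrier M. ?d i (w x))" using B by blast
    have "lin R M (?E (Suc i)) f" by (rule lin_cong[OF dw[OF w(1)]]) (simp add: w(2))
    then show "f \<in> ?Z" unfolding Z using w(2) cores_d_d[OF c lin_closed[OF w(1)]] by simp
  qed
  have ZB: "?Z \<subseteq> ?B \<longleftrightarrow> exv R M ?E ?d (Suc i)"
  proof
    assume ZB: "?Z \<subseteq> ?B"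
    show "exv R M ?E ?d (Suc i)"
    proof (rule exv_SucI)
      fix z assume z: "lin R M (?E (Suc i)) z" "\<And>x. x \<in> carrier M \<Longrightarrow> ?d (Suc i) (z x) = \<zero>\<^bsub>?E (Suc (Suc i))\<^esub>"
      have "lin R M (?E (Suc i)) (restrict z (carrier M))" by (rule lin_cong[OF z(1)]) simp
      then have "restrict z (carrier M) \<in> ?Z" unfolding Z using z(2) by simp
      then obtain w where w: "lin R M (?E i) w" "restrict z (carrier M) = (\<lambda>x\<in>carrier M. ?d i (w x))" using ZB B by blast
      have "?d i (w x) = z x" if "x \<in> carrier M" for x using fun_cong[OF w(2), of x] that by simp
      then show "\<exists>w. lin R M (?E i) w \<and> (\<forall>x\<in>carrier M. ?d i (w x) = z x)" using w(1) by blast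
    qed
  next
    assume ex: "exv R M ?E ?d (Suc i)"
    show "?Z \<subseteq> ?B"
    proof
      fix f assume "f \<in> ?Z"
      then have f: "lin R M (?E (Suc i)) f" "f \<in> extensional (carrier M)"
        "\<And>x. x \<in> carrier M \<Longrightarrow> ?d (Suc i) (f x) = \<zero>\<^bsub>?E (Suc (Suc i))\<^esub>" unfolding Z by blast+
      from exv_SucD[OF ex f(1,3)] obtain w where w: "lin R M (?E i) w" "\<And>x. x \<in> carrier M \<Longrightarrow> ?d i (w x) = f x" by blast
      have "f = (\<lambda>x\<in>carrier M. ?d i (w x))" using w(2) f(2) by (auto simp: extensional_def restrict_def)
      then show "f \<in> ?B" using B w(1) by blast
    qed
  qed
  have add: "f \<oplus>\<^bsub>?S\<^esub> g = (\<lambda>x\<in>carrier M. f x \<oplus>\<^bsub>?E (Suc i)\<^esub> g x)" for f g by (simp add: hom_module_def)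
  have zB: "(\<lambda>x\<in>carrier M. \<zero>\<^bsub>?E (Suc i)\<^esub>) \<in> ?B"
    unfolding B using lin_zero_map[OF M mE, of i] lin_zero[OF cores_d[OF c, of i]]
    by (intro exI[of _ "\<lambda>_. \<zero>\<^bsub>?E i\<^esub>"]) (simp add: mE)
  have cos: "?B +>\<^bsub>?S\<^esub> a = {b \<oplus>\<^bsub>?S\<^esub> a | b. b \<in> ?B}" for a by (auto simp: a_r_coset_def')
  have triv: "?B +>\<^bsub>?S\<^esub> a = ?B" if a: "a \<in> ?B" for a
  proof -
    obtain u where u: "lin R M (?E i) u" "a = (\<lambda>x\<in>carrier M. ?d i (u x))" using a B by blast
    have ac: "a x \<in> carrier (?E (Suc i))" if "x \<in> carrier M" for x using lin_closed[OF dw[OF u(1)] that] u(2) that by simp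
    have "b \<oplus>\<^bsub>?S\<^esub> a \<in> ?B" "\<exists>b'\<in>?B. b = b' \<oplus>\<^bsub>?S\<^esub> a" if b: "b \<in> ?B" for b
    proof -
      obtain w where w: "lin R M (?E i) w" "b = (\<lambda>x\<in>carrier M. ?d i (w x))" using b B by blast
      have bc: "b x \<in> carrier (?E (Suc i))" if "x \<in> carrier M" for x using lin_closed[OF dw[OF w(1)] that] w(2) that by simp
      have "b \<oplus>\<^bsub>?S\<^esub> a = (\<lambda>x\<in>carrier M. ?d i (w x \<oplus>\<^bsub>?E i\<^esub> u x))"
        unfolding add u(2) w(2)
        by (rule restrict_ext) (simp add: lin_add[OF cores_d[OF c] lin_closed[OF w(1)] lin_closed[OF u(1)]])
      then show "b \<oplus>\<^bsub>?S\<^esub> a \<in> ?B" unfolding B using lin_add_map[OF w(1) u(1)] by blast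
      let ?b = "\<lambda>x\<in>carrier M. ?d i (w x \<ominus>\<^bsub>?E i\<^esub> u x)"
      have "?b \<in> ?B" unfolding B using lin_minus_map[OF w(1) u(1)] by blast
      moreover have "b = ?b \<oplus>\<^bsub>?S\<^esub> a"
      proof (rule ext)
        fix x
        show "b x = (?b \<oplus>\<^bsub>?S\<^esub> a) x"
        proof (cases "x \<in> carrier M")
          case True
          have "?d i (w x \<ominus>\<^bsub>?E i\<^esub> u x) = b x \<ominus>\<^bsub>?E (Suc i)\<^esub> a x"
            using lin_minus[OF cores_d[OF c] lin_closed[OF w(1) True] lin_closed[OF u(1) True]] u(2) w(2) True by simp
          moreover have "(b x \<ominus>\<^bsub>?E (Suc i)\<^esub> a x) \<oplus>\<^bsub>?E (Suc i)\<^esub> a x = b x" using ac[OF True] bc[OF True] by algebra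
          ultimately show ?thesis unfolding add using True by simp
        next
          case False
          then show ?thesis unfolding add using w(2) by simp
        qed
      qed
      ultimately show "\<exists>b'\<in>?B. b = b' \<oplus>\<^bsub>?S\<^esub> a" by blast
    qed
    then show ?thesis unfolding cos by blast
  qed
  have zm: "zero_module (Ext R (Suc i) M N) \<longleftrightarrow> (\<Union>a\<in>?Z. {?B +>\<^bsub>?S\<^esub> a}) = {?B}"
    unfolding zero_module_def Ext_def quot_module_def A_RCOSETS_def' by (simp del: ext_coboundaries.simps)
  show ?thesis
    unfolding zm ZB[symmetric]
  proof
    assume eq: "(\<Union>a\<in>?Z. {?B +>\<^bsub>?S\<^esub> a}) = {?B}"
    show "?Z \<subseteq> ?B"
    proof
      fix a assume a: "a \<in> ?Z"
      then have "lin R M (?E (Suc i)) a" "a \<in> extensional (carrier M)" unfolding Z by blast+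
      then have "a = (\<lambda>x\<in>carrier M. \<zero>\<^bsub>?E (Suc i)\<^esub>) \<oplus>\<^bsub>?S\<^esub> a"
        unfolding add using lin_closed[of R M "?E (Suc i)" a] by (auto simp: extensional_def restrict_def)
      then have "a \<in> ?B +>\<^bsub>?S\<^esub> a" using zB cos by blast
      moreover have "?B +>\<^bsub>?S\<^esub> a = ?B" using eq a by blast
      ultimately show "a \<in> ?B" by simp
    qed
  next
    assume "?Z \<subseteq> ?B"
    then have "?Z = ?B" using BZ by blast
    then show "(\<Union>a\<in>?Z. {?B +>\<^bsub>?S\<^esub> a}) = {?B}" using triv zB by auto
  qed
qed

section \<open>Associated primes and the classes of the classification\<close>

text \<open>\<open>N\<close> is not assumed to be a module: the axioms are inherited along the
  surjection from \<open>M\<close>.\<close>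

lemma lin_surjI:
  assumes M: "module R M" and N: "carrier N = \<pi> ` carrier M" "\<zero>\<^bsub>N\<^esub> = \<pi> \<zero>\<^bsub>M\<^esub>"
    "\<And>x y. \<lbrakk>x \<in> carrier M; y \<in> carrier M\<rbrakk> \<Longrightarrow> \<pi> x \<oplus>\<^bsub>N\<^esub> \<pi> y = \<pi> (x \<oplus>\<^bsub>M\<^esub> y)"
    "\<And>r x. \<lbrakk>r \<in> carrier R; x \<in> carrier M\<rbrakk> \<Longrightarrow> r \<odot>\<^bsub>N\<^esub> \<pi> x = \<pi> (r \<odot>\<^bsub>M\<^esub> x)"
  shows "lin R M N \<pi>"
proof -
  interpret M: module R M by fact
  have "module R N"
  proof (rule moduleI[OF M.R.is_cring])
    show "abelian_group N"
    proof (rule abelian_groupI)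
      fix x assume "x \<in> carrier N"
      then obtain x' where x': "x = \<pi> x'" "x' \<in> carrier M" using N(1) by auto
      show "\<zero>\<^bsub>N\<^esub> \<oplus>\<^bsub>N\<^esub> x = x" using x' by (simp add: N)
      have "\<pi> (\<ominus>\<^bsub>M\<^esub> x') \<oplus>\<^bsub>N\<^esub> x = \<zero>\<^bsub>N\<^esub>" "\<pi> (\<ominus>\<^bsub>M\<^esub> x') \<in> carrier N"
        using x' by (auto simp: N M.l_neg)
      then show "\<exists>y\<in>carrier N. y \<oplus>\<^bsub>N\<^esub> x = \<zero>\<^bsub>N\<^esub>" by blast
    qed (auto simp: N M.a_ac)
  qed (auto simp: N M.smult_l_distr M.smult_r_distr M.smult_assoc1)
  then show ?thesis by (intro linI) (auto simp: M.module_axioms N)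
qed

lemma lin_quot_module:
  assumes M: "module R M" and H: "submodule H R M"
  shows "lin R M (quot_module M H) (\<lambda>x. H +>\<^bsub>M\<^esub> x)"
    "carrier (quot_module M H) = (\<lambda>x. H +>\<^bsub>M\<^esub> x) ` carrier M"
    "\<And>x. x \<in> carrier M \<Longrightarrow> H +>\<^bsub>M\<^esub> x = \<zero>\<^bsub>quot_module M H\<^esub> \<longleftrightarrow> x \<in> H"
proof -
  interpret M: module R M by fact
  interpret H: abelian_subgroup H M
    by (rule abelian_subgroupI3[OF additive_subgroup.intro[OF submodule.axioms(1)[OF H]] module_abelian_group[OF M]])
  show c: "carrier (quot_module M H) = (\<lambda>x. H +>\<^bsub>M\<^esub> x) ` carrier M"
    by (auto simp: quot_module_def A_RCOSETS_def')
  have H0: "H +>\<^bsub>M\<^esub> \<zero>\<^bsub>M\<^esub> = H" by (rule H.a_rcos_const) (rule submoduleD(2)[OF H])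
  show "lin R M (quot_module M H) (\<lambda>x. H +>\<^bsub>M\<^esub> x)"
  proof (rule lin_surjI[OF M c])
    show "\<zero>\<^bsub>quot_module M H\<^esub> = H +>\<^bsub>M\<^esub> \<zero>\<^bsub>M\<^esub>" using H0 by (simp add: quot_module_def)
    show "(H +>\<^bsub>M\<^esub> x) \<oplus>\<^bsub>quot_module M H\<^esub> (H +>\<^bsub>M\<^esub> y) = H +>\<^bsub>M\<^esub> (x \<oplus>\<^bsub>M\<^esub> y)" if "x \<in> carrier M" "y \<in> carrier M" for x y
      using H.a_rcos_sum[OF that] by (simp add: quot_module_def)
    fix r x assume r: "r \<in> carrier R" and x: "x \<in> carrier M"
    \<comment> \<open>All members of the coset contribute the same set to the union in the
      definition of scalar multiplication, so the union collapses.\<close>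
    have const: "H +>\<^bsub>M\<^esub> (r \<odot>\<^bsub>M\<^esub> y) = H +>\<^bsub>M\<^esub> (r \<odot>\<^bsub>M\<^esub> x)" if y: "y \<in> H +>\<^bsub>M\<^esub> x" for y
    proof -
      obtain h where h: "h \<in> H" "y = h \<oplus>\<^bsub>M\<^esub> x" using y by (auto simp: a_r_coset_def')
      have "r \<odot>\<^bsub>M\<^esub> y = r \<odot>\<^bsub>M\<^esub> h \<oplus>\<^bsub>M\<^esub> r \<odot>\<^bsub>M\<^esub> x" using h r x submoduleD(5)[OF H] by (simp add: M.smult_r_distr)
      moreover have "r \<odot>\<^bsub>M\<^esub> h \<in> H" using submoduleD(4)[OF H r h(1)] .
      ultimately have "r \<odot>\<^bsub>M\<^esub> y \<in> H +>\<^bsub>M\<^esub> (r \<odot>\<^bsub>M\<^esub> x)" by (auto simp: a_r_coset_def')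
      then show ?thesis using H.a_repr_independence'[of "r \<odot>\<^bsub>M\<^esub> y" "r \<odot>\<^bsub>M\<^esub> x"] r x by simp
    qed
    have ne: "H +>\<^bsub>M\<^esub> x \<noteq> {}" using H.a_rcos_self[OF x] by auto
    have "(\<Union>y\<in>H +>\<^bsub>M\<^esub> x. H +>\<^bsub>M\<^esub> (r \<odot>\<^bsub>M\<^esub> y)) = (\<Union>y\<in>H +>\<^bsub>M\<^esub> x. H +>\<^bsub>M\<^esub> (r \<odot>\<^bsub>M\<^esub> x))"
      using const by (intro SUP_cong refl)
    also have "\<dots> = H +>\<^bsub>M\<^esub> (r \<odot>\<^bsub>M\<^esub> x)" using ne by simp
    finally show "r \<odot>\<^bsub>quot_module M H\<^esub> (H +>\<^bsub>M\<^esub> x) = H +>\<^bsub>M\<^esub> (r \<odot>\<^bsub>M\<^esub> x)"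
      by (simp add: quot_module_def)
  qed
  show "H +>\<^bsub>M\<^esub> x = \<zero>\<^bsub>quot_module M H\<^esub> \<longleftrightarrow> x \<in> H" if x: "x \<in> carrier M" for x
  proof
    assume "H +>\<^bsub>M\<^esub> x = \<zero>\<^bsub>quot_module M H\<^esub>"
    then show "x \<in> H" using H.a_rcos_self[OF x] by (simp add: quot_module_def)
  next
    assume "x \<in> H"
    then show "H +>\<^bsub>M\<^esub> x = \<zero>\<^bsub>quot_module M H\<^esub>" using H.a_rcos_const by (simp add: quot_module_def)
  qed
qed

lemma quot_regular_hom:
  assumes R: "cring R" and p: "ideal p R" and N: "module R N" and x: "x \<in> carrier N"
    and px: "\<And>r. r \<in> p \<Longrightarrow> r \<odot>\<^bsub>N\<^esub> x = \<zero>\<^bsub>N\<^esub>"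
  obtains z where "lin R (quot_module (regular_module R) p) N z"
    "\<And>r. r \<in> carrier R \<Longrightarrow> z (p +>\<^bsub>regular_module R\<^esub> r) = r \<odot>\<^bsub>N\<^esub> x"
proof -
  have m: "module R (regular_module R)" by (rule module_regular[OF R])
  have s: "submodule p R (regular_module R)" using submodule_ideal_iff[OF R] p by blast
  note q = lin_quot_module[OF m s]
  have k: "r \<odot>\<^bsub>N\<^esub> x = \<zero>\<^bsub>N\<^esub>" if "r \<in> carrier (regular_module R)"
    "p +>\<^bsub>regular_module R\<^esub> r = \<zero>\<^bsub>quot_module (regular_module R) p\<^esub>" for r
    using q(3)[OF that(1)] that(2) px by blast
  have "(\<lambda>x. p +>\<^bsub>regular_module R\<^esub> x) ` carrier (regular_module R) = carrier (quot_module (regular_module R) p)"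
    using q(2) by simp
  from lin_factor[OF q(1) this lin_smult_map[OF N x] k] show thesis using that by auto
qed

lemma quot_regular_annihilated:
  assumes R: "cring R" and p: "ideal p R" and z: "lin R (quot_module (regular_module R) p) N z"
    and c: "c \<in> carrier (quot_module (regular_module R) p)" and r: "r \<in> p"
  shows "r \<odot>\<^bsub>N\<^esub> z c = \<zero>\<^bsub>N\<^esub>"
proof -
  have m: "module R (regular_module R)" by (rule module_regular[OF R])
  have s: "submodule p R (regular_module R)" using submodule_ideal_iff[OF R] p by blast
  note q = lin_quot_module[OF m s]
  interpret ideal p R by (rule p)
  obtain a where a: "c = p +>\<^bsub>regular_module R\<^esub> a" "a \<in> carrier R" using c q(2) by auto
  have rc: "r \<in> carrier R" using r Icarr by blast
  have "r \<otimes>\<^bsub>R\<^esub> a \<in> p" using I_r_closed[OF r a(2)] .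
  then have "r \<odot>\<^bsub>quot_module (regular_module R) p\<^esub> c = \<zero>\<^bsub>quot_module (regular_module R) p\<^esub>"
    using lin_smult[OF q(1) rc, of a] a q(3)[of "r \<otimes>\<^bsub>R\<^esub> a"] rc Icarr by simp
  then show ?thesis using lin_smult[OF z rc c] lin_zero[OF z] by simp
qed

text \<open>\<open>Hom(R/p, N) = 0\<close> for all \<open>p\<close> in \<open>Y\<close>, spelled out
  by elements. For a specialization closed set of primes over a noetherian ring this says that
  \<open>Ass N\<close> misses \<open>Y\<close>.\<close>

definition torsion_free :: "('r, 'm) module \<Rightarrow> 'r set set \<Rightarrow> bool" where
  "torsion_free N Y \<longleftrightarrow> (\<forall>p\<in>Y. \<forall>x\<in>carrier N. (\<forall>r\<in>p. r \<odot>\<^bsub>N\<^esub> x = \<zero>\<^bsub>N\<^esub>) \<longrightarrow> x = \<zero>\<^bsub>N\<^esub>)"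

lemma torsion_freeD:
  "\<lbrakk>torsion_free N Y; p \<in> Y; x \<in> carrier N; \<And>r. r \<in> p \<Longrightarrow> r \<odot>\<^bsub>N\<^esub> x = \<zero>\<^bsub>N\<^esub>\<rbrakk> \<Longrightarrow> x = \<zero>\<^bsub>N\<^esub>"
  by (simp add: torsion_free_def)

lemma torsion_free_mono: "torsion_free N Y \<Longrightarrow> Y' \<subseteq> Y \<Longrightarrow> torsion_free N Y'"
  by (auto simp: torsion_free_def)

lemma torsion_free_submodule: "torsion_free N Y \<Longrightarrow> H \<subseteq> carrier N \<Longrightarrow> torsion_free (N\<lparr>carrier := H\<rparr>) Y"
  by (auto simp: torsion_free_def)

lemma torsion_free_inj:
  assumes N: "torsion_free N Y" and f: "lin R M N f" "inj_on f (carrier M)"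
    and Y: "\<And>p. p \<in> Y \<Longrightarrow> p \<subseteq> carrier R"
  shows "torsion_free M Y"
  unfolding torsion_free_def
proof (intro ballI impI)
  fix p x assume p: "p \<in> Y" and x: "x \<in> carrier M" "\<forall>r\<in>p. r \<odot>\<^bsub>M\<^esub> x = \<zero>\<^bsub>M\<^esub>"
  have "f x = \<zero>\<^bsub>N\<^esub>"
  proof (rule torsion_freeD[OF N p lin_closed[OF f(1) x(1)]])
    fix r assume r: "r \<in> p"
    then have "r \<in> carrier R" using Y[OF p] by blast
    then show "r \<odot>\<^bsub>N\<^esub> f x = \<zero>\<^bsub>N\<^esub>" using lin_smult[OF f(1) _ x(1), of r] x(2) r lin_zero[OF f(1)] by simp
  qed
  then show "x = \<zero>\<^bsub>M\<^esub>" using f(2) x(1) unfolding lin_inj_iff[OF f(1)] by blast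
qed

lemma torsion_free_power:
  assumes "torsion_free N Y" shows "torsion_free (mod_power K N) Y"
  unfolding torsion_free_def
proof (intro ballI impI)
  fix p x assume p: "p \<in> Y" and x: "x \<in> carrier (mod_power K N)" "\<forall>r\<in>p. r \<odot>\<^bsub>mod_power K N\<^esub> x = \<zero>\<^bsub>mod_power K N\<^esub>"
  show "x = \<zero>\<^bsub>mod_power K N\<^esub>"
  proof (rule ext)
    fix k
    show "x k = \<zero>\<^bsub>mod_power K N\<^esub> k"
    proof (cases "k \<in> K")
      case True
      have "x k = \<zero>\<^bsub>N\<^esub>"
      proof (rule torsion_freeD[OF assms p])
        show "x k \<in> carrier N" using x(1) True by auto
        fix r assume "r \<in> p"
        then have "r \<odot>\<^bsub>mod_power K N\<^esub> x = \<zero>\<^bsub>mod_power K N\<^esub>" using x(2) by blast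
        from fun_cong[OF this, of k] show "r \<odot>\<^bsub>N\<^esub> x k = \<zero>\<^bsub>N\<^esub>" using True by simp
      qed
      then show ?thesis using True by simp
    next
      case False
      have "x \<in> (\<Pi>\<^sub>E k\<in>K. carrier N)" using x(1) by simp
      then show ?thesis using False PiE_arb[of x K _ k] by simp
    qed
  qed
qed

lemma torsion_free_dir_sum2: "torsion_free M Y \<Longrightarrow> torsion_free N Y \<Longrightarrow> torsion_free (dir_sum2 M N) Y"
  by (fastforce simp: torsion_free_def)

text \<open>A nonzero element killed by \<open>p\<close> has a nonzero multiple in \<open>A\<close>,
  which is killed by \<open>p\<close> as well.\<close>

lemma torsion_free_essential:
  assumes N: "module R N" and ess: "essential_submodule R A N" and A: "torsion_free (N\<lparr>carrier := A\<rparr>) Y"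
    and Y: "\<And>p. p \<in> Y \<Longrightarrow> p \<subseteq> carrier R"
  shows "torsion_free N Y"
  unfolding torsion_free_def
proof (intro ballI impI)
  interpret N: module R N by fact
  fix p x assume p: "p \<in> Y" and x: "x \<in> carrier N" "\<forall>r\<in>p. r \<odot>\<^bsub>N\<^esub> x = \<zero>\<^bsub>N\<^esub>"
  have sA: "submodule A R N" using ess by (simp add: essential_submodule_def)
  show "x = \<zero>\<^bsub>N\<^esub>"
  proof (rule ccontr)
    assume "x \<noteq> \<zero>\<^bsub>N\<^esub>"
    then obtain s where s: "s \<in> carrier R" "s \<odot>\<^bsub>N\<^esub> x \<in> A" "s \<odot>\<^bsub>N\<^esub> x \<noteq> \<zero>\<^bsub>N\<^esub>"
      using ess x(1) unfolding essential_iff[OF N sA] by blast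
    have "r \<odot>\<^bsub>N\<^esub> (s \<odot>\<^bsub>N\<^esub> x) = \<zero>\<^bsub>N\<^esub>" if r: "r \<in> p" for r
    proof -
      have rc: "r \<in> carrier R" using r Y[OF p] by blast
      have "r \<odot>\<^bsub>N\<^esub> (s \<odot>\<^bsub>N\<^esub> x) = s \<odot>\<^bsub>N\<^esub> (r \<odot>\<^bsub>N\<^esub> x)"
        using N.smult_assoc1[OF rc s(1) x(1)] N.smult_assoc1[OF s(1) rc x(1)] N.R.m_comm[OF rc s(1)] by simp
      then show ?thesis using x(2) r s(1) by simp
    qed
    then show False using torsion_freeD[OF A p, of "s \<odot>\<^bsub>N\<^esub> x"] s by simp
  qed
qed

text \<open>Choose an annihilator that is maximal among those of the nonzero multiples of
  \<open>x\<close>. If \<open>a b\<close> kills the chosen multiple \<open>y\<close> but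
  \<open>b\<close> does not, then \<open>b y\<close> has the same annihilator by maximality, and it
  contains \<open>a\<close>.\<close>

lemma prime_annihilator_exists:
  fixes N :: "('r, 'm) module"
  assumes R: "cring R" "noetherian_ring R" and N: "module R N" and x: "x \<in> carrier N" "x \<noteq> \<zero>\<^bsub>N\<^esub>"
  obtains s where "s \<in> carrier R" "s \<odot>\<^bsub>N\<^esub> x \<noteq> \<zero>\<^bsub>N\<^esub>" "primeideal {r \<in> carrier R. r \<odot>\<^bsub>N\<^esub> (s \<odot>\<^bsub>N\<^esub> x) = \<zero>\<^bsub>N\<^esub>} R"
proof -
  interpret N: module R N by fact
  define ann where "ann y = {r \<in> carrier R. r \<odot>\<^bsub>N\<^esub> y = \<zero>\<^bsub>N\<^esub>}" for y
  define \<A> where "\<A> = {ann (s \<odot>\<^bsub>N\<^esub> x) | s. s \<in> carrier R \<and> s \<odot>\<^bsub>N\<^esub> x \<noteq> \<zero>\<^bsub>N\<^esub>}"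
  have ideal: "ideal (ann y) R" if "y \<in> carrier N" for y
    using submodule_kernel[OF lin_smult_map[OF N that]] unfolding submodule_ideal_iff[OF R(1)]
    by (simp add: ann_def a_kernel_def')
  have "\<one>\<^bsub>R\<^esub> \<odot>\<^bsub>N\<^esub> x \<noteq> \<zero>\<^bsub>N\<^esub>" using x by simp
  then have "ann (\<one>\<^bsub>R\<^esub> \<odot>\<^bsub>N\<^esub> x) \<in> \<A>" unfolding \<A>_def using N.R.one_closed by blast
  then have ne: "\<A> \<noteq> {}" by blast
  have sub: "\<A> \<subseteq> {I. ideal I R}" unfolding \<A>_def using ideal x(1) by blast
  obtain J where J: "J \<in> \<A>" and max: "\<And>X. X \<in> \<A> \<Longrightarrow> J \<subseteq> X \<Longrightarrow> X = J"
  proof -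
    have "\<exists>M\<in>\<A>. \<forall>X\<in>\<A>. M \<subseteq> X \<longrightarrow> X = M"
    proof (rule subset_Zorn_nonempty[OF ne])
      fix \<C> assume C: "\<C> \<noteq> {}" "subset.chain \<A> \<C>"
      have CA: "\<C> \<subseteq> \<A>" and tot: "\<forall>X\<in>\<C>. \<forall>Y\<in>\<C>. X \<subseteq> Y \<or> Y \<subseteq> X"
        using C(2) unfolding subset_chain_def by auto
      have "subset.chain {I. ideal I R} \<C>"
        unfolding subset_chain_def using tot subset_trans[OF CA sub] by (rule conjI[rotated])
      from noetherian_ring.ideal_chain_is_trivial[OF R(2) C(1) this]
      show "\<Union>\<C> \<in> \<A>" by (rule subsetD[OF CA])
    qed
    then show thesis using that by blast
  qed
  obtain s where s: "J = ann (s \<odot>\<^bsub>N\<^esub> x)" "s \<in> carrier R" "s \<odot>\<^bsub>N\<^esub> x \<noteq> \<zero>\<^bsub>N\<^esub>" using J unfolding \<A>_def by blast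
  let ?y = "s \<odot>\<^bsub>N\<^esub> x"
  have yc: "?y \<in> carrier N" using s(2) x(1) by simp
  have "primeideal (ann ?y) R"
  proof (rule primeidealI[OF ideal[OF yc] R(1)])
    have "\<one>\<^bsub>R\<^esub> \<notin> ann ?y" using s(3) yc by (simp add: ann_def)
    then show "carrier R \<noteq> ann ?y" using N.R.one_closed by blast
    fix a b assume a: "a \<in> carrier R" and b: "b \<in> carrier R" and ab: "a \<otimes>\<^bsub>R\<^esub> b \<in> ann ?y"
    have aby: "a \<odot>\<^bsub>N\<^esub> (b \<odot>\<^bsub>N\<^esub> ?y) = \<zero>\<^bsub>N\<^esub>" using ab N.smult_assoc1[OF a b yc] by (simp add: ann_def)
    show "a \<in> ann ?y \<or> b \<in> ann ?y"
    proof (cases "b \<odot>\<^bsub>N\<^esub> ?y = \<zero>\<^bsub>N\<^esub>")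
      case True then show ?thesis using b by (simp add: ann_def)
    next
      case False
      have bs: "b \<odot>\<^bsub>N\<^esub> ?y = (b \<otimes>\<^bsub>R\<^esub> s) \<odot>\<^bsub>N\<^esub> x" using N.smult_assoc1[OF b s(2) x(1)] by simp
      have "ann (b \<odot>\<^bsub>N\<^esub> ?y) \<in> \<A>" unfolding \<A>_def using False b s(2) bs by (intro CollectI exI[of _ "b \<otimes>\<^bsub>R\<^esub> s"]) simp
      moreover have "J \<subseteq> ann (b \<odot>\<^bsub>N\<^esub> ?y)"
      proof
        fix r assume "r \<in> J"
        then have r: "r \<in> carrier R" "r \<odot>\<^bsub>N\<^esub> ?y = \<zero>\<^bsub>N\<^esub>" unfolding s(1) ann_def by auto
        have "r \<odot>\<^bsub>N\<^esub> (b \<odot>\<^bsub>N\<^esub> ?y) = b \<odot>\<^bsub>N\<^esub> (r \<odot>\<^bsub>N\<^esub> ?y)"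
          using N.smult_assoc1[OF r(1) b yc] N.smult_assoc1[OF b r(1) yc] N.R.m_comm[OF r(1) b] by simp
        then show "r \<in> ann (b \<odot>\<^bsub>N\<^esub> ?y)" using r b by (simp add: ann_def)
      qed
      ultimately have "ann (b \<odot>\<^bsub>N\<^esub> ?y) = ann ?y" using max s(1) by simp
      then show ?thesis using a aby unfolding ann_def by blast
    qed
  qed
  then show thesis using that s(2,3) unfolding ann_def by blast
qed

text \<open>A nonzero element killed by some \<open>p\<close> in \<open>Y\<close> has a multiple
  whose annihilator is a prime containing \<open>p\<close>; closure under specialization puts this
  prime into \<open>Y\<close>.\<close>

lemma Ass_disjoint_iff:
  fixes N :: "('r, 'm) module"
  assumes R: "cring R" "noetherian_ring R" and N: "module R N"
    and Y: "Y \<subseteq> Spec R" "specialization_closed R Y"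
  shows "Ass R N \<inter> Y = {} \<longleftrightarrow> torsion_free N Y"
proof
  interpret N: module R N by fact
  {
    assume A: "Ass R N \<inter> Y = {}"
    show "torsion_free N Y"
      unfolding torsion_free_def
    proof (intro ballI impI, rule ccontr)
      fix p x assume p: "p \<in> Y" and x: "x \<in> carrier N" "\<forall>r\<in>p. r \<odot>\<^bsub>N\<^esub> x = \<zero>\<^bsub>N\<^esub>" and nz: "x \<noteq> \<zero>\<^bsub>N\<^esub>"
      obtain s where s: "s \<in> carrier R" "s \<odot>\<^bsub>N\<^esub> x \<noteq> \<zero>\<^bsub>N\<^esub>"
        "primeideal {r \<in> carrier R. r \<odot>\<^bsub>N\<^esub> (s \<odot>\<^bsub>N\<^esub> x) = \<zero>\<^bsub>N\<^esub>} R"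
        using prime_annihilator_exists[OF R N x(1) nz] by blast
      let ?q = "{r \<in> carrier R. r \<odot>\<^bsub>N\<^esub> (s \<odot>\<^bsub>N\<^esub> x) = \<zero>\<^bsub>N\<^esub>}"
      have pc: "p \<subseteq> carrier R" using Y(1) p unfolding Spec_def by (auto dest!: primeideal.axioms(1) ideal_subset)
      have "p \<subseteq> ?q"
      proof
        fix r assume r: "r \<in> p"
        then have rc: "r \<in> carrier R" using pc by blast
        have "r \<odot>\<^bsub>N\<^esub> (s \<odot>\<^bsub>N\<^esub> x) = s \<odot>\<^bsub>N\<^esub> (r \<odot>\<^bsub>N\<^esub> x)"
          using N.smult_assoc1[OF rc s(1) x(1)] N.smult_assoc1[OF s(1) rc x(1)] N.R.m_comm[OF rc s(1)] by simp
        then show "r \<in> ?q" using rc x(2) r s(1) by simp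
      qed
      moreover have q: "?q \<in> Spec R" using s(3) by (simp add: Spec_def)
      ultimately have "?q \<in> Y" using Y(2) p unfolding specialization_closed_def by blast
      moreover have "s \<odot>\<^bsub>N\<^esub> x \<in> carrier N" using s(1) x(1) by simp
      then have "?q \<in> Ass R N" unfolding Ass_def using q by blast
      ultimately show False using A by blast
    qed
  next
    assume t: "torsion_free N Y"
    show "Ass R N \<inter> Y = {}"
    proof (rule equals0I)
      fix p assume p: "p \<in> Ass R N \<inter> Y"
      then obtain x where x: "x \<in> carrier N" "p = {r \<in> carrier R. r \<odot>\<^bsub>N\<^esub> x = \<zero>\<^bsub>N\<^esub>}" and pp: "primeideal p R"
        unfolding Ass_def Spec_def by blast
      have "x = \<zero>\<^bsub>N\<^esub>" by (rule torsion_freeD[OF t _ x(1)]) (use p x(2) in auto)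
      then have "p = carrier R" using x(2) by auto
      then show False using primeideal.I_notcarr[OF pp] by simp
    qed
  }
qed

text \<open>Left exactness of \<open>Hom\<close>: degree 0 cocycles are the maps into the image of
  \<open>N\<close>.\<close>

lemma exv_0_iff:
  assumes c: "cores R N E \<epsilon> d"
  shows "exv R M E d 0 \<longleftrightarrow> (\<forall>z. lin R M N z \<longrightarrow> (\<forall>x\<in>carrier M. z x = \<zero>\<^bsub>N\<^esub>))"
proof
  assume ex: "exv R M E d 0"
  show "\<forall>z. lin R M N z \<longrightarrow> (\<forall>x\<in>carrier M. z x = \<zero>\<^bsub>N\<^esub>)"
  proof (intro allI impI ballI)
    fix z x assume z: "lin R M N z" and x: "x \<in> carrier M"
    have "\<epsilon> (z x) = \<zero>\<^bsub>E 0\<^esub>"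
      by (rule exv_0D[OF ex lin_comp[OF z cores_aug[OF c]] cores_d_aug[OF c lin_closed[OF z]] x])
    then show "z x = \<zero>\<^bsub>N\<^esub>" using cores_inj[OF c] lin_closed[OF z x] unfolding lin_inj_iff[OF cores_aug[OF c]] by blast
  qed
next
  assume h: "\<forall>z. lin R M N z \<longrightarrow> (\<forall>x\<in>carrier M. z x = \<zero>\<^bsub>N\<^esub>)"
  obtain i where i: "lin R (E 0\<lparr>carrier := \<epsilon> ` carrier N\<rparr>) N i" "\<And>x. x \<in> carrier N \<Longrightarrow> i (\<epsilon> x) = x"
    using lin_inv[OF cores_aug[OF c] cores_inj[OF c]] by blast
  show "exv R M E d 0"
  proof (rule exv_0I)
    fix z x assume z: "lin R M (E 0) z" "\<And>x. x \<in> carrier M \<Longrightarrow> d 0 (z x) = \<zero>\<^bsub>E (Suc 0)\<^esub>" and x: "x \<in> carrier M"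
    have zi: "z x \<in> \<epsilon> ` carrier N" if "x \<in> carrier M" for x
      using cores_ker0[OF c lin_closed[OF z(1) that]] z(2)[OF that] by blast
    have "lin R M (E 0\<lparr>carrier := \<epsilon> ` carrier N\<rparr>) z"
      by (rule lin_corestrict[OF z(1) submodule_range[OF cores_aug[OF c]] zi])
    then have "i (z x) = \<zero>\<^bsub>N\<^esub>" using h lin_comp[OF _ i(1)] x by blast
    moreover obtain n where "z x = \<epsilon> n" "n \<in> carrier N" using zi[OF x] by blast
    ultimately show "z x = \<zero>\<^bsub>E 0\<^esub>" using i(2) lin_zero[OF cores_aug[OF c]] by simp
  qed
qed

text \<open>A class \<open>\<C>\<^sub>(\<^sub>Y\<^sub>)\<close> in terms of \<open>Ext\<^sup>j(R/p, -)\<close>: this removes the dependence on the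
  minimal coresolution.\<close>

lemma torsion_free_iff_exv:
  assumes R: "cring R" and M: "module R M" and min: "minimal_injective_coresolution R M E \<epsilon> d"
    and Y: "\<And>p. p \<in> Y \<Longrightarrow> ideal p R"
  shows "(\<forall>j<i. torsion_free (E j) Y) \<longleftrightarrow> (\<forall>j<i. \<forall>p\<in>Y. exv R (quot_module (regular_module R) p) E d j)"
proof
  have c: "cores R M E \<epsilon> d"
    by (rule injective_coresolution_cores[OF M]) (use min in \<open>simp add: minimal_injective_coresolution_def\<close>)
  have ess: "essential_submodule R (\<epsilon> ` carrier M) (E 0)" "essential_submodule R (d k ` carrier (E k)) (E (Suc k))" for k
    using min by (simp_all add: minimal_injective_coresolution_def)
  have Yc: "p \<subseteq> carrier R" if "p \<in> Y" for p by (rule ideal_subset[OF Y[OF that]])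
  note mE = cores_module[OF c]
  have quot: "lin R (regular_module R) (quot_module (regular_module R) p) (\<lambda>x. p +>\<^bsub>regular_module R\<^esub> x)"
    "carrier (quot_module (regular_module R) p) = (\<lambda>x. p +>\<^bsub>regular_module R\<^esub> x) ` carrier R" if "p \<in> Y" for p
    using lin_quot_module[OF module_regular[OF R], of p] Y[OF that] submodule_ideal_iff[OF R] by auto
  {
    assume t: "\<forall>j<i. torsion_free (E j) Y"
    show "\<forall>j<i. \<forall>p\<in>Y. exv R (quot_module (regular_module R) p) E d j"
    proof (intro allI impI ballI)
      fix j p assume j: "j < i" and p: "p \<in> Y"
      let ?Q = "quot_module (regular_module R) p"
      have z0: "z x = \<zero>\<^bsub>E j\<^esub>" if z: "lin R ?Q (E j) z" and x: "x \<in> carrier ?Q" for z x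
        using torsion_freeD[OF _ p lin_closed[OF z x]] t j quot_regular_annihilated[OF R Y[OF p] z x] by blast
      show "exv R ?Q E d j"
      proof (cases j)
        case 0
        then show ?thesis using z0 by (auto intro: exv_0I)
      next
        case (Suc k)
        show ?thesis unfolding Suc
        proof (rule exv_SucI)
          fix z assume z: "lin R ?Q (E (Suc k)) z"
          have "\<forall>x\<in>carrier ?Q. d k \<zero>\<^bsub>E k\<^esub> = z x" using z0 z lin_zero[OF cores_d[OF c, of k]] unfolding Suc by simp
          then show "\<exists>w. lin R ?Q (E k) w \<and> (\<forall>x\<in>carrier ?Q. d k (w x) = z x)"
            using lin_zero_map[OF lin_dom[OF z] mE, of k] by (intro exI[of _ "\<lambda>_. \<zero>\<^bsub>E k\<^esub>"]) simp
        qed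
      qed
    qed
  next
    assume ex: "\<forall>j<i. \<forall>p\<in>Y. exv R (quot_module (regular_module R) p) E d j"
    have "j < i \<Longrightarrow> torsion_free (E j) Y" for j
    proof (induction j)
      \<comment> \<open>A \<open>p\<close>-torsion element \<open>x\<close> in the kernel of
        \<open>d j\<close> defines a cocycle on \<open>R/p\<close>. In positive degree it has a
        primitive into the preceding term, which is zero as that term is torsion free; so
        \<open>x\<close> is zero. Minimality then extends torsion freeness from the kernel to the
        whole term.\<close>
      have ker: "x = \<zero>\<^bsub>E j\<^esub>" if j: "j < i" and p: "p \<in> Y" and x: "x \<in> carrier (E j)" "d j x = \<zero>\<^bsub>E (Suc j)\<^esub>"
        and px: "\<And>r. r \<in> p \<Longrightarrow> r \<odot>\<^bsub>E j\<^esub> x = \<zero>\<^bsub>E j\<^esub>" and prev: "\<And>k. j = Suc k \<Longrightarrow> torsion_free (E k) Y" for j p x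
      proof -
        let ?Q = "quot_module (regular_module R) p"
        interpret Ej: module R "E j" by (rule mE)
        interpret Es: module R "E (Suc j)" by (rule mE)
        obtain z where z: "lin R ?Q (E j) z" "\<And>r. r \<in> carrier R \<Longrightarrow> z (p +>\<^bsub>regular_module R\<^esub> r) = r \<odot>\<^bsub>E j\<^esub> x"
          using quot_regular_hom[OF R Y[OF p] mE x(1) px] by blast
        have one: "p +>\<^bsub>regular_module R\<^esub> \<one>\<^bsub>R\<^esub> \<in> carrier ?Q" "z (p +>\<^bsub>regular_module R\<^esub> \<one>\<^bsub>R\<^esub>) = x"
          using quot(2)[OF p] z(2) x(1) by auto
        have coc: "d j (z c) = \<zero>\<^bsub>E (Suc j)\<^esub>" if "c \<in> carrier ?Q" for c
        proof -
          have "c \<in> (\<lambda>x. p +>\<^bsub>regular_module R\<^esub> x) ` carrier R" using that unfolding quot(2)[OF p] .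
          then obtain r where r: "c = p +>\<^bsub>regular_module R\<^esub> r" "r \<in> carrier R" by (rule imageE)
          then show ?thesis using z(2) lin_smult[OF cores_d[OF c] r(2) x(1)] x(2) by simp
        qed
        have exj: "exv R ?Q E d j" using ex j p by blast
        show ?thesis
        proof (cases j)
          case 0
          then show ?thesis using exv_0D[OF exj[unfolded 0] z(1)[unfolded 0] coc[unfolded 0] one(1)] one(2) by simp
        next
          case (Suc k)
          from exv_SucD[OF exj[unfolded Suc] z(1)[unfolded Suc] coc[unfolded Suc]]
          obtain w where w: "lin R ?Q (E k) w" "\<And>c. c \<in> carrier ?Q \<Longrightarrow> d k (w c) = z c" by blast
          have "w (p +>\<^bsub>regular_module R\<^esub> \<one>\<^bsub>R\<^esub>) = \<zero>\<^bsub>E k\<^esub>"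
            by (rule torsion_freeD[OF prev[OF Suc] p lin_closed[OF w(1) one(1)]])
              (rule quot_regular_annihilated[OF R Y[OF p] w(1) one(1)])
          then show ?thesis using w(2)[OF one(1)] one(2) lin_zero[OF cores_d[OF c, of k]] Suc by simp
        qed
      qed
      {
        case 0
        have "torsion_free (E 0\<lparr>carrier := \<epsilon> ` carrier M\<rparr>) Y"
          unfolding torsion_free_def
        proof (intro ballI impI)
          fix p x assume p: "p \<in> Y" and x: "x \<in> carrier (E 0\<lparr>carrier := \<epsilon> ` carrier M\<rparr>)"
            and px: "\<forall>r\<in>p. r \<odot>\<^bsub>E 0\<lparr>carrier := \<epsilon> ` carrier M\<rparr>\<^esub> x = \<zero>\<^bsub>E 0\<lparr>carrier := \<epsilon> ` carrier M\<rparr>\<^esub>"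
          have xi: "x \<in> \<epsilon> ` carrier M" using x by simp
          then have xc: "x \<in> carrier (E 0)" using lin_closed[OF cores_aug[OF c]] by blast
          then show "x = \<zero>\<^bsub>E 0\<lparr>carrier := \<epsilon> ` carrier M\<rparr>\<^esub>"
            using ker[OF 0 p xc] cores_ker0[OF c xc] xi px by simp
        qed
        then show ?case by (rule torsion_free_essential[OF mE ess(1) _ Yc])
      next
        case (Suc k)
        have prev: "torsion_free (E k) Y" using Suc by simp
        have "torsion_free (E (Suc k)\<lparr>carrier := d k ` carrier (E k)\<rparr>) Y"
          unfolding torsion_free_def
        proof (intro ballI impI)
          fix p x assume p: "p \<in> Y" and x: "x \<in> carrier (E (Suc k)\<lparr>carrier := d k ` carrier (E k)\<rparr>)"
            and px: "\<forall>r\<in>p. r \<odot>\<^bsub>E (Suc k)\<lparr>carrier := d k ` carrier (E k)\<rparr>\<^esub> x = \<zero>\<^bsub>E (Suc k)\<lparr>carrier := d k ` carrier (E k)\<rparr>\<^esub>"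
          have xi: "x \<in> d k ` carrier (E k)" using x by simp
          then have xc: "x \<in> carrier (E (Suc k))" using lin_closed[OF cores_d[OF c]] by blast
          then show "x = \<zero>\<^bsub>E (Suc k)\<lparr>carrier := d k ` carrier (E k)\<rparr>\<^esub>"
            using ker[OF Suc.prems p xc] cores_ker[OF c xc] xi px prev by simp
        qed
        then show ?case by (rule torsion_free_essential[OF mE ess(2) _ Yc])
      }
    qed
    then show "\<forall>j<i. torsion_free (E j) Y" by blast
  }
qed

section \<open>The classes of the classification as vanishing conditions on Ext\<close>

context cogenerated
begin

text \<open>The definition tests \<open>Y i\<close> on one cosyzygy only. As the sets decrease, the
  conditions for smaller indices also cover \<open>Y i\<close>, so all degrees \<open>j < i\<close>
  may be required; essentiality passes from cosyzygies to injective terms. The resulting triangle of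
  conditions is independent of the coresolution.\<close>

lemma cot_class_iff:
  fixes M :: "('r, 'm) module"
  assumes M: "module R M" and le: "|UNIV :: 'm set| \<le>o |UNIV :: 'u set|"
    and Y: "\<forall>i\<in>{1..m}. Y i \<subseteq> Spec R \<and> specialization_closed R (Y i)" and dec: "\<forall>i\<in>{1..<m}. Y (i + 1) \<subseteq> Y i"
  shows "M \<in> cot_class R m Y \<longleftrightarrow>
    (\<forall>i\<in>{1..m}. \<forall>j<i. \<forall>p\<in>Y i. exv R (quot_module (regular_module R) p) (inj_term R M) (inj_diff R M) j)"
proof -
  let ?E = "inj_term R M" and ?d = "inj_diff R M"
  note min = minimal_min_cores[OF M le]
  have c: "cores R M ?E (inj_aug R M) ?d" by (rule cores_min[OF M le])
  have Yi: "ideal p R" if "p \<in> Y i" "i \<in> {1..m}" for p i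
    using Y that unfolding Spec_def by (auto dest!: primeideal.axioms(1))
  have anti: "Y k \<subseteq> Y i" if "1 \<le> i" "i \<le> k" "k \<le> m" for i k
    using that(2,3)
  proof (induction k rule: dec_induct)
    case (step k)
    then have "Y (Suc k) \<subseteq> Y k" using dec that(1) by auto
    then show ?case using step by simp
  qed simp
  have ess: "\<exists>A. mho R M k = (?E k)\<lparr>carrier := A\<rparr> \<and> essential_submodule R A (?E k)" for k
  proof (cases k)
    case 0
    then show ?thesis using min by (auto simp: minimal_injective_coresolution_def)
  next
    case (Suc l)
    then show ?thesis using min by (auto simp: minimal_injective_coresolution_def)
  qed
  have mho: "Ass R (mho R M k) \<inter> Y i = {} \<longleftrightarrow> torsion_free (?E k) (Y i)" if i: "i \<in> {1..m}" for k i
  proof -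
    obtain A where A: "mho R M k = (?E k)\<lparr>carrier := A\<rparr>" "essential_submodule R A (?E k)" using ess by blast
    have sA: "submodule A R (?E k)" using A(2) by (simp add: essential_submodule_def)
    have mk: "module R (mho R M k)" unfolding A(1) by (rule submodule_module[OF cores_module[OF c] sA])
    have "torsion_free (mho R M k) (Y i) \<longleftrightarrow> torsion_free (?E k) (Y i)"
    proof
      assume "torsion_free (mho R M k) (Y i)"
      then show "torsion_free (?E k) (Y i)"
        unfolding A(1) by (rule torsion_free_essential[OF cores_module[OF c] A(2)]) (rule ideal_subset[OF Yi[OF _ i]])
    next
      assume "torsion_free (?E k) (Y i)"
      then show "torsion_free (mho R M k) (Y i)" unfolding A(1) by (rule torsion_free_submodule[OF _ submoduleD(1)[OF sA]])
    qed
    then show ?thesis using Ass_disjoint_iff[OF cring noetherian mk] Y i by blast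
  qed
  have "M \<in> cot_class R m Y \<longleftrightarrow> (\<forall>i\<in>{1..m}. torsion_free (?E (i - 1)) (Y i))"
    unfolding cot_class_def using M mho by simp
  also have "\<dots> \<longleftrightarrow> (\<forall>i\<in>{1..m}. \<forall>j<i. torsion_free (?E j) (Y i))"
  proof (intro iffI ballI allI impI)
    fix i j assume t: "\<forall>i\<in>{1..m}. torsion_free (?E (i - 1)) (Y i)" and i: "i \<in> {1..m}" and j: "j < i"
    have "Suc j \<in> {1..m}" using i j by simp
    then have "torsion_free (?E j) (Y (Suc j))" using t by fastforce
    moreover have "Y i \<subseteq> Y (Suc j)" using i j by (intro anti) auto
    ultimately show "torsion_free (?E j) (Y i)" by (rule torsion_free_mono)
  next
    fix i assume t: "\<forall>i\<in>{1..m}. \<forall>j<i. torsion_free (?E j) (Y i)" and i: "i \<in> {1..m}"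
    have "i - 1 < i" using i by auto
    then show "torsion_free (?E (i - 1)) (Y i)" using t i by blast
  qed
  also have "\<dots> \<longleftrightarrow> (\<forall>i\<in>{1..m}. \<forall>j<i. \<forall>p\<in>Y i. exv R (quot_module (regular_module R) p) ?E ?d j)"
    using torsion_free_iff_exv[OF cring M min] Yi by meson
  finally show ?thesis .
qed

end

text \<open>A lifting problem on an injective module over a noetherian ring can be solved if it can be
  solved on all small injective submodules: take a maximal solution among those defined on an
  injective submodule \<open>S\<close>; a complement of \<open>S\<close> would contain a small injective submodule.\<close>

lemma lift_from_small_injectives:
  fixes I :: "('r, 'i) module" and X :: "('r, 'x) module"
  assumes R: "cring R" "noetherian_ring R" and I: "baer R I" and d: "lin R X Z d" and f: "lin R I Z f"
    and U: "infinite U" "|carrier R| \<le>o |U|"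
    and small: "\<And>H. \<lbrakk>submodule H R I; baer R (I\<lparr>carrier := H\<rparr>); |H| \<le>o |U :: 'k set|\<rbrakk> \<Longrightarrow>
      \<exists>g. lin R (I\<lparr>carrier := H\<rparr>) X g \<and> (\<forall>x\<in>H. d (g x) = f x)"
  shows "\<exists>g. lin R I X g \<and> (\<forall>x\<in>carrier I. d (g x) = f x)"
proof -
  have mI: "module R I" and mX: "module R X" by (rule baer_module[OF I], rule lin_dom[OF d])
  interpret I: module R I by (rule mI)
  interpret X: module R X by (rule mX)
  let ?P = "dir_sum2 I X"
  have mP: "module R ?P" by (rule module_dir_sum2[OF mI mX])
  \<comment> \<open>Partial solutions are graphs in the sum of \<open>I\<close> and
    \<open>X\<close>. Injectivity of their domain survives unions of chains by the noetherian
    condition and provides the complement used below.\<close>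
  define \<G> where "\<G> = {G. submodule G R ?P \<and> (\<forall>y. (\<zero>\<^bsub>I\<^esub>, y) \<in> G \<longrightarrow> y = \<zero>\<^bsub>X\<^esub>) \<and>
    baer R (I\<lparr>carrier := fst ` G\<rparr>) \<and> (\<forall>z\<in>G. d (snd z) = f (fst z))}"
  have "{\<zero>\<^bsub>?P\<^esub>} \<in> \<G>"
  proof -
    have "submodule {\<zero>\<^bsub>?P\<^esub>} R ?P" by (rule submodule_zero[OF mP])
    moreover have "baer R (I\<lparr>carrier := {\<zero>\<^bsub>I\<^esub>}\<rparr>)"
    proof (rule baer_retract[OF I lin_incl[OF mI submodule_zero[OF mI]]])
      show "lin R I (I\<lparr>carrier := {\<zero>\<^bsub>I\<^esub>}\<rparr>) (\<lambda>_. \<zero>\<^bsub>I\<^esub>)"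
        using lin_zero_map[OF mI submodule_module[OF mI submodule_zero[OF mI]]] by simp
    qed simp
    ultimately show ?thesis unfolding \<G>_def using lin_zero[OF d] lin_zero[OF f] by simp
  qed
  then have ne: "\<G> \<noteq> {}" by blast
  obtain G where G: "G \<in> \<G>" and max: "\<And>X. X \<in> \<G> \<Longrightarrow> G \<subseteq> X \<Longrightarrow> X = G"
  proof -
    have "\<exists>M\<in>\<G>. \<forall>X\<in>\<G>. M \<subseteq> X \<longrightarrow> X = M"
    proof (rule subset_Zorn_nonempty[OF ne])
      fix \<C> assume C: "\<C> \<noteq> {}" "subset.chain \<G> \<C>"
      then have sub: "\<C> \<subseteq> \<G>" by (simp add: subset.chain_def)
      have mem: "submodule H R ?P" "\<And>y. (\<zero>\<^bsub>I\<^esub>, y) \<in> H \<Longrightarrow> y = \<zero>\<^bsub>X\<^esub>" "baer R (I\<lparr>carrier := fst ` H\<rparr>)"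
        "\<And>z. z \<in> H \<Longrightarrow> d (snd z) = f (fst z)" if "H \<in> \<C>" for H
        using sub that unfolding \<G>_def by blast+
      have s: "submodule (\<Union>\<C>) R ?P" by (rule submodule_Union_chain[OF mP C mem(1)])
      have "subset.chain UNIV ((`) fst ` \<C>)"
        using C(2) unfolding subset.chain_def by (auto intro!: image_mono)
      then have "baer R (I\<lparr>carrier := \<Union>((`) fst ` \<C>)\<rparr>)"
      proof (rule baer_Union_chain[OF R mI, rotated])
        fix H assume "H \<in> (`) fst ` \<C>"
        then obtain K where K: "H = fst ` K" "K \<in> \<C>" by blast
        show "submodule H R I" unfolding K(1) by (rule submodule_image[OF lin_fst[OF mI mX] mem(1)[OF K(2)]])
        show "baer R (I\<lparr>carrier := H\<rparr>)" unfolding K(1) by (rule mem(3)[OF K(2)])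
      qed (use C(1) in simp)
      moreover have "\<Union>((`) fst ` \<C>) = fst ` \<Union>\<C>" by blast
      ultimately have "baer R (I\<lparr>carrier := fst ` \<Union>\<C>\<rparr>)" by simp
      then show "\<Union>\<C> \<in> \<G>" unfolding \<G>_def using s mem(2,4) by blast
    qed
    then show thesis using that by blast
  qed
  have sG: "submodule G R ?P" and zG: "\<And>y. (\<zero>\<^bsub>I\<^esub>, y) \<in> G \<Longrightarrow> y = \<zero>\<^bsub>X\<^esub>"
    and bG: "baer R (I\<lparr>carrier := fst ` G\<rparr>)" and fG: "\<And>z. z \<in> G \<Longrightarrow> d (snd z) = f (fst z)"
    using G unfolding \<G>_def by blast+
  note G' = submoduleD[OF sG]
  define S where "S = fst ` G"
  have sS: "submodule S R I" unfolding S_def by (rule submodule_image[OF lin_fst[OF mI mX] sG])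
  note SC = submoduleD(5)[OF sS]
  have bS: "baer R (I\<lparr>carrier := S\<rparr>)" using bG by (simp add: S_def)
  \<comment> \<open>Being injective, \<open>S\<close> splits off: \<open>p0\<close> projects onto
    it, and its kernel \<open>T\<close> will be injective too.\<close>
  obtain p0 where p0: "lin R I (I\<lparr>carrier := S\<rparr>) p0" "\<And>x. x \<in> S \<Longrightarrow> p0 x = x"
    using baer_split[OF bS lin_incl[OF mI sS]] by (auto simp: inj_on_def)
  have p: "lin R I I p0" by (rule lin_comp[OF p0(1) lin_incl[OF mI sS]])
  have pS: "p0 x \<in> S" if "x \<in> carrier I" for x using lin_closed[OF p0(1) that] by simp
  note pc = lin_closed[OF p]
  have "carrier I \<subseteq> S"
  proof (rule ccontr)
    assume "\<not> carrier I \<subseteq> S"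
    then obtain y where y: "y \<in> carrier I" "y \<notin> S" by blast
    define T where "T = a_kernel I I p0"
    have sT: "submodule T R I" unfolding T_def by (rule submodule_kernel[OF p])
    have T: "x \<in> T \<longleftrightarrow> x \<in> carrier I \<and> p0 x = \<zero>\<^bsub>I\<^esub>" for x by (simp add: T_def a_kernel_iff)
    have lq: "lin R I I (\<lambda>x. x \<ominus>\<^bsub>I\<^esub> p0 x)" by (rule lin_minus_map[OF lin_id[OF mI] p])
    have qT: "x \<ominus>\<^bsub>I\<^esub> p0 x \<in> T" if x: "x \<in> carrier I" for x
    proof -
      have "p0 (x \<ominus>\<^bsub>I\<^esub> p0 x) = p0 x \<ominus>\<^bsub>I\<^esub> p0 (p0 x)" by (rule lin_minus[OF p x pc[OF x]])
      also have "\<dots> = \<zero>\<^bsub>I\<^esub>" using p0(2)[OF pS[OF x]] pc[OF x] by (simp add: I.minus_eq_zero_iff)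
      finally show ?thesis unfolding T using lin_closed[OF lq x] by simp
    qed
    have mT: "module R (I\<lparr>carrier := T\<rparr>)" by (rule submodule_module[OF mI sT])
    have bT: "baer R (I\<lparr>carrier := T\<rparr>)"
    proof (rule baer_retract[OF I lin_incl[OF mI sT] lin_corestrict[OF lq sT qT]])
      fix x assume "x \<in> carrier (I\<lparr>carrier := T\<rparr>)"
      then show "x \<ominus>\<^bsub>I\<^esub> p0 x = x" unfolding partial_object.simps using T[of x] by (simp add: I.minus_zero_right)
    qed
    define x where "x = y \<ominus>\<^bsub>I\<^esub> p0 y"
    have xT: "x \<in> T" unfolding x_def by (rule qT[OF y(1)])
    have xnz: "x \<noteq> \<zero>\<^bsub>I\<^esub>"
    proof
      assume "x = \<zero>\<^bsub>I\<^esub>"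
      then have "y = p0 y" unfolding x_def using I.minus_eq_zero_iff[OF y(1) pc[OF y(1)]] by simp
      then show False using pS[OF y(1)] y(2) by simp
    qed
    have xs: "{x} \<subseteq> carrier (I\<lparr>carrier := T\<rparr>)" using xT by simp
    have x1: "|{x}| \<le>o |U|" by (rule card_of_singl_ordLeq) (use U(1) in auto)
    obtain H where H: "submodule H R (I\<lparr>carrier := T\<rparr>)" "baer R (I\<lparr>carrier := H\<rparr>)" "x \<in> H" "|H| \<le>o |U|"
    proof -
      obtain H where "submodule H R (I\<lparr>carrier := T\<rparr>)" "baer R (I\<lparr>carrier := T, carrier := H\<rparr>)" "{x} \<subseteq> H"
        "\<And>K :: 'k set. \<lbrakk>infinite K; |{x}| \<le>o |K|; |carrier R| \<le>o |K|\<rbrakk> \<Longrightarrow> |H| \<le>o |K|"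
        using small_injective_submodule[OF R bT xs, where ?'k = 'k] by metis
      then show thesis using that[of H] U x1 by simp
    qed
    have sH: "submodule H R I" "H \<subseteq> T" using H(1) submodule_trans[OF mI sT] by blast+
    have HC: "h \<in> carrier I" "p0 h = \<zero>\<^bsub>I\<^esub>" if "h \<in> H" for h using that sH(2) T by blast+
    obtain g where g: "lin R (I\<lparr>carrier := H\<rparr>) X g" "\<And>x. x \<in> H \<Longrightarrow> d (g x) = f x"
      using small[OF sH(1) H(2,4)] by blast
    have gc: "g h \<in> carrier X" if "h \<in> H" for h using lin_closed[OF g(1)] that by simp
    define K where "K = (\<lambda>h. (h, g h)) ` H"
    have sK: "submodule K R ?P"
      using submodule_range[OF lin_pair[OF lin_incl[OF mI sH(1)] g(1)]] by (simp add: K_def)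
    define G2 where "G2 = {a \<oplus>\<^bsub>?P\<^esub> b | a b. a \<in> G \<and> b \<in> K}"
    have sG2: "submodule G2 R ?P" unfolding G2_def by (rule submodule_sum[OF mP sG sK])
    have mem: "(fst a \<oplus>\<^bsub>I\<^esub> h, snd a \<oplus>\<^bsub>X\<^esub> g h) \<in> G2" if "a \<in> G" "h \<in> H" for a h
      unfolding G2_def K_def using that by force
    have elim: "\<exists>a h. a \<in> G \<and> h \<in> H \<and> z = (fst a \<oplus>\<^bsub>I\<^esub> h, snd a \<oplus>\<^bsub>X\<^esub> g h)" if "z \<in> G2" for z
      using that unfolding G2_def K_def by force
    have aG: "fst a \<in> carrier I" "snd a \<in> carrier X" "fst a \<in> S" if "a \<in> G" for a
      using G'(5)[OF that] that unfolding S_def by auto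
    have H0: "\<zero>\<^bsub>I\<^esub> \<in> H" "g \<zero>\<^bsub>I\<^esub> = \<zero>\<^bsub>X\<^esub>" using submoduleD(2)[OF sH(1)] lin_zero[OF g(1)] by simp_all
    have GG2: "G \<subseteq> G2"
    proof
      fix a assume a: "a \<in> G"
      show "a \<in> G2" using mem[OF a H0(1)] aG[OF a] H0(2) by simp
    qed
    have psplit: "p0 (s \<oplus>\<^bsub>I\<^esub> h) = s" if "s \<in> S" "h \<in> H" for s h
      using lin_add[OF p SC[OF that(1)] HC(1)[OF that(2)]] p0(2)[OF that(1)] HC(2)[OF that(2)] SC[OF that(1)] by simp
    have z2: "v = \<zero>\<^bsub>X\<^esub>" if v: "(\<zero>\<^bsub>I\<^esub>, v) \<in> G2" for v
    proof -
      obtain a h where ah: "a \<in> G" "h \<in> H" "(\<zero>\<^bsub>I\<^esub>, v) = (fst a \<oplus>\<^bsub>I\<^esub> h, snd a \<oplus>\<^bsub>X\<^esub> g h)" using elim[OF v] by blast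
      have e: "fst a \<oplus>\<^bsub>I\<^esub> h = \<zero>\<^bsub>I\<^esub>" using ah(3) by simp
      have "p0 (fst a \<oplus>\<^bsub>I\<^esub> h) = \<zero>\<^bsub>I\<^esub>" using e lin_zero[OF p] by simp
      then have a0: "fst a = \<zero>\<^bsub>I\<^esub>" using psplit[OF aG(3)[OF ah(1)] ah(2)] by simp
      then have "h = \<zero>\<^bsub>I\<^esub>" using e HC(1)[OF ah(2)] by simp
      moreover have "snd a = \<zero>\<^bsub>X\<^esub>" using zG[of "snd a"] a0 ah(1) by (metis prod.collapse)
      ultimately show ?thesis using ah(3) H0(2) by simp
    qed
    have f2: "d (snd z) = f (fst z)" if z: "z \<in> G2" for z
    proof -
      obtain a h where ah: "a \<in> G" "h \<in> H" "z = (fst a \<oplus>\<^bsub>I\<^esub> h, snd a \<oplus>\<^bsub>X\<^esub> g h)" using elim[OF z] by blast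
      then show ?thesis
        using lin_add[OF d aG(2)[OF ah(1)] gc[OF ah(2)]] lin_add[OF f aG(1)[OF ah(1)] HC(1)[OF ah(2)]] fG[OF ah(1)] g(2)[OF ah(2)]
        by simp
    qed
    let ?S2 = "fst ` G2"
    have sS2: "submodule ?S2 R I" by (rule submodule_image[OF lin_fst[OF mI mX] sG2])
    have mS2: "module R (I\<lparr>carrier := ?S2\<rparr>)" by (rule submodule_module[OF mI sS2])
    have S2: "\<exists>s h. s \<in> S \<and> h \<in> H \<and> w = s \<oplus>\<^bsub>I\<^esub> h" if "w \<in> ?S2" for w
      using that elim aG(3) by force
    \<comment> \<open>\<open>H\<close> lies in the kernel of \<open>p0\<close>, so the sum of
      \<open>S\<close> and \<open>H\<close> is direct and a retract of an injective module.\<close>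
    have b2: "baer R (I\<lparr>carrier := ?S2\<rparr>)"
    proof (rule baer_retract[OF baer_dir_sum2[OF bS H(2)]])
      let ?I2 = "I\<lparr>carrier := ?S2\<rparr>"
      have i2: "lin R ?I2 I (\<lambda>x. x)" by (rule lin_incl[OF mI sS2])
      have qH: "w \<ominus>\<^bsub>I\<^esub> p0 w \<in> H" if w: "w \<in> carrier ?I2" for w
      proof -
        have "w \<in> ?S2" using w by simp
        from S2[OF this] obtain s h where sh: "s \<in> S" "h \<in> H" "w = s \<oplus>\<^bsub>I\<^esub> h" by blast
        have "w \<ominus>\<^bsub>I\<^esub> p0 w = (s \<oplus>\<^bsub>I\<^esub> h) \<ominus>\<^bsub>I\<^esub> s" using psplit[OF sh(1,2)] sh(3) by simp
        also have "\<dots> = h" using SC[OF sh(1)] HC(1)[OF sh(2)] by algebra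
        finally show ?thesis using sh(2) by simp
      qed
      have l1: "lin R ?I2 (I\<lparr>carrier := S\<rparr>) p0" by (rule lin_comp[OF i2 p0(1)])
      have l2: "lin R ?I2 (I\<lparr>carrier := H\<rparr>) (\<lambda>w. w \<ominus>\<^bsub>I\<^esub> p0 w)"
        by (rule lin_corestrict[OF lin_comp[OF i2 lq] sH(1) qH])
      show "lin R ?I2 (dir_sum2 (I\<lparr>carrier := S\<rparr>) (I\<lparr>carrier := H\<rparr>)) (\<lambda>w. (p0 w, w \<ominus>\<^bsub>I\<^esub> p0 w))"
        by (rule lin_pair[OF l1 l2])
      have mS: "module R (I\<lparr>carrier := S\<rparr>)" and mH: "module R (I\<lparr>carrier := H\<rparr>)"
        by (rule baer_module[OF bS], rule baer_module[OF H(2)])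
      have ladd: "lin R (dir_sum2 (I\<lparr>carrier := S\<rparr>) (I\<lparr>carrier := H\<rparr>)) I (\<lambda>z. fst z \<oplus>\<^bsub>I\<^esub> snd z)"
        by (rule lin_add_map[OF lin_comp[OF lin_fst[OF mS mH] lin_incl[OF mI sS]] lin_comp[OF lin_snd[OF mS mH] lin_incl[OF mI sH(1)]]])
      show "lin R (dir_sum2 (I\<lparr>carrier := S\<rparr>) (I\<lparr>carrier := H\<rparr>)) ?I2 (\<lambda>z. fst z \<oplus>\<^bsub>I\<^esub> snd z)"
      proof (rule lin_corestrict[OF ladd sS2])
        fix z assume "z \<in> carrier (dir_sum2 (I\<lparr>carrier := S\<rparr>) (I\<lparr>carrier := H\<rparr>))"
        then have "fst z \<in> S" "snd z \<in> H" by auto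
        then obtain a where "a \<in> G" "fst z = fst a" unfolding S_def by blast
        then show "fst z \<oplus>\<^bsub>I\<^esub> snd z \<in> ?S2" using imageI[OF mem[of a "snd z"], of fst] \<open>snd z \<in> H\<close> by simp
      qed
      fix w assume "w \<in> carrier ?I2"
      then have "w \<in> carrier I" using submoduleD(5)[OF sS2] by simp
      moreover from this have "p0 w \<in> carrier I" by (rule pc)
      ultimately show "fst (p0 w, w \<ominus>\<^bsub>I\<^esub> p0 w) \<oplus>\<^bsub>I\<^esub> snd (p0 w, w \<ominus>\<^bsub>I\<^esub> p0 w) = w" unfolding fst_conv snd_conv by algebra
    qed
    have "G2 \<in> \<G>" unfolding \<G>_def using sG2 z2 b2 f2 by blast
    from max[OF this GG2] have "G2 = G" .
    moreover have "(\<zero>\<^bsub>I\<^esub>, \<zero>\<^bsub>X\<^esub>) \<in> G" using G'(2) by simp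
    from mem[OF this H(3)] have "(x, g x) \<in> G2" using HC(1)[OF H(3)] gc[OF H(3)] by simp
    ultimately have "x \<in> S" unfolding S_def by force
    then have "x = \<zero>\<^bsub>I\<^esub>" using p0(2) HC(2)[OF H(3)] by simp
    then show False using xnz by simp
  qed
  then have SI: "S = carrier I" using submoduleD(1)[OF sS] by blast
  have lf: "lin R (?P\<lparr>carrier := G\<rparr>) I fst" by (rule lin_restrict[OF lin_fst[OF mI mX] sG])
  have ls: "lin R (?P\<lparr>carrier := G\<rparr>) X snd" by (rule lin_restrict[OF lin_snd[OF mI mX] sG])
  have "inj_on fst (carrier (?P\<lparr>carrier := G\<rparr>))" unfolding lin_inj_iff[OF lf] using zG by auto
  from lin_inv[OF lf this] obtain h where h: "lin R (I\<lparr>carrier := fst ` G\<rparr>) (?P\<lparr>carrier := G\<rparr>) h"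
    "\<And>z. z \<in> G \<Longrightarrow> h (fst z) = z" by auto
  have "lin R I (?P\<lparr>carrier := G\<rparr>) h" using h(1) SI by (simp add: S_def)
  from lin_comp[OF this ls] have "lin R I X (\<lambda>x. snd (h x))" .
  moreover have "d (snd (h x)) = f x" if x: "x \<in> carrier I" for x
  proof -
    have "x \<in> fst ` G" using x SI unfolding S_def by simp
    then obtain z where "z \<in> G" "x = fst z" by blast
    then show ?thesis using h(2) fG by simp
  qed
  ultimately show ?thesis by blast
qed

section \<open>Free modules\<close>

definition free_module :: "('r, 'q) ring_scheme \<Rightarrow> 'i set \<Rightarrow> ('r, 'i \<Rightarrow> 'r) module" where
  "free_module R I = direct_sum I (\<lambda>_. regular_module R)"

definition free_basis :: "('r, 'q) ring_scheme \<Rightarrow> 'i set \<Rightarrow> 'i \<Rightarrow> 'i \<Rightarrow> 'r" where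
  "free_basis R I m = (\<lambda>i\<in>I. if i = m then \<one>\<^bsub>R\<^esub> else \<zero>\<^bsub>R\<^esub>)"

lemma free_module_simps:
  "f \<in> carrier (free_module R I) \<longleftrightarrow> f \<in> (\<Pi>\<^sub>E i\<in>I. carrier R) \<and> finite {i \<in> I. f i \<noteq> \<zero>\<^bsub>R\<^esub>}"
  "\<zero>\<^bsub>free_module R I\<^esub> = (\<lambda>i\<in>I. \<zero>\<^bsub>R\<^esub>)"
  "f \<oplus>\<^bsub>free_module R I\<^esub> g = (\<lambda>i\<in>I. f i \<oplus>\<^bsub>R\<^esub> g i)"
  "r \<odot>\<^bsub>free_module R I\<^esub> f = (\<lambda>i\<in>I. r \<otimes>\<^bsub>R\<^esub> f i)"
  by (simp_all add: free_module_def direct_sum_eq)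

lemma module_free: "cring R \<Longrightarrow> module R (free_module R I)"
  unfolding free_module_def by (intro module_direct_sum module_regular)

lemma free_basis_carrier:
  assumes "cring R" "m \<in> I" shows "free_basis R I m \<in> carrier (free_module R I)"
proof -
  interpret cring R by fact
  have "{i \<in> I. free_basis R I m i \<noteq> \<zero>\<^bsub>R\<^esub>} \<subseteq> {m}" by (auto simp: free_basis_def)
  then have "finite {i \<in> I. free_basis R I m i \<noteq> \<zero>\<^bsub>R\<^esub>}" by (rule finite_subset) simp
  then show ?thesis unfolding free_module_simps by (auto simp: free_basis_def)
qed

lemma free_lift_exists:
  fixes N :: "('r, 'n) module"
  assumes N: "module R N" and y: "\<And>i. i \<in> I \<Longrightarrow> y i \<in> carrier N"
  obtains u where "lin R (free_module R I) N u" "\<And>i. i \<in> I \<Longrightarrow> u (free_basis R I i) = y i"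
proof -
  interpret N: module R N by fact
  have cr: "cring R" by (rule N.R.is_cring)
  define u where "u f = finsum N (\<lambda>i. f i \<odot>\<^bsub>N\<^esub> y i) {i \<in> I. f i \<noteq> \<zero>\<^bsub>R\<^esub>}" for f
  have fc: "f i \<in> carrier R" if "f \<in> carrier (free_module R I)" "i \<in> I" for f i
    using that unfolding free_module_simps by auto
  have tc: "(\<lambda>i. f i \<odot>\<^bsub>N\<^esub> y i) \<in> T \<rightarrow> carrier N" if "f \<in> carrier (free_module R I)" "T \<subseteq> I" for f T
    using fc[OF that(1)] y that(2) by (intro Pi_I N.smult_closed) auto
  \<comment> \<open>The sum may be taken over any finite set containing the support, so that
    functions with different supports can be compared.\<close>
  have uT: "u f = finsum N (\<lambda>i. f i \<odot>\<^bsub>N\<^esub> y i) T"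
    if f: "f \<in> carrier (free_module R I)" and T: "finite T" "T \<subseteq> I" "{i \<in> I. f i \<noteq> \<zero>\<^bsub>R\<^esub>} \<subseteq> T" for f T
    unfolding u_def
  proof (rule N.add.finprod_mono_neutral_cong_left[OF T(1,3) _ refl tc[OF f T(2)]])
    fix i assume "i \<in> T - {i \<in> I. f i \<noteq> \<zero>\<^bsub>R\<^esub>}"
    then have "f i = \<zero>\<^bsub>R\<^esub>" "i \<in> I" using T(2) by auto
    then show "f i \<odot>\<^bsub>N\<^esub> y i = \<zero>\<^bsub>N\<^esub>" using y by simp
  qed
  have sup: "finite {i \<in> I. f i \<noteq> \<zero>\<^bsub>R\<^esub>}" if "f \<in> carrier (free_module R I)" for f
    using that unfolding free_module_simps by simp
  have mF: "module R (free_module R I)" by (rule module_free[OF cr])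
  interpret F: module R "free_module R I" by (rule mF)
  have l: "lin R (free_module R I) N u"
  proof (rule linI[OF mF N])
    fix f assume f: "f \<in> carrier (free_module R I)"
    show "u f \<in> carrier N" unfolding u_def by (rule N.finsum_closed[OF tc[OF f]]) blast
    show "u (r \<odot>\<^bsub>free_module R I\<^esub> f) = r \<odot>\<^bsub>N\<^esub> u f" if r: "r \<in> carrier R" for r
    proof -
      let ?T = "{i \<in> I. f i \<noteq> \<zero>\<^bsub>R\<^esub>}"
      have rf: "r \<odot>\<^bsub>free_module R I\<^esub> f \<in> carrier (free_module R I)" using r f by simp
      have "{i \<in> I. (r \<odot>\<^bsub>free_module R I\<^esub> f) i \<noteq> \<zero>\<^bsub>R\<^esub>} \<subseteq> ?T" using r by (auto simp: free_module_simps)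
      then have "u (r \<odot>\<^bsub>free_module R I\<^esub> f) = finsum N (\<lambda>i. (r \<odot>\<^bsub>free_module R I\<^esub> f) i \<odot>\<^bsub>N\<^esub> y i) ?T"
        using uT[OF rf sup[OF f]] by blast
      also have "\<dots> = finsum N (\<lambda>i. r \<odot>\<^bsub>N\<^esub> (f i \<odot>\<^bsub>N\<^esub> y i)) ?T"
      proof (rule N.finsum_cong'[OF refl])
        show "(\<lambda>i. r \<odot>\<^bsub>N\<^esub> (f i \<odot>\<^bsub>N\<^esub> y i)) \<in> ?T \<rightarrow> carrier N" using fc[OF f] y r by (intro Pi_I N.smult_closed) auto
        fix i assume "i \<in> ?T"
        then show "(r \<odot>\<^bsub>free_module R I\<^esub> f) i \<odot>\<^bsub>N\<^esub> y i = r \<odot>\<^bsub>N\<^esub> (f i \<odot>\<^bsub>N\<^esub> y i)"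
          using N.smult_assoc1[OF r fc[OF f] y, of i i] by (simp add: free_module_simps)
      qed
      also have "\<dots> = r \<odot>\<^bsub>N\<^esub> u f"
        unfolding u_def by (rule N.finsum_smult_ldistr[OF sup[OF f] r tc[OF f], symmetric]) blast
      finally show ?thesis .
    qed
    fix g assume g: "g \<in> carrier (free_module R I)"
    let ?T = "{i \<in> I. f i \<noteq> \<zero>\<^bsub>R\<^esub>} \<union> {i \<in> I. g i \<noteq> \<zero>\<^bsub>R\<^esub>}"
    have T: "finite ?T" "?T \<subseteq> I" using sup[OF f] sup[OF g] by auto
    have fg: "f \<oplus>\<^bsub>free_module R I\<^esub> g \<in> carrier (free_module R I)" using f g by simp
    have "{i \<in> I. (f \<oplus>\<^bsub>free_module R I\<^esub> g) i \<noteq> \<zero>\<^bsub>R\<^esub>} \<subseteq> ?T" by (auto simp: free_module_simps)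
    then have "u (f \<oplus>\<^bsub>free_module R I\<^esub> g) = finsum N (\<lambda>i. (f \<oplus>\<^bsub>free_module R I\<^esub> g) i \<odot>\<^bsub>N\<^esub> y i) ?T"
      by (rule uT[OF fg T])
    also have "\<dots> = finsum N (\<lambda>i. f i \<odot>\<^bsub>N\<^esub> y i \<oplus>\<^bsub>N\<^esub> g i \<odot>\<^bsub>N\<^esub> y i) ?T"
    proof (rule N.finsum_cong'[OF refl])
      show "(\<lambda>i. f i \<odot>\<^bsub>N\<^esub> y i \<oplus>\<^bsub>N\<^esub> g i \<odot>\<^bsub>N\<^esub> y i) \<in> ?T \<rightarrow> carrier N"
        using fc[OF f] fc[OF g] y by (intro Pi_I N.a_closed N.smult_closed) auto
      fix i assume "i \<in> ?T"
      then have i: "i \<in> I" by blast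
      show "(f \<oplus>\<^bsub>free_module R I\<^esub> g) i \<odot>\<^bsub>N\<^esub> y i = f i \<odot>\<^bsub>N\<^esub> y i \<oplus>\<^bsub>N\<^esub> g i \<odot>\<^bsub>N\<^esub> y i"
        using N.smult_l_distr[OF fc[OF f i] fc[OF g i] y[OF i]] i by (simp add: free_module_simps)
    qed
    also have "\<dots> = finsum N (\<lambda>i. f i \<odot>\<^bsub>N\<^esub> y i) ?T \<oplus>\<^bsub>N\<^esub> finsum N (\<lambda>i. g i \<odot>\<^bsub>N\<^esub> y i) ?T"
      by (rule N.finsum_addf[OF tc[OF f T(2)] tc[OF g T(2)]])
    also have "\<dots> = u f \<oplus>\<^bsub>N\<^esub> u g" using uT[OF f T] uT[OF g T] by simp
    finally show "u (f \<oplus>\<^bsub>free_module R I\<^esub> g) = u f \<oplus>\<^bsub>N\<^esub> u g" .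
  qed
  moreover have "u (free_basis R I m) = y m" if m: "m \<in> I" for m
  proof -
    have "u (free_basis R I m) = finsum N (\<lambda>i. free_basis R I m i \<odot>\<^bsub>N\<^esub> y i) {m}"
      by (rule uT[OF free_basis_carrier[OF cr m]]) (use m in \<open>auto simp: free_basis_def\<close>)
    also have "\<dots> = free_basis R I m m \<odot>\<^bsub>N\<^esub> y m \<oplus>\<^bsub>N\<^esub> finsum N (\<lambda>i. free_basis R I m i \<odot>\<^bsub>N\<^esub> y i) {}"
      by (rule N.finsum_insert) (use m y in \<open>auto simp: free_basis_def\<close>)
    also have "\<dots> = y m" using m y by (simp add: free_basis_def)
    finally show ?thesis .
  qed
  ultimately show thesis by (rule that)
qed

lemma free_module_induct:
  assumes R: "cring R" and K: "submodule K R (free_module R I)"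
    and b: "\<And>i. i \<in> I \<Longrightarrow> free_basis R I i \<in> K" and f: "f \<in> carrier (free_module R I)"
  shows "f \<in> K"
proof -
  interpret cring R by fact
  have "finite T \<Longrightarrow> T \<subseteq> I \<Longrightarrow> f \<in> carrier (free_module R I) \<Longrightarrow> {i \<in> I. f i \<noteq> \<zero>\<^bsub>R\<^esub>} \<subseteq> T \<Longrightarrow> f \<in> K" for T f
  proof (induction T arbitrary: f rule: finite_induct)
    case empty
    have fE: "f \<in> (\<Pi>\<^sub>E i\<in>I. carrier R)" using empty(2) unfolding free_module_simps by blast
    have "f = \<zero>\<^bsub>free_module R I\<^esub>"
    proof (rule ext)
      fix i
      show "f i = \<zero>\<^bsub>free_module R I\<^esub> i"
        using empty(3) PiE_arb[OF fE, of i] by (cases "i \<in> I") (auto simp: free_module_simps)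
    qed
    then show ?case using submoduleD(2)[OF K] by simp
  next
    case (insert m T)
    have m: "m \<in> I" using insert.prems by simp
    have fE: "f \<in> (\<Pi>\<^sub>E i\<in>I. carrier R)" and fin: "finite {i \<in> I. f i \<noteq> \<zero>\<^bsub>R\<^esub>}"
      using insert.prems(2) unfolding free_module_simps by auto
    have fi: "f i \<in> carrier R" if "i \<in> I" for i using fE that by auto
    define g where "g = (\<lambda>i\<in>I. if i = m then \<zero>\<^bsub>R\<^esub> else f i)"
    have "{i \<in> I. g i \<noteq> \<zero>\<^bsub>R\<^esub>} \<subseteq> {i \<in> I. f i \<noteq> \<zero>\<^bsub>R\<^esub>}" by (auto simp: g_def)
    then have "finite {i \<in> I. g i \<noteq> \<zero>\<^bsub>R\<^esub>}" using fin finite_subset by blast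
    then have g: "g \<in> carrier (free_module R I)" unfolding free_module_simps using fi by (auto simp: g_def)
    have "{i \<in> I. g i \<noteq> \<zero>\<^bsub>R\<^esub>} \<subseteq> T" using insert.prems(3) by (auto simp: g_def)
    then have gK: "g \<in> K" using insert.IH[OF _ g] insert.prems(1) by simp
    have "f m \<odot>\<^bsub>free_module R I\<^esub> free_basis R I m \<in> K" by (rule submoduleD(4)[OF K fi[OF m] b[OF m]])
    then have "g \<oplus>\<^bsub>free_module R I\<^esub> (f m \<odot>\<^bsub>free_module R I\<^esub> free_basis R I m) \<in> K" by (rule submoduleD(3)[OF K gK])
    moreover have "f = g \<oplus>\<^bsub>free_module R I\<^esub> (f m \<odot>\<^bsub>free_module R I\<^esub> free_basis R I m)"
    proof (rule ext)
      fix i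
      show "f i = (g \<oplus>\<^bsub>free_module R I\<^esub> (f m \<odot>\<^bsub>free_module R I\<^esub> free_basis R I m)) i"
        using fi m PiE_arb[OF fE, of i] by (cases "i \<in> I") (auto simp: free_module_simps g_def free_basis_def)
    qed
    ultimately show ?case by simp
  qed
  from this[OF _ _ f, of "{i \<in> I. f i \<noteq> \<zero>\<^bsub>R\<^esub>}"] show ?thesis
    using f unfolding free_module_simps by blast
qed

text \<open>Values of a cocycle on the basis are coboundaries because the coresolution is exact;
  chosen primitives define the map on the free module.\<close>

lemma exv_free:
  assumes c: "cores R N E \<epsilon> d" shows "exv R (free_module R I) E d (Suc i)"
proof (rule exv_SucI)
  let ?F = "free_module R I"
  fix z assume z: "lin R ?F (E (Suc i)) z" "\<And>x. x \<in> carrier ?F \<Longrightarrow> d (Suc i) (z x) = \<zero>\<^bsub>E (Suc (Suc i))\<^esub>"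
  have cr: "cring R" by (rule module.axioms(1)[OF lin_dom[OF z(1)]])
  note bc = free_basis_carrier[OF cr]
  have "\<exists>y\<in>carrier (E i). d i y = z (free_basis R I m)" if m: "m \<in> I" for m
  proof -
    have "z (free_basis R I m) \<in> d i ` carrier (E i)"
      using cores_ker[OF c lin_closed[OF z(1) bc[OF m]]] z(2)[OF bc[OF m]] by simp
    then show ?thesis unfolding image_iff by metis
  qed
  then have "\<forall>m\<in>I. \<exists>y. y \<in> carrier (E i) \<and> d i y = z (free_basis R I m)" by (simp add: Bex_def)
  from bchoice[OF this] obtain y where y0: "\<forall>m\<in>I. y m \<in> carrier (E i) \<and> d i (y m) = z (free_basis R I m)" ..
  then have y: "\<And>m. m \<in> I \<Longrightarrow> y m \<in> carrier (E i)" "\<And>m. m \<in> I \<Longrightarrow> d i (y m) = z (free_basis R I m)"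
    by simp_all
  obtain w where w: "lin R ?F (E i) w" "\<And>m. m \<in> I \<Longrightarrow> w (free_basis R I m) = y m"
    by (rule free_lift_exists[OF cores_module[OF c, of i], of I y]) (erule y(1), rule that)
  interpret E: module R "E (Suc i)" by (rule cores_module[OF c])
  have ld: "lin R ?F (E (Suc i)) (\<lambda>x. d i (w x))" by (rule lin_comp[OF w(1) cores_d[OF c]])
  have l: "lin R ?F (E (Suc i)) (\<lambda>x. d i (w x) \<ominus>\<^bsub>E (Suc i)\<^esub> z x)" by (rule lin_minus_map[OF ld z(1)])
  have eq: "x \<in> a_kernel ?F (E (Suc i)) (\<lambda>x. d i (w x) \<ominus>\<^bsub>E (Suc i)\<^esub> z x) \<longleftrightarrow> d i (w x) = z x" if "x \<in> carrier ?F" for x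
    unfolding a_kernel_iff using that E.minus_eq_zero_iff[OF lin_closed[OF ld that] lin_closed[OF z(1) that]] by simp
  have "d i (w x) = z x" if x: "x \<in> carrier ?F" for x
    unfolding eq[OF x, symmetric]
    by (rule free_module_induct[OF cr submodule_kernel[OF l] _ x]) (use eq[OF bc] w(2) y(2) in simp)
  then show "\<exists>w. lin R ?F (E i) w \<and> (\<forall>x\<in>carrier ?F. d i (w x) = z x)" using w(1) by blast
qed

text \<open>A function of finite support is coded by a list that enumerates its graph over the
  support.\<close>

lemma card_free_module:
  fixes U :: "'u set"
  assumes U: "infinite U" "|I| \<le>o |U|" "|carrier R| \<le>o |U|"
  shows "|carrier (free_module R I)| \<le>o |U|"
proof -
  define enc where "enc f = (SOME l. l \<in> lists (I \<times> carrier R) \<and> set l = (\<lambda>i. (i, f i)) ` {i \<in> I. f i \<noteq> \<zero>\<^bsub>R\<^esub>})" for f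
  have enc: "enc f \<in> lists (I \<times> carrier R)" "set (enc f) = (\<lambda>i. (i, f i)) ` {i \<in> I. f i \<noteq> \<zero>\<^bsub>R\<^esub>}"
    if f: "f \<in> carrier (free_module R I)" for f
  proof -
    have "finite ((\<lambda>i. (i, f i)) ` {i \<in> I. f i \<noteq> \<zero>\<^bsub>R\<^esub>})" using f unfolding free_module_simps by simp
    then obtain l where "set l = (\<lambda>i. (i, f i)) ` {i \<in> I. f i \<noteq> \<zero>\<^bsub>R\<^esub>}" using finite_list by blast
    moreover from this have "l \<in> lists (I \<times> carrier R)" using f unfolding free_module_simps by auto
    ultimately have "\<exists>l. l \<in> lists (I \<times> carrier R) \<and> set l = (\<lambda>i. (i, f i)) ` {i \<in> I. f i \<noteq> \<zero>\<^bsub>R\<^esub>}" by blast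
    from someI_ex[OF this] show "enc f \<in> lists (I \<times> carrier R)" "set (enc f) = (\<lambda>i. (i, f i)) ` {i \<in> I. f i \<noteq> \<zero>\<^bsub>R\<^esub>}"
      by (simp_all add: enc_def)
  qed
  have "inj_on enc (carrier (free_module R I))"
  proof (rule inj_onI)
    fix f g assume f: "f \<in> carrier (free_module R I)" and g: "g \<in> carrier (free_module R I)" and eq: "enc f = enc g"
    have s: "(\<lambda>i. (i, f i)) ` {i \<in> I. f i \<noteq> \<zero>\<^bsub>R\<^esub>} = (\<lambda>i. (i, g i)) ` {i \<in> I. g i \<noteq> \<zero>\<^bsub>R\<^esub>}"
      using enc(2)[OF f] enc(2)[OF g] eq by simp
    have "f i = g i" if i: "i \<in> I" for i
    proof -
      have "f i \<noteq> \<zero>\<^bsub>R\<^esub> \<Longrightarrow> (i, f i) \<in> (\<lambda>i. (i, g i)) ` {i \<in> I. g i \<noteq> \<zero>\<^bsub>R\<^esub>}" unfolding s[symmetric] using i by blast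
      moreover have "g i \<noteq> \<zero>\<^bsub>R\<^esub> \<Longrightarrow> (i, g i) \<in> (\<lambda>i. (i, f i)) ` {i \<in> I. f i \<noteq> \<zero>\<^bsub>R\<^esub>}" unfolding s using i by blast
      ultimately show ?thesis by (cases "f i = \<zero>\<^bsub>R\<^esub>"; cases "g i = \<zero>\<^bsub>R\<^esub>") auto
    qed
    then show "f = g" using f g unfolding free_module_simps by (intro PiE_eqI[of f I _ g]) auto
  qed
  then have "|carrier (free_module R I)| \<le>o |lists (I \<times> carrier R)|"
    using enc(1) by (intro card_of_ordLeq[THEN iffD1]) blast
  also have "|lists (I \<times> carrier R)| \<le>o |U|"
    by (rule card_of_lists_infinite[OF U(1)]) (use U in \<open>intro card_of_Sigma_ordLeq_infinite, auto\<close>)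
  finally show ?thesis .
qed

text \<open>The free module on the elements of \<open>M\<close> is formed on a function type. As
  \<open>'u\<close> is infinite and no smaller than \<open>R\<close>, a copy fits \<open>'u\<close>,
  where the description of the class of \<open>C\<close> applies.\<close>

lemma free_cover_exists:
  fixes M :: "('r, 'u) module"
  assumes M: "module R M" and U: "infinite (UNIV :: 'u set)" "|carrier R| \<le>o |UNIV :: 'u set|"
    and c: "cores R N E \<epsilon> d"
  obtains F :: "('r, 'u) module" and \<beta> where "lin R F M \<beta>" "\<beta> ` carrier F = carrier M" "\<And>i. exv R F E d (Suc i)"
proof -
  have cr: "cring R" by (rule module.axioms(1)[OF M])
  let ?F = "free_module R (carrier M)"
  have mF: "module R ?F" by (rule module_free[OF cr])
  obtain u where u: "lin R ?F M u" "\<And>i. i \<in> carrier M \<Longrightarrow> u (free_basis R (carrier M) i) = i"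
    by (rule free_lift_exists[OF M, of "carrier M" "\<lambda>i. i"]) (assumption, rule that)
  have "|carrier ?F| \<le>o |UNIV :: 'u set|" by (rule card_free_module[OF U(1) card_of_mono1[OF subset_UNIV] U(2)])
  from transport_exists[OF mF this] obtain F :: "('r, 'u) module" and \<pi> \<rho> where
    F: "lin R ?F F \<pi>" "lin R F ?F \<rho>" "\<And>x. x \<in> carrier ?F \<Longrightarrow> \<rho> (\<pi> x) = x" "\<And>x. x \<in> carrier F \<Longrightarrow> \<pi> (\<rho> x) = x" by metis
  show thesis
  proof (rule that[OF lin_comp[OF F(2) u(1)]])
    show "(\<lambda>x. u (\<rho> x)) ` carrier F = carrier M"
    proof
      show "(\<lambda>x. u (\<rho> x)) ` carrier F \<subseteq> carrier M" using lin_closed[OF lin_comp[OF F(2) u(1)]] by blast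
      show "carrier M \<subseteq> (\<lambda>x. u (\<rho> x)) ` carrier F"
      proof
        fix m assume m: "m \<in> carrier M"
        have b: "free_basis R (carrier M) m \<in> carrier ?F" by (rule free_basis_carrier[OF cr m])
        show "m \<in> (\<lambda>x. u (\<rho> x)) ` carrier F"
          by (rule image_eqI[of _ _ "\<pi> (free_basis R (carrier M) m)"]) (use F(3)[OF b] u(2)[OF m] lin_closed[OF F(1) b] in simp_all)
      qed
    qed
    show "exv R F E d (Suc i)" for i
      by (rule exv_retract_first[OF cores_d[OF c] F(2) F(1) F(4) exv_free[OF c]])
  qed
qed

lemma ses_kernel:
  assumes b: "lin R B C \<beta>" "\<beta> ` carrier B = carrier C"
  shows "ses R (B\<lparr>carrier := a_kernel B C \<beta>\<rparr>) B C (\<lambda>x. x) \<beta>"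
  unfolding ses_def using b lin_incl[OF lin_dom[OF b(1)] submodule_kernel[OF b(1)]] by (auto simp: a_kernel_iff inj_on_def)

section \<open>Shifting a cotilting module\<close>

text \<open>\<open>Ext\<close> is translated into \<open>exv\<close> once and for all, so that
  coresolutions and types can be changed freely. The class of \<open>C\<close> is known for modules
  on \<open>'u\<close> only.\<close>

locale cotilting_data = cogenerated R W
  for R :: "('r, 'q) ring_scheme" and W :: "('r, 'u) module" +
  fixes C :: "('r, 'c) module" and Y :: "nat \<Rightarrow> 'r set set" and n :: nat
  assumes module_C: "module R C" and le_C: "|UNIV :: 'c set| \<le>o |UNIV :: 'u set|"
    and n2: "n \<ge> 2"
    and exv_power_C: "\<And>(K :: 'u set) i. exv R (mod_power K C) (inj_term R C) (inj_diff R C) (Suc i)"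
    and perp_C: "\<And>M :: ('r, 'u) module. module R M \<Longrightarrow>
      (\<forall>i. exv R M (inj_term R C) (inj_diff R C) (Suc i)) \<longleftrightarrow> M \<in> cot_class R n Y"
    and Y: "\<forall>i\<in>{1..n}. Y i \<subseteq> Spec R \<and> specialization_closed R (Y i)"
    and decreasing: "\<forall>i\<in>{1..<n}. Y (i + 1) \<subseteq> Y i"
begin

abbreviation "E \<equiv> inj_term R C"
abbreviation "d \<equiv> inj_diff R C"
abbreviation "quot p \<equiv> quot_module (regular_module R) p"
abbreviation "Y' \<equiv> \<lambda>i. Y (i + 1)"

lemma cores_C: "cores R C E (inj_aug R C) d"
  by (rule cores_min[OF module_C le_C])

lemma Y': "\<forall>i\<in>{1..n - 1}. Y' i \<subseteq> Spec R \<and> specialization_closed R (Y' i)"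
  and decreasing': "\<forall>i\<in>{1..<n - 1}. Y' (i + 1) \<subseteq> Y' i"
proof -
  show "\<forall>i\<in>{1..n - 1}. Y' i \<subseteq> Spec R \<and> specialization_closed R (Y' i)"
  proof
    fix i assume "i \<in> {1..n - 1}"
    then have "i + 1 \<in> {1..n}" by auto
    then show "Y' i \<subseteq> Spec R \<and> specialization_closed R (Y' i)" using Y by blast
  qed
  show "\<forall>i\<in>{1..<n - 1}. Y' (i + 1) \<subseteq> Y' i"
  proof
    fix i assume "i \<in> {1..<n - 1}"
    then have "i + 1 \<in> {1..<n}" by auto
    then show "Y' (i + 1) \<subseteq> Y' i" using decreasing by blast
  qed
qed

lemma Y_ideal: "i \<in> {1..n} \<Longrightarrow> p \<in> Y i \<Longrightarrow> ideal p R"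
  using Y unfolding Spec_def by (auto dest!: primeideal.axioms(1))

lemma Y_subset_Y2: assumes "i \<in> {2..n}" shows "Y i \<subseteq> Y 2"
proof -
  have "2 \<le> i" "i \<le> n" using assms by auto
  then show ?thesis
  proof (induction i rule: dec_induct)
    case (step k)
    then have "Y (Suc k) \<subseteq> Y k" using decreasing by auto
    then show ?case using step by simp
  qed simp
qed

lemma univ_le: "|UNIV :: 'u set| \<le>o |UNIV :: 'u set|"
  by (rule card_of_mono1) simp

lemma ring_le: "|carrier R| \<le>o |UNIV :: 'u set|"
  by (rule ordLeq_transitive[OF card_of_mono1[OF subset_UNIV] ring_le_univ])

lemmas in_class_iff = cot_class_iff[OF _ univ_le]

text \<open>\<open>C\<close> is a power of itself with one factor, so a copy of it lies in its own
  cotilting class. The condition on \<open>Y 2\<close> in degree 0, available since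
  \<open>n \<ge> 2\<close>, excludes torsion in \<open>C\<close>, hence in its envelope.\<close>

lemma torsion_free_E0: "torsion_free (E 0) (Y 2)"
proof -
  have "|carrier C| \<le>o |UNIV :: 'u set|" by (rule ordLeq_transitive[OF card_of_mono1[OF subset_UNIV] le_C])
  from transport_exists[OF module_C this] obtain Q :: "('r, 'u) module" and \<pi> \<rho> where
    Q: "lin R C Q \<pi>" "lin R Q C \<rho>" "\<And>x. x \<in> carrier C \<Longrightarrow> \<rho> (\<pi> x) = x" "\<And>x. x \<in> carrier Q \<Longrightarrow> \<pi> (\<rho> x) = x" by metis
  have mQ: "module R Q" by (rule lin_cod[OF Q(1)])
  let ?K = "{undefined :: 'u}"
  have s: "lin R Q (mod_power ?K C) (\<lambda>q. \<lambda>k\<in>?K. \<rho> q)" by (rule lin_power_tuple[OF mQ Q(2)])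
  have p: "lin R (mod_power ?K C) Q (\<lambda>x. \<pi> (x undefined))" by (rule lin_comp[OF lin_power_proj[OF module_C] Q(1)]) simp
  have "exv R Q E d (Suc i)" for i
    by (rule exv_retract_first[OF cores_d[OF cores_C] s p _ exv_power_C]) (use Q(4) in simp)
  then have "Q \<in> cot_class R n Y" using perp_C[OF mQ] by blast
  then have h: "\<forall>i\<in>{1..n}. \<forall>j<i. \<forall>p\<in>Y i. exv R (quot p) (inj_term R Q) (inj_diff R Q) j"
    unfolding in_class_iff[OF mQ Y decreasing] .
  have ex: "exv R (quot p) (inj_term R Q) (inj_diff R Q) 0" if "p \<in> Y 2" for p
    using h[rule_format, of 2 0 p] that n2 by simp
  have "\<forall>j<1. \<forall>p\<in>Y 2. exv R (quot p) E d j"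
    using exv_retract[OF cores_min[OF mQ univ_le] cores_C Q(1,2,3) ex] by simp
  then have "\<forall>j<1. torsion_free (E j) (Y 2)"
    using torsion_free_iff_exv[OF cring module_C minimal_min_cores[OF module_C le_C], of "Y 2" 1] Y_ideal[of 2] n2 by auto
  then show ?thesis by simp
qed

text \<open>Compare \<open>M\<close> with the kernel \<open>K\<close> of an epimorphism from a free module, which lies in both classes.\<close>

lemma perp_shift_iff:
  fixes M :: "('r, 'u) module"
  assumes M: "module R M"
  shows "(\<forall>i. exv R M E d (Suc (Suc i))) \<longleftrightarrow> M \<in> cot_class R (n - 1) Y'"
proof -
  obtain F :: "('r, 'u) module" and \<beta> where F: "lin R F M \<beta>" "\<beta> ` carrier F = carrier M" "\<And>i. exv R F E d (Suc i)"
    using free_cover_exists[OF M infinite_univ ring_le cores_C] by blast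
  let ?K = "F\<lparr>carrier := a_kernel F M \<beta>\<rparr>"
  note S = ses_kernel[OF F(1,2)]
  have mF: "module R F" and mK: "module R ?K" by (rule lin_dom[OF F(1)], rule lin_dom[OF sesD(1)[OF S]])
  note cF = cores_min[OF mF univ_le] and cK = cores_min[OF mK univ_le] and cM = cores_min[OF M univ_le]
  have "F \<in> cot_class R n Y" using perp_C[OF mF] F(3) by blast
  then have exF: "exv R (quot p) (inj_term R F) (inj_diff R F) j" if "i \<in> {1..n}" "j < i" "p \<in> Y i" for i j p
    unfolding in_class_iff[OF mF Y decreasing] using that by blast
  have "(\<forall>i. exv R M E d (Suc (Suc i))) \<longleftrightarrow> (\<forall>i. exv R ?K E d (Suc i))"
    using exv_cokernel[OF S cores_C _ F(3)] exv_kernel[OF S cores_C F(3)] by blast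
  also have "\<dots> \<longleftrightarrow> ?K \<in> cot_class R n Y" by (rule perp_C[OF mK])
  also have "\<dots> \<longleftrightarrow> M \<in> cot_class R (n - 1) Y'"
    unfolding in_class_iff[OF mK Y decreasing] in_class_iff[OF M Y' decreasing']
  proof
    assume K: "\<forall>i\<in>{1..n}. \<forall>j<i. \<forall>p\<in>Y i. exv R (quot p) (inj_term R ?K) (inj_diff R ?K) j"
    show "\<forall>i\<in>{1..n - 1}. \<forall>j<i. \<forall>p\<in>Y' i. exv R (quot p) (inj_term R M) (inj_diff R M) j"
    proof (intro ballI allI impI)
      fix i j p assume i: "i \<in> {1..n - 1}" and j: "j < i" and p: "p \<in> Y' i"
      \<comment> \<open>The condition on \<open>Y' i\<close> in degree \<open>j < i\<close> for
        \<open>M\<close> corresponds to the one on \<open>Y (i + 1)\<close> in degree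
        \<open>j + 1 < i + 1\<close> for \<open>?K\<close>.\<close>
      have i': "i + 1 \<in> {1..n}" using i by auto
      have "exv R (quot p) (inj_term R F) (inj_diff R F) j" using exF[OF i' _ p] j by simp
      moreover have "exv R (quot p) (inj_term R ?K) (inj_diff R ?K) (Suc j)" using K[rule_format, of "i + 1" "Suc j" p] i' j p by simp
      ultimately show "exv R (quot p) (inj_term R M) (inj_diff R M) j" by (rule exv_ses_quotient[OF S cK cF cM])
    qed
  next
    assume h: "\<forall>i\<in>{1..n - 1}. \<forall>j<i. \<forall>p\<in>Y' i. exv R (quot p) (inj_term R M) (inj_diff R M) j"
    show "\<forall>i\<in>{1..n}. \<forall>j<i. \<forall>p\<in>Y i. exv R (quot p) (inj_term R ?K) (inj_diff R ?K) j"
    proof (intro ballI allI impI)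
      fix i j p assume i: "i \<in> {1..n}" and j: "j < i" and p: "p \<in> Y i"
      have Fj: "exv R (quot p) (inj_term R F) (inj_diff R F) j" by (rule exF[OF i j p])
      show "exv R (quot p) (inj_term R ?K) (inj_diff R ?K) j"
      proof (cases j)
        case 0
        \<comment> \<open>Degree 0 has no counterpart for \<open>M\<close>; here a map into
          \<open>?K\<close> is a map into \<open>F\<close>, which belongs to the class of
          \<open>C\<close>.\<close>
        show ?thesis unfolding 0 exv_0_iff[OF cK]
        proof (intro allI impI ballI)
          fix z x assume z: "lin R (quot p) ?K z" and x: "x \<in> carrier (quot p)"
          then show "z x = \<zero>\<^bsub>?K\<^esub>" using Fj[unfolded 0 exv_0_iff[OF cF]] lin_comp[OF z sesD(1)[OF S]] by simp
        qed
      next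
        case (Suc k)
        have "i - 1 \<in> {1..n - 1}" "k < i - 1" "Y' (i - 1) = Y i" using i j Suc by auto
        then have "exv R (quot p) (inj_term R M) (inj_diff R M) k" using h p by blast
        then show ?thesis unfolding Suc by (rule exv_ses_sub[OF S cK cF cM Fj[unfolded Suc]])
      qed
    qed
  qed
  finally show ?thesis .
qed

text \<open>A small injective submodule has a copy on \<open>'u\<close> in the shifted class: maps
  from \<open>R/p\<close> vanish because all later \<open>Y i\<close> lie in \<open>Y 2\<close>, and
  higher Ext into an injective is zero. The equation for a primitive is a lifting problem, so it can
  be solved on all of \<open>I\<close> once it can on these submodules.\<close>

lemma exv_injective_torsion_free:
  fixes I :: "('r, 'i) module"
  assumes I: "baer R I" and t: "torsion_free I (Y 2)"
  shows "exv R I E d (Suc (Suc i))"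
proof (rule exv_SucI)
  fix z assume z: "lin R I (E (Suc (Suc i))) z" "\<And>x. x \<in> carrier I \<Longrightarrow> d (Suc (Suc i)) (z x) = \<zero>\<^bsub>E (Suc (Suc (Suc i)))\<^esub>"
  have mI: "module R I" by (rule baer_module[OF I])
  show "\<exists>w. lin R I (E (Suc i)) w \<and> (\<forall>x\<in>carrier I. d (Suc i) (w x) = z x)"
  proof (rule lift_from_small_injectives[OF cring noetherian I cores_d[OF cores_C] z(1) infinite_univ ring_le])
    fix H assume H: "submodule H R I" "baer R (I\<lparr>carrier := H\<rparr>)" "|H| \<le>o |UNIV :: 'u set|"
    let ?H = "I\<lparr>carrier := H\<rparr>"
    have mH: "module R ?H" by (rule baer_module[OF H(2)])
    have "|carrier ?H| \<le>o |UNIV :: 'u set|" using H(3) by simp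
    from transport_exists[OF mH this] obtain Q :: "('r, 'u) module" and \<pi> \<rho> where
      Q: "lin R ?H Q \<pi>" "lin R Q ?H \<rho>" "\<And>x. x \<in> carrier ?H \<Longrightarrow> \<rho> (\<pi> x) = x" "\<And>x. x \<in> carrier Q \<Longrightarrow> \<pi> (\<rho> x) = x" by metis
    have bQ: "baer R Q" by (rule baer_retract[OF H(2) Q(2,1)]) (rule Q(4))
    have mQ: "module R Q" by (rule baer_module[OF bQ])
    have "inj_on \<rho> (carrier Q)" using Q(4) by (rule inj_on_inverseI)
    then have tQ: "torsion_free Q (Y 2)"
      by (rule torsion_free_inj[OF torsion_free_submodule[OF t submoduleD(1)[OF H(1)]] Q(2)])
        (rule ideal_subset[OF Y_ideal[of 2]], use n2 in auto)
    have "Q \<in> cot_class R (n - 1) Y'"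
      unfolding in_class_iff[OF mQ Y' decreasing']
    proof (intro ballI allI impI)
      fix i j p assume i: "i \<in> {1..n - 1}" and p: "p \<in> Y' i"
      have i': "i + 1 \<in> {2..n}" "i + 1 \<in> {1..n}" using i by auto
      have p2: "p \<in> Y 2" using Y_subset_Y2[OF i'(1)] p by blast
      have pI: "ideal p R" by (rule Y_ideal[OF i'(2) p])
      show "exv R (quot p) (inj_term R Q) (inj_diff R Q) j"
      proof (cases j)
        case 0
        show ?thesis unfolding 0 exv_0_iff[OF cores_min[OF mQ univ_le]]
        proof (intro allI impI ballI)
          fix z x assume z: "lin R (quot p) Q z" and x: "x \<in> carrier (quot p)"
          show "z x = \<zero>\<^bsub>Q\<^esub>"
            by (rule torsion_freeD[OF tQ p2 lin_closed[OF z x] quot_regular_annihilated[OF cring pI z x]])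
        qed
      next
        case (Suc k)
        have "module R (quot p)"
          using lin_cod[OF lin_quot_module(1)[OF module_regular[OF cring]]] pI submodule_ideal_iff[OF cring] by blast
        then show ?thesis unfolding Suc by (rule exv_injective_cores[OF cores_min[OF mQ univ_le] bQ])
      qed
    qed
    then have exQ: "exv R Q E d (Suc (Suc i))" using perp_shift_iff[OF mQ] by blast
    have exH: "exv R ?H E d (Suc (Suc i))"
      by (rule exv_retract_first[OF cores_d[OF cores_C] Q(1) Q(2) _ exQ]) (erule Q(3))
    have "d (Suc (Suc i)) (z x) = \<zero>\<^bsub>E (Suc (Suc (Suc i)))\<^esub>" if "x \<in> carrier ?H" for x
      by (rule z(2)) (use submoduleD(5)[OF H(1)] that in simp)
    from exv_SucD[OF exH lin_restrict[OF z(1) H(1)] this]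
    obtain w where "lin R ?H (E (Suc i)) w" "\<And>x. x \<in> carrier ?H \<Longrightarrow> d (Suc i) (w x) = z x" by blast
    then show "\<exists>g. lin R ?H (E (Suc i)) g \<and> (\<forall>x\<in>H. d (Suc i) (g x) = z x)" by auto
  qed
qed

end

text \<open>The direct sum of the envelopes \<open>E(R/p)\<close> enters only through these
  properties: injectivity, absence of \<open>Y 2\<close>-torsion, and cogeneration of the torsion
  free injectives on \<open>'u\<close>.\<close>

locale shifted_cotilting = cotilting_data R W C Y n
  for R :: "('r, 'q) ring_scheme" and W :: "('r, 'u) module" and C :: "('r, 'c) module"
    and Y :: "nat \<Rightarrow> 'r set set" and n :: nat +
  fixes J :: "('r, 'j) module"
  assumes baer_J: "baer R J" and torsion_free_J: "torsion_free J (Y 2)"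
    and cogenerates_J: "\<And>(I :: ('r, 'u) module) x. \<lbrakk>baer R I; torsion_free I (Y 2); x \<in> carrier I; x \<noteq> \<zero>\<^bsub>I\<^esub>\<rbrakk> \<Longrightarrow>
      \<exists>f. lin R I J f \<and> f x \<noteq> \<zero>\<^bsub>J\<^esub>"
begin

abbreviation "V1 \<equiv> (E (Suc 0))\<lparr>carrier := d 0 ` carrier (E 0)\<rparr>"
abbreviation "D \<equiv> dir_sum2 V1 J"
abbreviation "ED \<equiv> \<lambda>i. dir_sum2 (E (Suc i)) (inj_cores J i)"
abbreviation "dD \<equiv> \<lambda>i. map_prod (d (Suc i)) (\<lambda>_. undefined)"

lemma cores_V1: "cores R V1 (\<lambda>i. E (Suc i)) (\<lambda>x. x) (\<lambda>i. d (Suc i))"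
  by (rule cores_cosyzygy[OF cores_C])

lemma cores_D: "cores R D ED (map_prod (\<lambda>x. x) (\<lambda>x. x)) dD"
  by (rule cores_dir_sum2[OF cores_V1 cores_injective[OF baer_J]])

lemma module_V1: "module R V1"
  by (rule lin_dom[OF cores_aug[OF cores_V1]])

lemma module_J: "module R J"
  by (rule baer_module[OF baer_J])

lemma module_D: "module R D"
  by (rule module_dir_sum2[OF module_V1 module_J])

lemma exv_D_iff:
  assumes M: "module R M" shows "exv R M ED dD (Suc i) \<longleftrightarrow> exv R M E d (Suc (Suc i))"
proof
  interpret V: module R V1 by (rule module_V1)
  interpret J: module R J by (rule module_J)
  have s: "lin R V1 D (\<lambda>x. (x, \<zero>\<^bsub>J\<^esub>))" by (rule lin_pair[OF lin_id[OF module_V1] lin_zero_map[OF module_V1 module_J]])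
  have p: "lin R D V1 fst" by (rule lin_fst[OF module_V1 module_J])
  assume "exv R M ED dD (Suc i)"
  from exv_retract[OF cores_D cores_V1 s p _ this]
  show "exv R M E d (Suc (Suc i))" unfolding exv_shift[symmetric] by simp
next
  assume "exv R M E d (Suc (Suc i))"
  then have "exv R M (\<lambda>i. E (Suc i)) (\<lambda>i. d (Suc i)) (Suc i)" unfolding exv_shift .
  then show "exv R M ED dD (Suc i)"
    by (rule exv_dir_sum2[OF cores_V1 cores_injective[OF baer_J] _ exv_injective[OF baer_J M]])
qed

text \<open>In the exact sequence \<open>0 \<rightarrow> C\<^sup>K \<rightarrow> (E\<^sub>0(C)
  \<oplus> J)\<^sup>K \<rightarrow> D\<^sup>K \<rightarrow> 0\<close> the middle term has no
  \<open>Ext\<^sup>i\<^sup>+\<^sup>2\<close> into \<open>C\<close> and the left one no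
  \<open>Ext\<^sup>i\<^sup>+\<^sup>1\<close>; hence
  \<open>Ext\<^sup>i\<^sup>+\<^sup>2(D\<^sup>K, C)\<close>, that is
  \<open>Ext\<^sup>i\<^sup>+\<^sup>1(D\<^sup>K, D)\<close>, vanishes.\<close>

lemma exv_power_D: "exv R (mod_power (K :: 'u set) D) ED dD (Suc i)"
proof -
  let ?Q = "dir_sum2 (E 0) J"
  note mE = cores_module[OF cores_C]
  note ea = cores_aug[OF cores_C]
  have bQ: "baer R ?Q" by (rule baer_dir_sum2[OF cores_baer[OF cores_C] baer_J])
  have mQ: "module R ?Q" by (rule baer_module[OF bQ])
  have dV: "lin R (E 0) V1 (d 0)" by (rule lin_corestrict[OF cores_d[OF cores_C] submodule_range[OF cores_d[OF cores_C]]]) simp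
  let ?a = "\<lambda>x. (inj_aug R C x, \<zero>\<^bsub>J\<^esub>)" and ?b = "map_prod (d 0) (\<lambda>x. x)"
  have la: "lin R C ?Q ?a" by (rule lin_pair[OF ea lin_zero_map[OF module_C module_J]])
  have lb: "lin R ?Q D ?b" by (rule lin_map_prod[OF dV lin_id[OF module_J]])
  have "ses R (mod_power K C) (mod_power K ?Q) (mod_power K D) (\<lambda>x. \<lambda>k\<in>K. ?a (x k)) (\<lambda>x. \<lambda>k\<in>K. ?b (x k))"
    unfolding ses_def
  proof (intro conjI ballI)
    show "lin R (mod_power K C) (mod_power K ?Q) (\<lambda>x. \<lambda>k\<in>K. ?a (x k))" by (rule lin_power_map[OF la])
    show "lin R (mod_power K ?Q) (mod_power K D) (\<lambda>x. \<lambda>k\<in>K. ?b (x k))" by (rule lin_power_map[OF lb])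
    show "inj_on (\<lambda>x. \<lambda>k\<in>K. ?a (x k)) (carrier (mod_power K C))"
    proof (rule inj_onI)
      fix x y assume x: "x \<in> carrier (mod_power K C)" and y: "y \<in> carrier (mod_power K C)"
        and eq: "(\<lambda>k\<in>K. ?a (x k)) = (\<lambda>k\<in>K. ?a (y k))"
      have "x k = y k" if k: "k \<in> K" for k
      proof -
        have "x k \<in> carrier C" "y k \<in> carrier C" using x y k by auto
        moreover have "inj_aug R C (x k) = inj_aug R C (y k)" using fun_cong[OF eq, of k] k by simp
        ultimately show ?thesis using cores_inj[OF cores_C] by (simp add: inj_on_def)
      qed
      then show "x = y" using x y by (intro PiE_eqI[of x K "\<lambda>_. carrier C" y]) simp_all
    qed
    show "(\<lambda>x. \<lambda>k\<in>K. ?b (x k)) ` carrier (mod_power K ?Q) = carrier (mod_power K D)"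
    proof
      show "carrier (mod_power K D) \<subseteq> (\<lambda>x. \<lambda>k\<in>K. ?b (x k)) ` carrier (mod_power K ?Q)"
      proof
        fix x assume x: "x \<in> carrier (mod_power K D)"
        then have x': "x \<in> (\<Pi>\<^sub>E k\<in>K. carrier D)" by simp
        have "x k \<in> ?b ` carrier ?Q" if k: "k \<in> K" for k
        proof -
          have "x k \<in> carrier D" using PiE_mem[OF x' k] .
          then obtain e where "fst (x k) = d 0 e" "e \<in> carrier (E 0)" "snd (x k) \<in> carrier J" by auto
          then show ?thesis by (intro image_eqI[of _ _ "(e, snd (x k))"]) (simp_all add: prod_eq_iff)
        qed
        then show "x \<in> (\<lambda>x. \<lambda>k\<in>K. ?b (x k)) ` carrier (mod_power K ?Q)"
          unfolding mod_power_simps(1) power_map_image[OF x'] by blast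
      qed
    qed (use lin_closed[OF lin_power_map[OF lb]] in blast)
    fix x assume x: "x \<in> carrier (mod_power K ?Q)"
    then have x': "x \<in> (\<Pi>\<^sub>E k\<in>K. carrier ?Q)" by simp
    have "?b (x k) = \<zero>\<^bsub>D\<^esub> \<longleftrightarrow> x k \<in> ?a ` carrier C" if k: "k \<in> K" for k
    proof -
      have "x k \<in> carrier ?Q" using PiE_mem[OF x' k] .
      then have xk: "fst (x k) \<in> carrier (E 0)" "snd (x k) \<in> carrier J" by auto
      have "?b (x k) = \<zero>\<^bsub>D\<^esub> \<longleftrightarrow> d 0 (fst (x k)) = \<zero>\<^bsub>E (Suc 0)\<^esub> \<and> snd (x k) = \<zero>\<^bsub>J\<^esub>"
        by (simp add: map_prod_def case_prod_beta)
      also have "\<dots> \<longleftrightarrow> x k \<in> ?a ` carrier C"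
        unfolding cores_ker0[OF cores_C xk(1)] by (cases "x k") auto
      finally show ?thesis .
    qed
    then have "(\<forall>k\<in>K. ?b (x k) = \<zero>\<^bsub>D\<^esub>) \<longleftrightarrow> (\<forall>k\<in>K. x k \<in> ?a ` carrier C)" by blast
    moreover have "(\<lambda>k\<in>K. ?b (x k)) = \<zero>\<^bsub>mod_power K D\<^esub> \<longleftrightarrow> (\<forall>k\<in>K. ?b (x k) = \<zero>\<^bsub>D\<^esub>)"
      unfolding mod_power_simps(2) restrict_def fun_eq_iff by auto
    moreover have "x \<in> (\<lambda>x. \<lambda>k\<in>K. ?a (x k)) ` carrier (mod_power K C) \<longleftrightarrow> (\<forall>k\<in>K. x k \<in> ?a ` carrier C)"
      unfolding mod_power_simps(1) by (rule power_map_image[OF x'])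
    ultimately show "(\<lambda>k\<in>K. ?b (x k)) = \<zero>\<^bsub>mod_power K D\<^esub> \<longleftrightarrow> x \<in> (\<lambda>x. \<lambda>k\<in>K. ?a (x k)) ` carrier (mod_power K C)"
      by blast
  qed
  moreover have "exv R (mod_power K ?Q) E d (Suc (Suc i))"
    by (rule exv_injective_torsion_free[OF baer_mod_power[OF bQ] torsion_free_power[OF torsion_free_dir_sum2[OF torsion_free_E0 torsion_free_J]]])
  ultimately have "exv R (mod_power K D) E d (Suc (Suc i))"
    using exv_cokernel[OF _ cores_C exv_power_C] by blast
  then show ?thesis unfolding exv_D_iff[OF module_mod_power[OF module_D]] .
qed

end

section \<open>Resolutions by summands of powers\<close>

text \<open>A section with a retraction, unlike an internal decomposition, composes well and crosses
  types.\<close>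

lemma direct_summand_retract:
  assumes P: "module R P" and M: "module R M" and ds: "direct_summand R M P"
  obtains s p where "lin R M P s" "lin R P M p" "\<And>x. x \<in> carrier M \<Longrightarrow> p (s x) = x"
proof -
  interpret P: module R P by fact
  obtain A B f where A: "submodule A R P" and B: "submodule B R P" and AB: "A \<inter> B = {\<zero>\<^bsub>P\<^esub>}"
    and sum: "A <+>\<^bsub>P\<^esub> B = carrier P" and f: "f \<in> mod_hom R M (P\<lparr>carrier := A\<rparr>)" "bij_betw f (carrier M) A"
    using ds by (auto simp: direct_summand_def mod_isomorphic_def)
  let ?A = "P\<lparr>carrier := A\<rparr>" and ?B = "P\<lparr>carrier := B\<rparr>"
  have mA: "module R ?A" and mB: "module R ?B" by (rule submodule_module[OF P A], rule submodule_module[OF P B])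
  have lf: "lin R M ?A f" by (rule mod_hom_lin[OF f(1) M mA])
  let ?S = "dir_sum2 ?A ?B"
  let ?a = "\<lambda>z. fst z \<oplus>\<^bsub>P\<^esub> snd z"
  have la: "lin R ?S P ?a"
    by (rule lin_add_map[OF lin_comp[OF lin_fst[OF mA mB] lin_incl[OF P A]] lin_comp[OF lin_snd[OF mA mB] lin_incl[OF P B]]])
  have "z = \<zero>\<^bsub>?S\<^esub>" if z: "z \<in> carrier ?S" "?a z = \<zero>\<^bsub>P\<^esub>" for z
  proof -
    have zc: "fst z \<in> A" "snd z \<in> B" using z(1) by auto
    have c: "fst z \<in> carrier P" "snd z \<in> carrier P" using submoduleD(5)[OF A zc(1)] submoduleD(5)[OF B zc(2)] by auto
    have "snd z \<oplus>\<^bsub>P\<^esub> fst z = \<zero>\<^bsub>P\<^esub>" using z(2) P.a_comm[OF c] by simp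
    then have "snd z = \<ominus>\<^bsub>P\<^esub> fst z" using P.minus_equality[OF _ c] by simp
    then have "snd z \<in> A" using submoduleD(6)[OF A zc(1)] by simp
    then have "snd z = \<zero>\<^bsub>P\<^esub>" using zc(2) AB by blast
    then show ?thesis using z(2) c by (simp add: prod_eq_iff)
  qed
  then have ia: "inj_on ?a (carrier ?S)" unfolding lin_inj_iff[OF la] by blast
  have range: "?a ` carrier ?S = carrier P"
  proof
    show "?a ` carrier ?S \<subseteq> carrier P" using lin_closed[OF la] by blast
    show "carrier P \<subseteq> ?a ` carrier ?S"
    proof
      fix x assume "x \<in> carrier P"
      then obtain a b where ab: "x = a \<oplus>\<^bsub>P\<^esub> b" "a \<in> A" "b \<in> B" unfolding sum[symmetric] set_add_def' by blast
      show "x \<in> ?a ` carrier ?S" by (rule image_eqI[of _ _ "(a, b)"]) (use ab in simp_all)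
    qed
  qed
  obtain h where h0: "lin R (P\<lparr>carrier := ?a ` carrier ?S\<rparr>) ?S h" "\<And>x. x \<in> carrier ?S \<Longrightarrow> h (?a x) = x"
    using lin_inv[OF la ia] by blast
  have h: "lin R P ?S h" using h0(1) unfolding range by simp
  obtain i where i: "lin R (?A\<lparr>carrier := f ` carrier M\<rparr>) M i" "\<And>x. x \<in> carrier M \<Longrightarrow> i (f x) = x"
    using lin_inv[OF lf bij_betw_imp_inj_on[OF f(2)]] by blast
  have "f ` carrier M = A" using f(2) by (rule bij_betw_imp_surj_on)
  then have i': "lin R ?A M i" using i(1) by simp
  show thesis
  proof (rule that)
    show "lin R M P f" by (rule lin_comp[OF lf lin_incl[OF P A]])
    show "lin R P M (\<lambda>x. i (fst (h x)))" by (rule lin_comp[OF lin_comp[OF h lin_fst[OF mA mB]] i'])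
    fix x assume x: "x \<in> carrier M"
    have fA: "f x \<in> A" using lin_closed[OF lf x] by simp
    have "h (?a (f x, \<zero>\<^bsub>P\<^esub>)) = (f x, \<zero>\<^bsub>P\<^esub>)" by (rule h0(2)) (use fA submoduleD(2)[OF B] in simp)
    then have "h (f x) = (f x, \<zero>\<^bsub>P\<^esub>)" using submoduleD(5)[OF A fA] by simp
    then show "i (fst (h (f x))) = x" using i(2)[OF x] by simp
  qed
qed

lemma retract_direct_summand:
  assumes s: "lin R M P s" and p: "lin R P M p" and ps: "\<And>x. x \<in> carrier M \<Longrightarrow> p (s x) = x"
  shows "direct_summand R M P"
  unfolding direct_summand_def
proof (intro exI conjI)
  interpret P: module R P by (rule lin_cod[OF s])
  interpret M: module R M by (rule lin_dom[OF s])
  show A: "submodule (s ` carrier M) R P" by (rule submodule_range[OF s])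
  show B: "submodule (a_kernel P M p) R P" by (rule submodule_kernel[OF p])
  note sc = lin_closed[OF s] and pc = lin_closed[OF p]
  show "s ` carrier M \<inter> a_kernel P M p = {\<zero>\<^bsub>P\<^esub>}"
  proof
    show "s ` carrier M \<inter> a_kernel P M p \<subseteq> {\<zero>\<^bsub>P\<^esub>}" using ps lin_zero[OF s] by (auto simp: a_kernel_iff)
    show "{\<zero>\<^bsub>P\<^esub>} \<subseteq> s ` carrier M \<inter> a_kernel P M p" using submoduleD(2)[OF A] submoduleD(2)[OF B] by blast
  qed
  show "s ` carrier M <+>\<^bsub>P\<^esub> a_kernel P M p = carrier P"
  proof
    show "s ` carrier M <+>\<^bsub>P\<^esub> a_kernel P M p \<subseteq> carrier P"
      using sc by (auto simp: set_add_def' a_kernel_iff)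
    show "carrier P \<subseteq> s ` carrier M <+>\<^bsub>P\<^esub> a_kernel P M p"
    proof
      fix x assume x: "x \<in> carrier P"
      have c: "s (p x) \<in> carrier P" by (rule sc[OF pc[OF x]])
      have "p (x \<ominus>\<^bsub>P\<^esub> s (p x)) = \<zero>\<^bsub>M\<^esub>"
        using lin_minus[OF p x c] ps[OF pc[OF x]] pc[OF x] by (simp add: M.minus_eq_zero_iff)
      then have "x \<ominus>\<^bsub>P\<^esub> s (p x) \<in> a_kernel P M p" using x c by (simp add: a_kernel_iff)
      moreover have "x = s (p x) \<oplus>\<^bsub>P\<^esub> (x \<ominus>\<^bsub>P\<^esub> s (p x))" using x c by algebra
      moreover have "s (p x) \<in> s ` carrier M" using pc[OF x] by blast
      ultimately show "x \<in> s ` carrier M <+>\<^bsub>P\<^esub> a_kernel P M p" unfolding set_add_def' by blast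
    qed
  qed
  have "lin R M (P\<lparr>carrier := s ` carrier M\<rparr>) s" by (rule lin_corestrict[OF s A]) simp
  from lin_mod_hom[OF this] have 1: "restrict s (carrier M) \<in> mod_hom R M (P\<lparr>carrier := s ` carrier M\<rparr>)" .
  have "inj_on s (carrier M)" by (rule inj_on_inverseI) (rule ps)
  then have "bij_betw (restrict s (carrier M)) (carrier M) (carrier (P\<lparr>carrier := s ` carrier M\<rparr>))"
    by (simp add: bij_betw_def inj_on_def)
  then show "mod_isomorphic R M (P\<lparr>carrier := s ` carrier M\<rparr>)"
    unfolding mod_isomorphic_def by (rule bexI[OF _ 1])
qed

text \<open>A finite exact sequence ending in \<open>N\<close> with terms satisfying
  \<open>\<P>\<close>, encoded by its first epimorphism and the recursively resolved kernel
  \<open>B\<close>. This suits induction, while the indexed sequence of \<open>cotilting\<close> is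
  produced only at the end.\<close>

inductive finitely_resolved ::
  "('r, 'q) ring_scheme \<Rightarrow> (('r, 'u) module \<Rightarrow> bool) \<Rightarrow> ('r, 'u) module \<Rightarrow> bool"
  for R :: "('r, 'q) ring_scheme" and \<P> :: "('r, 'u) module \<Rightarrow> bool" where
  base: "\<P> N \<Longrightarrow> finitely_resolved R \<P> N"
| step: "\<P> P \<Longrightarrow> ses R B P N \<alpha> \<beta> \<Longrightarrow> finitely_resolved R \<P> B \<Longrightarrow> finitely_resolved R \<P> N"

section \<open>Summands of powers of \<open>D\<close>\<close>

context shifted_cotilting
begin

abbreviation "DU \<equiv> mod_power (UNIV :: 'u set) D"

text \<open>A summand of a power of \<open>D\<close> with one fixed exponent, the whole universe:
  being infinite, it has room for two copies of itself, so direct sums stay inside.\<close>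

definition retD :: "('r, 'x) module \<Rightarrow> bool" where
  "retD X \<longleftrightarrow> (\<exists>s p. lin R X DU s \<and> lin R DU X p \<and> (\<forall>x\<in>carrier X. p (s x) = x))"

lemma module_DU: "module R DU"
  by (rule module_mod_power[OF module_D])

lemma retD_module: "retD X \<Longrightarrow> module R X"
  unfolding retD_def using lin_dom by blast

lemma retDI: "lin R X DU s \<Longrightarrow> lin R DU X p \<Longrightarrow> (\<And>x. x \<in> carrier X \<Longrightarrow> p (s x) = x) \<Longrightarrow> retD X"
  unfolding retD_def by blast

lemma retD_retract:
  assumes X: "retD X" and s: "lin R X' X s" and p: "lin R X X' p" and ps: "\<And>x. x \<in> carrier X' \<Longrightarrow> p (s x) = x"
  shows "retD X'"
proof -
  obtain s1 p1 where 1: "lin R X DU s1" "lin R DU X p1" "\<forall>x\<in>carrier X. p1 (s1 x) = x" using X unfolding retD_def by blast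
  show ?thesis
    by (rule retDI[OF lin_comp[OF s 1(1)] lin_comp[OF 1(2) p]]) (use 1(3) ps lin_closed[OF s] in simp)
qed

lemma retD_dir_sum2:
  assumes X: "retD X" and X': "retD X'" shows "retD (dir_sum2 X X')"
proof -
  obtain s1 p1 where 1: "lin R X DU s1" "lin R DU X p1" "\<And>x. x \<in> carrier X \<Longrightarrow> p1 (s1 x) = x" using X unfolding retD_def by blast
  obtain s2 p2 where 2: "lin R X' DU s2" "lin R DU X' p2" "\<And>x. x \<in> carrier X' \<Longrightarrow> p2 (s2 x) = x" using X' unfolding retD_def by blast
  note m = retD_module[OF X] retD_module[OF X']
  have "|UNIV :: ('u + 'u) set| \<le>o |UNIV :: 'u set|"
    using ordIso_imp_ordLeq[OF card_of_Plus_infinite1[OF infinite_univ univ_le]] by simp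
  then obtain \<iota> :: "'u + 'u \<Rightarrow> 'u" where \<iota>: "inj \<iota>" by (metis card_of_ordLeq)
  \<comment> \<open>Outside the range of \<open>\<iota>\<close> the value of \<open>inv_into\<close>
    is arbitrary; this is harmless, as \<open>p\<close> reads only coordinates in the range.\<close>
  define s where "s z = (\<lambda>u\<in>UNIV. case inv_into UNIV \<iota> u of Inl v \<Rightarrow> s1 (fst z) v | Inr v \<Rightarrow> s2 (snd z) v)" for z
  define p where "p z = (p1 (\<lambda>v\<in>UNIV. z (\<iota> (Inl v))), p2 (\<lambda>v\<in>UNIV. z (\<iota> (Inr v))))" for z
  note pr = lin_power_proj[OF module_D]
  show ?thesis
  proof (rule retDI)
    show "lin R (dir_sum2 X X') DU s"
      unfolding s_def
    proof (rule lin_power_tuple[OF module_dir_sum2[OF m]])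
      fix u :: 'u
      show "lin R (dir_sum2 X X') D (\<lambda>z. case inv_into UNIV \<iota> u of Inl v \<Rightarrow> s1 (fst z) v | Inr v \<Rightarrow> s2 (snd z) v)"
        using lin_comp[OF lin_comp[OF lin_fst[OF m] 1(1)] pr] lin_comp[OF lin_comp[OF lin_snd[OF m] 2(1)] pr]
        by (cases "inv_into UNIV \<iota> u") simp_all
    qed
    have re: "lin R DU DU (\<lambda>z. \<lambda>v\<in>UNIV. z (g v))" for g :: "'u \<Rightarrow> 'u"
      by (rule lin_power_tuple[OF module_DU]) (rule pr, simp)
    show "lin R DU (dir_sum2 X X') p"
      unfolding p_def by (rule lin_pair[OF lin_comp[OF re 1(2)] lin_comp[OF re 2(2)]])
    fix z assume z: "z \<in> carrier (dir_sum2 X X')"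
    have "(\<lambda>v\<in>UNIV. s z (\<iota> (Inl v))) = s1 (fst z)" "(\<lambda>v\<in>UNIV. s z (\<iota> (Inr v))) = s2 (snd z)"
      by (auto simp: s_def inv_into_f_f[OF \<iota>])
    then show "p (s z) = z" using 1(3) 2(3) z by (auto simp: p_def)
  qed
qed

lemma exv_retD_D:
  assumes "retD V" shows "exv R V ED dD (Suc i)"
proof -
  obtain s p where 1: "lin R V DU s" "lin R DU V p" "\<And>x. x \<in> carrier V \<Longrightarrow> p (s x) = x" using assms unfolding retD_def by blast
  show ?thesis by (rule exv_retract_first[OF cores_d[OF cores_D] 1(1,2) _ exv_power_D]) (erule 1(3))
qed

lemma exv_retD:
  assumes "retD V" "retD X" "cores R X F \<zeta> e" shows "exv R V F e (Suc i)"
proof -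
  obtain s p where 1: "lin R X DU s" "lin R DU X p" "\<And>x. x \<in> carrier X \<Longrightarrow> p (s x) = x" using assms(2) unfolding retD_def by blast
  show ?thesis
    by (rule exv_retract[OF cores_power[OF cores_D] assms(3) 1(1,2) _ exv_power[OF cores_D exv_retD_D[OF assms(1)]]]) (erule 1(3))
qed

text \<open>Each element \<open>x\<close> of the universe gets a map \<open>f x\<close> into
  \<open>J\<close> that does not kill it, so the elements themselves index an embedding into a power
  of \<open>J\<close>; it splits because \<open>I\<close> is injective.\<close>

lemma retD_injective:
  fixes I :: "('r, 'u) module"
  assumes I: "baer R I" and t: "torsion_free I (Y 2)"
  shows "retD I"
proof -
  have mI: "module R I" by (rule baer_module[OF I])
  have "\<exists>f. lin R I J f \<and> (x \<in> carrier I \<and> x \<noteq> \<zero>\<^bsub>I\<^esub> \<longrightarrow> f x \<noteq> \<zero>\<^bsub>J\<^esub>)" for x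
  proof (cases "x \<in> carrier I \<and> x \<noteq> \<zero>\<^bsub>I\<^esub>")
    case True
    then show ?thesis using cogenerates_J[OF I t, of x] by blast
  next
    case False
    then show ?thesis using lin_zero_map[OF mI module_J] by blast
  qed
  then have "\<forall>x. \<exists>f. lin R I J f \<and> (x \<in> carrier I \<and> x \<noteq> \<zero>\<^bsub>I\<^esub> \<longrightarrow> f x \<noteq> \<zero>\<^bsub>J\<^esub>)" ..
  from choice[OF this] obtain f where f': "\<forall>x. lin R I J (f x) \<and> (x \<in> carrier I \<and> x \<noteq> \<zero>\<^bsub>I\<^esub> \<longrightarrow> f x x \<noteq> \<zero>\<^bsub>J\<^esub>)" ..
  have f: "\<And>x. lin R I J (f x)" "\<And>x. x \<in> carrier I \<Longrightarrow> x \<noteq> \<zero>\<^bsub>I\<^esub> \<Longrightarrow> f x x \<noteq> \<zero>\<^bsub>J\<^esub>"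
    using f' by simp_all
  have s: "lin R I DU (\<lambda>i. \<lambda>u\<in>UNIV. (\<zero>\<^bsub>V1\<^esub>, f u i))"
    by (rule lin_power_tuple[OF mI]) (rule lin_pair[OF lin_zero_map[OF mI module_V1] f(1)])
  have "inj_on (\<lambda>i. \<lambda>u\<in>UNIV. (\<zero>\<^bsub>V1\<^esub>, f u i)) (carrier I)"
    unfolding lin_inj_iff[OF s]
  proof (intro ballI impI)
    fix x assume x: "x \<in> carrier I" and eq: "(\<lambda>u\<in>UNIV. (\<zero>\<^bsub>V1\<^esub>, f u x)) = \<zero>\<^bsub>DU\<^esub>"
    have "f x x = \<zero>\<^bsub>J\<^esub>" using fun_cong[OF eq, of x] by simp
    then show "x = \<zero>\<^bsub>I\<^esub>" using f(2) x by blast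
  qed
  from baer_split[OF I s this] obtain p where "lin R DU I p" "\<And>x. x \<in> carrier I \<Longrightarrow> p (\<lambda>u\<in>UNIV. (\<zero>\<^bsub>V1\<^esub>, f u x)) = x" by blast
  then show ?thesis using retDI[OF s] by blast
qed

lemma retD_V1_power: "retD (mod_power (K :: 'u set) V1)"
proof (rule retDI)
  interpret V: module R V1 by (rule module_V1)
  have mK: "module R (mod_power K V1)" by (rule module_mod_power[OF module_V1])
  show "lin R (mod_power K V1) DU (\<lambda>a. \<lambda>u\<in>UNIV. (if u \<in> K then a u else \<zero>\<^bsub>V1\<^esub>, \<zero>\<^bsub>J\<^esub>))"
  proof (rule lin_power_tuple[OF mK], rule lin_pair[OF _ lin_zero_map[OF mK module_J]])
    fix u
    show "lin R (mod_power K V1) V1 (\<lambda>a. if u \<in> K then a u else \<zero>\<^bsub>V1\<^esub>)"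
      using lin_power_proj[OF module_V1, of u K] lin_zero_map[OF mK module_V1] by (cases "u \<in> K") simp_all
  qed
  show "lin R DU (mod_power K V1) (\<lambda>z. \<lambda>k\<in>K. fst (z k))"
    by (rule lin_power_tuple[OF module_DU], rule lin_comp[OF lin_power_proj[OF module_D] lin_fst[OF module_V1 module_J]]) simp
  fix a assume "a \<in> carrier (mod_power K V1)"
  then have a: "a \<in> (\<Pi>\<^sub>E k\<in>K. carrier V1)" by simp
  show "(\<lambda>k\<in>K. fst ((\<lambda>u\<in>UNIV. (if u \<in> K then a u else \<zero>\<^bsub>V1\<^esub>, \<zero>\<^bsub>J\<^esub>)) k)) = a"
    by (rule ext) (use PiE_arb[OF a] in \<open>simp add: restrict_def\<close>)
qed

text \<open>An embedding of a summand of \<open>C\<^sup>K\<close> into an injective submodule of \<open>E\<^sub>0(C)\<^sup>K\<close> need not be an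
  injective envelope.  The two maps between its cokernel \<open>V\<close> and \<open>\<mho>\<^sub>1(C)\<^sup>K\<close> compose to the identity
  only up to a map that factors through the injective module.\<close>

lemma injective_embedding_of_summand:
  fixes X :: "('r, 'u) module"
  assumes s: "lin R X (mod_power (K :: 'u set) C) s" and p: "lin R (mod_power K C) X p"
    and ps: "\<And>x. x \<in> carrier X \<Longrightarrow> p (s x) = x"
  obtains I V :: "('r, 'u) module" and \<iota> \<pi> where "baer R I" "retD I" "ses R X I V \<iota> \<pi>" "retD V"
proof -
  let ?E = "mod_power K (E 0)" and ?eK = "\<lambda>x. \<lambda>k\<in>K. inj_aug R C (x k)" and ?dK = "\<lambda>x. \<lambda>k\<in>K. d 0 (x k)"
  let ?V1K = "mod_power K V1"
  note cK = cores_power[OF cores_C, of K]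
  note eK = cores_aug[OF cK] and ieK = cores_inj[OF cK]
  have bE: "baer R ?E" by (rule cores_baer[OF cK])
  have mE: "module R ?E" by (rule baer_module[OF bE])
  have tE: "torsion_free ?E (Y 2)" by (rule torsion_free_power[OF torsion_free_E0])
  have mX: "module R X" by (rule lin_dom[OF s])
  let ?j = "\<lambda>x. ?eK (s x)"
  have lj: "lin R X ?E ?j" by (rule lin_comp[OF s eK])
  have inj_s: "inj_on s (carrier X)" by (rule inj_on_inverseI) (rule ps)
  have ij: "inj_on ?j (carrier X)"
  proof (rule inj_onI)
    fix x y assume x: "x \<in> carrier X" and y: "y \<in> carrier X" and eq: "?j x = ?j y"
    have "s x = s y" by (rule inj_onD[OF ieK eq lin_closed[OF s x] lin_closed[OF s y]])
    then show "x = y" using inj_onD[OF inj_s _ x y] by blast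
  qed
  \<comment> \<open>The power of \<open>E 0\<close> lives on a larger type; an injective submodule
    around the image of \<open>X\<close> that fits \<open>'u\<close> replaces it.\<close>
  have "|?j ` carrier X| \<le>o |UNIV :: 'u set|" by (rule ordLeq_transitive[OF card_of_image card_of_mono1[OF subset_UNIV]])
  then obtain H where H: "submodule H R ?E" "baer R (?E\<lparr>carrier := H\<rparr>)" "?j ` carrier X \<subseteq> H" "|H| \<le>o |UNIV :: 'u set|"
    using small_injective_submodule[OF cring noetherian bE submoduleD(1)[OF submodule_range[OF lj]], where ?'k = 'u]
      infinite_univ ring_le by metis
  let ?H = "?E\<lparr>carrier := H\<rparr>"
  have mH: "module R ?H" by (rule baer_module[OF H(2)])
  have "|carrier ?H| \<le>o |UNIV :: 'u set|" using H(4) by simp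
  from transport_exists[OF mH this] obtain I :: "('r, 'u) module" and \<tau> \<rho> where
    I: "lin R ?H I \<tau>" "lin R I ?H \<rho>" "\<And>x. x \<in> carrier ?H \<Longrightarrow> \<rho> (\<tau> x) = x" "\<And>x. x \<in> carrier I \<Longrightarrow> \<tau> (\<rho> x) = x" by metis
  have bI: "baer R I" by (rule baer_retract[OF H(2) I(2,1)]) (erule I(4))
  have mI: "module R I" by (rule baer_module[OF bI])
  interpret I: module R I by (rule mI)
  have i\<rho>: "inj_on \<rho> (carrier I)" by (rule inj_on_inverseI) (rule I(4))
  have tI: "torsion_free I (Y 2)"
    by (rule torsion_free_inj[OF torsion_free_submodule[OF tE submoduleD(1)[OF H(1)]] I(2) i\<rho>])
      (rule ideal_subset[OF Y_ideal[of 2]], use n2 in auto)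
  have rI: "retD I" by (rule retD_injective[OF bI tI])
  have l\<sigma>: "lin R I ?E \<rho>" by (rule lin_comp[OF I(2) lin_incl[OF mE H(1)]])
  have ljH: "lin R X ?H ?j" by (rule lin_corestrict[OF lj H(1)]) (use H(3) in blast)
  define \<iota> where "\<iota> x = \<tau> (?j x)" for x
  have l\<iota>: "lin R X I \<iota>" unfolding \<iota>_def by (rule lin_comp[OF ljH I(1)])
  have \<rho>\<iota>: "\<rho> (\<iota> x) = ?j x" if "x \<in> carrier X" for x unfolding \<iota>_def by (rule I(3)[OF lin_closed[OF ljH that]])
  have i\<iota>: "inj_on \<iota> (carrier X)"
  proof (rule inj_onI)
    fix x y assume x: "x \<in> carrier X" and y: "y \<in> carrier X" and eq: "\<iota> x = \<iota> y"
    have "?j x = ?j y" using \<rho>\<iota>[OF x] \<rho>\<iota>[OF y] eq by metis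
    then show "x = y" using inj_onD[OF ij _ x y] by blast
  qed
  obtain V :: "('r, 'u) module" and \<pi> where V: "lin R I V \<pi>" "\<pi> ` carrier I = carrier V" "a_kernel I V \<pi> = \<iota> ` carrier X"
    using quotient_exists[OF mI submodule_range[OF l\<iota>] card_of_mono1[OF subset_UNIV]] by metis
  have S: "ses R X I V \<iota> \<pi>" unfolding ses_def using l\<iota> i\<iota> V by (auto simp: a_kernel_iff set_eq_iff)
  note s' = sesD[OF S]
  have mV: "module R V" by (rule lin_cod[OF V(1)])
  interpret V: module R V by (rule mV)
  obtain p0 where p0: "lin R ?E I p0" "\<And>x. x \<in> carrier (mod_power K C) \<Longrightarrow> p0 (?eK x) = \<iota> (p x)"
    using baer_extend[OF bI eK ieK lin_comp[OF p l\<iota>]] by blast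
  have lp: "lin R I I (\<lambda>x. p0 (\<rho> x))" by (rule lin_comp[OF l\<sigma> p0(1)])
  \<comment> \<open>On the image of \<open>X\<close> the map \<open>p0 \<rho>\<close> is the
    identity, so its difference from the identity of \<open>I\<close> factors through
    \<open>V\<close>. This \<open>h\<close> is the defect of the two comparison maps
    \<open>s1\<close> and \<open>p1\<close>.\<close>
  have "p0 (\<rho> (\<iota> x)) \<ominus>\<^bsub>I\<^esub> \<iota> x = \<zero>\<^bsub>I\<^esub>" if x: "x \<in> carrier X" for x
  proof -
    have "p0 (\<rho> (\<iota> x)) = \<iota> x" unfolding \<rho>\<iota>[OF x] p0(2)[OF lin_closed[OF s x]] ps[OF x] ..
    then show ?thesis using lin_closed[OF l\<iota> x] by (simp add: I.minus_eq_zero_iff)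
  qed
  from ses_factor[OF S lin_minus_map[OF lp lin_id[OF mI]] this]
  obtain h where h: "lin R V I h" "\<And>x. x \<in> carrier I \<Longrightarrow> h (\<pi> x) = p0 (\<rho> x) \<ominus>\<^bsub>I\<^esub> x" by blast
  have d0V: "lin R (E 0) V1 (d 0)" by (rule lin_corestrict[OF cores_d[OF cores_C] submodule_range[OF cores_d[OF cores_C]]]) simp
  have ldK: "lin R ?E ?V1K ?dK" by (rule lin_power_map[OF d0V])
  have surj: "?dK ` carrier ?E = carrier ?V1K"
  proof
    show "carrier ?V1K \<subseteq> ?dK ` carrier ?E"
    proof
      fix x assume "x \<in> carrier ?V1K"
      then have x: "x \<in> (\<Pi>\<^sub>E k\<in>K. carrier V1)" by simp
      have "\<forall>k\<in>K. x k \<in> d 0 ` carrier (E 0)" using PiE_mem[OF x] by simp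
      then show "x \<in> ?dK ` carrier ?E" unfolding mod_power_simps(1) power_map_image[OF x] .
    qed
  qed (use lin_closed[OF ldK] in blast)
  have kerdK: "x \<in> ?eK ` carrier (mod_power K C)" if x: "x \<in> carrier ?E" and 0: "?dK x = \<zero>\<^bsub>?V1K\<^esub>" for x
  proof -
    have "?dK x = \<zero>\<^bsub>mod_power K (E 1)\<^esub>" using 0 by simp
    then show ?thesis using cores_ker0[OF cK x] by simp
  qed
  have dKe: "?dK (?eK x) = \<zero>\<^bsub>?V1K\<^esub>" if "x \<in> carrier (mod_power K C)" for x
    using cores_d_aug[OF cK that] by simp
  have "?dK (\<rho> (\<iota> x)) = \<zero>\<^bsub>?V1K\<^esub>" if x: "x \<in> carrier X" for x
    unfolding \<rho>\<iota>[OF x] by (rule dKe[OF lin_closed[OF s x]])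
  from ses_factor[OF S lin_comp[OF l\<sigma> ldK] this]
  obtain s1 where s1: "lin R V ?V1K s1" "\<And>x. x \<in> carrier I \<Longrightarrow> s1 (\<pi> x) = ?dK (\<rho> x)" by blast
  have k1: "\<pi> (p0 e) = \<zero>\<^bsub>V\<^esub>" if e: "e \<in> carrier ?E" "?dK e = \<zero>\<^bsub>?V1K\<^esub>" for e
  proof -
    obtain x where x: "e = ?eK x" "x \<in> carrier (mod_power K C)" using kerdK[OF e] by blast
    show ?thesis unfolding x(1) p0(2)[OF x(2)] by (rule s'(6)[OF lin_closed[OF p x(2)]])
  qed
  from lin_factor[OF ldK surj lin_comp[OF p0(1) V(1)] k1]
  obtain p1 where p1: "lin R ?V1K V p1" "\<And>e. e \<in> carrier ?E \<Longrightarrow> p1 (?dK e) = \<pi> (p0 e)" by blast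
  have mV1K: "module R ?V1K" by (rule module_mod_power[OF module_V1])
  have "retD V"
  \<comment> \<open>\<open>V\<close> is a retract of the sum of a power of \<open>V1\<close> and
    \<open>I\<close>: the section is \<open>v \<mapsto> (s1 v, h v)\<close>, the retraction
    \<open>(a, b) \<mapsto> p1 a - \<pi> b\<close>.\<close>
  proof (rule retD_retract[OF retD_dir_sum2[OF retD_V1_power rI] lin_pair[OF s1(1) h(1)]
        lin_minus_map[OF lin_comp[OF lin_fst[OF mV1K mI] p1(1)] lin_comp[OF lin_snd[OF mV1K mI] V(1)]]])
    fix v assume "v \<in> carrier V"
    then have "v \<in> \<pi> ` carrier I" using V(2) by simp
    then obtain x where x: "v = \<pi> x" "x \<in> carrier I" by (rule imageE)
    have c: "p0 (\<rho> x) \<in> carrier I" "\<pi> x \<in> carrier V" "\<pi> (p0 (\<rho> x)) \<in> carrier V"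
      using lin_closed[OF lp x(2)] lin_closed[OF V(1) x(2)] lin_closed[OF V(1) lin_closed[OF lp x(2)]] by auto
    have "p1 (s1 v) = \<pi> (p0 (\<rho> x))" unfolding x(1) s1(2)[OF x(2)] by (rule p1(2)[OF lin_closed[OF l\<sigma> x(2)]])
    moreover have "\<pi> (h v) = \<pi> (p0 (\<rho> x)) \<ominus>\<^bsub>V\<^esub> \<pi> x" unfolding x(1) h(2)[OF x(2)] by (rule lin_minus[OF V(1) c(1) x(2)])
    moreover have "\<pi> (p0 (\<rho> x)) \<ominus>\<^bsub>V\<^esub> (\<pi> (p0 (\<rho> x)) \<ominus>\<^bsub>V\<^esub> \<pi> x) = \<pi> x" using c(2,3) by algebra
    ultimately show "p1 (fst (s1 v, h v)) \<ominus>\<^bsub>V\<^esub> \<pi> (snd (s1 v, h v)) = v" unfolding x(1) by simp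
  qed
  then show thesis using that bI rI S by blast
qed

abbreviation finres :: "('r, 'u) module \<Rightarrow> bool" where
  "finres \<equiv> finitely_resolved R retD"

lemma finres_module: "finres N \<Longrightarrow> module R N"
  by (erule finitely_resolved.cases) (auto dest: retD_module sesD(3) lin_cod)

text \<open>Passing from \<open>N\<close> to its syzygy \<open>B\<close> raises the degree by one,
  so the induction treats all degrees at once.\<close>

lemma exv_finres:
  assumes "finres B" "retD V" shows "exv R V (inj_term R B) (inj_diff R B) (Suc i)"
  using assms(1)
proof (induction B arbitrary: i rule: finitely_resolved.induct)
  case (base N)
  then show ?case by (rule exv_retD[OF assms(2) _ cores_min[OF retD_module[OF base] univ_le]])
next
  case (step P B N \<alpha> \<beta>)
  note m = lin_dom[OF sesD(1)[OF step(2)]] lin_dom[OF sesD(3)[OF step(2)]] lin_cod[OF sesD(3)[OF step(2)]]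
  show ?case
    by (rule exv_ses_quotient[OF step(2) cores_min[OF m(1) univ_le] cores_min[OF m(2) univ_le] cores_min[OF m(3) univ_le]
      exv_retD[OF assms(2) step(1) cores_min[OF m(2) univ_le]] step.IH])
qed

lemma transport_dir_sum2:
  fixes X X' :: "('r, 'u) module"
  assumes "module R X" "module R X'"
  obtains Q :: "('r, 'u) module" and \<tau> \<rho> where "lin R (dir_sum2 X X') Q \<tau>" "lin R Q (dir_sum2 X X') \<rho>"
    "\<And>x. x \<in> carrier (dir_sum2 X X') \<Longrightarrow> \<rho> (\<tau> x) = x" "\<And>x. x \<in> carrier Q \<Longrightarrow> \<tau> (\<rho> x) = x"
proof -
  have "|carrier X \<times> carrier X'| \<le>o |UNIV :: 'u set|"
    by (rule card_of_Sigma_ordLeq_infinite[OF infinite_univ]) (auto intro: card_of_mono1)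
  then have "|carrier (dir_sum2 X X')| \<le>o |UNIV :: 'u set|" by simp
  from transport_exists[OF module_dir_sum2[OF assms] this] show thesis using that by metis
qed

text \<open>Only the term that maps onto \<open>B\<close> changes: it receives \<open>V\<close> as
  an additional summand, and the kernel \<open>B'\<close> stays. \<open>Z\<close> is any isomorphic
  copy of the sum of \<open>B\<close> and \<open>V\<close>.\<close>

lemma finres_sum:
  assumes B: "finres B" and V: "retD (V :: ('r, 'u) module)" and \<theta>: "lin R (dir_sum2 B V) Z \<theta>"
    and bij: "inj_on \<theta> (carrier (dir_sum2 B V))" "\<theta> ` carrier (dir_sum2 B V) = carrier Z"
  shows "finres (Z :: ('r, 'u) module)"
  using B
proof cases
  case base
  obtain g where g: "lin R (Z\<lparr>carrier := \<theta> ` carrier (dir_sum2 B V)\<rparr>) (dir_sum2 B V) g"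
    "\<And>x. x \<in> carrier (dir_sum2 B V) \<Longrightarrow> g (\<theta> x) = x" using lin_inv[OF \<theta> bij(1)] by blast
  have g': "lin R Z (dir_sum2 B V) g" using g(1) bij(2) by simp
  have "retD Z"
  proof (rule retD_retract[OF retD_dir_sum2[OF base V] g' \<theta>])
    fix z assume "z \<in> carrier Z"
    then have "z \<in> \<theta> ` carrier (dir_sum2 B V)" using bij(2) by simp
    then show "\<theta> (g z) = z" using g(2) by auto
  qed
  then show ?thesis by (rule finitely_resolved.base)
next
  case (step P B' \<alpha> \<beta>)
  note s = sesD[OF step(2)]
  have mP: "module R P" and mB: "module R B" and mV: "module R V" and mB': "module R B'"
    using lin_cod[OF s(1)] lin_cod[OF s(3)] retD_module[OF V] lin_dom[OF s(1)] by auto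
  interpret V: module R V by (rule mV)
  obtain Q :: "('r, 'u) module" and \<tau> \<rho> where Q: "lin R (dir_sum2 P V) Q \<tau>" "lin R Q (dir_sum2 P V) \<rho>"
    "\<And>x. x \<in> carrier (dir_sum2 P V) \<Longrightarrow> \<rho> (\<tau> x) = x" "\<And>x. x \<in> carrier Q \<Longrightarrow> \<tau> (\<rho> x) = x"
    using transport_dir_sum2[OF mP mV] by metis
  have rQ: "retD Q" by (rule retD_retract[OF retD_dir_sum2[OF step(1) V] Q(2,1)]) (erule Q(4))
  let ?a = "\<lambda>b. \<tau> (\<alpha> b, \<zero>\<^bsub>V\<^esub>)" and ?b = "\<lambda>q. \<theta> (map_prod \<beta> (\<lambda>x. x) (\<rho> q))"
  have la0: "lin R B' (dir_sum2 P V) (\<lambda>b. (\<alpha> b, \<zero>\<^bsub>V\<^esub>))" by (rule lin_pair[OF s(1) lin_zero_map[OF mB' mV]])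
  have la: "lin R B' Q ?a" by (rule lin_comp[OF la0 Q(1)])
  have lm: "lin R (dir_sum2 P V) (dir_sum2 B V) (map_prod \<beta> (\<lambda>x. x))" by (rule lin_map_prod[OF s(3) lin_id[OF mV]])
  have lb: "lin R Q Z ?b" by (rule lin_comp[OF lin_comp[OF Q(2) lm] \<theta>])
  have "ses R B' Q Z ?a ?b"
    unfolding ses_def
  proof (intro conjI ballI la lb)
    have 0: "\<alpha> b = \<zero>\<^bsub>P\<^esub> \<Longrightarrow> b \<in> carrier B' \<Longrightarrow> b = \<zero>\<^bsub>B'\<^esub>" for b using s(2) unfolding lin_inj_iff[OF s(1)] by blast
    show "inj_on ?a (carrier B')"
      unfolding lin_inj_iff[OF la]
    proof (intro ballI impI)
      fix b assume b: "b \<in> carrier B'" and eq: "?a b = \<zero>\<^bsub>Q\<^esub>"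
      have "(\<alpha> b, \<zero>\<^bsub>V\<^esub>) = \<zero>\<^bsub>dir_sum2 P V\<^esub>" using Q(3)[OF lin_closed[OF la0 b]] eq lin_zero[OF Q(2)] by simp
      then show "b = \<zero>\<^bsub>B'\<^esub>" using 0 b by simp
    qed
    show "?b ` carrier Q = carrier Z"
    proof
      show "carrier Z \<subseteq> ?b ` carrier Q"
      proof
        fix z assume "z \<in> carrier Z"
        then have "z \<in> \<theta> ` carrier (dir_sum2 B V)" using bij(2) by simp
        then obtain y where y: "z = \<theta> y" "y \<in> carrier (dir_sum2 B V)" by (rule imageE)
        have "fst y \<in> \<beta> ` carrier P" using y(2) s(4) by auto
        then obtain x where x: "fst y = \<beta> x" "x \<in> carrier P" by (rule imageE)
        have c: "(x, snd y) \<in> carrier (dir_sum2 P V)" using x(2) y(2) by auto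
        have "?b (\<tau> (x, snd y)) = z" unfolding Q(3)[OF c] y(1) using x(1)[symmetric] by simp
        then show "z \<in> ?b ` carrier Q" using lin_closed[OF Q(1) c] by blast
      qed
    qed (use lin_closed[OF lb] in blast)
    fix q assume q: "q \<in> carrier Q"
    have qc: "\<rho> q \<in> carrier (dir_sum2 P V)" by (rule lin_closed[OF Q(2) q])
    then have qc': "fst (\<rho> q) \<in> carrier P" "snd (\<rho> q) \<in> carrier V" by auto
    show "?b q = \<zero>\<^bsub>Z\<^esub> \<longleftrightarrow> q \<in> ?a ` carrier B'"
    proof
      assume "?b q = \<zero>\<^bsub>Z\<^esub>"
      then have "map_prod \<beta> (\<lambda>x. x) (\<rho> q) = \<zero>\<^bsub>dir_sum2 B V\<^esub>"
        using bij(1) lin_closed[OF lm qc] unfolding lin_inj_iff[OF \<theta>] by blast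
      then have 1: "\<beta> (fst (\<rho> q)) = \<zero>\<^bsub>B\<^esub>" "snd (\<rho> q) = \<zero>\<^bsub>V\<^esub>" by (simp_all add: map_prod_def case_prod_beta)
      obtain b where b: "fst (\<rho> q) = \<alpha> b" "b \<in> carrier B'" using s(5)[OF qc'(1)] 1(1) by blast
      have "?a b = q" using Q(4)[OF q] b(1) 1(2) by (metis prod.collapse)
      then show "q \<in> ?a ` carrier B'" using b(2) by blast
    next
      assume "q \<in> ?a ` carrier B'"
      then obtain b where b: "q = ?a b" "b \<in> carrier B'" by (rule imageE)
      have "map_prod \<beta> (\<lambda>x. x) (\<rho> q) = \<zero>\<^bsub>dir_sum2 B V\<^esub>"
        unfolding b(1) Q(3)[OF lin_closed[OF la0 b(2)]] using s(6)[OF b(2)] by simp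
      then show "?b q = \<zero>\<^bsub>Z\<^esub>" using lin_zero[OF \<theta>] by simp
    qed
  qed
  then show ?thesis by (rule finitely_resolved.step[OF rQ _ step(3)])
qed

end

section \<open>Embeddings into finitely resolved modules, and the resolution of an injective
  module\<close>

context shifted_cotilting
begin

definition coresolved_by_finres :: "('r, 'u) module \<Rightarrow> bool" where
  "coresolved_by_finres A \<longleftrightarrow> (\<exists>N V :: ('r, 'u) module. \<exists>\<nu> \<mu>. finres N \<and> retD V \<and> ses R A N V \<nu> \<mu>)"

lemma coresolved_zero:
  fixes A :: "('r, 'u) module"
  assumes A: "module R A" and z: "carrier A = {\<zero>\<^bsub>A\<^esub>}"
  shows "coresolved_by_finres A"
proof -
  interpret A: module R A by fact
  have r: "retD A"
    by (rule retDI[OF lin_zero_map[OF A module_DU] lin_zero_map[OF module_DU A]]) (use z in auto)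
  have "ses R A A A (\<lambda>x. x) (\<lambda>x. \<zero>\<^bsub>A\<^esub>)"
    unfolding ses_def using lin_id[OF A] lin_zero_map[OF A A] z by auto
  then show ?thesis unfolding coresolved_by_finres_def using finitely_resolved.base[of retD A R] r by blast
qed

text \<open>Let \<open>A\<close> sit in \<open>N\<close> with cokernel \<open>V\<close> and
  \<open>X\<close> in the injective \<open>I\<close> with cokernel \<open>V'\<close>. Extend
  \<open>\<iota> \<alpha>\<close> to \<open>e : N \<rightarrow> I\<close>; then
  \<open>n \<mapsto> (e n, \<mu> n)\<close> embeds \<open>N\<close> into the sum of \<open>I\<close>
  and \<open>V\<close>, and its cokernel \<open>N'\<close> is again finitely resolved.
  \<open>\<beta> x \<mapsto> [\<iota> x, 0]\<close> embeds \<open>Z\<close> into \<open>N'\<close>,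
  with cokernel map \<open>[i, v] \<mapsto> \<pi> i - t v\<close>, where \<open>t\<close> is induced
  by \<open>\<pi> e\<close>.\<close>

lemma coresolved_cokernel:
  fixes A X Z :: "('r, 'u) module"
  assumes S: "ses R A X Z \<alpha> \<beta>"
    and s: "lin R X (mod_power (K :: 'u set) C) s" and p: "lin R (mod_power K C) X p"
    and ps: "\<And>x. x \<in> carrier X \<Longrightarrow> p (s x) = x"
    and A: "coresolved_by_finres A"
  shows "coresolved_by_finres Z"
proof -
  note s1 = sesD[OF S]
  obtain N V :: "('r, 'u) module" and \<nu> \<mu> where N: "finres N" and V: "retD V" and S2: "ses R A N V \<nu> \<mu>"
    using A unfolding coresolved_by_finres_def by blast
  note s2 = sesD[OF S2]
  obtain I V' :: "('r, 'u) module" and \<iota> \<pi> where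
    I: "baer R I" and rI: "retD I" and S3: "ses R X I V' \<iota> \<pi>" and V': "retD V'"
    by (rule injective_embedding_of_summand[OF s p]) (erule ps, rule that)
  note s3 = sesD[OF S3]
  have mI: "module R I" and mV: "module R V" and mN: "module R N" and mX: "module R X" and mV': "module R V'"
    by (rule baer_module[OF I], rule retD_module[OF V], rule finres_module[OF N], rule lin_cod[OF s1(1)], rule retD_module[OF V'])
  interpret I: module R I by (rule mI)
  interpret V: module R V by (rule mV)
  interpret V': module R V' by (rule mV')
  obtain e where e: "lin R N I e" "\<And>a. a \<in> carrier A \<Longrightarrow> e (\<nu> a) = \<iota> (\<alpha> a)"
    using baer_extend[OF I s2(1,2) lin_comp[OF s1(1) s3(1)]] by blast
  let ?S = "dir_sum2 I V"
  have mS: "module R ?S" by (rule module_dir_sum2[OF mI mV])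
  obtain Q :: "('r, 'u) module" and \<tau> \<rho> where Q: "lin R ?S Q \<tau>" "lin R Q ?S \<rho>"
    "\<And>x. x \<in> carrier ?S \<Longrightarrow> \<rho> (\<tau> x) = x" "\<And>x. x \<in> carrier Q \<Longrightarrow> \<tau> (\<rho> x) = x"
    using transport_dir_sum2[OF mI mV] by metis
  have rQ: "retD Q" by (rule retD_retract[OF retD_dir_sum2[OF rI V] Q(2,1)]) (erule Q(4))
  have i\<rho>: "inj_on \<rho> (carrier Q)" by (rule inj_on_inverseI) (rule Q(4))
  have i\<tau>: "inj_on \<tau> (carrier ?S)" by (rule inj_on_inverseI) (rule Q(3))
  let ?j = "\<lambda>n. (e n, \<mu> n)"
  have lj0: "lin R N ?S ?j" by (rule lin_pair[OF e(1) s2(3)])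
  have lj: "lin R N Q (\<lambda>n. \<tau> (?j n))" by (rule lin_comp[OF lj0 Q(1)])
  have \<iota>x: "\<iota> x = \<zero>\<^bsub>I\<^esub> \<Longrightarrow> x \<in> carrier X \<Longrightarrow> x = \<zero>\<^bsub>X\<^esub>" for x using s3(2) unfolding lin_inj_iff[OF s3(1)] by blast
  have \<alpha>x: "\<alpha> x = \<zero>\<^bsub>X\<^esub> \<Longrightarrow> x \<in> carrier A \<Longrightarrow> x = \<zero>\<^bsub>A\<^esub>" for x using s1(2) unfolding lin_inj_iff[OF s1(1)] by blast
  have ij: "inj_on (\<lambda>n. \<tau> (?j n)) (carrier N)"
    unfolding lin_inj_iff[OF lj]
  proof (intro ballI impI)
    fix m assume m: "m \<in> carrier N" and 0: "\<tau> (?j m) = \<zero>\<^bsub>Q\<^esub>"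
    have "?j m = \<zero>\<^bsub>?S\<^esub>" using Q(3)[OF lin_closed[OF lj0 m]] 0 lin_zero[OF Q(2)] by simp
    then have 1: "e m = \<zero>\<^bsub>I\<^esub>" "\<mu> m = \<zero>\<^bsub>V\<^esub>" by simp_all
    obtain a where a: "m = \<nu> a" "a \<in> carrier A" using s2(5)[OF m] 1(2) by blast
    have "\<iota> (\<alpha> a) = \<zero>\<^bsub>I\<^esub>" using 1(1) e(2)[OF a(2)] a(1) by simp
    then have "a = \<zero>\<^bsub>A\<^esub>" using \<alpha>x[OF _ a(2)] \<iota>x[OF _ lin_closed[OF s1(1) a(2)]] by blast
    then show "m = \<zero>\<^bsub>N\<^esub>" using a(1) lin_zero[OF s2(1)] by simp
  qed
  have mQ: "module R Q" by (rule retD_module[OF rQ])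
  obtain N' :: "('r, 'u) module" and \<kappa> where N': "lin R Q N' \<kappa>" "\<kappa> ` carrier Q = carrier N'"
    "a_kernel Q N' \<kappa> = (\<lambda>n. \<tau> (?j n)) ` carrier N"
    using quotient_exists[OF mQ submodule_range[OF lj] card_of_mono1[OF subset_UNIV]] by metis
  have S4: "ses R N Q N' (\<lambda>n. \<tau> (?j n)) \<kappa>" unfolding ses_def using lj ij N' by (auto simp: a_kernel_iff set_eq_iff)
  have fN': "finres N'" by (rule finitely_resolved.step[OF rQ S4 N])
  have mN': "module R N'" by (rule finres_module[OF fN'])
  have \<kappa>\<tau>: "\<kappa> (\<tau> z) = \<zero>\<^bsub>N'\<^esub> \<longleftrightarrow> z \<in> ?j ` carrier N" if z: "z \<in> carrier ?S" for z
    unfolding sesD(5)[OF S4 lin_closed[OF Q(1) z]]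
  proof
    assume "\<tau> z \<in> (\<lambda>n. \<tau> (?j n)) ` carrier N"
    then obtain m where m: "\<tau> z = \<tau> (?j m)" "m \<in> carrier N" by (rule imageE)
    have "z = ?j m" by (rule inj_onD[OF i\<tau> m(1) z lin_closed[OF lj0 m(2)]])
    then show "z \<in> ?j ` carrier N" using m(2) by blast
  qed auto
  have l\<kappa>\<tau>: "lin R ?S N' (\<lambda>z. \<kappa> (\<tau> z))" by (rule lin_comp[OF Q(1) N'(1)])
  let ?x = "\<lambda>x. (\<iota> x, \<zero>\<^bsub>V\<^esub>)"
  have lx: "lin R X ?S ?x" by (rule lin_pair[OF s3(1) lin_zero_map[OF mX mV]])
  have "\<kappa> (\<tau> (?x (\<alpha> a))) = \<zero>\<^bsub>N'\<^esub>" if a: "a \<in> carrier A" for a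
  proof -
    have "?x (\<alpha> a) = ?j (\<nu> a)" using e(2)[OF a] s2(6)[OF a] by simp
    then have "?x (\<alpha> a) \<in> ?j ` carrier N" using lin_closed[OF s2(1) a] by blast
    then show ?thesis unfolding \<kappa>\<tau>[OF lin_closed[OF lx lin_closed[OF s1(1) a]]] .
  qed
  from ses_factor[OF S lin_comp[OF lx l\<kappa>\<tau>] this]
  obtain f where f: "lin R Z N' f" "\<And>x. x \<in> carrier X \<Longrightarrow> f (\<beta> x) = \<kappa> (\<tau> (?x x))" by blast
  have "\<pi> (e a) = \<zero>\<^bsub>V'\<^esub>" if a: "a \<in> \<nu> ` carrier A" for a
  proof -
    obtain b where b: "a = \<nu> b" "b \<in> carrier A" using a by (rule imageE)
    show ?thesis unfolding b(1) e(2)[OF b(2)] by (rule s3(6)[OF lin_closed[OF s1(1) b(2)]])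
  qed
  then have "\<pi> (e (\<nu> a)) = \<zero>\<^bsub>V'\<^esub>" if "a \<in> carrier A" for a using that by blast
  from ses_factor[OF S2 lin_comp[OF e(1) s3(3)] this]
  obtain t where t: "lin R V V' t" "\<And>n. n \<in> carrier N \<Longrightarrow> t (\<mu> n) = \<pi> (e n)" by blast
  let ?g = "\<lambda>z. \<pi> (fst z) \<ominus>\<^bsub>V'\<^esub> t (snd z)"
  have lg: "lin R ?S V' ?g"
    by (rule lin_minus_map[OF lin_comp[OF lin_fst[OF mI mV] s3(3)] lin_comp[OF lin_snd[OF mI mV] t(1)]])
  have gj: "?g (\<rho> (\<tau> (?j m))) = \<zero>\<^bsub>V'\<^esub>" if m: "m \<in> carrier N" for m
  proof -
    have c: "\<pi> (e m) \<in> carrier V'" by (rule lin_closed[OF s3(3) lin_closed[OF e(1) m]])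
    show ?thesis unfolding Q(3)[OF lin_closed[OF lj0 m]] using t(2)[OF m] c by (simp add: V'.minus_eq_zero_iff)
  qed
  from ses_factor[OF S4 lin_comp[OF Q(2) lg] gj]
  obtain g where g: "lin R N' V' g" "\<And>q. q \<in> carrier Q \<Longrightarrow> g (\<kappa> q) = ?g (\<rho> q)" by blast
  have g\<kappa>\<tau>: "g (\<kappa> (\<tau> z)) = ?g z" if z: "z \<in> carrier ?S" for z
    unfolding g(2)[OF lin_closed[OF Q(1) z]] Q(3)[OF z] ..
  have xZ: "z \<in> \<beta> ` carrier X" if "z \<in> carrier Z" for z using that s1(4) by simp
  have yN': "\<exists>q\<in>carrier ?S. y = \<kappa> (\<tau> q)" if y: "y \<in> carrier N'" for y
  proof -
    have "y \<in> \<kappa> ` carrier Q" using y N'(2) by simp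
    then obtain q where q: "y = \<kappa> q" "q \<in> carrier Q" by (rule imageE)
    show ?thesis by (rule bexI[of _ "\<rho> q"]) (use q Q(4)[OF q(2)] lin_closed[OF Q(2) q(2)] in simp_all)
  qed
  have "ses R Z N' V' f g"
    unfolding ses_def
  proof (intro conjI ballI f(1) g(1))
    show "inj_on f (carrier Z)"
      unfolding lin_inj_iff[OF f(1)]
    proof (intro ballI impI)
      fix z assume z: "z \<in> carrier Z" and 0: "f z = \<zero>\<^bsub>N'\<^esub>"
      obtain x where x: "z = \<beta> x" "x \<in> carrier X" using xZ[OF z] by (rule imageE)
      have "?x x \<in> ?j ` carrier N" using 0 unfolding x(1) f(2)[OF x(2)] \<kappa>\<tau>[OF lin_closed[OF lx x(2)]] .
      then obtain m where m: "?x x = ?j m" "m \<in> carrier N" by (rule imageE)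
      then obtain a where a: "m = \<nu> a" "a \<in> carrier A" using s2(5)[OF m(2)] by auto
      have "\<iota> x = \<iota> (\<alpha> a)" using m(1) e(2)[OF a(2)] a(1) by simp
      then have "x = \<alpha> a" by (rule inj_onD[OF s3(2) _ x(2) lin_closed[OF s1(1) a(2)]])
      then show "z = \<zero>\<^bsub>Z\<^esub>" using x(1) s1(6)[OF a(2)] by simp
    qed
    show "g ` carrier N' = carrier V'"
    proof
      show "carrier V' \<subseteq> g ` carrier N'"
      proof
        fix v assume v: "v \<in> carrier V'"
        then have "v \<in> \<pi> ` carrier I" using s3(4) by simp
        then obtain i where i: "v = \<pi> i" "i \<in> carrier I" by (rule imageE)
        have c: "(i, \<zero>\<^bsub>V\<^esub>) \<in> carrier ?S" using i(2) by simp
        have "g (\<kappa> (\<tau> (i, \<zero>\<^bsub>V\<^esub>))) = v"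
          unfolding g\<kappa>\<tau>[OF c] using lin_zero[OF t(1)] v i(1) by (simp add: V'.minus_eq)
        then show "v \<in> g ` carrier N'" using lin_closed[OF l\<kappa>\<tau> c] by blast
      qed
    qed (use lin_closed[OF g(1)] in blast)
    fix y assume y: "y \<in> carrier N'"
    obtain q where q: "y = \<kappa> (\<tau> q)" "q \<in> carrier ?S" using yN'[OF y] by blast
    have qc: "fst q \<in> carrier I" "snd q \<in> carrier V" using q(2) by auto
    show "g y = \<zero>\<^bsub>V'\<^esub> \<longleftrightarrow> y \<in> f ` carrier Z"
    proof
      assume "g y = \<zero>\<^bsub>V'\<^esub>"
      then have gq: "?g q = \<zero>\<^bsub>V'\<^esub>" using g\<kappa>\<tau>[OF q(2)] q(1) by simp
      have c: "\<pi> (fst q) \<in> carrier V'" "t (snd q) \<in> carrier V'"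
        by (rule lin_closed[OF s3(3) qc(1)], rule lin_closed[OF t(1) qc(2)])
      have eq: "\<pi> (fst q) = t (snd q)" using gq unfolding V'.minus_eq_zero_iff[OF c] .
      have "snd q \<in> \<mu> ` carrier N" using qc(2) s2(4) by simp
      then obtain m where m: "snd q = \<mu> m" "m \<in> carrier N" by (rule imageE)
      have em: "e m \<in> carrier I" by (rule lin_closed[OF e(1) m(2)])
      have "\<pi> (fst q \<ominus>\<^bsub>I\<^esub> e m) = \<zero>\<^bsub>V'\<^esub>"
        unfolding lin_minus[OF s3(3) qc(1) em] V'.minus_eq_zero_iff[OF c(1) lin_closed[OF s3(3) em]]
        using eq t(2)[OF m(2)] m(1) by simp
      then obtain x where x: "fst q \<ominus>\<^bsub>I\<^esub> e m = \<iota> x" "x \<in> carrier X" using s3(5)[OF I.minus_closed[OF qc(1) em]] by blast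
      have qd: "q = ?x x \<oplus>\<^bsub>?S\<^esub> ?j m"
      proof (rule prod_eqI)
        have "fst q = (fst q \<ominus>\<^bsub>I\<^esub> e m) \<oplus>\<^bsub>I\<^esub> e m" using qc(1) em by algebra
        then show "fst q = fst (?x x \<oplus>\<^bsub>?S\<^esub> ?j m)" using x(1) by simp
        show "snd q = snd (?x x \<oplus>\<^bsub>?S\<^esub> ?j m)" using m(1) qc(2) by simp
      qed
      have "\<kappa> (\<tau> q) = \<kappa> (\<tau> (?x x)) \<oplus>\<^bsub>N'\<^esub> \<kappa> (\<tau> (?j m))"
        unfolding qd by (rule lin_add[OF l\<kappa>\<tau> lin_closed[OF lx x(2)] lin_closed[OF lj0 m(2)]])
      moreover have "\<kappa> (\<tau> (?j m)) = \<zero>\<^bsub>N'\<^esub>" using \<kappa>\<tau>[OF lin_closed[OF lj0 m(2)]] m(2) by blast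
      moreover have "\<kappa> (\<tau> (?x x)) \<in> carrier N'" by (rule lin_closed[OF l\<kappa>\<tau> lin_closed[OF lx x(2)]])
      ultimately have "y = \<kappa> (\<tau> (?x x))" using q(1) abelian_monoid.r_zero[OF abelian_group.axioms(1)[OF module.axioms(2)[OF mN']]] by simp
      then have "y = f (\<beta> x)" using f(2)[OF x(2)] by simp
      then show "y \<in> f ` carrier Z" using lin_closed[OF s1(3) x(2)] by blast
    next
      assume "y \<in> f ` carrier Z"
      then obtain z where z: "y = f z" "z \<in> carrier Z" by (rule imageE)
      obtain x where x: "z = \<beta> x" "x \<in> carrier X" using xZ[OF z(2)] by (rule imageE)
      have "g y = ?g (?x x)" unfolding z(1) x(1) f(2)[OF x(2)] by (rule g\<kappa>\<tau>[OF lin_closed[OF lx x(2)]])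
      also have "\<dots> = \<zero>\<^bsub>V'\<^esub>" using s3(6)[OF x(2)] lin_zero[OF t(1)] by (simp add: V'.minus_eq)
      finally show "g y = \<zero>\<^bsub>V'\<^esub>" .
    qed
  qed
  then show ?thesis unfolding coresolved_by_finres_def using fN' V' by blast
qed

text \<open>The embedding into \<open>N\<close> splits by \<open>r\<close>, with
  \<open>\<sigma>\<close> the complementary section of \<open>\<mu>\<close>. If \<open>N\<close> is
  a summand of a power of \<open>D\<close>, so is \<open>Q\<close>. Otherwise take the epimorphism
  \<open>P \<rightarrow> N \<rightarrow> Q\<close>: its kernel is the preimage of the copy of
  \<open>V\<close>, an extension of \<open>V\<close> by the syzygy \<open>B\<close>. This extension
  splits, so the kernel is finitely resolved.\<close>

lemma finres_injective:
  fixes Q :: "('r, 'u) module"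
  assumes Q: "baer R Q" and A: "coresolved_by_finres Q"
  shows "finres Q"
proof -
  obtain N V :: "('r, 'u) module" and \<nu> \<mu> where N: "finres N" and V: "retD V" and S: "ses R Q N V \<nu> \<mu>"
    using A unfolding coresolved_by_finres_def by blast
  note s = sesD[OF S]
  have mQ: "module R Q" by (rule baer_module[OF Q])
  obtain r where r: "lin R N Q r" "\<And>x. x \<in> carrier Q \<Longrightarrow> r (\<nu> x) = x" using baer_split[OF Q s(1,2)] by blast
  show ?thesis
    using N
  proof cases
    case base
    have "retD Q" by (rule retD_retract[OF base s(1) r(1)]) (erule r(2))
    then show ?thesis by (rule finitely_resolved.base)
  next
    case (step P B \<alpha> \<beta>)
    note s' = sesD[OF step(2)]
    have mN: "module R N" and mV: "module R V" and mP: "module R P" and mB: "module R B"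
      using lin_cod[OF s(1)] lin_cod[OF s(3)] lin_cod[OF s'(1)] lin_dom[OF s'(1)] by auto
    interpret N: module R N by (rule mN)
    interpret Q: module R Q by (rule mQ)
    interpret P: module R P by (rule mP)
    interpret V: module R V by (rule mV)
    have "x \<ominus>\<^bsub>N\<^esub> \<nu> (r x) = \<zero>\<^bsub>N\<^esub>" if x: "x \<in> \<nu> ` carrier Q" for x
    proof -
      obtain w where w: "x = \<nu> w" "w \<in> carrier Q" using x by (rule imageE)
      show ?thesis unfolding w(1) r(2)[OF w(2)] using lin_closed[OF s(1) w(2)] by (simp add: N.minus_eq_zero_iff)
    qed
    then have "\<nu> w \<ominus>\<^bsub>N\<^esub> \<nu> (r (\<nu> w)) = \<zero>\<^bsub>N\<^esub>" if "w \<in> carrier Q" for w using that by blast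
    from ses_factor[OF S lin_minus_map[OF lin_id[OF mN] lin_comp[OF r(1) s(1)]] this]
    obtain \<sigma> where \<sigma>: "lin R V N \<sigma>" "\<And>x. x \<in> carrier N \<Longrightarrow> \<sigma> (\<mu> x) = x \<ominus>\<^bsub>N\<^esub> \<nu> (r x)" by blast
    have V_\<mu>: "v \<in> \<mu> ` carrier N" if "v \<in> carrier V" for v using that s(4) by simp
    have r\<sigma>: "r (\<sigma> v) = \<zero>\<^bsub>Q\<^esub>" and \<mu>\<sigma>: "\<mu> (\<sigma> v) = v" if v: "v \<in> carrier V" for v
    proof -
      obtain x where x: "v = \<mu> x" "x \<in> carrier N" using V_\<mu>[OF v] by (rule imageE)
      have c: "r x \<in> carrier Q" "\<nu> (r x) \<in> carrier N"
        by (rule lin_closed[OF r(1) x(2)], rule lin_closed[OF lin_comp[OF r(1) s(1)] x(2)])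
      show "r (\<sigma> v) = \<zero>\<^bsub>Q\<^esub>"
        unfolding x(1) \<sigma>(2)[OF x(2)] lin_minus[OF r(1) x(2) c(2)] r(2)[OF c(1)] using c(1) by (simp add: Q.minus_eq_zero_iff)
      show "\<mu> (\<sigma> v) = v"
        unfolding x(1) \<sigma>(2)[OF x(2)] lin_minus[OF s(3) x(2) c(2)] s(6)[OF c(1)]
        using lin_closed[OF s(3) x(2)] by (simp add: V.minus_eq)
    qed
    \<comment> \<open>\<open>\<sigma>\<close> lifts through \<open>\<beta>\<close> because
      \<open>Ext\<^sup>1(V, B) = 0\<close>; the lift splits the extension of \<open>V\<close> by
      \<open>B\<close>.\<close>
    obtain \<sigma>' where \<sigma>': "lin R V P \<sigma>'" "\<And>v. v \<in> carrier V \<Longrightarrow> \<beta> (\<sigma>' v) = \<sigma> v"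
      using ext1_lift[OF step(2) cores_min[OF mB univ_le] cores_min[OF mP univ_le] cores_min[OF mN univ_le]
        exv_finres[OF step(3) V] \<sigma>(1)] by blast
    let ?q = "\<lambda>x. r (\<beta> x)"
    have lq: "lin R P Q ?q" by (rule lin_comp[OF s'(3) r(1)])
    have q_surj: "?q ` carrier P = carrier Q"
    proof
      show "carrier Q \<subseteq> ?q ` carrier P"
      proof
        fix w assume w: "w \<in> carrier Q"
        have "\<nu> w \<in> \<beta> ` carrier P" using lin_closed[OF s(1) w] s'(4) by simp
        then obtain x where "\<nu> w = \<beta> x" "x \<in> carrier P" by (rule imageE)
        then show "w \<in> ?q ` carrier P" using r(2)[OF w] by (intro image_eqI[of _ _ x]) simp_all
      qed
    qed (use lin_closed[OF lq] in blast)
    let ?K = "P\<lparr>carrier := a_kernel P Q ?q\<rparr>"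
    let ?\<theta> = "\<lambda>z. \<alpha> (fst z) \<oplus>\<^bsub>P\<^esub> \<sigma>' (snd z)"
    have l\<theta>0: "lin R (dir_sum2 B V) P ?\<theta>"
      by (rule lin_add_map[OF lin_comp[OF lin_fst[OF mB mV] s'(1)] lin_comp[OF lin_snd[OF mB mV] \<sigma>'(1)]])
    have \<beta>\<theta>: "\<beta> (?\<theta> z) = \<sigma> (snd z)" if z: "z \<in> carrier (dir_sum2 B V)" for z
    proof -
      have c: "fst z \<in> carrier B" "snd z \<in> carrier V" using z by auto
      have "\<beta> (?\<theta> z) = \<beta> (\<alpha> (fst z)) \<oplus>\<^bsub>N\<^esub> \<beta> (\<sigma>' (snd z))"
        by (rule lin_add[OF s'(3) lin_closed[OF s'(1) c(1)] lin_closed[OF \<sigma>'(1) c(2)]])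
      then show ?thesis using s'(6)[OF c(1)] \<sigma>'(2)[OF c(2)] lin_closed[OF \<sigma>(1) c(2)] by simp
    qed
    have l\<theta>: "lin R (dir_sum2 B V) ?K ?\<theta>"
    proof (rule lin_corestrict[OF l\<theta>0 submodule_kernel[OF lq]])
      fix z assume z: "z \<in> carrier (dir_sum2 B V)"
      have "?q (?\<theta> z) = \<zero>\<^bsub>Q\<^esub>" unfolding \<beta>\<theta>[OF z] by (rule r\<sigma>) (use z in auto)
      then show "?\<theta> z \<in> a_kernel P Q ?q" using lin_closed[OF l\<theta>0 z] unfolding a_kernel_iff by blast
    qed
    have "finres ?K"
    proof (rule finres_sum[OF step(3) V l\<theta>])
      show "inj_on ?\<theta> (carrier (dir_sum2 B V))"
        unfolding lin_inj_iff[OF l\<theta>0]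
      proof (intro ballI impI)
        fix z assume z: "z \<in> carrier (dir_sum2 B V)" and 0: "?\<theta> z = \<zero>\<^bsub>P\<^esub>"
        have c: "fst z \<in> carrier B" "snd z \<in> carrier V" using z by auto
        have "\<sigma> (snd z) = \<zero>\<^bsub>N\<^esub>" using \<beta>\<theta>[OF z] 0 lin_zero[OF s'(3)] by simp
        then have z2: "snd z = \<zero>\<^bsub>V\<^esub>" using \<mu>\<sigma>[OF c(2)] lin_zero[OF s(3)] by simp
        then have "\<alpha> (fst z) = \<zero>\<^bsub>P\<^esub>" using 0 lin_zero[OF \<sigma>'(1)] lin_closed[OF s'(1) c(1)] by simp
        then have "fst z = \<zero>\<^bsub>B\<^esub>" using s'(2) c(1) unfolding lin_inj_iff[OF s'(1)] by blast
        then show "z = \<zero>\<^bsub>dir_sum2 B V\<^esub>" using z2 by (simp add: prod_eq_iff)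
      qed
      show "?\<theta> ` carrier (dir_sum2 B V) = carrier ?K"
      proof
        show "carrier ?K \<subseteq> ?\<theta> ` carrier (dir_sum2 B V)"
        proof
          fix k assume "k \<in> carrier ?K"
          then have k: "k \<in> carrier P" "r (\<beta> k) = \<zero>\<^bsub>Q\<^esub>" by (simp_all add: a_kernel_iff)
          have b: "\<beta> k \<in> carrier N" by (rule lin_closed[OF s'(3) k(1)])
          have v: "\<mu> (\<beta> k) \<in> carrier V" by (rule lin_closed[OF s(3) b])
          have c: "\<sigma>' (\<mu> (\<beta> k)) \<in> carrier P" by (rule lin_closed[OF \<sigma>'(1) v])
          have "\<beta> (\<sigma>' (\<mu> (\<beta> k))) = \<beta> k"
            unfolding \<sigma>'(2)[OF v] \<sigma>(2)[OF b] k(2) lin_zero[OF s(1)] using b by (simp add: N.minus_eq)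
          then have "\<beta> (k \<ominus>\<^bsub>P\<^esub> \<sigma>' (\<mu> (\<beta> k))) = \<zero>\<^bsub>N\<^esub>"
            unfolding lin_minus[OF s'(3) k(1) c] using b by (simp add: N.minus_eq_zero_iff)
          then obtain a where a: "k \<ominus>\<^bsub>P\<^esub> \<sigma>' (\<mu> (\<beta> k)) = \<alpha> a" "a \<in> carrier B"
            using s'(5)[OF P.minus_closed[OF k(1) c]] by blast
          have "k = (k \<ominus>\<^bsub>P\<^esub> \<sigma>' (\<mu> (\<beta> k))) \<oplus>\<^bsub>P\<^esub> \<sigma>' (\<mu> (\<beta> k))" using k(1) c by algebra
          then have "k = ?\<theta> (a, \<mu> (\<beta> k))" using a(1) by simp
          moreover have "(a, \<mu> (\<beta> k)) \<in> carrier (dir_sum2 B V)" using a(2) v by simp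
          ultimately show "k \<in> ?\<theta> ` carrier (dir_sum2 B V)" by (rule image_eqI)
        qed
      qed (use lin_closed[OF l\<theta>] in blast)
    qed
    from finitely_resolved.step[OF step(1) ses_kernel[OF lq q_surj] this] show ?thesis .
  qed
qed

definition retD_resolution ::
  "('r, 'u) module \<Rightarrow> nat \<Rightarrow> (nat \<Rightarrow> ('r, 'u) module) \<Rightarrow> (nat \<Rightarrow> 'u \<Rightarrow> 'u) \<Rightarrow> bool" where
  "retD_resolution N r X \<delta> \<longleftrightarrow> X 0 = N \<and> (\<forall>j\<le>r. retD (X (Suc j)) \<and> lin R (X (Suc j)) (X j) (\<delta> j)) \<and>
     \<delta> 0 ` carrier (X 1) = carrier N \<and>
     (\<forall>j<r. \<delta> (Suc j) ` carrier (X (Suc (Suc j))) = a_kernel (X (Suc j)) (X j) (\<delta> j)) \<and>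
     inj_on (\<delta> r) (carrier (X (Suc r)))"

text \<open>Unwinds the recursion by splicing: the sequence for \<open>B\<close> is shifted by one
  place behind \<open>P\<close>, and its last map onto \<open>B\<close> is composed with
  \<open>\<alpha>\<close>.\<close>

lemma retD_resolution_exists:
  assumes "finres N" shows "\<exists>r X \<delta>. retD_resolution N r X \<delta>"
  using assms
proof induction
  case (base N)
  then have "retD_resolution N 0 (\<lambda>_. N) (\<lambda>_ x. x)" by (simp add: retD_resolution_def lin_id retD_module)
  then show ?case by blast
next
  case (step P B N \<alpha> \<beta>)
  note s = sesD[OF step(2)]
  from step.IH obtain r X \<delta> where "retD_resolution B r X \<delta>" by blast
  then have h: "X 0 = B" "\<forall>j\<le>r. retD (X (Suc j)) \<and> lin R (X (Suc j)) (X j) (\<delta> j)"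
    "\<delta> 0 ` carrier (X 1) = carrier B"
    "\<forall>j<r. \<delta> (Suc j) ` carrier (X (Suc (Suc j))) = a_kernel (X (Suc j)) (X j) (\<delta> j)"
    "inj_on (\<delta> r) (carrier (X (Suc r)))" unfolding retD_resolution_def by blast+
  have l0: "lin R (X 1) B (\<delta> 0)" using h(1,2) by (metis One_nat_def le0)
  define X' where "X' = case_nat N (case_nat P (\<lambda>j. X (Suc j)))"
  define \<delta>' where "\<delta>' = case_nat \<beta> (case_nat (\<lambda>x. \<alpha> (\<delta> 0 x)) (\<lambda>j. \<delta> (Suc j)))"
  have X': "X' 0 = N" "X' (Suc 0) = P" "X' (Suc (Suc j)) = X (Suc j)" for j by (simp_all add: X'_def)
  have \<delta>': "\<delta>' 0 = \<beta>" "\<delta>' (Suc 0) = (\<lambda>x. \<alpha> (\<delta> 0 x))" "\<delta>' (Suc (Suc j)) = \<delta> (Suc j)" for j by (simp_all add: \<delta>'_def)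
  have l1: "lin R (X (Suc 0)) P (\<lambda>x. \<alpha> (\<delta> 0 x))" using lin_comp[OF l0 s(1)] by simp
  have r0: "retD (X (Suc 0))" using h(2) by blast
  have 1: "retD (X' (Suc j)) \<and> lin R (X' (Suc j)) (X' j) (\<delta>' j)" if j: "j \<le> Suc r" for j
  proof (cases j)
    case 0
    then show ?thesis using step(1) s(3) by (simp add: X' \<delta>')
  next
    case (Suc k)
    show ?thesis
    proof (cases k)
      case 0
      then show ?thesis using Suc l1 r0 by (simp add: X' \<delta>')
    next
      case (Suc i)
      then show ?thesis using \<open>j = Suc k\<close> h(2) j by (simp add: X' \<delta>')
    qed
  qed
  have 2: "\<delta>' (Suc j) ` carrier (X' (Suc (Suc j))) = a_kernel (X' (Suc j)) (X' j) (\<delta>' j)" if j: "j < Suc r" for j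
  proof (cases j)
    case 0
    have "(\<lambda>x. \<alpha> (\<delta> 0 x)) ` carrier (X (Suc 0)) = \<alpha> ` carrier B" using h(3) by (simp add: image_image[symmetric])
    also have "\<dots> = a_kernel P N \<beta>" using s(5) lin_closed[OF s(1)] by (auto simp: a_kernel_iff)
    finally show ?thesis using 0 by (simp add: X' \<delta>')
  next
    case (Suc k)
    show ?thesis
    proof (cases k)
      case 0
      have "1 \<le> r" using j Suc 0 by simp
      then have "\<delta> (Suc 0) ` carrier (X (Suc (Suc 0))) = a_kernel (X (Suc 0)) B (\<delta> 0)" using h(1,4) by auto
      also have "\<dots> = a_kernel (X (Suc 0)) P (\<lambda>x. \<alpha> (\<delta> 0 x))"
      proof -
        have "\<delta> 0 x = \<zero>\<^bsub>B\<^esub> \<longleftrightarrow> \<alpha> (\<delta> 0 x) = \<zero>\<^bsub>P\<^esub>" if "x \<in> carrier (X (Suc 0))" for x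
        proof -
          have "\<delta> 0 x \<in> carrier B" using lin_closed[OF l0] that by simp
          then show ?thesis using s(2) lin_zero[OF s(1)] unfolding lin_inj_iff[OF s(1)] by metis
        qed
        then show ?thesis using lin_zero[OF s(1)] by (auto simp: a_kernel_iff)
      qed
      finally show ?thesis using Suc 0 by (simp add: X' \<delta>')
    next
      case (Suc i)
      then show ?thesis using \<open>j = Suc k\<close> h(4) j by (simp add: X' \<delta>')
    qed
  qed
  have 3: "inj_on (\<delta>' (Suc r)) (carrier (X' (Suc (Suc r))))"
  proof (cases r)
    case 0
    have i0: "inj_on (\<delta> 0) (carrier (X (Suc 0)))" using h(5) 0 by simp
    have "inj_on (\<lambda>x. \<alpha> (\<delta> 0 x)) (carrier (X (Suc 0)))"
    proof (rule inj_onI)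
      fix x y assume x: "x \<in> carrier (X (Suc 0))" and y: "y \<in> carrier (X (Suc 0))" and eq: "\<alpha> (\<delta> 0 x) = \<alpha> (\<delta> 0 y)"
      have c: "\<delta> 0 x \<in> carrier B" "\<delta> 0 y \<in> carrier B" using lin_closed[OF l0] x y by simp_all
      have "\<delta> 0 x = \<delta> 0 y" by (rule inj_onD[OF s(2) eq c])
      then show "x = y" using inj_onD[OF i0 _ x y] by blast
    qed
    then show ?thesis using 0 by (simp add: X' \<delta>')
  next
    case (Suc k)
    then show ?thesis using h(5) by (simp add: X' \<delta>')
  qed
  have "retD_resolution N (Suc r) X' \<delta>'"
    unfolding retD_resolution_def using 1 2 3 s(4) by (simp add: X' \<delta>')
  then show ?case by blast
qed

end

text \<open>Vanishing of \<open>Ext\<^sup>k\<^sup>+\<^sup>1\<close> at the \<open>(k+1)\<close>st cosyzygy splits the inclusion of this cosyzygy off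
  \<open>E\<^sub>k\<close>, which minimality forbids unless the cosyzygy is zero.\<close>

lemma minimal_zero_term:
  assumes M: "module R M" and min: "minimal_injective_coresolution R M E \<epsilon> d"
    and ex: "exv R ((E (Suc k))\<lparr>carrier := d k ` carrier (E k)\<rparr>) E d (Suc k)"
  shows "zero_module (E (Suc k))"
proof -
  have c: "cores R M E \<epsilon> d"
    using injective_coresolution_cores[OF M] min unfolding minimal_injective_coresolution_def by blast
  let ?T = "(E (Suc k))\<lparr>carrier := d k ` carrier (E k)\<rparr>"
  note m = cores_module[OF c]
  interpret Ek: module R "E k" by (rule m)
  interpret Es: module R "E (Suc k)" by (rule m)
  note dk = cores_d[OF c, of k]
  note sub = submodule_range[OF dk]
  have incl: "lin R ?T (E (Suc k)) (\<lambda>x. x)" by (rule lin_incl[OF m sub])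
  have "d (Suc k) x = \<zero>\<^bsub>E (Suc (Suc k))\<^esub>" if "x \<in> carrier ?T" for x
    using c that lin_closed[OF dk] unfolding cores_def by auto
  from exv_SucD[OF ex incl this]
  obtain w where w: "lin R ?T (E k) w" "\<And>x. x \<in> carrier ?T \<Longrightarrow> d k (w x) = x" by blast
  have zero_of_essential: "L = {\<zero>\<^bsub>N\<^esub>}" if "essential_submodule R H N" "submodule L R N" "L \<inter> H = {\<zero>\<^bsub>N\<^esub>}" for L H and N :: "('a, 'd) module"
    using that unfolding essential_submodule_def by blast
  have ker: "essential_submodule R (a_kernel (E k) (E (Suc k)) (d k)) (E k)"
  proof (cases k)
    case 0
    have "a_kernel (E 0) (E 1) (d 0) = \<epsilon> ` carrier M"
      using min unfolding minimal_injective_coresolution_def injective_coresolution_def by simp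
    then show ?thesis using min 0 unfolding minimal_injective_coresolution_def by simp
  next
    case (Suc i)
    have "a_kernel (E (Suc i)) (E (Suc (Suc i))) (d (Suc i)) = d i ` carrier (E i)"
      using min unfolding minimal_injective_coresolution_def injective_coresolution_def by simp
    then show ?thesis using min Suc unfolding minimal_injective_coresolution_def by simp
  qed
  have sw: "submodule (w ` carrier ?T) R (E k)" by (rule submodule_range[OF w(1)])
  have z: "\<zero>\<^bsub>E (Suc k)\<^esub> \<in> carrier ?T" using submoduleD(2)[OF sub] by simp
  \<comment> \<open>\<open>w\<close> is a section of \<open>d k\<close> over the cosyzygy, so its
    image meets the kernel of \<open>d k\<close> trivially. By minimality this kernel is essential,
    hence \<open>w\<close> is zero.\<close>
  have "w ` carrier ?T \<inter> a_kernel (E k) (E (Suc k)) (d k) = {\<zero>\<^bsub>E k\<^esub>}"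
  proof
    show "w ` carrier ?T \<inter> a_kernel (E k) (E (Suc k)) (d k) \<subseteq> {\<zero>\<^bsub>E k\<^esub>}"
    proof
      fix y assume y: "y \<in> w ` carrier ?T \<inter> a_kernel (E k) (E (Suc k)) (d k)"
      then have "y \<in> w ` carrier ?T" ..
      then obtain x where x: "y = w x" "x \<in> carrier ?T" by (rule imageE)
      have "d k y = \<zero>\<^bsub>E (Suc k)\<^esub>" using y by (simp add: a_kernel_iff)
      then have "x = \<zero>\<^bsub>E (Suc k)\<^esub>" using w(2)[OF x(2)] x(1) by simp
      then show "y \<in> {\<zero>\<^bsub>E k\<^esub>}" using x(1) lin_zero[OF w(1)] by simp
    qed
    have "\<zero>\<^bsub>E k\<^esub> \<in> w ` carrier ?T" by (rule submoduleD(2)[OF sw])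
    then show "{\<zero>\<^bsub>E k\<^esub>} \<subseteq> w ` carrier ?T \<inter> a_kernel (E k) (E (Suc k)) (d k)"
      using lin_zero[OF dk] by (simp add: a_kernel_iff)
  qed
  from zero_of_essential[OF ker sw this] have w0: "w ` carrier ?T = {\<zero>\<^bsub>E k\<^esub>}" .
  have T0: "d k ` carrier (E k) = {\<zero>\<^bsub>E (Suc k)\<^esub>}"
  proof
    show "d k ` carrier (E k) \<subseteq> {\<zero>\<^bsub>E (Suc k)\<^esub>}"
    proof
      fix x assume "x \<in> d k ` carrier (E k)"
      then have x: "x \<in> carrier ?T" by simp
      then have "w x = \<zero>\<^bsub>E k\<^esub>" using w0 by blast
      then show "x \<in> {\<zero>\<^bsub>E (Suc k)\<^esub>}" using w(2)[OF x] lin_zero[OF dk] by simp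
    qed
    show "{\<zero>\<^bsub>E (Suc k)\<^esub>} \<subseteq> d k ` carrier (E k)" using z by simp
  qed
  \<comment> \<open>The zero submodule is now essential in the next term, which forces that term to
    vanish.\<close>
  have ess: "essential_submodule R {\<zero>\<^bsub>E (Suc k)\<^esub>} (E (Suc k))"
    using min T0 unfolding minimal_injective_coresolution_def by metis
  have full: "submodule (carrier (E (Suc k))) R (E (Suc k))"
    by (rule submoduleI[OF m]) auto
  have "carrier (E (Suc k)) \<inter> {\<zero>\<^bsub>E (Suc k)\<^esub>} = {\<zero>\<^bsub>E (Suc k)\<^esub>}" by simp
  from zero_of_essential[OF ess full this] show ?thesis unfolding zero_module_def .
qed

section \<open>The cotilting conditions for \<open>D\<close>\<close>

context shifted_cotilting
begin

text \<open>The kernel of \<open>\<delta> j\<close> is \<open>?Z (j + 1)\<close> by exactness, so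
  \<open>coresolved_cokernel\<close> descends from \<open>j = r\<close>, where the kernel is zero,
  to \<open>?Z 0\<close>, which is \<open>W\<close>; there the embedding splits.\<close>

lemma coresolution_exists:
  assumes summands: "\<And>j. j \<le> r \<Longrightarrow> in_Prod TYPE('u) R C (X (Suc j)) \<and> \<delta> j \<in> mod_hom R (X (Suc j)) (X j)"
    and X0: "X 0 = W"
    and surj: "\<delta> 0 ` carrier (X 1) = carrier (X 0)"
    and exact: "\<And>j. j < r \<Longrightarrow> \<delta> (Suc j) ` carrier (X (Suc (Suc j))) = a_kernel (X (Suc j)) (X j) (\<delta> j)"
    and inj: "inj_on (\<delta> r) (carrier (X (Suc r)))"
  shows "\<exists>r X \<delta>. retD_resolution W r X \<delta>"
proof -
  have mX: "module R (X j)" if "j \<le> Suc r" for j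
  proof (cases j)
    case 0
    then show ?thesis using X0 baer_module[OF inj_W] by simp
  next
    case (Suc k)
    then show ?thesis using summands[of k] that unfolding in_Prod_def by simp
  qed
  have l\<delta>: "lin R (X (Suc j)) (X j) (\<delta> j)" if "j \<le> r" for j
    by (rule mod_hom_lin) (use summands[OF that] mX[of j] mX[of "Suc j"] that in auto)
  let ?Z = "\<lambda>j. (X j)\<lparr>carrier := \<delta> j ` carrier (X (Suc j))\<rparr>"
  have step: "coresolved_by_finres (?Z j)"
    if j: "j \<le> r" and A: "coresolved_by_finres ((X (Suc j))\<lparr>carrier := a_kernel (X (Suc j)) (X j) (\<delta> j)\<rparr>)" for j
  proof -
    have "module R (X (Suc j))" "in_Prod TYPE('u) R C (X (Suc j))" using mX[of "Suc j"] summands[OF j] j by auto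
    then obtain K :: "'u set" where K: "direct_summand R (X (Suc j)) (mod_power K C)" unfolding in_Prod_def by blast
    obtain s p where sp: "lin R (X (Suc j)) (mod_power K C) s" "lin R (mod_power K C) (X (Suc j)) p"
      "\<And>x. x \<in> carrier (X (Suc j)) \<Longrightarrow> p (s x) = x"
      using direct_summand_retract[OF module_mod_power[OF module_C] \<open>module R (X (Suc j))\<close> K] by blast
    have l: "lin R (X (Suc j)) (?Z j) (\<delta> j)" by (rule lin_corestrict[OF l\<delta>[OF j] submodule_range[OF l\<delta>[OF j]]]) simp
    have k: "a_kernel (X (Suc j)) (?Z j) (\<delta> j) = a_kernel (X (Suc j)) (X j) (\<delta> j)" by (auto simp: a_kernel_iff)
    have S: "ses R ((X (Suc j))\<lparr>carrier := a_kernel (X (Suc j)) (X j) (\<delta> j)\<rparr>) (X (Suc j)) (?Z j) (\<lambda>x. x) (\<delta> j)"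
      using ses_kernel[OF l] unfolding k by simp
    show ?thesis by (rule coresolved_cokernel[OF S sp(1,2) _ A]) (erule sp(3))
  qed
  have "coresolved_by_finres (?Z 0)"
  proof (rule inc_induct[of 0 r "\<lambda>j. coresolved_by_finres (?Z j)"])
    note lr = l\<delta>[OF order_refl]
    have inj0: "a_kernel (X (Suc r)) (X r) (\<delta> r) = {\<zero>\<^bsub>X (Suc r)\<^esub>}"
    proof
      show "a_kernel (X (Suc r)) (X r) (\<delta> r) \<subseteq> {\<zero>\<^bsub>X (Suc r)\<^esub>}"
        using inj unfolding lin_inj_iff[OF lr] a_kernel_iff subset_iff by blast
      show "{\<zero>\<^bsub>X (Suc r)\<^esub>} \<subseteq> a_kernel (X (Suc r)) (X r) (\<delta> r)"
        using submoduleD(2)[OF submodule_kernel[OF lr]] by blast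
    qed
    have "module R ((X (Suc r))\<lparr>carrier := a_kernel (X (Suc r)) (X r) (\<delta> r)\<rparr>)"
      by (rule submodule_module[OF mX[OF order_refl] submodule_kernel[OF lr]])
    from step[OF order_refl coresolved_zero[OF this]] inj0
    show "coresolved_by_finres (?Z r)"
      by simp
    fix j assume "j < r" "coresolved_by_finres (?Z (Suc j))"
    then show "coresolved_by_finres (?Z j)" using step[of j] exact[of j] by simp
  qed simp
  then have "coresolved_by_finres W" using X0 surj by simp
  then show ?thesis by (rule retD_resolution_exists[OF finres_injective[OF inj_W]])
qed

lemma retD_in_Prod: "retD X \<Longrightarrow> in_Prod TYPE('u) R D X"
  unfolding in_Prod_def retD_def using retract_direct_summand[of R X DU] lin_dom by blast

lemma exv_above_dimension:
  assumes "inj_dim_le R n C" "n \<le> i" shows "exv R M E d (Suc i)"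
proof -
  obtain F :: "nat \<Rightarrow> ('r, ('r, 'c) hulltype) module" and \<zeta> e where
    F: "injective_coresolution R C F \<zeta> e" "\<forall>i>n. zero_module (F i)"
    using assms(1) unfolding inj_dim_le_def by blast
  have c: "cores R C F \<zeta> e" by (rule injective_coresolution_cores[OF module_C F(1)])
  have z: "carrier (F (Suc i)) = {\<zero>\<^bsub>F (Suc i)\<^esub>}" using F(2) assms(2) unfolding zero_module_def by simp
  have "exv R M F e (Suc i)"
  proof (rule exv_SucI)
    fix f assume f: "lin R M (F (Suc i)) f"
    have "e i \<zero>\<^bsub>F i\<^esub> = f x" if "x \<in> carrier M" for x
      using lin_closed[OF f that] z lin_zero[OF cores_d[OF c, of i]] by simp
    then show "\<exists>w. lin R M (F i) w \<and> (\<forall>x\<in>carrier M. e i (w x) = f x)"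
      using lin_zero_map[OF lin_dom[OF f] cores_module[OF c]] by blast
  qed
  then show ?thesis unfolding exv_independent[OF c cores_C] .
qed

text \<open>\<open>inj_term R D\<close> is chosen by \<open>SOME\<close>; that it is a minimal
  coresolution is known once the type of \<open>D\<close> is no larger than the universe.\<close>

context
  assumes le_D: "|UNIV :: (('r, 'c) hulltype \<times> 'j) set| \<le>o |UNIV :: 'u set|"
begin

lemmas cores_min_D = cores_min[OF module_D le_D]

lemma exv_min_D_iff: "module R M \<Longrightarrow> exv R M (inj_term R D) (inj_diff R D) (Suc i) \<longleftrightarrow> exv R M E d (Suc (Suc i))"
  unfolding exv_independent[OF cores_min_D cores_D] by (rule exv_D_iff)

text \<open>The coresolution has to live on the hull type of \<open>D\<close>, hence the minimal one
  is taken. Its term in degree \<open>k + 1 > n - 1\<close> vanishes by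
  \<open>minimal_zero_term\<close>, for \<open>Ext\<^sup>k\<^sup>+\<^sup>1\<close> into
  \<open>D\<close> is \<open>Ext\<^sup>k\<^sup>+\<^sup>2\<close> into \<open>C\<close> and
  \<open>k + 2 > n\<close>.\<close>

lemma inj_dim_D:
  assumes "inj_dim_le R n C" shows "inj_dim_le R (n - 1) D"
  unfolding inj_dim_le_def
proof (intro exI conjI allI impI)
  note min = minimal_min_cores[OF module_D le_D]
  show "injective_coresolution R D (inj_term R D) (inj_aug R D) (inj_diff R D)"
    using min unfolding minimal_injective_coresolution_def by blast
  fix i assume i: "n - 1 < i"
  then obtain k where k: "i = Suc k" by (cases i) auto
  let ?T = "(inj_term R D (Suc k))\<lparr>carrier := inj_diff R D k ` carrier (inj_term R D k)\<rparr>"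
  have "module R ?T"
    by (rule submodule_module[OF cores_module[OF cores_min_D] submodule_range[OF cores_d[OF cores_min_D]]])
  then have "exv R ?T (inj_term R D) (inj_diff R D) (Suc k)"
    by (rule iffD2[OF exv_min_D_iff exv_above_dimension[OF assms]]) (use i k in auto)
  then show "zero_module (inj_term R D i)" unfolding k by (rule minimal_zero_term[OF module_D min])
qed

theorem cotilting_D:
  assumes C: "cotilting TYPE('u) R n C"
    and summands: "\<And>j. j \<le> r \<Longrightarrow> in_Prod TYPE('u) R C (X (Suc j)) \<and> \<delta> j \<in> mod_hom R (X (Suc j)) (X j)"
    and X0: "X 0 = W"
    and surj: "\<delta> 0 ` carrier (X 1) = carrier (X 0)"
    and exact: "\<And>j. j < r \<Longrightarrow> \<delta> (Suc j) ` carrier (X (Suc (Suc j))) = a_kernel (X (Suc j)) (X j) (\<delta> j)"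
    and inj: "inj_on (\<delta> r) (carrier (X (Suc r)))"
  shows "cotilting TYPE('u) R (n - 1) D"
  unfolding cotilting_def
proof (intro conjI allI impI)
  show "module R D" by (rule module_D)
  show "inj_dim_le R (n - 1) D" by (rule inj_dim_D) (use C in \<open>simp add: cotilting_def\<close>)
  show "zero_module (Ext R i (mod_power K D) D)" if i: "1 \<le> i" for i and K :: "'u set"
  proof -
    obtain k where "i = Suc k" using i by (cases i) auto
    then show ?thesis
      using iffD2[OF zero_Ext_iff[OF module_mod_power[OF module_D] cores_min_D]
          iffD2[OF exv_independent[OF cores_min_D cores_D] exv_power_D]] by simp
  qed
  obtain r' X' \<delta>' where "retD_resolution W r' X' \<delta>'"
    using coresolution_exists[OF summands X0 surj exact inj] by blast
  then have h: "X' 0 = W" "\<And>j. j \<le> r' \<Longrightarrow> retD (X' (Suc j))" "\<And>j. j \<le> r' \<Longrightarrow> lin R (X' (Suc j)) (X' j) (\<delta>' j)"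
    "\<delta>' 0 ` carrier (X' 1) = carrier W"
    "\<And>j. j < r' \<Longrightarrow> \<delta>' (Suc j) ` carrier (X' (Suc (Suc j))) = a_kernel (X' (Suc j)) (X' j) (\<delta>' j)"
    "inj_on (\<delta>' r') (carrier (X' (Suc r')))" unfolding retD_resolution_def by blast+
  \<comment> \<open>\<open>mod_hom\<close> in the definition of \<open>cotilting\<close> asks for
    extensional maps again.\<close>
  let ?\<delta> = "\<lambda>j. restrict (\<delta>' j) (carrier (X' (Suc j)))"
  show "\<exists>r \<delta>. \<exists>X :: nat \<Rightarrow> ('r, 'u) module.
      injective_module R (X 0) \<and> cogenerator R (X 0) \<and>
      (\<forall>j\<le>r. in_Prod TYPE('u) R D (X (Suc j)) \<and> \<delta> j \<in> mod_hom R (X (Suc j)) (X j)) \<and>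
      \<delta> 0 ` carrier (X 1) = carrier (X 0) \<and>
      (\<forall>j<r. \<delta> (Suc j) ` carrier (X (Suc (Suc j))) = a_kernel (X (Suc j)) (X j) (\<delta> j)) \<and>
      inj_on (\<delta> r) (carrier (X (Suc r)))"
  proof (rule exI[of _ r'], rule exI[of _ ?\<delta>], rule exI[of _ X'], intro conjI allI impI)
    show "injective_module R (X' 0)" using inj_W h(1) by (simp add: injective_module_iff_baer)
    show "cogenerator R (X' 0)" using cogenerator_W h(1) by simp
    show "in_Prod TYPE('u) R D (X' (Suc j))" if "j \<le> r'" for j by (rule retD_in_Prod[OF h(2)[OF that]])
    show "?\<delta> j \<in> mod_hom R (X' (Suc j)) (X' j)" if "j \<le> r'" for j by (rule lin_mod_hom[OF h(3)[OF that]])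
    show "?\<delta> 0 ` carrier (X' 1) = carrier (X' 0)" using h(1,4) by simp
    show "?\<delta> (Suc j) ` carrier (X' (Suc (Suc j))) = a_kernel (X' (Suc j)) (X' j) (?\<delta> j)" if "j < r'" for j
      using h(5)[OF that] by (auto simp: a_kernel_iff)
    show "inj_on (?\<delta> r') (carrier (X' (Suc r')))" using h(6) by simp
  qed
qed

theorem perp_D: "(perp R D :: ('r, 'u) module set) = cot_class R (n - 1) Y'"
proof (rule Set.set_eqI)
  fix M :: "('r, 'u) module"
  show "M \<in> perp R D \<longleftrightarrow> M \<in> cot_class R (n - 1) Y'"
  proof (cases "module R M")
    case True
    have "M \<in> perp R D \<longleftrightarrow> (\<forall>i. zero_module (Ext R (Suc i) M D))"
      unfolding perp_def using True by (auto simp: Suc_le_eq dest: gr0_implies_Suc)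
    also have "\<dots> \<longleftrightarrow> (\<forall>i. exv R M E d (Suc (Suc i)))"
      unfolding zero_Ext_iff[OF True cores_min_D] exv_min_D_iff[OF True] ..
    also have "\<dots> \<longleftrightarrow> M \<in> cot_class R (n - 1) Y'" by (rule perp_shift_iff[OF True])
    finally show ?thesis .
  qed (simp add: perp_def cot_class_def)
qed

end

end

section \<open>The injective module attached to the primes outside \<open>Y\<^sub>2\<close>\<close>

lemma direct_sum_simps:
  "carrier (direct_sum I F) = {f \<in> \<Pi>\<^sub>E i\<in>I. carrier (F i). finite {i \<in> I. f i \<noteq> \<zero>\<^bsub>F i\<^esub>}}"
  "\<zero>\<^bsub>direct_sum I F\<^esub> = (\<lambda>i\<in>I. \<zero>\<^bsub>F i\<^esub>)" "r \<odot>\<^bsub>direct_sum I F\<^esub> f = (\<lambda>i\<in>I. r \<odot>\<^bsub>F i\<^esub> f i)"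
  by (simp_all add: direct_sum_def mod_product_def)

lemma lin_single:
  assumes R: "cring R" and F: "\<And>i. i \<in> I \<Longrightarrow> module R (F i)" and p: "p \<in> I"
  shows "lin R (F p) (direct_sum I F) (\<lambda>x. \<lambda>i\<in>I. if i = p then x else \<zero>\<^bsub>F i\<^esub>)"
  unfolding direct_sum_eq
proof (rule lin_corestrict[OF _ submodule_direct_sum[OF R F]])
  show l: "lin R (F p) (mod_product I F) (\<lambda>x. \<lambda>i\<in>I. if i = p then x else \<zero>\<^bsub>F i\<^esub>)"
  proof (rule lin_tuple[OF R F[OF p]])
    fix i assume "i \<in> I"
    then show "lin R (F p) (F i) (\<lambda>x. if i = p then x else \<zero>\<^bsub>F i\<^esub>)"
      using lin_id[OF F[OF p]] lin_zero_map[OF F[OF p] F] by (cases "i = p") simp_all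
  qed
  fix x assume x: "x \<in> carrier (F p)"
  have "finite {i \<in> I. (\<lambda>i\<in>I. if i = p then x else \<zero>\<^bsub>F i\<^esub>) i \<noteq> \<zero>\<^bsub>F i\<^esub>}"
    by (rule finite_subset[of _ "{p}"]) auto
  then show "(\<lambda>i\<in>I. if i = p then x else \<zero>\<^bsub>F i\<^esub>) \<in> {f \<in> carrier (mod_product I F). finite {i \<in> I. f i \<noteq> \<zero>\<^bsub>F i\<^esub>}}"
    using lin_closed[OF l x] by blast
qed

lemma torsion_free_direct_sum:
  assumes "\<And>i. i \<in> I \<Longrightarrow> torsion_free (F i) Y" shows "torsion_free (direct_sum I F) Y"
  unfolding torsion_free_def
proof (intro ballI impI)
  fix p x assume p: "p \<in> Y" and x: "x \<in> carrier (direct_sum I F)" and 0: "\<forall>r\<in>p. r \<odot>\<^bsub>direct_sum I F\<^esub> x = \<zero>\<^bsub>direct_sum I F\<^esub>"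
  have x': "x \<in> (\<Pi>\<^sub>E i\<in>I. carrier (F i))" using x by (simp add: direct_sum_simps)
  have "x i = \<zero>\<^bsub>F i\<^esub>" if i: "i \<in> I" for i
  proof (rule torsion_freeD[OF assms[OF i] p PiE_mem[OF x' i]])
    fix r assume "r \<in> p"
    then have "(\<lambda>i\<in>I. r \<odot>\<^bsub>F i\<^esub> x i) = (\<lambda>i\<in>I. \<zero>\<^bsub>F i\<^esub>)" using 0 unfolding direct_sum_simps by blast
    from fun_cong[OF this, of i] show "r \<odot>\<^bsub>F i\<^esub> x i = \<zero>\<^bsub>F i\<^esub>" using i by simp
  qed
  then show "x = \<zero>\<^bsub>direct_sum I F\<^esub>"
    unfolding direct_sum_simps using PiE_arb[OF x'] by (auto simp: fun_eq_iff restrict_def)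
qed

text \<open>If \<open>q\<close> kills a nonzero class in \<open>R/p\<close>, then
  \<open>q \<subseteq> p\<close> because \<open>p\<close> is prime, and closure under specialization
  would put \<open>p\<close> into \<open>Y\<close>.\<close>

lemma torsion_free_quotient_prime:
  assumes R: "cring R" and p: "primeideal p R" and Y: "Y \<subseteq> Spec R" "specialization_closed R Y" "p \<notin> Y"
  shows "torsion_free (quot_module (regular_module R) p) Y"
  unfolding torsion_free_def
proof (intro ballI impI)
  let ?Q = "quot_module (regular_module R) p"
  interpret p: primeideal p R by (rule p)
  fix q x assume q: "q \<in> Y" and x: "x \<in> carrier ?Q" and 0: "\<forall>r\<in>q. r \<odot>\<^bsub>?Q\<^esub> x = \<zero>\<^bsub>?Q\<^esub>"
  have sp: "submodule p R (regular_module R)" using submodule_ideal_iff[OF R] p.is_ideal by blast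
  note l = lin_quot_module[OF module_regular[OF R] sp]
  have qc: "q \<subseteq> carrier R"
    using q Y(1) ideal_subset[OF primeideal.axioms(1)] unfolding Spec_def by blast
  obtain a where a: "x = p +>\<^bsub>regular_module R\<^esub> a" "a \<in> carrier R" using x unfolding l(2) by auto
  show "x = \<zero>\<^bsub>?Q\<^esub>"
  proof (rule ccontr)
    assume "x \<noteq> \<zero>\<^bsub>?Q\<^esub>"
    then have ap: "a \<notin> p" using l(3)[of a] a by simp
    have "q \<subseteq> p"
    proof
      fix r assume r: "r \<in> q"
      then have rc: "r \<in> carrier R" using qc by blast
      have "p +>\<^bsub>regular_module R\<^esub> (r \<otimes>\<^bsub>R\<^esub> a) = r \<odot>\<^bsub>?Q\<^esub> x"
        using lin_smult[OF l(1) rc] a by simp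
      then have "r \<otimes>\<^bsub>R\<^esub> a \<in> p" using 0 r l(3)[of "r \<otimes>\<^bsub>R\<^esub> a"] rc a(2) by simp
      then show "r \<in> p" using p.I_prime[OF rc a(2)] ap by blast
    qed
    then have "p \<in> Y" using Y(2) q p unfolding specialization_closed_def Spec_def by blast
    then show False using Y(3) by blast
  qed
qed

context cotilting_data
begin

abbreviation "X2 \<equiv> Spec R - Y 2"
abbreviation "J \<equiv> direct_sum X2 (\<lambda>p. inj_envelope R (quot p))"

text \<open>The modules \<open>R/p\<close> have sets of ring elements as elements; their minimal
  coresolutions are available once this type is no larger than the universe.\<close>

context
  assumes le_quot: "|UNIV :: 'r set set| \<le>o |UNIV :: 'u set|"
begin

lemma module_quot: "primeideal p R \<Longrightarrow> module R (quot p)"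
  using lin_cod[OF lin_quot_module(1)[OF module_regular[OF cring]]] submodule_ideal_iff[OF cring] primeideal.axioms(1) by blast

lemma X2_prime: "p \<in> X2 \<Longrightarrow> primeideal p R"
  by (simp add: Spec_def)

lemma cores_quot: "p \<in> X2 \<Longrightarrow> cores R (quot p) (inj_term R (quot p)) (inj_aug R (quot p)) (inj_diff R (quot p))"
  by (rule cores_min[OF module_quot[OF X2_prime] le_quot])

lemma baer_envelope: "p \<in> X2 \<Longrightarrow> baer R (inj_envelope R (quot p))"
  unfolding inj_envelope_def by (rule cores_baer[OF cores_quot])

lemma baer_J: "baer R J"
  by (rule baer_direct_sum[OF cring noetherian baer_envelope])

lemma Y2: "Y 2 \<subseteq> Spec R" "specialization_closed R (Y 2)"
  using Y n2 by auto

lemma torsion_free_J: "torsion_free J (Y 2)"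
proof (rule torsion_free_direct_sum)
  fix p assume p: "p \<in> X2"
  note c = cores_quot[OF p]
  have ess: "essential_submodule R (inj_aug R (quot p) ` carrier (quot p)) (inj_envelope R (quot p))"
    using minimal_min_cores[OF module_quot[OF X2_prime[OF p]] le_quot]
    unfolding minimal_injective_coresolution_def inj_envelope_def by blast
  have Yc: "q \<subseteq> carrier R" if "q \<in> Y 2" for q
    by (rule ideal_subset[OF Y_ideal[of 2]]) (use n2 that in auto)
  obtain h where h: "lin R ((inj_term R (quot p) 0)\<lparr>carrier := inj_aug R (quot p) ` carrier (quot p)\<rparr>) (quot p) h"
    "\<And>x. x \<in> carrier (quot p) \<Longrightarrow> h (inj_aug R (quot p) x) = x"
    using lin_inv[OF cores_aug[OF c] cores_inj[OF c]] by blast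
  have "inj_on h (carrier ((inj_term R (quot p) 0)\<lparr>carrier := inj_aug R (quot p) ` carrier (quot p)\<rparr>))"
    by (rule inj_on_inverseI[of _ "inj_aug R (quot p)"]) (use h(2) in auto)
  from torsion_free_inj[OF torsion_free_quotient_prime[OF cring X2_prime[OF p] Y2] h(1) this Yc]
  have "torsion_free ((inj_envelope R (quot p))\<lparr>carrier := inj_aug R (quot p) ` carrier (quot p)\<rparr>) (Y 2)"
    using p unfolding inj_envelope_def by blast
  then show "torsion_free (inj_envelope R (quot p)) (Y 2)"
    by (rule torsion_free_essential[OF baer_module[OF baer_envelope[OF p]] ess _ Yc])
qed

text \<open>A nonzero element has a multiple \<open>y\<close> with prime annihilator \<open>\<pp>\<close>; torsion freeness puts \<open>\<pp>\<close>
  into \<open>X2\<close>, and the embedding \<open>R y \<cong> R/\<pp> \<rightarrow> E(R/\<pp>)\<close> extends.\<close>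

lemma cogenerates_J:
  fixes I :: "('r, 'i) module"
  assumes I: "module R I" and t: "torsion_free I (Y 2)" and x: "x \<in> carrier I" "x \<noteq> \<zero>\<^bsub>I\<^esub>"
  shows "\<exists>f. lin R I J f \<and> f x \<noteq> \<zero>\<^bsub>J\<^esub>"
proof -
  obtain s where s: "s \<in> carrier R" "s \<odot>\<^bsub>I\<^esub> x \<noteq> \<zero>\<^bsub>I\<^esub>"
    and pr: "primeideal {r \<in> carrier R. r \<odot>\<^bsub>I\<^esub> (s \<odot>\<^bsub>I\<^esub> x) = \<zero>\<^bsub>I\<^esub>} R"
    by (rule prime_annihilator_exists[OF cring noetherian I x])
  define p where "p = {r \<in> carrier R. r \<odot>\<^bsub>I\<^esub> (s \<odot>\<^bsub>I\<^esub> x) = \<zero>\<^bsub>I\<^esub>}"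
  interpret I: module R I by (rule I)
  interpret p: primeideal p R unfolding p_def by (rule pr)
  let ?y = "s \<odot>\<^bsub>I\<^esub> x" and ?e = "inj_aug R (quot p)"
  have y: "?y \<in> carrier I" using s x by simp
  have ann: "r \<odot>\<^bsub>I\<^esub> ?y = \<zero>\<^bsub>I\<^esub>" if "r \<in> p" for r using that unfolding p_def by blast
  have "p \<notin> Y 2"
  proof
    assume "p \<in> Y 2"
    from torsion_freeD[OF t this y ann] show False using s(2) by contradiction
  qed
  then have pX: "p \<in> X2" unfolding Spec_def using p.primeideal_axioms by blast
  have mF: "module R (inj_envelope R (quot q))" if "q \<in> X2" for q by (rule baer_module[OF baer_envelope[OF that]])
  have sp: "submodule p R (regular_module R)" using submodule_ideal_iff[OF cring] p.is_ideal by blast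
  note q = lin_quot_module[OF module_regular[OF cring] sp]
  note c = cores_quot[OF pX]
  have e: "lin R (quot p) (inj_envelope R (quot p)) ?e" unfolding inj_envelope_def by (rule cores_aug[OF c])
  have si: "lin R (inj_envelope R (quot p)) J (\<lambda>x. \<lambda>i\<in>X2. if i = p then x else \<zero>\<^bsub>inj_envelope R (quot i)\<^esub>)"
    by (rule lin_single[OF cring mF pX])
  let ?g = "\<lambda>r. \<lambda>i\<in>X2. if i = p then ?e (p +>\<^bsub>regular_module R\<^esub> r) else \<zero>\<^bsub>inj_envelope R (quot i)\<^esub>"
  have g: "lin R (regular_module R) J ?g" by (rule lin_comp[OF lin_comp[OF q(1) e] si])
  have "?g r = \<zero>\<^bsub>J\<^esub>" if r: "r \<in> carrier (regular_module R)" "r \<odot>\<^bsub>I\<^esub> ?y = \<zero>\<^bsub>I\<^esub>" for r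
  proof -
    have "r \<in> p" unfolding p_def using r by simp
    then have "p +>\<^bsub>regular_module R\<^esub> r = \<zero>\<^bsub>quot p\<^esub>" using q(3)[OF r(1)] by simp
    then have "?e (p +>\<^bsub>regular_module R\<^esub> r) = \<zero>\<^bsub>inj_envelope R (quot p)\<^esub>" using lin_zero[OF e] by simp
    then show ?thesis unfolding direct_sum_simps(2) by (intro restrict_ext) auto
  qed
  from baer_extend_over[OF baer_J lin_smult_map[OF I y] g this]
  obtain h where h: "lin R I J h" "\<And>r. r \<in> carrier (regular_module R) \<Longrightarrow> h (r \<odot>\<^bsub>I\<^esub> ?y) = ?g r" by blast
  have "h x \<noteq> \<zero>\<^bsub>J\<^esub>"
  proof
    assume 0: "h x = \<zero>\<^bsub>J\<^esub>"
    have mJ: "module R J" by (rule baer_module[OF baer_J])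
    have "h ?y = s \<odot>\<^bsub>J\<^esub> \<zero>\<^bsub>J\<^esub>" using lin_smult[OF h(1) s(1) x(1)] 0 by simp
    then have "h ?y = \<zero>\<^bsub>J\<^esub>" using module.smult_r_null[OF mJ s(1)] by simp
    then have "?g \<one>\<^bsub>R\<^esub> = \<zero>\<^bsub>J\<^esub>" using h(2)[of "\<one>\<^bsub>R\<^esub>"] y by simp
    from fun_cong[OF this, of p] have "?e (p +>\<^bsub>regular_module R\<^esub> \<one>\<^bsub>R\<^esub>) = \<zero>\<^bsub>inj_envelope R (quot p)\<^esub>"
      using pX by (simp add: direct_sum_simps)
    moreover have "p +>\<^bsub>regular_module R\<^esub> \<one>\<^bsub>R\<^esub> \<in> carrier (quot p)" using lin_closed[OF q(1)] by simp
    ultimately have "p +>\<^bsub>regular_module R\<^esub> \<one>\<^bsub>R\<^esub> = \<zero>\<^bsub>quot p\<^esub>"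
      using cores_inj[OF c] unfolding lin_inj_iff[OF cores_aug[OF c]] inj_envelope_def by blast
    then have "\<one>\<^bsub>R\<^esub> \<in> p" using q(3)[of "\<one>\<^bsub>R\<^esub>"] by simp
    then show False using p.I_notcarr p.one_imp_carrier by blast
  qed
  then show ?thesis using h(1) by blast
qed

lemma shifted_cotilting_J: "shifted_cotilting R W C Y n J"
  by (rule shifted_cotilting.intro[OF cotilting_data_axioms shifted_cotilting_axioms.intro])
    (auto intro: baer_J torsion_free_J cogenerates_J baer_module)

end

end

section \<open>The size of the universe\<close>

text \<open>A function is coded by its graph, so a function type costs one power set.\<close>

lemma card_of_function_type:
  assumes S: "infinite (UNIV :: 's set)" and A: "|UNIV :: 'a set| \<le>o |UNIV :: 's set|" and B: "|UNIV :: 'b set| \<le>o |UNIV :: 's set|"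
  shows "|UNIV :: ('a \<Rightarrow> 'b) set| \<le>o |UNIV :: 's set set|"
proof -
  have "|(UNIV :: 'a set) \<times> (UNIV :: 'b set)| \<le>o |UNIV :: 's set|"
    by (rule card_of_Sigma_ordLeq_infinite[OF S A]) (use B in simp)
  then obtain i :: "'a \<times> 'b \<Rightarrow> 's" where i: "inj i" by (metis card_of_ordLeq UNIV_Times_UNIV)
  have "inj (\<lambda>f :: 'a \<Rightarrow> 'b. range (\<lambda>a. i (a, f a)))"
  proof (rule injI, rule ext)
    fix f g :: "'a \<Rightarrow> 'b" and a assume eq: "range (\<lambda>a. i (a, f a)) = range (\<lambda>a. i (a, g a))"
    have "i (a, f a) \<in> range (\<lambda>a. i (a, g a))" unfolding eq[symmetric] by blast
    then obtain b where "i (a, f a) = i (b, g b)" by blast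
    then show "f a = g a" using injD[OF i] by blast
  qed
  then show ?thesis using card_of_ordLeq subset_UNIV by blast
qed

lemma card_of_set_type_mono: "|UNIV :: 'a set| \<le>o |UNIV :: 's set| \<Longrightarrow> |UNIV :: 'a set set| \<le>o |UNIV :: 's set set|"
proof -
  assume "|UNIV :: 'a set| \<le>o |UNIV :: 's set|"
  then obtain i :: "'a \<Rightarrow> 's" where "inj i" by (metis card_of_ordLeq)
  then show ?thesis by (intro card_of_ordLeqI[of "image i"]) (auto simp: inj_image_eq_iff intro: injI)
qed

lemma card_of_set_type: "|UNIV :: 'a set| \<le>o |UNIV :: 'a set set|"
  by (rule card_of_ordLeqI[of "\<lambda>a. {a}"]) (auto intro: injI)

text \<open>With \<open>L\<close> the lists over \<open>'r + 'c\<close>, the hull type of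
  \<open>'c\<close> is bounded by one power set of \<open>L\<close>, and that of
  \<open>'r set\<close> by two. Functions from \<open>'r set\<close> into the latter need a third,
  so the type of \<open>D\<close> fits into three iterated power sets; the universe contains
  four.\<close>

lemma universe_bounds:
  shows "infinite (UNIV :: ('r, 'c, 't) univ set)"
    and "|UNIV :: 'r set| \<le>o |UNIV :: ('r, 'c, 't) univ set|"
    and "|UNIV :: 'c set| \<le>o |UNIV :: ('r, 'c, 't) univ set|"
    and "|UNIV :: 'r set set| \<le>o |UNIV :: ('r, 'c, 't) univ set|"
    and "|UNIV :: (('r, 'c) hulltype \<times> ('r set \<Rightarrow> ('r, 'r set) hulltype)) set| \<le>o |UNIV :: ('r, 'c, 't) univ set|"
proof -
  let ?L = "UNIV :: ('r + 'c) list set" and ?L1 = "UNIV :: ('r + 'c) list set set"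
    and ?L2 = "UNIV :: ('r + 'c) list set set set" and ?L3 = "UNIV :: ('r + 'c) list set set set set"
    and ?L4 = "UNIV :: ('r + 'c) list set set set set set" and ?U = "UNIV :: ('r, 'c, 't) univ set"
  note tr = ordLeq_transitive
  have i0: "infinite ?L" by (rule infinite_UNIV_listI)
  have s0: "|?L| \<le>o |?L1|" and s1: "|?L1| \<le>o |?L2|" and s2: "|?L2| \<le>o |?L3|" and s3: "|?L3| \<le>o |?L4|"
    by (rule card_of_set_type)+
  have s4: "|?L4| \<le>o |?U|" by (rule card_of_ordLeqI[of Inr]) (auto intro: injI)
  note u3 = tr[OF s3 s4] note u2 = tr[OF s2 u3] note u1 = tr[OF s1 u2] note u0 = tr[OF s0 u1]
  have i1: "infinite ?L1" by (rule card_of_ordLeq_infinite[OF s0 i0])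
  have i2: "infinite ?L2" by (rule card_of_ordLeq_infinite[OF s1 i1])
  have i3: "infinite ?L3" by (rule card_of_ordLeq_infinite[OF s2 i2])
  show "infinite ?U" by (rule card_of_ordLeq_infinite[OF u0 i0])
  have r: "|UNIV :: 'r set| \<le>o |?L|" by (rule card_of_ordLeqI[of "\<lambda>r. [Inl r]"]) (auto intro: injI)
  have c: "|UNIV :: 'c set| \<le>o |?L|" by (rule card_of_ordLeqI[of "\<lambda>c. [Inr c]"]) (auto intro: injI)
  show "|UNIV :: 'r set| \<le>o |?U|" "|UNIV :: 'c set| \<le>o |?U|" by (rule tr[OF r u0], rule tr[OF c u0])
  have rs: "|UNIV :: 'r set set| \<le>o |?L1|" by (rule card_of_set_type_mono[OF r])
  show "|UNIV :: 'r set set| \<le>o |?U|" by (rule tr[OF rs u1])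
  have nat: "|UNIV :: nat set| \<le>o |?L|" using i0 infinite_iff_card_of_nat by blast
  have times: "|UNIV :: ('a \<times> 'b) set| \<le>o |UNIV :: 's set|"
    if "infinite (UNIV :: 's set)" "|UNIV :: 'a set| \<le>o |UNIV :: 's set|" "|UNIV :: 'b set| \<le>o |UNIV :: 's set|"
    using card_of_Sigma_ordLeq_infinite[OF that(1,2), of "\<lambda>_. UNIV :: 'b set"] that(3) by simp
  have rn: "|UNIV :: ('r \<times> nat) set| \<le>o |?L|" by (rule times[OF i0 r nat])
  have "|UNIV :: ('r, 'c) hulltype set| \<le>o |?L1|" by (rule card_of_function_type[OF i0 rn times[OF i0 c nat]])
  then have h: "|UNIV :: ('r, 'c) hulltype set| \<le>o |?L3|" by (rule tr[OF _ tr[OF s1 s2]])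
  have "|UNIV :: ('r, 'r set) hulltype set| \<le>o |?L2|"
    by (rule card_of_function_type[OF i1 tr[OF rn s0] times[OF i1 rs tr[OF nat s0]]])
  from card_of_function_type[OF i2 tr[OF rs s1] this]
  have "|UNIV :: ('r set \<Rightarrow> ('r, 'r set) hulltype) set| \<le>o |?L3|" .
  from times[OF i3 h this] show "|UNIV :: (('r, 'c) hulltype \<times> ('r set \<Rightarrow> ('r, 'r set) hulltype)) set| \<le>o |?U|"
    by (rule tr[OF _ u3])
qed

theorem corollary3p17:
  fixes R :: "('r, 'q) ring_scheme"
    and C :: "('r, 'c) module"
    and Y :: "nat \<Rightarrow> 'r set set"
    and n :: nat
    and X2 :: "'r set set"
    and D :: "('r, ('r, 'c) hulltype \<times> ('r set \<Rightarrow> ('r, 'r set) hulltype)) module"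
  assumes "cring R" and "noetherian_ring R"
    and "n \<ge> 2"
    and "cotilting TYPE(('r, 'c, 't) univ) R n C"
    and "(perp R C :: ('r, ('r, 'c, 't) univ) module set) = cot_class R n Y"
    and "\<forall>i\<in>{1..n}. Y i \<subseteq> Spec R \<and> specialization_closed R (Y i)"
    and "\<forall>i\<in>{1..<n}. Y (i + 1) \<subseteq> Y i"
    and "\<forall>i\<in>{1..n}. Ass R (mho R (regular_module R) (i - 1)) \<inter> Y i = {}"
    and "X2 = Spec R - Y 2"
    and "D = dir_sum2 (mho R C 1)
               (direct_sum X2 (\<lambda>p. inj_envelope R (quot_module (regular_module R) p)))"
  shows "cotilting TYPE(('r, 'c, 't) univ) R (n - 1) D \<and>
         (perp R D :: ('r, ('r, 'c, 't) univ) module set) = cot_class R (n - 1) (\<lambda>i. Y (i + 1))"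
proof -
  note bounds = universe_bounds[where ?'r = 'r and ?'c = 'c and ?'t = 't]
  have mC: "module R C" using assms(4) unfolding cotilting_def by blast
  obtain r \<delta> and X :: "nat \<Rightarrow> ('r, ('r, 'c, 't) univ) module" where
    X0: "injective_module R (X 0)" "cogenerator R (X 0)" and
    summands: "\<forall>j\<le>r. in_Prod TYPE(('r, 'c, 't) univ) R C (X (Suc j)) \<and> \<delta> j \<in> mod_hom R (X (Suc j)) (X j)" and
    surj: "\<delta> 0 ` carrier (X 1) = carrier (X 0)" and
    exact: "\<forall>j<r. \<delta> (Suc j) ` carrier (X (Suc (Suc j))) = a_kernel (X (Suc j)) (X j) (\<delta> j)" and
    inj: "inj_on (\<delta> r) (carrier (X (Suc r)))"
    using assms(4) unfolding cotilting_def by (elim exE conjE)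
  \<comment> \<open>The cogenerator from the exact sequence for \<open>C\<close> supplies all
    injectives and also ends the exact sequence constructed for \<open>D\<close>.\<close>
  interpret W: cogenerated R "X 0"
    by (rule cogenerated.intro) (use assms(1,2) X0 bounds(1,2) in \<open>simp_all add: injective_module_iff_baer\<close>)
  note cC = W.cores_min[OF mC bounds(3)]
  interpret C: cotilting_data R "X 0" C Y n
  proof (rule cotilting_data.intro[OF W.cogenerated_axioms cotilting_data_axioms.intro])
    fix K :: "('r, 'c, 't) univ set" and i
    have "zero_module (Ext R (Suc i) (mod_power K C) C)" using assms(4) unfolding cotilting_def by simp
    then show "exv R (mod_power K C) (inj_term R C) (inj_diff R C) (Suc i)"
      unfolding zero_Ext_iff[OF module_mod_power[OF mC] cC] .
  next
    fix M :: "('r, ('r, 'c, 't) univ) module" assume M: "module R M"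
    have "(\<forall>i. exv R M (inj_term R C) (inj_diff R C) (Suc i)) \<longleftrightarrow> M \<in> perp R C"
      unfolding zero_Ext_iff[OF M cC, symmetric] perp_def using M by (auto simp: Suc_le_eq dest: gr0_implies_Suc)
    then show "(\<forall>i. exv R M (inj_term R C) (inj_diff R C) (Suc i)) \<longleftrightarrow> M \<in> cot_class R n Y"
      using assms(5) by simp
  qed (use mC bounds(3) assms(3,6,7) in simp_all)
  interpret S: shifted_cotilting R "X 0" C Y n C.J by (rule C.shifted_cotilting_J[OF bounds(4)])
  \<comment> \<open>\<open>mho R C 1\<close> unfolds to the image of \<open>d 0\<close> inside
    \<open>E 1\<close>, that is to \<open>V1\<close>.\<close>
  have D: "D = S.D" unfolding assms(9,10) by simp
  have "cotilting TYPE(('r, 'c, 't) univ) R (n - 1) D"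
    unfolding D by (rule S.cotilting_D[OF bounds(5) assms(4) _ refl surj _ inj]) (use summands exact in blast)+
  then show ?thesis using S.perp_D[OF bounds(5)] unfolding D ..
qed

end
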